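(* Let $\mathscr{G}$ be a proper étale Lie groupoid. Then the principal $\mathrm{Eff}(\mathscr{G})$-bundle over $\mathscr{G}$ associated to the functor $\mathrm{Eff}:\mathscr{G}\to\mathrm{Eff}(\mathscr{G})$ is a Serre fibration.
   Context: An étale Lie groupoid is a Lie groupoid $\mathscr{G}$ whose source and target maps $s,t:\mathscr{G}_1\to\mathscr{G}_0$ are local diffeomorphisms; it is proper if $\mathscr{G}_1$ is Hausdorff and $(s,t):\mathscr{G}_1\to\mathscr{G}_0\times\mathscr{G}_0$ is a proper map. For an arrow $g\in\mathscr{G}_1$, choose an open neighbourhood $U$ of $g$ on which $s$ and $t$ are injective; $\mathrm{Eff}(g)$ is the germ at $s(g)$ of the local diffeomorphism $t\circ(s|_U)^{-1}$ of $\mathscr{G}_0$. The effect groupoid $\mathrm{Eff}(\mathscr{G})$ is the étale Lie groupoid with objects $\mathscr{G}_0$ and arrows $\{\mathrm{Eff}(g):g\in\mathscr{G}_1\}$ (with the sheaf topology on germs, composition of germs), and $\mathrm{Eff}:\mathscr{G}\to\mathrm{Eff}(\mathscr{G})$ is the functor which is the identity on objects and $g\mapsto\mathrm{Eff}(g)$ on arrows. A topological groupoid $\mathscr{G}$ has spaces $\mathscr{G}_0$ of objects and $\mathscr{G}_1$ of arrows, with all structure maps (source $s$, target $t$, multiplication, inverse, unit $x\mapsto1_x$) continuous; $gg'$ is defined when $s(g)=t(g')$. A space $X$ is viewed as the unit groupoid $(X\rightrightarrows X)$. A right $\mathscr{G}$-action on $X$ along $\epsilon:X\to\mathscr{G}_0$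 is a continuous map $X\times_{\mathscr{G}_0}\mathscr{G}_1=\{(x,g):\epsilon(x)=t(g)\}\to X$, $(x,g)\mapsto xg$, with $\epsilon(xg)=s(g)$, $x1_{\epsilon(x)}=x$, $(xg)g'=x(gg')$; left $\mathscr{H}$-actions along $\pi:X\to\mathscr{H}_0$ are defined analogously ($hx$ is defined when $s(h)=\pi(x)$, and $\pi(hx)=t(h)$). A principal $\mathscr{G}$-bundle over $\mathscr{H}$ is a space $P$ with a left $\mathscr{H}$-action along $\pi:P\to\mathscr{H}_0$ and a right $\mathscr{G}$-action along $\epsilon:P\to\mathscr{G}_0$ such that $\pi$ has local sections (continuous sections over an open neighbourhood of each point), $\pi(pg)=\pi(p)$, $\epsilon(hp)=\epsilon(p)$, $h(pg)=(hp)g$, and $(p,g)\mapsto(p,pg)$ is a homeomorphism $P\times_{\mathscr{G}_0}\mathscr{G}_1\to P\times_{\mathscr{H}_0}P$. Isomorphisms are equivariant homeomorphisms commuting with $\pi$ and $\epsilon$. For a principal $\mathscr{H}$-bundle $Q$ over $\mathscr{K}$ and a principal $\mathscr{G}$-bundle $P$ over $\mathscr{H}$, $Q\otimes P$ is the quotient of $Q\times_{\mathscr{H}_0}P$ by $(qh,p)\sim(q,hp)$; it is a principal $\mathscr{G}$-bundle over $\mathscr{K}$. The principal $\mathscr{G}$-bundle over $\mathscr{H}$ associated to a continuous functor $\phi:\mathscr{H}\to\mathscr{G}$ is $\langle\phi\rangle=\{(y,g)\in\mathscr{H}_0\times\mathscr{G}_1:\phi(y)=t(g)\}$, with $\pi(y,g)=y$,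 $\epsilon(y,g)=s(g)$, $(y,g)g'=(y,gg')$ and $h(y,g)=(t(h),\phi(h)g)$. Serre fibration (bundles): a principal $\mathscr{G}$-bundle $P$ over $\mathscr{H}$ is a Serre fibration if for every $n\ge0$ and every triple $(\alpha,\beta,h)$, where $\alpha$ is a principal $\mathscr{H}$-bundle over $I^n$ ($I=[0,1]$), $\beta$ a principal $\mathscr{G}$-bundle over $I^{n+1}$ and $h:\alpha\otimes P\to\beta|_{I^n\times\{0\}}$ an isomorphism, there is a triple $(A,B,H)$ with $A$ a principal $\mathscr{H}$-bundle over $I^{n+1}$, $B$ a principal $\mathscr{G}$-bundle over $I^{n+1}$ and $H:A\otimes P\to B$ an isomorphism of principal $\mathscr{G}$-bundles over $I^{n+1}$, such that there are isomorphisms $q:\alpha\to A|_{I^n\times\{0\}}$ and $R:\beta\to B$ with $H|_{I^n\times\{0\}}\circ(q\otimes\mathrm{id})=R|_{I^n\times\{0\}}\circ h$. *)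

theory Defs
  imports "HOL-Analysis.Analysis"
begin

section \<open>Smooth manifolds\<close>

text \<open>Coordinates take values in the library's \<^const>\<open>Euclidean_space\<close> \<open>n\<close>, i.e. the sequences
  \<open>nat \<Rightarrow> real\<close> vanishing from index \<open>n\<close> on. Unlike the class \<open>euclidean_space\<close> this includes
  dimension 0, which is needed for discrete groupoids.\<close>

definition partial_deriv :: "nat \<Rightarrow> ((nat \<Rightarrow> real) \<Rightarrow> real) \<Rightarrow> (nat \<Rightarrow> real) \<Rightarrow> real" where
  "partial_deriv i f x = deriv (\<lambda>t. f (x(i := t))) (x i)"

definition partially_differentiable :: "nat \<Rightarrow> ((nat \<Rightarrow> real) \<Rightarrow> real) \<Rightarrow> (nat \<Rightarrow> real) \<Rightarrow> bool" where
  "partially_differentiable i f x \<longleftrightarrow> (\<lambda>t. f (x(i := t))) field_differentiable at (x i)"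

text \<open>\<open>Ck_on k n U f\<close>: \<open>f\<close> is \<open>k\<close> times continuously differentiable on the open set \<open>U\<close> of
  \<open>\<real>\<^sup>n\<close>.\<close>

primrec Ck_on :: "nat \<Rightarrow> nat \<Rightarrow> (nat \<Rightarrow> real) set \<Rightarrow> ((nat \<Rightarrow> real) \<Rightarrow> real) \<Rightarrow> bool" where
  "Ck_on 0 n U f \<longleftrightarrow> continuous_map (subtopology (Euclidean_space n) U) euclideanreal f"
| "Ck_on (Suc k) n U f \<longleftrightarrow>
     continuous_map (subtopology (Euclidean_space n) U) euclideanreal f \<and>
     (\<forall>i<n. (\<forall>x\<in>U. partially_differentiable i f x) \<and> Ck_on k n U (partial_deriv i f))"

definition smooth_coords ::
    "nat \<Rightarrow> (nat \<Rightarrow> real) set \<Rightarrow> nat \<Rightarrow> ((nat \<Rightarrow> real) \<Rightarrow> (nat \<Rightarrow> real)) \<Rightarrow> bool" where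
  "smooth_coords n U m f \<longleftrightarrow> (\<forall>j<m. \<forall>k. Ck_on k n U (\<lambda>x. f x j))"

text \<open>A chart is a pair of its domain and its coordinate map; the atlas need not be maximal.\<close>

record 'a manifold =
  mtop :: "'a topology"
  mdim :: nat
  atlas :: "('a set \<times> ('a \<Rightarrow> nat \<Rightarrow> real)) set"

text \<open>Neither the Hausdorff property nor second countability is part of this notion, since the
  arrow manifold of a Lie groupoid need have neither.\<close>

definition smooth_manifold :: "'a manifold \<Rightarrow> bool" where
  "smooth_manifold M \<longleftrightarrow>
     (\<forall>(U, \<phi>)\<in>atlas M.
        openin (mtop M) U \<and> openin (Euclidean_space (mdim M)) (\<phi> ` U) \<and>
        homeomorphic_map (subtopology (mtop M) U)
          (subtopology (Euclidean_space (mdim M)) (\<phi> ` U)) \<phi>) \<and>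
     (\<Union>(U, \<phi>)\<in>atlas M. U) = topspace (mtop M) \<and>
     (\<forall>(U, \<phi>)\<in>atlas M. \<forall>(V, \<psi>)\<in>atlas M.
        smooth_coords (mdim M) (\<phi> ` (U \<inter> V)) (mdim M) (\<psi> \<circ> inv_into U \<phi>))"

text \<open>Smoothness on an open set \<open>W\<close> of \<open>M\<close>.\<close>

definition smooth_on :: "'a manifold \<Rightarrow> 'a set \<Rightarrow> 'b manifold \<Rightarrow> ('a \<Rightarrow> 'b) \<Rightarrow> bool" where
  "smooth_on M W N f \<longleftrightarrow>
     continuous_map (subtopology (mtop M) W) (mtop N) f \<and>
     (\<forall>(U, \<phi>)\<in>atlas M. \<forall>(V, \<psi>)\<in>atlas N.
        smooth_coords (mdim M) (\<phi> ` (U \<inter> W \<inter> f -` V)) (mdim N) (\<psi> \<circ> f \<circ> inv_into U \<phi>))"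

abbreviation smooth_map :: "'a manifold \<Rightarrow> 'b manifold \<Rightarrow> ('a \<Rightarrow> 'b) \<Rightarrow> bool" where
  "smooth_map M N f \<equiv> smooth_on M (topspace (mtop M)) N f"

definition local_diffeo_on :: "'a manifold \<Rightarrow> 'a set \<Rightarrow> 'b manifold \<Rightarrow> ('a \<Rightarrow> 'b) \<Rightarrow> bool" where
  "local_diffeo_on M V N f \<longleftrightarrow>
     (\<forall>x\<in>V. \<exists>W. openin (mtop M) W \<and> x \<in> W \<and> W \<subseteq> V \<and> openin (mtop N) (f ` W) \<and> inj_on f W \<and>
        smooth_on M W N f \<and> smooth_on N (f ` W) M (inv_into W f))"

abbreviation local_diffeo :: "'a manifold \<Rightarrow> 'b manifold \<Rightarrow> ('a \<Rightarrow> 'b) \<Rightarrow> bool" where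
  "local_diffeo M N f \<equiv> local_diffeo_on M (topspace (mtop M)) N f"

text \<open>The chart \<open>\<phi> \<times> \<psi>\<close>, under the identification of \<open>\<real>\<^sup>m \<times> \<real>\<^sup>n\<close> with \<open>\<real>\<^sup>m\<^sup>+\<^sup>n\<close> by concatenation.\<close>

definition prod_manifold :: "'a manifold \<Rightarrow> 'b manifold \<Rightarrow> ('a \<times> 'b) manifold" where
  "prod_manifold M N =
     \<lparr>mtop = prod_topology (mtop M) (mtop N),
      mdim = mdim M + mdim N,
      atlas = {(U \<times> V, \<lambda>(x, y) i. if i < mdim M then \<phi> x i else \<psi> y (i - mdim M)) |U \<phi> V \<psi>.
                (U, \<phi>) \<in> atlas M \<and> (V, \<psi>) \<in> atlas N}\<rparr>"

text \<open>Smoothness of a map defined on a subset \<open>S\<close>, by local smooth extension to the ambient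
  manifold. For an embedded submanifold \<open>S\<close> this is smoothness for its submanifold structure;
  it is used for the submanifold of composable pairs of arrows.\<close>

definition smooth_on_subset :: "'a manifold \<Rightarrow> 'a set \<Rightarrow> 'b manifold \<Rightarrow> ('a \<Rightarrow> 'b) \<Rightarrow> bool" where
  "smooth_on_subset M S N f \<longleftrightarrow>
     (\<forall>x\<in>S. \<exists>W F. openin (mtop M) W \<and> x \<in> W \<and> smooth_on M W N F \<and> (\<forall>y\<in>W \<inter> S. F y = f y))"


section \<open>Topological groupoids and \'etale Lie groupoids\<close>

record ('o, 'a) groupoid =
  Obj :: "'o topology"
  Arr :: "'a topology"
  src :: "'a \<Rightarrow> 'o"
  tgt :: "'a \<Rightarrow> 'o"
  gmult :: "'a \<Rightarrow> 'a \<Rightarrow> 'a"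
  ginv :: "'a \<Rightarrow> 'a"
  gunit :: "'o \<Rightarrow> 'a"

abbreviation objects :: "('o, 'a, 'z) groupoid_scheme \<Rightarrow> 'o set" where
  "objects G \<equiv> topspace (Obj G)"

abbreviation arrows :: "('o, 'a, 'z) groupoid_scheme \<Rightarrow> 'a set" where
  "arrows G \<equiv> topspace (Arr G)"

definition composable :: "('o, 'a, 'z) groupoid_scheme \<Rightarrow> ('a \<times> 'a) set" where
  "composable G = {(g, g'). g \<in> arrows G \<and> g' \<in> arrows G \<and> src G g = tgt G g'}"

definition topological_groupoid :: "('o, 'a, 'z) groupoid_scheme \<Rightarrow> bool" where
  "topological_groupoid G \<longleftrightarrow>
     continuous_map (Arr G) (Obj G) (src G) \<and>
     continuous_map (Arr G) (Obj G) (tgt G) \<and>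
     continuous_map (subtopology (prod_topology (Arr G) (Arr G)) (composable G)) (Arr G)
       (\<lambda>(g, g'). gmult G g g') \<and>
     continuous_map (Arr G) (Arr G) (ginv G) \<and>
     continuous_map (Obj G) (Arr G) (gunit G) \<and>
     (\<forall>(g, g')\<in>composable G. src G (gmult G g g') = src G g' \<and> tgt G (gmult G g g') = tgt G g) \<and>
     (\<forall>g g' g''. (g, g') \<in> composable G \<and> (g', g'') \<in> composable G \<longrightarrow>
        gmult G (gmult G g g') g'' = gmult G g (gmult G g' g'')) \<and>
     (\<forall>x\<in>objects G. src G (gunit G x) = x \<and> tgt G (gunit G x) = x) \<and>
     (\<forall>g\<in>arrows G. gmult G (gunit G (tgt G g)) g = g \<and> gmult G g (gunit G (src G g)) = g) \<and>
     (\<forall>g\<in>arrows G. src G (ginv G g) = tgt G g \<and> tgt G (ginv G g) = src G g \<and>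
        gmult G g (ginv G g) = gunit G (tgt G g) \<and> gmult G (ginv G g) g = gunit G (src G g))"

definition unit_groupoid :: "'x topology \<Rightarrow> ('x, 'x) groupoid" where
  "unit_groupoid X =
     \<lparr>Obj = X, Arr = X, src = id, tgt = id, gmult = (\<lambda>x y. x), ginv = id, gunit = id\<rparr>"

record ('o, 'a) lie_groupoid = "('o, 'a) groupoid" +
  obj_dim :: nat
  obj_atlas :: "('o set \<times> ('o \<Rightarrow> nat \<Rightarrow> real)) set"
  arr_dim :: nat
  arr_atlas :: "('a set \<times> ('a \<Rightarrow> nat \<Rightarrow> real)) set"

definition obj_manifold :: "('o, 'a, 'z) lie_groupoid_scheme \<Rightarrow> 'o manifold" where
  "obj_manifold G = \<lparr>mtop = Obj G, mdim = obj_dim G, atlas = obj_atlas G\<rparr>"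

definition arr_manifold :: "('o, 'a, 'z) lie_groupoid_scheme \<Rightarrow> 'a manifold" where
  "arr_manifold G = \<lparr>mtop = Arr G, mdim = arr_dim G, atlas = arr_atlas G\<rparr>"

text \<open>As usual for Lie groupoids, the manifold of objects is Hausdorff while the manifold of arrows
  need not be. The submersion condition on source and target is subsumed by their being local
  diffeomorphisms.\<close>

definition etale_lie_groupoid :: "('o, 'a, 'z) lie_groupoid_scheme \<Rightarrow> bool" where
  "etale_lie_groupoid G \<longleftrightarrow>
     topological_groupoid G \<and>
     smooth_manifold (obj_manifold G) \<and> Hausdorff_space (Obj G) \<and>
     smooth_manifold (arr_manifold G) \<and>
     smooth_map (arr_manifold G) (obj_manifold G) (src G) \<and>
     smooth_map (arr_manifold G) (obj_manifold G) (tgt G) \<and>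
     smooth_on_subset (prod_manifold (arr_manifold G) (arr_manifold G)) (composable G)
       (arr_manifold G) (\<lambda>(g, g'). gmult G g g') \<and>
     smooth_map (arr_manifold G) (arr_manifold G) (ginv G) \<and>
     smooth_map (obj_manifold G) (arr_manifold G) (gunit G) \<and>
     local_diffeo (arr_manifold G) (obj_manifold G) (src G) \<and>
     local_diffeo (arr_manifold G) (obj_manifold G) (tgt G)"

definition proper_groupoid :: "('o, 'a, 'z) groupoid_scheme \<Rightarrow> bool" where
  "proper_groupoid G \<longleftrightarrow>
     Hausdorff_space (Arr G) \<and>
     proper_map (Arr G) (prod_topology (Obj G) (Obj G)) (\<lambda>g. (src G g, tgt G g))"


section \<open>The effect groupoid\<close>

text \<open>A germ is recorded together with its base point; its second component is the class of all
  functions agreeing with the given one near the base point.\<close>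

type_synonym 'o germ = "'o \<times> ('o \<Rightarrow> 'o) set"

definition germ :: "'o topology \<Rightarrow> 'o \<Rightarrow> ('o \<Rightarrow> 'o) \<Rightarrow> 'o germ" where
  "germ X x f = (x, {h. \<exists>W. openin X W \<and> x \<in> W \<and> (\<forall>y\<in>W. h y = f y)})"

definition germ_rep :: "'o germ \<Rightarrow> 'o \<Rightarrow> 'o" where
  "germ_rep c = (SOME f. f \<in> snd c)"

definition germ_src :: "'o germ \<Rightarrow> 'o" where
  "germ_src c = fst c"

definition germ_tgt :: "'o germ \<Rightarrow> 'o" where
  "germ_tgt c = germ_rep c (fst c)"

definition germ_comp :: "'o topology \<Rightarrow> 'o germ \<Rightarrow> 'o germ \<Rightarrow> 'o germ" where
  "germ_comp X c d = germ X (germ_src d) (germ_rep c \<circ> germ_rep d)"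

text \<open>For the germ of a local homeomorphism \<open>f\<close> at \<open>x\<close>, the functions that are left inverse to
  \<open>f\<close> near \<open>x\<close> are exactly the members of the germ of the local inverse of \<open>f\<close> at \<open>f x\<close>.\<close>

definition germ_inverse :: "'o topology \<Rightarrow> 'o germ \<Rightarrow> 'o germ" where
  "germ_inverse X c =
     (germ_tgt c, {h. \<exists>W. openin X W \<and> germ_src c \<in> W \<and> (\<forall>y\<in>W. h (germ_rep c y) = y)})"

text \<open>The sheaf topology on the germs of local diffeomorphisms: the germs of a fixed local
  diffeomorphism \<open>f\<close> at the points of its open domain \<open>V\<close> form a basic open set.\<close>

definition germ_topology :: "'o manifold \<Rightarrow> 'o germ topology" where
  "germ_topology M =
     topology_generated_by
       {(\<lambda>y. germ (mtop M) y f) ` V |V f. openin (mtop M) V \<and> local_diffeo_on M V M f}"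

text \<open>The germ does not depend on the choice of \<open>U\<close>.\<close>

definition effect :: "('o, 'a, 'z) groupoid_scheme \<Rightarrow> 'a \<Rightarrow> 'o germ" where
  "effect G g =
     (let U = (SOME U. openin (Arr G) U \<and> g \<in> U \<and> inj_on (src G) U \<and> inj_on (tgt G) U)
      in germ (Obj G) (src G g) (tgt G \<circ> inv_into U (src G)))"

definition effect_groupoid :: "('o, 'a, 'z) lie_groupoid_scheme \<Rightarrow> ('o, 'o germ) groupoid" where
  "effect_groupoid G =
     \<lparr>Obj = Obj G,
      Arr = subtopology (germ_topology (obj_manifold G)) (effect G ` arrows G),
      src = germ_src,
      tgt = germ_tgt,
      gmult = germ_comp (Obj G),
      ginv = germ_inverse (Obj G),
      gunit = (\<lambda>x. germ (Obj G) x id)\<rparr>"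


section \<open>Principal bundles\<close>

text \<open>\<open>lact P h p\<close> is \<open>hp\<close> and \<open>ract P p g\<close> is \<open>pg\<close>; their values are relevant only where the action
  is defined.\<close>

record ('p, 'h0, 'h1, 'g0, 'g1) bibundle =
  Tot :: "'p topology"
  proj :: "'p \<Rightarrow> 'h0"
  eps :: "'p \<Rightarrow> 'g0"
  lact :: "'h1 \<Rightarrow> 'p \<Rightarrow> 'p"
  ract :: "'p \<Rightarrow> 'g1 \<Rightarrow> 'p"

abbreviation total_space :: "('p, 'h0, 'h1, 'g0, 'g1) bibundle \<Rightarrow> 'p set" where
  "total_space P \<equiv> topspace (Tot P)"

definition right_action ::
    "('g0, 'g1, 'z) groupoid_scheme \<Rightarrow> 'x topology \<Rightarrow> ('x \<Rightarrow> 'g0) \<Rightarrow> ('x \<Rightarrow> 'g1 \<Rightarrow> 'x) \<Rightarrow> bool" where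
  "right_action G X e act \<longleftrightarrow>
     continuous_map X (Obj G) e \<and>
     continuous_map (subtopology (prod_topology X (Arr G)) {(x, g). e x = tgt G g}) X
       (\<lambda>(x, g). act x g) \<and>
     (\<forall>x\<in>topspace X. \<forall>g\<in>arrows G. e x = tgt G g \<longrightarrow> e (act x g) = src G g) \<and>
     (\<forall>x\<in>topspace X. act x (gunit G (e x)) = x) \<and>
     (\<forall>x\<in>topspace X. \<forall>g\<in>arrows G. \<forall>g'\<in>arrows G. e x = tgt G g \<and> src G g = tgt G g' \<longrightarrow>
        act (act x g) g' = act x (gmult G g g'))"

definition left_action ::
    "('h0, 'h1, 'z) groupoid_scheme \<Rightarrow> 'x topology \<Rightarrow> ('x \<Rightarrow> 'h0) \<Rightarrow> ('h1 \<Rightarrow> 'x \<Rightarrow> 'x) \<Rightarrow> bool" where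
  "left_action H X p act \<longleftrightarrow>
     continuous_map X (Obj H) p \<and>
     continuous_map (subtopology (prod_topology (Arr H) X) {(h, x). src H h = p x}) X
       (\<lambda>(h, x). act h x) \<and>
     (\<forall>x\<in>topspace X. \<forall>h\<in>arrows H. src H h = p x \<longrightarrow> p (act h x) = tgt H h) \<and>
     (\<forall>x\<in>topspace X. act (gunit H (p x)) x = x) \<and>
     (\<forall>x\<in>topspace X. \<forall>h\<in>arrows H. \<forall>h'\<in>arrows H. src H h' = p x \<and> src H h = tgt H h' \<longrightarrow>
        act h (act h' x) = act (gmult H h h') x)"

text \<open>\<open>principal_bundle G H P\<close>: \<open>P\<close> is a principal \<open>G\<close>-bundle over \<open>H\<close>.\<close>

definition principal_bundle ::
    "('g0, 'g1, 'y) groupoid_scheme \<Rightarrow> ('h0, 'h1, 'z) groupoid_scheme \<Rightarrow>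
     ('p, 'h0, 'h1, 'g0, 'g1) bibundle \<Rightarrow> bool" where
  "principal_bundle G H P \<longleftrightarrow>
     topological_groupoid G \<and> topological_groupoid H \<and>
     left_action H (Tot P) (proj P) (lact P) \<and>
     right_action G (Tot P) (eps P) (ract P) \<and>
     (\<forall>y\<in>objects H. \<exists>U \<sigma>. openin (Obj H) U \<and> y \<in> U \<and>
        continuous_map (subtopology (Obj H) U) (Tot P) \<sigma> \<and> (\<forall>z\<in>U. proj P (\<sigma> z) = z)) \<and>
     (\<forall>p\<in>total_space P. \<forall>g\<in>arrows G. eps P p = tgt G g \<longrightarrow> proj P (ract P p g) = proj P p) \<and>
     (\<forall>p\<in>total_space P. \<forall>h\<in>arrows H. src H h = proj P p \<longrightarrow> eps P (lact P h p) = eps P p) \<and>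
     (\<forall>p\<in>total_space P. \<forall>g\<in>arrows G. \<forall>h\<in>arrows H. eps P p = tgt G g \<and> src H h = proj P p \<longrightarrow>
        lact P h (ract P p g) = ract P (lact P h p) g) \<and>
     homeomorphic_map
       (subtopology (prod_topology (Tot P) (Arr G)) {(p, g). eps P p = tgt G g})
       (subtopology (prod_topology (Tot P) (Tot P)) {(p, p'). proj P p = proj P p'})
       (\<lambda>(p, g). (p, ract P p g))"

definition bundle_iso ::
    "('g0, 'g1, 'y) groupoid_scheme \<Rightarrow> ('h0, 'h1, 'z) groupoid_scheme \<Rightarrow>
     ('p, 'h0, 'h1, 'g0, 'g1) bibundle \<Rightarrow> ('q, 'h0, 'h1, 'g0, 'g1) bibundle \<Rightarrow> ('p \<Rightarrow> 'q) \<Rightarrow> bool" where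
  "bundle_iso G H P Q f \<longleftrightarrow>
     homeomorphic_map (Tot P) (Tot Q) f \<and>
     (\<forall>p\<in>total_space P. proj Q (f p) = proj P p \<and> eps Q (f p) = eps P p) \<and>
     (\<forall>p\<in>total_space P. \<forall>g\<in>arrows G. eps P p = tgt G g \<longrightarrow> f (ract P p g) = ract Q (f p) g) \<and>
     (\<forall>p\<in>total_space P. \<forall>h\<in>arrows H. src H h = proj P p \<longrightarrow> f (lact P h p) = lact Q h (f p))"

definition restrict_bundle ::
    "'h0 set \<Rightarrow> ('p, 'h0, 'h1, 'g0, 'g1) bibundle \<Rightarrow> ('p, 'h0, 'h1, 'g0, 'g1) bibundle" where
  "restrict_bundle S P = P\<lparr>Tot := subtopology (Tot P) {p. proj P p \<in> S}\<rparr>"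

definition functor_bundle ::
    "('g0, 'g1, 'y) groupoid_scheme \<Rightarrow> ('h0, 'h1, 'z) groupoid_scheme \<Rightarrow>
     ('h0 \<Rightarrow> 'g0) \<Rightarrow> ('h1 \<Rightarrow> 'g1) \<Rightarrow> ('h0 \<times> 'g1, 'h0, 'h1, 'g0, 'g1) bibundle" where
  "functor_bundle G H \<phi>\<^sub>0 \<phi>\<^sub>1 =
     \<lparr>Tot = subtopology (prod_topology (Obj H) (Arr G)) {(y, g). \<phi>\<^sub>0 y = tgt G g},
      proj = (\<lambda>(y, g). y),
      eps = (\<lambda>(y, g). src G g),
      lact = (\<lambda>h (y, g). (tgt H h, gmult G (\<phi>\<^sub>1 h) g)),
      ract = (\<lambda>(y, g) g'. (y, gmult G g g'))\<rparr>"


section \<open>Tensor product of bundles\<close>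

definition quotient_topology :: "'x topology \<Rightarrow> ('x \<times> 'x) set \<Rightarrow> 'x set topology" where
  "quotient_topology X r =
     topology (\<lambda>V. V \<subseteq> topspace X // r \<and> openin X {x \<in> topspace X. r `` {x} \<in> V})"

lemma openin_quotient_topology:
  "openin (quotient_topology X r) V \<longleftrightarrow>
     V \<subseteq> topspace X // r \<and> openin X {x \<in> topspace X. r `` {x} \<in> V}"
proof -
  have "istopology (\<lambda>V. V \<subseteq> topspace X // r \<and> openin X {x \<in> topspace X. r `` {x} \<in> V})"
    unfolding istopology_def
  proof (intro conjI allI impI)
    fix S T
    assume "S \<subseteq> topspace X // r \<and> openin X {x \<in> topspace X. r `` {x} \<in> S}"
      and "T \<subseteq> topspace X // r \<and> openin X {x \<in> topspace X. r `` {x} \<in> T}"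
    moreover have "{x \<in> topspace X. r `` {x} \<in> S \<inter> T} =
        {x \<in> topspace X. r `` {x} \<in> S} \<inter> {x \<in> topspace X. r `` {x} \<in> T}"
      by auto
    ultimately show "S \<inter> T \<subseteq> topspace X // r" "openin X {x \<in> topspace X. r `` {x} \<in> S \<inter> T}"
      by auto
  next
    fix \<K>
    assume K: "\<forall>S\<in>\<K>. S \<subseteq> topspace X // r \<and> openin X {x \<in> topspace X. r `` {x} \<in> S}"
    then show "\<Union>\<K> \<subseteq> topspace X // r"
      by blast
    have "{x \<in> topspace X. r `` {x} \<in> \<Union>\<K>} = (\<Union>S\<in>\<K>. {x \<in> topspace X. r `` {x} \<in> S})"
      by auto
    then show "openin X {x \<in> topspace X. r `` {x} \<in> \<Union>\<K>}"
      using K by (metis (no_types, lifting) openin_Union imageE)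
  qed
  then show ?thesis
    unfolding quotient_topology_def by (simp add: topology_inverse')
qed

text \<open>The relation \<open>(qh, p) \<sim> (q, hp)\<close>; the groupoid and action laws make it an equivalence relation
  on \<open>tensor_domain Q P\<close>.\<close>

definition tensor_domain ::
    "('q, 'k0, 'k1, 'h0, 'h1) bibundle \<Rightarrow> ('p, 'h0, 'h1, 'g0, 'g1) bibundle \<Rightarrow> ('q \<times> 'p) set" where
  "tensor_domain Q P = {(q, p). q \<in> total_space Q \<and> p \<in> total_space P \<and> eps Q q = proj P p}"

definition tensor_rel ::
    "('h0, 'h1, 'z) groupoid_scheme \<Rightarrow> ('q, 'k0, 'k1, 'h0, 'h1) bibundle \<Rightarrow>
     ('p, 'h0, 'h1, 'g0, 'g1) bibundle \<Rightarrow> (('q \<times> 'p) \<times> ('q \<times> 'p)) set" where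
  "tensor_rel H Q P =
     {((ract Q q h, p), (q, lact P h p)) |q h p. q \<in> total_space Q \<and> h \<in> arrows H \<and> p \<in> total_space P \<and>
        eps Q q = tgt H h \<and> src H h = proj P p}"

definition tensor_class ::
    "('h0, 'h1, 'z) groupoid_scheme \<Rightarrow> ('q, 'k0, 'k1, 'h0, 'h1) bibundle \<Rightarrow>
     ('p, 'h0, 'h1, 'g0, 'g1) bibundle \<Rightarrow> 'q \<times> 'p \<Rightarrow> ('q \<times> 'p) set" where
  "tensor_class H Q P z = tensor_rel H Q P `` {z}"

text \<open>\<open>tensor H Q P\<close> is \<open>Q \<otimes> P\<close>, for \<open>Q\<close> a principal \<open>H\<close>-bundle and \<open>P\<close> a bundle over \<open>H\<close>. The structure
  maps and actions on a class are computed from an arbitrary representative.\<close>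

definition tensor ::
    "('h0, 'h1, 'z) groupoid_scheme \<Rightarrow> ('q, 'k0, 'k1, 'h0, 'h1) bibundle \<Rightarrow>
     ('p, 'h0, 'h1, 'g0, 'g1) bibundle \<Rightarrow> (('q \<times> 'p) set, 'k0, 'k1, 'g0, 'g1) bibundle" where
  "tensor H Q P =
     \<lparr>Tot = quotient_topology
              (subtopology (prod_topology (Tot Q) (Tot P)) (tensor_domain Q P)) (tensor_rel H Q P),
      proj = (\<lambda>c. proj Q (fst (SOME z. z \<in> c))),
      eps = (\<lambda>c. eps P (snd (SOME z. z \<in> c))),
      lact = (\<lambda>k c. let (q, p) = (SOME z. z \<in> c) in tensor_class H Q P (lact Q k q, p)),
      ract = (\<lambda>c g. let (q, p) = (SOME z. z \<in> c) in tensor_class H Q P (q, ract P p g))\<rparr>"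

text \<open>\<open>tensor_map H Q' P f\<close> is the map \<open>f \<otimes> id\<close> into \<open>Q' \<otimes> P\<close>.\<close>

definition tensor_map ::
    "('h0, 'h1, 'z) groupoid_scheme \<Rightarrow> ('q2, 'k0, 'k1, 'h0, 'h1) bibundle \<Rightarrow>
     ('p, 'h0, 'h1, 'g0, 'g1) bibundle \<Rightarrow> ('q1 \<Rightarrow> 'q2) \<Rightarrow> ('q1 \<times> 'p) set \<Rightarrow> ('q2 \<times> 'p) set" where
  "tensor_map H Q' P f c = (let (q, p) = (SOME z. z \<in> c) in tensor_class H Q' P (f q, p))"

text \<open>Restricting the base commutes with the tensor product, and the canonical identification of
  \<open>Q|\<^sub>S \<otimes> P\<close> with \<open>(Q \<otimes> P)|\<^sub>S\<close> is an equality of equivalence classes.\<close>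

lemma tensor_class_restrict:
  assumes Q: "principal_bundle H K Q" and q: "proj Q q \<in> S"
  shows "tensor_class H (restrict_bundle S Q) P (q, p) = tensor_class H Q P (q, p)"
proof -
  have "\<forall>q'\<in>total_space Q. \<forall>h\<in>arrows H. eps Q q' = tgt H h \<longrightarrow>
      proj Q (ract Q q' h) = proj Q q'"
    using Q unfolding principal_bundle_def by (elim conjE)
  then show ?thesis
    using q by (fastforce simp: tensor_class_def tensor_rel_def restrict_bundle_def)
qed


section \<open>Serre fibrations\<close>

text \<open>With \<open>\<real>\<^sup>n\<close> realised as \<^const>\<open>Euclidean_space\<close> \<open>n\<close>, the face \<open>I\<^sup>n \<times> {0}\<close> of \<open>I\<^sup>n\<^sup>+\<^sup>1\<close> is literally the
  cube \<open>I\<^sup>n\<close>.\<close>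

definition cube :: "nat \<Rightarrow> (nat \<Rightarrow> real) topology" where
  "cube n = subtopology (Euclidean_space n) {x. \<forall>i<n. 0 \<le> x i \<and> x i \<le> 1}"

lemma cube_face: "subtopology (cube (Suc n)) {x. x n = 0} = cube n"
proof -
  have *: "(\<forall>i\<ge>Suc n. x i = 0) \<and> (\<forall>i<Suc n. 0 \<le> x i \<and> x i \<le> 1) \<and> x n = 0 \<longleftrightarrow>
      (\<forall>i\<ge>n. x i = 0) \<and> (\<forall>i<n. 0 \<le> x i \<and> x i \<le> 1)" (is "?l \<longleftrightarrow> ?r") for x :: "nat \<Rightarrow> real"
  proof
    assume l: ?l
    have "x i = 0" if "n \<le> i" for i
      using l that by (cases "i = n") auto
    with l show ?r by simp
  next
    assume r: ?r
    have "0 \<le> x i \<and> x i \<le> 1" if "i < Suc n" for i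
      using r that by (cases "i = n") auto
    with r show ?l by simp
  qed
  have "{x::nat \<Rightarrow> real. \<forall>i\<ge>Suc n. x i = 0} \<inter> {x. \<forall>i<Suc n. 0 \<le> x i \<and> x i \<le> 1} \<inter> {x. x n = 0} =
      {x. \<forall>i\<ge>n. x i = 0} \<inter> {x. \<forall>i<n. 0 \<le> x i \<and> x i \<le> 1}"
    by (intro set_eqI) (simp only: Int_iff mem_Collect_eq conj_assoc *)
  then show ?thesis
    unfolding cube_def Euclidean_space_def subtopology_subtopology by simp
qed

text \<open>The total spaces of the given bundles \<open>\<alpha>\<close> and \<open>\<beta>\<close> live in arbitrary types \<open>'q\<close> and \<open>'r\<close>. HOL has no
  existential quantifier over types, so the total spaces of \<open>A\<close> and \<open>B\<close> are taken in
  \<open>(nat \<Rightarrow> real) \<times> 'h1\<close> and \<open>(nat \<Rightarrow> real) \<times> 'g1\<close>. This loses nothing: choosing a point \<open>p\<^sub>x\<close> over each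
  \<open>x \<in> I\<^sup>m\<close> in a principal \<open>G\<close>-bundle over \<open>I\<^sup>m\<close>, the injection \<open>p\<^sub>xg \<mapsto> (x, g)\<close> transports the bundle to an
  isomorphic one with total space in \<open>(nat \<Rightarrow> real) \<times> 'g1\<close>.\<close>

definition serre_fibration ::
    "'q itself \<Rightarrow> 'r itself \<Rightarrow> ('g0, 'g1, 'y) groupoid_scheme \<Rightarrow> ('h0, 'h1, 'z) groupoid_scheme \<Rightarrow>
     ('p, 'h0, 'h1, 'g0, 'g1) bibundle \<Rightarrow> bool" where
  "serre_fibration _ _ G H P \<longleftrightarrow>
     principal_bundle G H P \<and>
     (\<forall>n (\<alpha> :: ('q, nat \<Rightarrow> real, nat \<Rightarrow> real, 'h0, 'h1) bibundle)
        (\<beta> :: ('r, nat \<Rightarrow> real, nat \<Rightarrow> real, 'g0, 'g1) bibundle) h.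
        principal_bundle H (unit_groupoid (cube n)) \<alpha> \<and>
        principal_bundle G (unit_groupoid (cube (Suc n))) \<beta> \<and>
        bundle_iso G (unit_groupoid (cube n))
          (tensor H \<alpha> P) (restrict_bundle (topspace (cube n)) \<beta>) h \<longrightarrow>
        (\<exists>(A :: ((nat \<Rightarrow> real) \<times> 'h1, nat \<Rightarrow> real, nat \<Rightarrow> real, 'h0, 'h1) bibundle)
           (B :: ((nat \<Rightarrow> real) \<times> 'g1, nat \<Rightarrow> real, nat \<Rightarrow> real, 'g0, 'g1) bibundle) K q R.
           principal_bundle H (unit_groupoid (cube (Suc n))) A \<and>
           principal_bundle G (unit_groupoid (cube (Suc n))) B \<and>
           bundle_iso G (unit_groupoid (cube (Suc n))) (tensor H A P) B K \<and>
           bundle_iso H (unit_groupoid (cube n)) \<alpha> (restrict_bundle (topspace (cube n)) A) q \<and>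
           bundle_iso G (unit_groupoid (cube (Suc n))) \<beta> B R \<and>
           (\<forall>z\<in>total_space (tensor H \<alpha> P).
              K (tensor_map H (restrict_bundle (topspace (cube n)) A) P q z) = R (h z))))"

end

theory Submission
  imports Defs
begin

text \<open>
  The total space of the bundle of \<open>Eff\<close> is, up to a redundant object, the space of arrows of
  \<open>Eff(G)\<close>. An isomorphism \<open>h\<close> from \<open>\<alpha> \<otimes> \<langle>Eff\<rangle>\<close> to the restriction of \<open>\<beta>\<close> is therefore the same as an
  \<open>Eff\<close>-equivariant map \<open>\<alpha> \<rightarrow> \<beta>\<close> over the inclusion of the face, namely \<open>a \<mapsto> h [a, 1]\<close>; in other
  words, \<open>\<alpha>\<close> is a lift of the restriction of \<open>\<beta>\<close> through \<open>Eff : G \<rightarrow> Eff(G)\<close>. The theorem says that a lift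
  over the face \<open>I\<^sup>n \<times> {0}\<close> extends to a lift of \<open>\<beta>\<close> over the whole cube. It holds because on arrows
  \<open>Eff\<close> is a covering map.

  Two parallel arrows have the same effect iff they differ by an isotropy arrow that acts as the
  identity near its base point. The set \<open>K\<close> of these arrows is clearly open, and \<open>Eff\<close> is a covering as
  soon as \<open>K\<close> is also closed. This is where properness and smoothness enter. If an isotropy arrow \<open>k\<close> at
  \<open>x\<close> lies in the closure of \<open>K\<close>, it acts near \<open>x\<close> by a local diffeomorphism \<open>f\<close> which fixes \<open>x\<close> and is the
  identity on open sets accumulating at \<open>x\<close>, so that its differential at \<open>x\<close> is the identity. By properness
  the isotropy group of \<open>x\<close> is compact, and it is discrete, hence finite; so \<open>f\<close> has finite order. A map of
  finite order with identical differential is the identity near the fixed point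
  (\<open>finite_order_eq_id_near\<close>), so \<open>k\<close> lies in \<open>K\<close> (\<open>effect_trivial_of_accumulation\<close>). A second use of
  properness turns this into evenly covered neighbourhoods (\<open>effect_sheets\<close>).

  The lifting problem is then solved for any such covering functor \<open>E : G \<rightarrow> Q\<close>. Choose a point \<open>c y\<close> of
  \<open>\<beta>\<close> over each \<open>y\<close>, without any continuity. As a set with an action of \<open>G\<close> and an equivariant map to
  \<open>\<beta>\<close>, a lift can always be taken to be the set of all \<open>(y, g)\<close> with \<open>t(g) = \<epsilon>(c y)\<close> and the map
  \<open>(y, g) \<mapsto> c y E(g)\<close>; only the topology of the lift has to be found. It is given by an atlas of sections
  \<open>y \<mapsto> (y, r y)\<close> which become continuous sections of \<open>\<beta>\<close> and whose transition functions \<open>r\<inverse>r'\<close> are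
  continuous (\<open>glued_bundle\<close>). The bundle \<open>\<alpha>\<close> provides an atlas over the face, and the atlas is
  extended in time by short steps (\<open>atlas_step\<close>). During a step, \<open>\<beta>\<close> has sections over small open sets of
  the face times the time interval. Two such sections differ by paths of arrows of \<open>Q\<close>, which lift
  uniquely to paths of arrows of \<open>G\<close> starting at the transition function that is already known;
  uniqueness preserves the cocycle rule, and the lifted paths depend continuously on the point of the
  face (\<open>lift_family_cont\<close>). Since the cube is compact, one length of the steps serves all points
  (\<open>uniform_slabs\<close>), so finitely many steps reach time 1.
\<close>

section \<open>Local continuity and boxes in Euclidean space\<close>

lemma continuous_map_if_locally:
  assumes "\<And>x. x \<in> topspace X \<Longrightarrow> \<exists>U. openin X U \<and> x \<in> U \<and> continuous_map (subtopology X U) Y f"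
  shows "continuous_map X Y f"
proof -
  define I where "I = {U. openin X U \<and> continuous_map (subtopology X U) Y f}"
  show ?thesis
    by (rule pasting_lemma[where I = I and T = id and f = "\<lambda>_. f"])
      (use assms in \<open>auto simp: I_def, blast?\<close>)
qed

lemma continuous_map_on_local:
  assumes "\<And>x. x \<in> U \<Longrightarrow> x \<in> topspace X \<Longrightarrow> \<exists>V. openin X V \<and> x \<in> V \<and> continuous_map (subtopology X (U \<inter> V)) Y f"
  shows "continuous_map (subtopology X U) Y f"
proof (rule continuous_map_if_locally)
  fix x assume x: "x \<in> topspace (subtopology X U)"
  then obtain V where V: "openin X V" "x \<in> V" "continuous_map (subtopology X (U \<inter> V)) Y f"
    using assms[of x] by auto
  have "openin (subtopology X U) (U \<inter> V)" using V(1) by (rule openin_subtopology_Int2)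
  with V x show "\<exists>W. openin (subtopology X U) W \<and> x \<in> W \<and> continuous_map (subtopology (subtopology X U) W) Y f"
    by (intro exI[of _ "U \<inter> V"]) (simp add: subtopology_subtopology)
qed

lemma open_box_Euclidean_space:
  assumes "openin (Euclidean_space n) U" "u \<in> U"
  shows "\<exists>e>0. \<forall>v\<in>topspace (Euclidean_space n). (\<forall>i<n. \<bar>v i - u i\<bar> < e) \<longrightarrow> v \<in> U"
proof -
  obtain T where T: "openin (powertop_real UNIV) T" and U: "U = T \<inter> {x. \<forall>i\<ge>n. x i = 0}"
    using assms(1) unfolding Euclidean_space_def openin_subtopology by blast
  have "u \<in> T" using assms U by simp
  then obtain W where W: "finite {i. W i \<noteq> UNIV}" "\<And>i. open (W i)" "u \<in> Pi\<^sub>E UNIV W" "Pi\<^sub>E UNIV W \<subseteq> T"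
    using T unfolding openin_product_topology_alt by force
  have "\<exists>d>0. ball (u i) d \<subseteq> W i" for i
    using W(2,3) open_contains_ball[of "W i"] by (auto simp: PiE_def Pi_def)
  then obtain d where d: "\<And>i. d i > 0" "\<And>i. ball (u i) (d i) \<subseteq> W i" by metis
  define e where "e = Min (insert 1 (d ` {i. W i \<noteq> UNIV}))"
  have fin: "finite (insert 1 (d ` {i. W i \<noteq> UNIV}))" using W(1) by simp
  have "e > 0" unfolding e_def using fin d(1) by (subst Min_gr_iff) auto
  moreover have "v \<in> U" if v: "v \<in> topspace (Euclidean_space n)" "\<And>i. i < n \<Longrightarrow> \<bar>v i - u i\<bar> < e" for v
  proof -
    have "v i \<in> W i" for i
    proof (cases "W i = UNIV")
      case False
      then have "e \<le> d i" unfolding e_def by (intro Min_le[OF fin]) auto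
      moreover have "\<bar>v i - u i\<bar> < e"
        using v U assms(2) \<open>e > 0\<close> by (cases "i < n") (auto simp: topspace_Euclidean_space)
      ultimately have "v i \<in> ball (u i) (d i)" by (simp add: dist_real_def)
      then show ?thesis using d(2) by blast
    qed auto
    then have "v \<in> T" using W(4) by auto
    then show ?thesis using U v(1) by (simp add: topspace_Euclidean_space)
  qed
  ultimately show ?thesis by blast
qed

lemma continuous_map_Euclidean_coordinate: "continuous_map (Euclidean_space n) euclideanreal (\<lambda>x. x i)"
  unfolding Euclidean_space_def
  by (intro continuous_map_from_subtopology continuous_map_product_projection) auto

lemma openin_box_Euclidean_space:
  "openin (Euclidean_space n) {v \<in> topspace (Euclidean_space n). \<forall>i<n. \<bar>v i - u i\<bar> < e}"
proof -
  have "openin (Euclidean_space n) {v \<in> topspace (Euclidean_space n). \<forall>i<k. \<bar>v i - u i\<bar> < e}" for k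
  proof (induction k)
    case 0
    then show ?case by simp
  next
    case (Suc k)
    have "openin (Euclidean_space n) {v \<in> topspace (Euclidean_space n). v k \<in> ball (u k) e}"
      by (rule openin_continuous_map_preimage[OF continuous_map_Euclidean_coordinate]) auto
    moreover have "{v \<in> topspace (Euclidean_space n). \<forall>i<Suc k. \<bar>v i - u i\<bar> < e} =
      {v \<in> topspace (Euclidean_space n). \<forall>i<k. \<bar>v i - u i\<bar> < e} \<inter> {v \<in> topspace (Euclidean_space n). v k \<in> ball (u k) e}"
      by (auto simp: less_Suc_eq dist_real_def abs_minus_commute)
    ultimately show ?case using Suc by (simp add: openin_Int)
  qed
  then show ?thesis .
qed

lemma Euclidean_space_update:
  "x \<in> topspace (Euclidean_space n) \<Longrightarrow> i < n \<Longrightarrow> x(i := t) \<in> topspace (Euclidean_space n)"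
  by (simp add: topspace_Euclidean_space)

lemma eventually_update_in_open:
  assumes "openin (Euclidean_space n) U" "x \<in> U" "i < n"
  shows "\<forall>\<^sub>F t in nhds (x i). x(i := t) \<in> U"
proof -
  obtain e where e: "e > 0"
    "\<forall>v\<in>topspace (Euclidean_space n). (\<forall>i<n. \<bar>v i - x i\<bar> < e) \<longrightarrow> v \<in> U"
    using open_box_Euclidean_space[OF assms(1,2)] by blast
  have xn: "x \<in> topspace (Euclidean_space n)" using assms openin_subset by blast
  have "x(i := t) \<in> U" if "dist t (x i) < e" for t
    using that e(1) Euclidean_space_update[OF xn assms(3)] by (intro e(2)[rule_format]) (auto simp: dist_real_def)
  then show ?thesis using \<open>e > 0\<close> unfolding eventually_nhds_metric by blast
qed

section \<open>Calculus of \<open>C\<^sup>k\<close> functions\<close>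

lemma partial_cong:
  assumes U: "openin (Euclidean_space n) U" and fg: "\<And>x. x \<in> U \<Longrightarrow> f x = g x" and x: "x \<in> U" "i < n"
  shows "partially_differentiable i f x \<longleftrightarrow> partially_differentiable i g x"
    "partial_deriv i f x = partial_deriv i g x"
proof -
  have ev: "\<forall>\<^sub>F t in nhds (x i). f (x(i := t)) = g (x(i := t))"
    using eventually_update_in_open[OF U x] by (rule eventually_mono) (rule fg)
  show "partial_deriv i f x = partial_deriv i g x"
    unfolding partial_deriv_def by (rule deriv_cong_ev[OF ev refl])
  show "partially_differentiable i f x \<longleftrightarrow> partially_differentiable i g x"
    unfolding partially_differentiable_def field_differentiable_def
    using DERIV_cong_ev[OF refl ev refl] by blast
qed

lemma partial_has_derivative:
  assumes "partially_differentiable i f x"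
  shows "((\<lambda>t. f (x(i := t))) has_field_derivative partial_deriv i f x) (at (x i))"
  using assms unfolding partially_differentiable_def partial_deriv_def
  by (simp add: field_differentiable_derivI)

lemma partialI:
  assumes "((\<lambda>t. f (x(i := t))) has_field_derivative D) (at (x i))"
  shows "partially_differentiable i f x" "partial_deriv i f x = D"
  using assms unfolding partially_differentiable_def partial_deriv_def
  by (auto simp: field_differentiable_def DERIV_imp_deriv)

lemma Ck_on_continuous: "Ck_on k n U f \<Longrightarrow> continuous_map (subtopology (Euclidean_space n) U) euclideanreal f"
  by (cases k) auto

lemma Ck_on_cong:
  assumes U: "openin (Euclidean_space n) U"
  shows "(\<And>x. x \<in> U \<Longrightarrow> f x = g x) \<Longrightarrow> Ck_on k n U f \<longleftrightarrow> Ck_on k n U g"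
proof (induction k arbitrary: f g)
  case 0
  then show ?case unfolding Ck_on.simps by (intro iffI; elim continuous_map_eq) simp_all
next
  case (Suc k)
  have "continuous_map (subtopology (Euclidean_space n) U) euclideanreal f \<longleftrightarrow>
      continuous_map (subtopology (Euclidean_space n) U) euclideanreal g"
    using Suc.prems by (intro iffI; elim continuous_map_eq) simp_all
  moreover have "(\<forall>x\<in>U. partially_differentiable i f x) \<longleftrightarrow> (\<forall>x\<in>U. partially_differentiable i g x)" if "i < n" for i
    using partial_cong(1)[of n U f g _ i] U Suc.prems that by blast
  moreover have "Ck_on k n U (partial_deriv i f) \<longleftrightarrow> Ck_on k n U (partial_deriv i g)" if "i < n" for i
    by (rule Suc.IH, rule partial_cong(2)[of n U f g _ i]) (use U Suc.prems that in auto)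
  ultimately show ?case by simp
qed

lemma Ck_on_eqI:
  assumes "openin (Euclidean_space n) U" "Ck_on k n U g" "\<And>x. x \<in> U \<Longrightarrow> f x = g x"
  shows "Ck_on k n U f"
  using Ck_on_cong[of n U f g k] assms by blast

lemma Ck_on_subset: "Ck_on k n U f \<Longrightarrow> V \<subseteq> U \<Longrightarrow> Ck_on k n V f"
  by (induction k arbitrary: f) (auto intro: continuous_map_from_subtopology_mono)

lemma Ck_on_Suc_D: "Ck_on (Suc k) n U f \<Longrightarrow> Ck_on k n U f"
  by (induction k arbitrary: f) auto

lemma Ck_on_local:
  assumes "\<And>x. x \<in> U \<Longrightarrow> \<exists>V. openin (Euclidean_space n) V \<and> x \<in> V \<and> Ck_on k n (U \<inter> V) f"
  shows "Ck_on k n U f"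
  using assms
proof (induction k arbitrary: f)
  case 0
  show ?case unfolding Ck_on.simps
    by (rule continuous_map_on_local) (rule 0[unfolded Ck_on.simps])
next
  case (Suc k)
  have "continuous_map (subtopology (Euclidean_space n) U) euclideanreal f"
    by (rule continuous_map_on_local) (meson Suc.prems Ck_on_continuous)
  moreover have "partially_differentiable i f x" if ix: "i < n" "x \<in> U" for i x
  proof -
    obtain V where "x \<in> V" "Ck_on (Suc k) n (U \<inter> V) f" using Suc.prems[OF ix(2)] by blast
    then show ?thesis using ix by auto
  qed
  moreover have "Ck_on k n U (partial_deriv i f)" if "i < n" for i
  proof (rule Suc.IH)
    fix x assume "x \<in> U"
    then obtain V where "openin (Euclidean_space n) V" "x \<in> V" "Ck_on (Suc k) n (U \<inter> V) f"
      using Suc.prems[OF \<open>x \<in> U\<close>] by blast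
    then show "\<exists>V. openin (Euclidean_space n) V \<and> x \<in> V \<and> Ck_on k n (U \<inter> V) (partial_deriv i f)"
      using that by auto
  qed
  ultimately show ?case by simp
qed

lemma Ck_on_const: "Ck_on k n U (\<lambda>_. c)"
proof (induction k arbitrary: c)
  case (Suc k)
  have p: "partially_differentiable i (\<lambda>_. c) x" "partial_deriv i (\<lambda>_. c) = (\<lambda>_. 0)" for i x
    using partialI[of "\<lambda>_. c" _ i 0] by auto
  show ?case using Suc by (simp add: p)
qed simp

lemma Ck_on_add:
  assumes U: "openin (Euclidean_space n) U"
  shows "Ck_on k n U f \<Longrightarrow> Ck_on k n U g \<Longrightarrow> Ck_on k n U (\<lambda>x. f x + g x)"
proof (induction k arbitrary: f g)
  case 0
  then show ?case unfolding Ck_on.simps by (rule continuous_map_add)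
next
  case (Suc k)
  have *: "partially_differentiable i (\<lambda>x. f x + g x) x \<and>
     partial_deriv i (\<lambda>x. f x + g x) x = partial_deriv i f x + partial_deriv i g x" if "i < n" "x \<in> U" for i x
    using partialI[OF DERIV_add[OF partial_has_derivative[of i f x] partial_has_derivative[of i g x]]] Suc.prems that by simp
  have D: "Ck_on k n U (partial_deriv i (\<lambda>x. f x + g x))" if "i < n" for i
    by (rule Ck_on_eqI[OF U Suc.IH[of "partial_deriv i f" "partial_deriv i g"]])
      (use Suc.prems that * in auto)
  have C: "continuous_map (subtopology (Euclidean_space n) U) euclideanreal (\<lambda>x. f x + g x)"
    using Suc.prems by (intro continuous_map_add) (simp_all only: Ck_on.simps)
  show ?case unfolding Ck_on.simps
    by (intro conjI allI impI ballI C D *[THEN conjunct1]) assumption+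
qed

lemma Ck_on_mult:
  assumes U: "openin (Euclidean_space n) U"
  shows "Ck_on k n U f \<Longrightarrow> Ck_on k n U g \<Longrightarrow> Ck_on k n U (\<lambda>x. f x * g x)"
proof (induction k arbitrary: f g)
  case 0
  then show ?case unfolding Ck_on.simps by (rule continuous_map_real_mult)
next
  case (Suc k)
  have *: "partially_differentiable i (\<lambda>x. f x * g x) x \<and>
     partial_deriv i (\<lambda>x. f x * g x) x = partial_deriv i f x * g x + partial_deriv i g x * f x" if "i < n" "x \<in> U" for i x
    using partialI[OF DERIV_mult[OF partial_has_derivative[of i f x] partial_has_derivative[of i g x]]] Suc.prems that by simp
  have D: "Ck_on k n U (partial_deriv i (\<lambda>x. f x * g x))" if "i < n" for i
  proof -
    have "Ck_on k n U f" "Ck_on k n U g" using Suc.prems by (blast intro: Ck_on_Suc_D)+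
    then have "Ck_on k n U (\<lambda>x. partial_deriv i f x * g x + partial_deriv i g x * f x)"
      using Suc.prems that by (intro Ck_on_add[OF U] Suc.IH) auto
    then show ?thesis by (rule Ck_on_eqI[OF U]) (use * that in auto)
  qed
  have C: "continuous_map (subtopology (Euclidean_space n) U) euclideanreal (\<lambda>x. f x * g x)"
    using Suc.prems by (intro continuous_map_real_mult) (simp_all only: Ck_on.simps)
  show ?case unfolding Ck_on.simps
    by (intro conjI allI impI ballI C D *[THEN conjunct1]) assumption+
qed

lemma Ck_on_sum:
  assumes U: "openin (Euclidean_space n) U"
  shows "(\<And>j. j < m \<Longrightarrow> Ck_on k n U (f j)) \<Longrightarrow> Ck_on k n U (\<lambda>x. \<Sum>j<(m::nat). f j x)"
  by (induction m) (auto simp: Ck_on_const intro!: Ck_on_add[OF U])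

lemma mean_value_unordered:
  fixes F F' :: "real \<Rightarrow> real"
  assumes "\<And>t. min a b \<le> t \<Longrightarrow> t \<le> max a b \<Longrightarrow> (F has_field_derivative F' t) (at t)"
  shows "\<exists>\<xi>. min a b \<le> \<xi> \<and> \<xi> \<le> max a b \<and> F b - F a = F' \<xi> * (b - a)"
proof (cases a b rule: linorder_cases)
  case less
  then obtain \<xi> where "a < \<xi>" "\<xi> < b" "F b - F a = (b - a) * F' \<xi>"
    using MVT2[of a b F F'] assms by auto
  then show ?thesis by (intro exI[of _ \<xi>]) auto
next
  case greater
  then obtain \<xi> where "b < \<xi>" "\<xi> < a" "F a - F b = (a - b) * F' \<xi>"
    using MVT2[of b a F F'] assms by auto
  then show ?thesis by (intro exI[of _ \<xi>]) (auto simp: algebra_simps)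
qed auto

text \<open>Go from \<open>u\<close> to \<open>v\<close> along the coordinate axes, one coordinate at a time, and apply the mean value theorem
  on each segment.\<close>

lemma mean_value_partial:
  assumes u: "u \<in> topspace (Euclidean_space n)" and v: "v \<in> topspace (Euclidean_space n)"
    and d: "\<And>w i. i < n \<Longrightarrow> w \<in> topspace (Euclidean_space n) \<Longrightarrow>
      (\<And>j. min (u j) (v j) \<le> w j \<and> w j \<le> max (u j) (v j)) \<Longrightarrow> partially_differentiable i f w"
  shows "\<exists>w. (\<forall>i<n. w i \<in> topspace (Euclidean_space n) \<and>
      (\<forall>j. min (u j) (v j) \<le> w i j \<and> w i j \<le> max (u j) (v j))) \<and>
      f v - f u = (\<Sum>i<n. partial_deriv i f (w i) * (v i - u i))"
proof -
  define z where "z i = (\<lambda>j. if j < i then v j else u j)" for i :: nat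
  have z0: "z 0 = u" by (simp add: z_def)
  have zn: "z n = v" using u v by (auto simp: z_def topspace_Euclidean_space fun_eq_iff)
  have "\<exists>\<xi>. min (u i) (v i) \<le> \<xi> \<and> \<xi> \<le> max (u i) (v i) \<and>
      f (z (Suc i)) - f (z i) = partial_deriv i f ((z i)(i := \<xi>)) * (v i - u i)" if "i < n" for i
  proof -
    have "((\<lambda>t. f ((z i)(i := t))) has_field_derivative partial_deriv i f ((z i)(i := t))) (at t)"
      if t: "min (u i) (v i) \<le> t" "t \<le> max (u i) (v i)" for t
    proof -
      have "partially_differentiable i f ((z i)(i := t))"
        using \<open>i < n\<close> u v t by (intro d) (auto simp: z_def topspace_Euclidean_space)
      from partial_has_derivative[OF this] show ?thesis by simp
    qed
    from mean_value_unordered[OF this] have "\<exists>\<xi>. min (u i) (v i) \<le> \<xi> \<and> \<xi> \<le> max (u i) (v i) \<and>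
      f ((z i)(i := v i)) - f ((z i)(i := u i)) = partial_deriv i f ((z i)(i := \<xi>)) * (v i - u i)" .
    moreover have "(z i)(i := v i) = z (Suc i)" "(z i)(i := u i) = z i"
      by (auto simp: z_def fun_eq_iff)
    ultimately show ?thesis by simp
  qed
  then obtain \<xi> where \<xi>: "\<And>i. i < n \<Longrightarrow> min (u i) (v i) \<le> \<xi> i \<and> \<xi> i \<le> max (u i) (v i) \<and>
      f (z (Suc i)) - f (z i) = partial_deriv i f ((z i)(i := \<xi> i)) * (v i - u i)" by metis
  have "f v - f u = (\<Sum>i<n. f (z (Suc i)) - f (z i))"
    by (subst sum_lessThan_telescope) (simp add: z0 zn)
  also have "\<dots> = (\<Sum>i<n. partial_deriv i f ((z i)(i := \<xi> i)) * (v i - u i))"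
    using \<xi> by simp
  finally show ?thesis
    by (intro exI[of _ "\<lambda>i. (z i)(i := \<xi> i)"])
      (use \<xi> u v in \<open>auto simp: z_def topspace_Euclidean_space\<close>)
qed

lemma continuous_map_box:
  assumes U: "openin (Euclidean_space n) U" "u \<in> U"
    and g: "continuous_map (subtopology (Euclidean_space n) U) euclideanreal g" and e: "e > 0"
  shows "\<exists>d>0. \<forall>v\<in>topspace (Euclidean_space n). (\<forall>i<n. \<bar>v i - u i\<bar> < d) \<longrightarrow> v \<in> U \<and> \<bar>g v - g u\<bar> < e"
proof -
  have "openin (subtopology (Euclidean_space n) U) {v \<in> topspace (subtopology (Euclidean_space n) U). g v \<in> ball (g u) e}"
    by (rule openin_continuous_map_preimage[OF g]) auto
  then have "openin (Euclidean_space n) {v \<in> topspace (subtopology (Euclidean_space n) U). g v \<in> ball (g u) e}"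
    using U(1) openin_trans_full by blast
  moreover have "u \<in> {v \<in> topspace (subtopology (Euclidean_space n) U). g v \<in> ball (g u) e}"
    using U e openin_subset[OF U(1)] by auto
  ultimately have "\<exists>d>0. \<forall>v\<in>topspace (Euclidean_space n). (\<forall>i<n. \<bar>v i - u i\<bar> < d) \<longrightarrow>
      v \<in> {v \<in> topspace (subtopology (Euclidean_space n) U). g v \<in> ball (g u) e}"
    by (rule open_box_Euclidean_space)
  then obtain d where "d > 0" "\<forall>v\<in>topspace (Euclidean_space n). (\<forall>i<n. \<bar>v i - u i\<bar> < d) \<longrightarrow>
      v \<in> {v \<in> topspace (subtopology (Euclidean_space n) U). g v \<in> ball (g u) e}" by blast
  then show ?thesis by (intro exI[of _ d]) (auto simp: dist_real_def abs_minus_commute)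
qed

text \<open>Strict differentiability: the partial derivatives at \<open>u\<close> approximate the difference quotients between
  any two points near \<open>u\<close>, not only those at \<open>u\<close> itself. Comparing consecutive iterates of a map near a
  fixed point requires this uniformity.\<close>

lemma C1_slopes:
  assumes U: "openin (Euclidean_space n) U" "u \<in> U" and f: "Ck_on (Suc 0) n U f" and e: "e > 0"
  shows "\<exists>d>0. \<forall>v\<in>topspace (Euclidean_space n). \<forall>w\<in>topspace (Euclidean_space n).
    (\<forall>i<n. \<bar>v i - u i\<bar> < d) \<longrightarrow> (\<forall>i<n. \<bar>w i - u i\<bar> < d) \<longrightarrow> v \<in> U \<and>
    (\<exists>q. f w - f v = (\<Sum>i<n. q i * (w i - v i)) \<and> (\<forall>i<n. \<bar>q i - partial_deriv i f u\<bar> < e))"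
proof -
  have "\<exists>d>0. \<forall>v\<in>topspace (Euclidean_space n). (\<forall>i<n. \<bar>v i - u i\<bar> < d) \<longrightarrow>
      v \<in> U \<and> \<bar>partial_deriv k f v - partial_deriv k f u\<bar> < e" if "k < n" for k
    using continuous_map_box[OF U _ e] f that by simp
  then have "\<forall>k. \<exists>d. k < n \<longrightarrow> d > 0 \<and> (\<forall>v\<in>topspace (Euclidean_space n). (\<forall>i<n. \<bar>v i - u i\<bar> < d) \<longrightarrow>
      v \<in> U \<and> \<bar>partial_deriv k f v - partial_deriv k f u\<bar> < e)" by blast
  from choice[OF this] obtain d where d: "\<forall>k<n. d k > 0 \<and> (\<forall>v\<in>topspace (Euclidean_space n).
      (\<forall>i<n. \<bar>v i - u i\<bar> < d k) \<longrightarrow> v \<in> U \<and> \<bar>partial_deriv k f v - partial_deriv k f u\<bar> < e)" by blast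
  obtain d0 where d0: "d0 > 0" "\<forall>v\<in>topspace (Euclidean_space n). (\<forall>i<n. \<bar>v i - u i\<bar> < d0) \<longrightarrow> v \<in> U"
    using open_box_Euclidean_space[OF U] by blast
  define D where "D = Min (insert d0 (d ` {..<n}))"
  have D: "D > 0" "D \<le> d0" "\<And>k. k < n \<Longrightarrow> D \<le> d k"
    unfolding D_def using d d0(1) by (auto simp: Min_gr_iff)
  have "v \<in> U \<and> (\<exists>q. f w - f v = (\<Sum>i<n. q i * (w i - v i)) \<and> (\<forall>i<n. \<bar>q i - partial_deriv i f u\<bar> < e))"
    if v: "v\<in>topspace (Euclidean_space n)" "\<And>i. i < n \<Longrightarrow> \<bar>v i - u i\<bar> < D"
      and w: "w\<in>topspace (Euclidean_space n)" "\<And>i. i < n \<Longrightarrow> \<bar>w i - u i\<bar> < D" for v w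
  proof -
    have between: "\<bar>z i - u i\<bar> < D" if "\<And>j. min (v j) (w j) \<le> z j \<and> z j \<le> max (v j) (w j)" "i < n" for z i
      using v(2)[OF that(2)] w(2)[OF that(2)] that(1)[of i] by (auto simp: min_def max_def split: if_splits)
    have "\<exists>z. (\<forall>i<n. z i \<in> topspace (Euclidean_space n) \<and>
      (\<forall>j. min (v j) (w j) \<le> z i j \<and> z i j \<le> max (v j) (w j))) \<and>
      f w - f v = (\<Sum>i<n. partial_deriv i f (z i) * (w i - v i))"
    proof (rule mean_value_partial[OF v(1) w(1)])
      fix z i assume z: "i < n" "z \<in> topspace (Euclidean_space n)" "\<And>j. min (v j) (w j) \<le> z j \<and> z j \<le> max (v j) (w j)"
      have "\<bar>z i - u i\<bar> < d0" if "i < n" for i using between[OF z(3) that] D(2) by linarith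
      then have "z \<in> U" using d0(2) z(2) by blast
      then show "partially_differentiable i f z" using f z(1) by simp
    qed
    then obtain z where z: "\<And>i. i < n \<Longrightarrow> z i \<in> topspace (Euclidean_space n) \<and>
      (\<forall>j. min (v j) (w j) \<le> z i j \<and> z i j \<le> max (v j) (w j))"
      "f w - f v = (\<Sum>i<n. partial_deriv i f (z i) * (w i - v i))" by blast
    have "\<bar>partial_deriv i f (z i) - partial_deriv i f u\<bar> < e" if "i < n" for i
    proof -
      have "\<bar>z i j - u j\<bar> < d i" if "j < n" for j
        using between[of "z i" j] z(1)[OF \<open>i < n\<close>] that D(3)[OF \<open>i < n\<close>] by force
      then show ?thesis using d z(1)[OF that] that by blast
    qed
    moreover have "v \<in> U"
    proof -
      have "\<bar>v i - u i\<bar> < d0" if "i < n" for i using v(2)[OF that] D(2) by linarith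
      then show ?thesis using d0(2) v(1) by blast
    qed
    ultimately show ?thesis using z(2) by (intro conjI exI[of _ "\<lambda>i. partial_deriv i f (z i)"]) auto
  qed
  then show ?thesis using D(1) by blast
qed

text \<open>By \<open>C1_slopes\<close> the difference quotients of the composite are sums of products of numbers close to the
  partial derivatives of \<open>g\<close> with difference quotients \<open>s j\<close> of the coordinates of \<open>F\<close>; the latter converge and
  hence are bounded.\<close>

lemma partial_chain:
  assumes U: "openin (Euclidean_space n) U" "x \<in> U" "i < n"
    and V: "openin (Euclidean_space m) V" and F: "\<And>x. x \<in> U \<Longrightarrow> F x \<in> V"
    and dF: "\<And>j. j < m \<Longrightarrow> partially_differentiable i (\<lambda>x. F x j) x"
    and g: "Ck_on (Suc 0) m V g"
  shows "((\<lambda>t. g (F (x(i := t)))) has_field_derivative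
    (\<Sum>j<m. partial_deriv j g (F x) * partial_deriv i (\<lambda>x. F x j) x)) (at (x i))"
proof -
  define s where "s j t = (F (x(i := t)) j - F x j) / (t - x i)" for j t
  define D where "D j = partial_deriv i (\<lambda>x. F x j) x" for j
  have s: "(s j \<longlongrightarrow> D j) (at (x i))" if "j < m" for j
    using partial_has_derivative[OF dF[OF that]] unfolding has_field_derivative_iff s_def D_def by simp
  have c: "((\<lambda>t. F (x(i := t)) j) \<longlongrightarrow> F x j) (at (x i))" if "j < m" for j
    using DERIV_isCont[OF partial_has_derivative[OF dF[OF that]]] by (simp add: isCont_def)
  have small: "((\<lambda>t. (g (F (x(i := t))) - g (F x)) / (t - x i) - (\<Sum>j<m. partial_deriv j g (F x) * s j t)) \<longlongrightarrow> 0) (at (x i))"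
  proof (rule tendstoI)
    fix e :: real assume e: "e > 0"
    define B where "B = (\<Sum>j<m. \<bar>D j\<bar>) + 1"
    have B: "B > 0" unfolding B_def by (smt (verit) sum_nonneg abs_ge_zero)
    have FxV: "F x \<in> V" using F U by simp
    obtain d where d: "d > 0" "\<And>w. w \<in> topspace (Euclidean_space m) \<Longrightarrow> (\<And>j. j < m \<Longrightarrow> \<bar>w j - F x j\<bar> < d) \<Longrightarrow>
      \<exists>q. g w - g (F x) = (\<Sum>j<m. q j * (w j - F x j)) \<and> (\<forall>j<m. \<bar>q j - partial_deriv j g (F x)\<bar> < e / B)"
    proof -
      obtain d where "d > 0" and d: "\<forall>v\<in>topspace (Euclidean_space m). \<forall>w\<in>topspace (Euclidean_space m).
    (\<forall>i<m. \<bar>v i - F x i\<bar> < d) \<longrightarrow> (\<forall>i<m. \<bar>w i - F x i\<bar> < d) \<longrightarrow> v \<in> V \<and>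
    (\<exists>q. g w - g v = (\<Sum>i<m. q i * (w i - v i)) \<and> (\<forall>i<m. \<bar>q i - partial_deriv i g (F x)\<bar> < e / B))"
        using C1_slopes[OF V FxV g, of "e / B"] B e by auto
      have "F x \<in> topspace (Euclidean_space m)" using V FxV openin_subset by blast
      with d \<open>d > 0\<close> show thesis by (intro that[of d]) auto
    qed
    have "\<forall>\<^sub>F t in at (x i). (\<forall>j\<in>{..<m}. \<bar>F (x(i := t)) j - F x j\<bar> < d)"
      using tendstoD[OF c d(1)] by (intro eventually_ball_finite) (auto simp: dist_real_def)
    moreover have "\<forall>\<^sub>F t in at (x i). (\<Sum>j<m. \<bar>s j t\<bar>) < B"
    proof -
      have "((\<lambda>t. \<Sum>j<m. \<bar>s j t\<bar>) \<longlongrightarrow> (\<Sum>j<m. \<bar>D j\<bar>)) (at (x i))"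
        by (intro tendsto_sum tendsto_rabs s) auto
      then show ?thesis by (rule order_tendstoD) (simp add: B_def)
    qed
    moreover have "\<forall>\<^sub>F t in at (x i). x(i := t) \<in> U"
      using eventually_update_in_open[OF U] by (simp add: eventually_at_filter eventually_mono)
    moreover have "\<forall>\<^sub>F t in at (x i). t \<noteq> x i" by (simp add: eventually_at_filter)
    ultimately show "\<forall>\<^sub>F t in at (x i). dist ((g (F (x(i := t))) - g (F x)) / (t - x i) - (\<Sum>j<m. partial_deriv j g (F x) * s j t)) 0 < e"
    proof eventually_elim
      case (elim t)
      then have "F (x(i := t)) \<in> topspace (Euclidean_space m)" using F openin_subset[OF V] elim(3) by blast
      then have "\<exists>q. g (F (x(i := t))) - g (F x) = (\<Sum>j<m. q j * (F (x(i := t)) j - F x j)) \<and>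
          (\<forall>j<m. \<bar>q j - partial_deriv j g (F x)\<bar> < e / B)"
        by (rule d(2)) (use elim(1) in simp)
      then obtain q where q: "g (F (x(i := t))) - g (F x) = (\<Sum>j<m. q j * (F (x(i := t)) j - F x j))"
        "\<And>j. j < m \<Longrightarrow> \<bar>q j - partial_deriv j g (F x)\<bar> < e / B"
        by blast
      have "(g (F (x(i := t))) - g (F x)) / (t - x i) - (\<Sum>j<m. partial_deriv j g (F x) * s j t)
          = (\<Sum>j<m. (q j - partial_deriv j g (F x)) * s j t)"
      proof -
        have "(g (F (x(i := t))) - g (F x)) / (t - x i) = (\<Sum>j<m. q j * s j t)"
          by (simp add: q(1) s_def sum_divide_distrib)
        then show ?thesis by (simp add: left_diff_distrib sum_subtractf)
      qed
      also have "\<bar>\<dots>\<bar> \<le> (\<Sum>j<m. \<bar>(q j - partial_deriv j g (F x)) * s j t\<bar>)" by (rule sum_abs)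
      also have "\<dots> \<le> (\<Sum>j<m. e / B * \<bar>s j t\<bar>)"
        unfolding abs_mult by (intro sum_mono mult_right_mono less_imp_le[OF q(2)]) auto
      also have "\<dots> = e / B * (\<Sum>j<m. \<bar>s j t\<bar>)" by (simp add: sum_distrib_left)
      also have "\<dots> < e / B * B" using elim e B by (intro mult_strict_left_mono) auto
      finally show ?case using B by simp
    qed
  qed
  have "((\<lambda>t. \<Sum>j<m. partial_deriv j g (F x) * s j t) \<longlongrightarrow> (\<Sum>j<m. partial_deriv j g (F x) * D j)) (at (x i))"
    by (intro tendsto_sum tendsto_mult tendsto_const s) auto
  from tendsto_add[OF small this] show ?thesis
    unfolding has_field_derivative_iff D_def by simp
qed

text \<open>By the chain rule the partial derivatives of the composite are sums of products of partial derivatives,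
  which are one order less regular, so that the rules for sums and products and the induction hypothesis
  apply.\<close>

lemma Ck_on_compose:
  assumes U: "openin (Euclidean_space n) U" and V: "openin (Euclidean_space m) V"
    and F: "continuous_map (subtopology (Euclidean_space n) U) (subtopology (Euclidean_space m) V) F"
  shows "(\<And>j. j < m \<Longrightarrow> Ck_on k n U (\<lambda>x. F x j)) \<Longrightarrow> Ck_on k m V g \<Longrightarrow> Ck_on k n U (\<lambda>x. g (F x))"
proof (induction k arbitrary: g)
  case 0
  then show ?case using continuous_map_compose[OF F, of euclideanreal g] by (simp add: o_def)
next
  case (Suc k)
  have FV: "F x \<in> V" if "x \<in> U" for x
  proof -
    have "x \<in> topspace (Euclidean_space n)" using that U openin_subset by blast
    then show ?thesis using F that by (auto simp: continuous_map_def Pi_iff)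
  qed
  have "Ck_on (Suc 0) m V g" using Suc.prems(2) Ck_on_continuous[of k m V] by auto
  note chain = partialI[OF partial_chain[OF U _ _ V FV _ this]]
  have c: "continuous_map (subtopology (Euclidean_space n) U) euclideanreal (\<lambda>x. g (F x))"
    using continuous_map_compose[OF F, of euclideanreal g] Suc.prems(2) by (simp add: o_def)
  have d: "partially_differentiable i (\<lambda>x. g (F x)) x" if "i < n" "x \<in> U" for i x
    using Suc.prems(1) that by (intro chain) auto
  have D: "Ck_on k n U (partial_deriv i (\<lambda>x. g (F x)))" if i: "i < n" for i
  proof -
    have "Ck_on k n U (\<lambda>x. \<Sum>j<m. partial_deriv j g (F x) * partial_deriv i (\<lambda>x. F x j) x)"
    proof (rule Ck_on_sum[OF U], rule Ck_on_mult[OF U])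
      fix j assume j: "j < m"
      show "Ck_on k n U (\<lambda>x. partial_deriv j g (F x))"
      proof (rule Suc.IH)
        show "Ck_on k n U (\<lambda>x. F x j)" if "j < m" for j by (rule Ck_on_Suc_D[OF Suc.prems(1)[OF that]])
        show "Ck_on k m V (partial_deriv j g)" using Suc.prems(2) j by simp
      qed
      show "Ck_on k n U (partial_deriv i (\<lambda>x. F x j))"
        using Suc.prems(1)[OF j] i by simp
    qed
    moreover have "partial_deriv i (\<lambda>x. g (F x)) x =
        (\<Sum>j<m. partial_deriv j g (F x) * partial_deriv i (\<lambda>x. F x j) x)" if "x \<in> U" for x
      using Suc.prems(1) i that by (intro chain) auto
    ultimately show ?thesis by (rule Ck_on_eqI[OF U])
  qed
  show ?case unfolding Ck_on.simps by (intro conjI allI impI ballI c d D) assumption+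
qed

section \<open>Maps of finite order that fix open sets\<close>

lemma uniform_positive_bound:
  fixes n :: nat
  assumes "\<And>j. j < n \<Longrightarrow> \<exists>d>0. P j (d::real)"
    and mono: "\<And>j d d'. P j d \<Longrightarrow> 0 < d' \<Longrightarrow> d' \<le> d \<Longrightarrow> P j d'"
  shows "\<exists>d>0. \<forall>j<n. P j d"
  using assms(1)
proof (induction n)
  case 0
  show ?case by (intro exI[of _ 1]) auto
next
  case (Suc n)
  obtain d where d: "d > 0" "\<forall>j<n. P j d" using Suc.IH Suc.prems less_SucI by blast
  obtain e where e: "e > 0" "P n e" using Suc.prems[of n] by auto
  have "P j (min d e)" if "j < Suc n" for j
    using that d e mono[of j d "min d e"] mono[of n e "min d e"] by (cases "j = n") auto
  then show ?case using d e by (intro exI[of _ "min d e"]) auto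
qed

lemma openin_preimage_on:
  assumes "openin X W" "continuous_map (subtopology X W) Y f" "openin Y V"
  shows "openin X (W \<inter> f -` V)"
proof -
  have "openin (subtopology X W) {x \<in> topspace (subtopology X W). f x \<in> V}"
    using assms(2,3) by (rule openin_continuous_map_preimage)
  moreover have "{x \<in> topspace (subtopology X W). f x \<in> V} = W \<inter> f -` V"
    using openin_subset[OF assms(1)] by auto
  ultimately show ?thesis using assms(1) openin_trans_full by metis
qed

lemma iterates_stay_near_fixed_point:
  assumes f: "continuous_map (subtopology X U) X f" and U: "openin X U"
    and B: "openin X B" "u \<in> B" "B \<subseteq> U" and fixp: "f u = u"
  shows "\<exists>N. openin X N \<and> u \<in> N \<and> N \<subseteq> B \<and> (\<forall>v\<in>N. \<forall>i\<le>k. (f ^^ i) v \<in> B)"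
proof (induction k)
  case 0
  show ?case using B by (intro exI[of _ B]) auto
next
  case (Suc k)
  then obtain N where N: "openin X N" "u \<in> N" "N \<subseteq> B" "\<forall>v\<in>N. \<forall>i\<le>k. (f ^^ i) v \<in> B" by blast
  define N' where "N' = B \<inter> f -` N"
  have "openin X N'" unfolding N'_def using B(1) continuous_map_from_subtopology_mono[OF f B(3)] N(1)
    by (rule openin_preimage_on)
  moreover have "u \<in> N'" using B N fixp by (simp add: N'_def)
  moreover have "(f ^^ i) v \<in> B" if v: "v \<in> N'" and i: "i \<le> Suc k" for v i
  proof (cases i)
    case 0
    then show ?thesis using v by (simp add: N'_def)
  next
    case (Suc l)
    have "(f ^^ l) (f v) \<in> B" using N(4) v i Suc by (auto simp: N'_def)
    then show ?thesis by (simp add: Suc funpow_swap1)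
  qed
  ultimately show ?case by (intro exI[of _ N']) (auto simp: N'_def)
qed

text \<open>The differential of \<open>f\<close> at \<open>u0\<close> is a limit of differentials of the identity, so \<open>f - id\<close> has an arbitrarily
  small Lipschitz constant near \<open>u0\<close>. Hence for \<open>u\<close> near \<open>u0\<close> the steps \<open>f\<^sup>i\<^sup>+\<^sup>1(u) - f\<^sup>i(u)\<close>, \<open>i < m\<close>, hardly differ
  from the first one. But they add up to \<open>f\<^sup>m(u) - u = 0\<close>, so the first one is 0.\<close>

lemma finite_order_eq_id_near:
  assumes U: "openin (Euclidean_space n) U" "u0 \<in> U"
    and f: "continuous_map (subtopology (Euclidean_space n) U) (Euclidean_space n) f"
    and C1: "\<And>j. j < n \<Longrightarrow> Ck_on (Suc 0) n U (\<lambda>u. f u j)"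
    and fixp: "f u0 = u0" and m: "m > 0"
    and N: "openin (Euclidean_space n) N" "u0 \<in> N" "\<And>u. u \<in> N \<Longrightarrow> (f ^^ m) u = u"
    and acc: "\<And>N. openin (Euclidean_space n) N \<Longrightarrow> u0 \<in> N \<Longrightarrow>
      \<exists>O'. openin (Euclidean_space n) O' \<and> O' \<inter> N \<noteq> {} \<and> (\<forall>u\<in>O'. f u = u)"
  shows "\<exists>N. openin (Euclidean_space n) N \<and> u0 \<in> N \<and> (\<forall>u\<in>N. f u = u)"
proof -
  let ?E = "Euclidean_space n"
  have u0: "u0 \<in> topspace ?E" using U openin_subset by blast
  have D: "partial_deriv i (\<lambda>u. f u j) u0 = (if i = j then 1 else 0)" if ij: "i < n" "j < n" for i j
  proof (rule ccontr)
    assume ne: "partial_deriv i (\<lambda>u. f u j) u0 \<noteq> (if i = j then 1 else 0)"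
    define e where "e = \<bar>partial_deriv i (\<lambda>u. f u j) u0 - (if i = j then 1 else 0)\<bar>"
    have e: "e > 0" using ne by (simp add: e_def)
    have "continuous_map (subtopology ?E U) euclideanreal (partial_deriv i (\<lambda>u. f u j))"
      using C1[OF ij(2)] ij(1) by simp
    from continuous_map_box[OF U this e] obtain d where d: "d > 0" "\<forall>v\<in>topspace ?E. (\<forall>i<n. \<bar>v i - u0 i\<bar> < d) \<longrightarrow>
        v \<in> U \<and> \<bar>partial_deriv i (\<lambda>u. f u j) v - partial_deriv i (\<lambda>u. f u j) u0\<bar> < e" by blast
    have "u0 \<in> {v \<in> topspace ?E. \<forall>i<n. \<bar>v i - u0 i\<bar> < d}" using u0 d(1) by simp
    from acc[OF openin_box_Euclidean_space this] obtain O' w where O': "openin ?E O'" "\<forall>u\<in>O'. f u = u"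
      and w: "w \<in> O'" "w \<in> topspace ?E" "\<forall>i<n. \<bar>w i - u0 i\<bar> < d" by blast
    have "partial_deriv i (\<lambda>u. f u j) w = partial_deriv i (\<lambda>u. u j) w"
      by (rule partial_cong(2)[OF O'(1) _ w(1) ij(1)]) (simp add: O'(2))
    also have "partial_deriv i (\<lambda>u. u j) w = (if i = j then 1 else 0)"
      by (rule partialI(2)) (auto intro!: derivative_eq_intros)
    finally have "\<bar>(if i = j then 1 else 0) - partial_deriv i (\<lambda>u. f u j) u0\<bar> < e"
      using d(2) w by auto
    then show False by (simp add: e_def abs_minus_commute)
  qed
  \<comment> \<open>With this bound on the coordinates, \<open>f - id\<close> is Lipschitz with constant \<open>2\<^sup>-\<^sup>m\<close> for the \<open>\<ell>\<^sup>1\<close> norm \<open>L\<close>: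
    small enough to absorb that the norm of the steps \<open>\<delta> i\<close> may double in each of the \<open>m\<close> iterations.\<close>
  define \<epsilon> :: real where "\<epsilon> = 1 / (2 ^ m * (real n + 1))"
  have \<epsilon>: "\<epsilon> > 0" by (simp add: \<epsilon>_def)
  have "\<exists>d>0. \<forall>j<n. \<forall>v\<in>topspace ?E. \<forall>w\<in>topspace ?E.
    (\<forall>i<n. \<bar>v i - u0 i\<bar> < d) \<longrightarrow> (\<forall>i<n. \<bar>w i - u0 i\<bar> < d) \<longrightarrow> v \<in> U \<and>
    (\<exists>q. f w j - f v j = (\<Sum>i<n. q i * (w i - v i)) \<and> (\<forall>i<n. \<bar>q i - partial_deriv i (\<lambda>u. f u j) u0\<bar> < \<epsilon>))"
  proof (rule uniform_positive_bound)
    fix j assume "j < n"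
    from C1_slopes[OF U C1[OF this] \<epsilon>] show "\<exists>d>0. \<forall>v\<in>topspace ?E. \<forall>w\<in>topspace ?E.
    (\<forall>i<n. \<bar>v i - u0 i\<bar> < d) \<longrightarrow> (\<forall>i<n. \<bar>w i - u0 i\<bar> < d) \<longrightarrow> v \<in> U \<and>
    (\<exists>q. f w j - f v j = (\<Sum>i<n. q i * (w i - v i)) \<and> (\<forall>i<n. \<bar>q i - partial_deriv i (\<lambda>u. f u j) u0\<bar> < \<epsilon>))" .
  qed (meson less_le_trans)
  then obtain d where d: "d > 0" and slopes: "\<And>j v w. j < n \<Longrightarrow> v\<in>topspace ?E \<Longrightarrow> w\<in>topspace ?E \<Longrightarrow>
    (\<forall>i<n. \<bar>v i - u0 i\<bar> < d) \<Longrightarrow> (\<forall>i<n. \<bar>w i - u0 i\<bar> < d) \<Longrightarrow>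
    \<exists>q. f w j - f v j = (\<Sum>i<n. q i * (w i - v i)) \<and> (\<forall>i<n. \<bar>q i - partial_deriv i (\<lambda>u. f u j) u0\<bar> < \<epsilon>)"
    by blast
  define B where "B = U \<inter> {v \<in> topspace ?E. \<forall>i<n. \<bar>v i - u0 i\<bar> < d}"
  have B: "openin ?E B" "u0 \<in> B" "B \<subseteq> U"
    unfolding B_def using U u0 d openin_box_Euclidean_space by (auto intro: openin_Int)
  define L where "L v = (\<Sum>j<n. \<bar>v j\<bar>)" for v :: "nat \<Rightarrow> real"
  have L0: "L v \<ge> 0" for v by (simp add: L_def sum_nonneg)
  have Ltri: "L (\<lambda>j. v j + w j) \<le> L v + L w" for v w
    unfolding L_def sum.distrib[symmetric] by (intro sum_mono) auto
  have Lip: "L (\<lambda>j. (f w j - f v j) - (w j - v j)) \<le> 1 / 2 ^ m * L (\<lambda>j. w j - v j)" if vw: "v \<in> B" "w \<in> B" for v w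
  proof -
    have b: "\<bar>(f w j - f v j) - (w j - v j)\<bar> \<le> \<epsilon> * L (\<lambda>j. w j - v j)" if j: "j < n" for j
    proof -
      obtain q where q: "f w j - f v j = (\<Sum>i<n. q i * (w i - v i))"
        "\<forall>i<n. \<bar>q i - partial_deriv i (\<lambda>u. f u j) u0\<bar> < \<epsilon>"
        using slopes[OF j, of v w] vw unfolding B_def by blast
      have "w j - v j = (\<Sum>i<n. (if i = j then 1 else 0) * (w i - v i))"
        using j by (simp add: if_distrib if_distribR sum.delta cong: if_cong)
      then have "(f w j - f v j) - (w j - v j) = (\<Sum>i<n. (q i - (if i = j then 1 else 0)) * (w i - v i))"
        by (simp only: q(1) left_diff_distrib sum_subtractf)
      also have "\<bar>\<dots>\<bar> \<le> (\<Sum>i<n. \<bar>(q i - (if i = j then 1 else 0)) * (w i - v i)\<bar>)" by (rule sum_abs)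
      also have "\<dots> \<le> (\<Sum>i<n. \<epsilon> * \<bar>w i - v i\<bar>)"
      proof (rule sum_mono)
        fix i assume "i \<in> {..<n}"
        then have "\<bar>q i - (if i = j then 1 else 0)\<bar> < \<epsilon>" using q(2) D[of i j] j by auto
        then show "\<bar>(q i - (if i = j then 1 else 0)) * (w i - v i)\<bar> \<le> \<epsilon> * \<bar>w i - v i\<bar>"
          unfolding abs_mult by (rule mult_right_mono[OF less_imp_le]) simp
      qed
      finally show ?thesis by (simp add: L_def sum_distrib_left)
    qed
    have "L (\<lambda>j. (f w j - f v j) - (w j - v j)) \<le> (\<Sum>j<n. \<epsilon> * L (\<lambda>j. w j - v j))"
      unfolding L_def[of "\<lambda>j. (f w j - f v j) - (w j - v j)"] by (intro sum_mono b) auto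
    also have "\<dots> = real n * \<epsilon> * L (\<lambda>j. w j - v j)" by simp
    also have "\<dots> \<le> 1 / 2 ^ m * L (\<lambda>j. w j - v j)"
    proof (rule mult_right_mono[OF _ L0])
      have "real n * \<epsilon> = (real n / (real n + 1)) * (1 / 2 ^ m)" by (simp add: \<epsilon>_def)
      also have "\<dots> \<le> 1 * (1 / 2 ^ m)" by (intro mult_right_mono) auto
      finally show "real n * \<epsilon> \<le> 1 / 2 ^ m" by simp
    qed
    finally show ?thesis .
  qed
  obtain N' where N': "openin ?E N'" "u0 \<in> N'" "N' \<subseteq> B" "\<forall>v\<in>N'. \<forall>i\<le>m. (f ^^ i) v \<in> B"
    using iterates_stay_near_fixed_point[OF f U(1) B fixp] by blast
  have "f u = u" if u: "u \<in> N' \<inter> N" for u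
  proof -
    define \<delta> where "\<delta> i = (\<lambda>j. (f ^^ Suc i) u j - (f ^^ i) u j)" for i
    define l where "l = L (\<delta> 0)"
    have step: "L (\<lambda>j. \<delta> (Suc i) j - \<delta> i j) \<le> 1 / 2 ^ m * L (\<delta> i)" if i: "i < m" for i
    proof -
      have "(f ^^ i) u \<in> B" "(f ^^ Suc i) u \<in> B" using N'(4) u i by (auto simp del: funpow.simps)
      from Lip[OF this] show ?thesis by (simp add: \<delta>_def)
    qed
    have le1: "1 / 2 ^ m \<le> (1::real)" by simp
    have bound: "L (\<delta> i) \<le> 2 ^ i * l \<and> L (\<lambda>j. \<delta> i j - \<delta> 0 j) \<le> 1 / 2 ^ m * (2 ^ i - 1) * l" if "i < m" for i
      using that
    proof (induction i)
      case 0
      then show ?case by (simp add: l_def L_def)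
    next
      case (Suc i)
      then have IH: "L (\<delta> i) \<le> 2 ^ i * l" "L (\<lambda>j. \<delta> i j - \<delta> 0 j) \<le> 1 / 2 ^ m * (2 ^ i - 1) * l" by auto
      have st: "L (\<lambda>j. \<delta> (Suc i) j - \<delta> i j) \<le> 1 / 2 ^ m * L (\<delta> i)" using Suc.prems by (intro step) simp
      have "L (\<delta> (Suc i)) \<le> L (\<lambda>j. \<delta> (Suc i) j - \<delta> i j) + L (\<delta> i)"
        using Ltri[of "\<lambda>j. \<delta> (Suc i) j - \<delta> i j" "\<delta> i"] by simp
      also have "\<dots> \<le> 1 * L (\<delta> i) + L (\<delta> i)"
        using st mult_right_mono[OF le1 L0[of "\<delta> i"]] by linarith
      also have "\<dots> \<le> 2 ^ Suc i * l" using IH(1) by simp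
      finally have 1: "L (\<delta> (Suc i)) \<le> 2 ^ Suc i * l" .
      have "L (\<lambda>j. \<delta> (Suc i) j - \<delta> 0 j) \<le> L (\<lambda>j. \<delta> (Suc i) j - \<delta> i j) + L (\<lambda>j. \<delta> i j - \<delta> 0 j)"
        using Ltri[of "\<lambda>j. \<delta> (Suc i) j - \<delta> i j" "\<lambda>j. \<delta> i j - \<delta> 0 j"] by simp
      also have "\<dots> \<le> 1 / 2 ^ m * (2 ^ i * l) + 1 / 2 ^ m * (2 ^ i - 1) * l"
        using st IH(2) mult_left_mono[OF IH(1), of "1 / 2 ^ m"] by simp
      also have "\<dots> = 1 / 2 ^ m * (2 ^ Suc i - 1) * l" by (simp add: field_simps)
      finally show ?case using 1 by blast
    qed
    have tel: "(\<Sum>i<m. \<delta> i j) = 0" for j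
    proof -
      have "(\<Sum>i<m. \<delta> i j) = (f ^^ m) u j - (f ^^ 0) u j"
        unfolding \<delta>_def by (rule sum_lessThan_telescope)
      then show ?thesis using N(3)[of u] u by simp
    qed
    have "real m * l = (\<Sum>j<n. \<bar>\<Sum>i<m. \<delta> i j - \<delta> 0 j\<bar>)"
      by (simp add: sum_subtractf tel l_def L_def abs_mult sum_distrib_left)
    also have "\<dots> \<le> (\<Sum>j<n. \<Sum>i<m. \<bar>\<delta> i j - \<delta> 0 j\<bar>)" by (intro sum_mono sum_abs)
    also have "\<dots> = (\<Sum>i<m. L (\<lambda>j. \<delta> i j - \<delta> 0 j))" unfolding L_def by (rule sum.swap)
    also have "\<dots> \<le> (\<Sum>i<m. 1 / 2 ^ m * 2 ^ i * l)"
    proof (rule sum_mono)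
      fix i assume "i \<in> {..<m}"
      then have "L (\<lambda>j. \<delta> i j - \<delta> 0 j) \<le> 1 / 2 ^ m * (2 ^ i - 1) * l" using bound by simp
      also have "\<dots> \<le> 1 / 2 ^ m * 2 ^ i * l"
        using L0[of "\<delta> 0"] by (intro mult_right_mono mult_left_mono) (auto simp: l_def)
      finally show "L (\<lambda>j. \<delta> i j - \<delta> 0 j) \<le> 1 / 2 ^ m * 2 ^ i * l" .
    qed
    also have "\<dots> = (1 - 1 / 2 ^ m) * l"
    proof -
      have "(\<Sum>i<m. (2::real) ^ i) = 2 ^ m - 1" by (subst geometric_sum) auto
      then have "(\<Sum>i<m. 1 / 2 ^ m * 2 ^ i * l) = 1 / 2 ^ m * (2 ^ m - 1) * l"
        by (simp only: sum_distrib_left[symmetric] sum_distrib_right[symmetric])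
      then show ?thesis by (simp add: field_simps)
    qed
    finally have "real m * l \<le> (1 - 1 / 2 ^ m) * l" .
    moreover have "1 * l \<le> real m * l" using m L0[of "\<delta> 0"] by (intro mult_right_mono) (auto simp: l_def)
    ultimately have "1 / 2 ^ m * l \<le> 0" by (simp add: algebra_simps)
    then have "l \<le> 0" by (simp add: field_simps)
    then have "l = 0" using L0[of "\<delta> 0"] by (simp add: l_def)
    then have eq: "f u j = u j" if "j < n" for j
      using that unfolding l_def L_def by (subst (asm) sum_nonneg_eq_0_iff) (auto simp: \<delta>_def)
    have uB: "u \<in> B" using u N'(3) by blast
    then have "u \<in> topspace (subtopology ?E U)" using B by (auto dest: openin_subset)
    then have "f u \<in> topspace ?E" using f unfolding continuous_map_def by blast
    moreover have "u \<in> topspace ?E" using uB by (simp add: B_def)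
    ultimately have "f u j = u j" for j
      using eq by (cases "j < n") (auto simp: topspace_Euclidean_space)
    then show ?thesis by blast
  qed
  then show ?thesis using N N' by (intro exI[of _ "N' \<inter> N"]) (auto intro: openin_Int)
qed

section \<open>Smooth maps between manifolds\<close>

lemma chart_facts:
  assumes "smooth_manifold M" "(U, \<phi>) \<in> atlas M"
  shows "openin (mtop M) U" "openin (Euclidean_space (mdim M)) (\<phi> ` U)" "inj_on \<phi> U"
    "continuous_map (subtopology (mtop M) U) (Euclidean_space (mdim M)) \<phi>"
    "continuous_map (subtopology (Euclidean_space (mdim M)) (\<phi> ` U)) (subtopology (mtop M) U) (inv_into U \<phi>)"
proof -
  show U: "openin (mtop M) U" and V: "openin (Euclidean_space (mdim M)) (\<phi> ` U)"
    using assms unfolding smooth_manifold_def by blast+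
  have h: "homeomorphic_map (subtopology (mtop M) U) (subtopology (Euclidean_space (mdim M)) (\<phi> ` U)) \<phi>"
    using assms unfolding smooth_manifold_def by blast
  have top: "topspace (subtopology (mtop M) U) = U" using openin_subset[OF U] by auto
  show inj: "inj_on \<phi> U" using homeomorphic_imp_injective_map[OF h] top by simp
  show "continuous_map (subtopology (mtop M) U) (Euclidean_space (mdim M)) \<phi>"
    using homeomorphic_imp_continuous_map[OF h] continuous_map_in_subtopology by blast
  obtain g where g: "homeomorphic_maps (subtopology (mtop M) U) (subtopology (Euclidean_space (mdim M)) (\<phi> ` U)) \<phi> g"
    using h homeomorphic_map_maps by blast
  have "continuous_map (subtopology (Euclidean_space (mdim M)) (\<phi> ` U)) (subtopology (mtop M) U) g"
    using g by (simp add: homeomorphic_maps_def)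
  moreover have "g y = inv_into U \<phi> y" if y: "y \<in> topspace (subtopology (Euclidean_space (mdim M)) (\<phi> ` U))" for y
  proof -
    obtain p where p: "p \<in> U" "y = \<phi> p" using y by auto
    then have "g y = p" using g top unfolding homeomorphic_maps_def by auto
    then show ?thesis using p inj by simp
  qed
  ultimately show "continuous_map (subtopology (Euclidean_space (mdim M)) (\<phi> ` U)) (subtopology (mtop M) U) (inv_into U \<phi>)"
    by (rule continuous_map_eq)
qed

lemma chart_exists:
  assumes "smooth_manifold M" "x \<in> topspace (mtop M)"
  shows "\<exists>C \<kappa>. (C, \<kappa>) \<in> atlas M \<and> x \<in> C"
proof -
  have "(\<Union>(U, \<phi>)\<in>atlas M. U) = topspace (mtop M)" using assms(1) unfolding smooth_manifold_def by (elim conjE)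
  then obtain c where "c \<in> atlas M" "x \<in> (case c of (U, \<phi>) \<Rightarrow> U)" using assms(2) by blast
  then show ?thesis by (cases c) auto
qed

lemma chart_open_image:
  assumes "smooth_manifold M" "(U, \<phi>) \<in> atlas M" "openin (mtop M) S" "S \<subseteq> U"
  shows "openin (Euclidean_space (mdim M)) (\<phi> ` S)"
proof -
  have "continuous_map (subtopology (Euclidean_space (mdim M)) (\<phi> ` U)) (mtop M) (inv_into U \<phi>)"
    using chart_facts(5)[OF assms(1,2)] continuous_map_in_subtopology by blast
  from openin_preimage_on[OF chart_facts(2)[OF assms(1,2)] this assms(3)]
  have "openin (Euclidean_space (mdim M)) (\<phi> ` U \<inter> inv_into U \<phi> -` S)" .
  moreover have "\<phi> ` U \<inter> inv_into U \<phi> -` S = \<phi> ` S"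
    using assms(4) chart_facts(3)[OF assms(1,2)] by (auto simp: subset_iff)
  ultimately show ?thesis by simp
qed

lemma smooth_on_continuous: "smooth_on M W N f \<Longrightarrow> continuous_map (subtopology (mtop M) W) (mtop N) f"
  by (simp add: smooth_on_def)

lemma smooth_onI:
  assumes "continuous_map (subtopology (mtop M) W) (mtop N) f"
    and "\<And>U \<phi> V \<psi>. (U, \<phi>) \<in> atlas M \<Longrightarrow> (V, \<psi>) \<in> atlas N \<Longrightarrow>
      smooth_coords (mdim M) (\<phi> ` (U \<inter> W \<inter> f -` V)) (mdim N) (\<psi> \<circ> f \<circ> inv_into U \<phi>)"
  shows "smooth_on M W N f"
  using assms unfolding smooth_on_def by auto

lemma smooth_on_subset:
  assumes "smooth_on M W N f" "W' \<subseteq> W"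
  shows "smooth_on M W' N f"
proof (rule smooth_onI)
  show "continuous_map (subtopology (mtop M) W') (mtop N) f"
    using assms continuous_map_from_subtopology_mono unfolding smooth_on_def by blast
  fix U \<phi> V \<psi> assume UV: "(U, \<phi>) \<in> atlas M" "(V, \<psi>) \<in> atlas N"
  have "smooth_coords (mdim M) (\<phi> ` (U \<inter> W \<inter> f -` V)) (mdim N) (\<psi> \<circ> f \<circ> inv_into U \<phi>)"
    using assms(1) UV unfolding smooth_on_def by blast
  moreover have "\<phi> ` (U \<inter> W' \<inter> f -` V) \<subseteq> \<phi> ` (U \<inter> W \<inter> f -` V)" using assms(2) by blast
  ultimately have "smooth_coords (mdim M) (\<phi> ` (U \<inter> W' \<inter> f -` V)) (mdim N) (\<psi> \<circ> f \<circ> inv_into U \<phi>)"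
    unfolding smooth_coords_def using Ck_on_subset by blast
  then show "smooth_coords (mdim M) (\<phi> ` (U \<inter> W' \<inter> f -` V)) (mdim N) (\<psi> \<circ> f \<circ> inv_into U \<phi>)"
    .
qed

lemma smooth_on_eqI:
  assumes M: "smooth_manifold M" "smooth_manifold N" and W: "openin (mtop M) W"
    and f: "smooth_on M W N f" and eq: "\<And>x. x \<in> W \<Longrightarrow> g x = f x"
  shows "smooth_on M W N g"
proof (rule smooth_onI)
  show "continuous_map (subtopology (mtop M) W) (mtop N) g"
    using smooth_on_continuous[OF f] by (rule continuous_map_eq) (simp add: eq)
  fix U \<phi> V \<psi> assume UV: "(U, \<phi>) \<in> atlas M" "(V, \<psi>) \<in> atlas N"
  have 1: "smooth_coords (mdim M) (\<phi> ` (U \<inter> W \<inter> f -` V)) (mdim N) (\<psi> \<circ> f \<circ> inv_into U \<phi>)"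
    using f UV unfolding smooth_on_def by blast
  have same: "U \<inter> W \<inter> g -` V = U \<inter> W \<inter> f -` V" using eq by auto
  have "openin (mtop M) (W \<inter> f -` V)"
    using openin_preimage_on[OF W smooth_on_continuous[OF f]] chart_facts(1)[OF M(2) UV(2)] by blast
  then have "openin (mtop M) (U \<inter> W \<inter> f -` V)"
    using chart_facts(1)[OF M(1) UV(1)] by (simp add: Int_assoc openin_Int)
  then have op: "openin (Euclidean_space (mdim M)) (\<phi> ` (U \<inter> W \<inter> f -` V))"
    by (intro chart_open_image[OF M(1) UV(1)]) auto
  have "smooth_coords (mdim M) (\<phi> ` (U \<inter> W \<inter> g -` V)) (mdim N) (\<psi> \<circ> g \<circ> inv_into U \<phi>)"
    unfolding smooth_coords_def same
  proof (intro allI impI, rule Ck_on_eqI[OF op])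
    fix j k assume "j < mdim N"
    then show "Ck_on k (mdim M) (\<phi> ` (U \<inter> W \<inter> f -` V)) (\<lambda>x. (\<psi> \<circ> f \<circ> inv_into U \<phi>) x j)"
      using 1 by (simp add: smooth_coords_def)
    fix x assume "x \<in> \<phi> ` (U \<inter> W \<inter> f -` V)"
    then show "(\<psi> \<circ> g \<circ> inv_into U \<phi>) x j = (\<psi> \<circ> f \<circ> inv_into U \<phi>) x j"
      using chart_facts(3)[OF M(1) UV(1)] eq by auto
  qed
  then show "smooth_coords (mdim M) (\<phi> ` (U \<inter> W \<inter> g -` V)) (mdim N) (\<psi> \<circ> g \<circ> inv_into U \<phi>)"
    .
qed

text \<open>Near a point whose image lies in the domain of a chart of \<open>N\<close>, the coordinate expression of the composite
  is the composite of the coordinate expressions, and smoothness is local.\<close>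

lemma smooth_on_compose:
  assumes M: "smooth_manifold M" "smooth_manifold N" "smooth_manifold L"
    and W: "openin (mtop M) W" "openin (mtop N) W'"
    and f: "smooth_on M W N f" and g: "smooth_on N W' L g" and fW: "f ` W \<subseteq> W'"
  shows "smooth_on M W L (g \<circ> f)"
proof (rule smooth_onI)
  have "continuous_map (subtopology (mtop M) W) (subtopology (mtop N) W') f"
    using smooth_on_continuous[OF f] fW by (intro continuous_map_into_subtopology) auto
  from continuous_map_compose[OF this smooth_on_continuous[OF g]]
  show cont: "continuous_map (subtopology (mtop M) W) (mtop L) (g \<circ> f)" .
  fix U \<phi> V \<psi> assume UV: "(U, \<phi>) \<in> atlas M" "(V, \<psi>) \<in> atlas L"
  note cU = chart_facts[OF M(1) UV(1)] and cV = chart_facts[OF M(3) UV(2)]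
  have "Ck_on k (mdim M) (\<phi> ` (U \<inter> W \<inter> (g \<circ> f) -` V)) (\<lambda>x. (\<psi> \<circ> (g \<circ> f) \<circ> inv_into U \<phi>) x j)"
    if j: "j < mdim L" for j k
  proof (rule Ck_on_local)
    fix x assume "x \<in> \<phi> ` (U \<inter> W \<inter> (g \<circ> f) -` V)"
    then obtain p where p: "p \<in> U" "p \<in> W" "g (f p) \<in> V" "x = \<phi> p" by auto
    have "f p \<in> topspace (mtop N)" using p fW openin_subset[OF W(2)] by blast
    then obtain C \<kappa> where C: "(C, \<kappa>) \<in> atlas N" "f p \<in> C"
      using chart_exists[OF M(2)] by blast
    note cC = chart_facts[OF M(2) C(1)]
    define T where "T = U \<inter> (W \<inter> f -` C) \<inter> (W \<inter> (g \<circ> f) -` V)"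
    define S where "S = \<phi> ` T"
    define V' where "V' = \<kappa> ` (C \<inter> W' \<inter> g -` V)"
    have "openin (mtop M) T" unfolding T_def
      using openin_preimage_on[OF W(1) smooth_on_continuous[OF f] cC(1)]
        openin_preimage_on[OF W(1) cont cV(1)] cU(1) openin_Int by blast
    then have S: "openin (Euclidean_space (mdim M)) S"
      unfolding S_def by (rule chart_open_image[OF M(1) UV(1)]) (auto simp: T_def)
    have "openin (mtop N) (C \<inter> (W' \<inter> g -` V))"
      using openin_preimage_on[OF W(2) smooth_on_continuous[OF g] cV(1)] cC(1) openin_Int by blast
    then have V': "openin (Euclidean_space (mdim N)) V'"
      unfolding V'_def by (intro chart_open_image[OF M(2) C(1)]) (auto simp: Int_assoc)
    define F where "F = \<kappa> \<circ> f \<circ> inv_into U \<phi>"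
    define G where "G = \<psi> \<circ> g \<circ> inv_into C \<kappa>"
    have inv: "inv_into U \<phi> y \<in> T" if "y \<in> S" for y
      using that cU(3) by (auto simp: S_def T_def)
    have "continuous_map (subtopology (Euclidean_space (mdim M)) S) (subtopology (mtop M) U) (inv_into U \<phi>)"
      by (rule continuous_map_from_subtopology_mono[OF cU(5)]) (auto simp: S_def T_def)
    then have "continuous_map (subtopology (Euclidean_space (mdim M)) S) (mtop M) (inv_into U \<phi>)"
      using continuous_map_in_subtopology by blast
    then have a: "continuous_map (subtopology (Euclidean_space (mdim M)) S) (subtopology (mtop M) T) (inv_into U \<phi>)"
      using inv by (intro continuous_map_into_subtopology) auto
    have b: "continuous_map (subtopology (mtop M) T) (subtopology (mtop N) C) f"
      using continuous_map_from_subtopology_mono[OF smooth_on_continuous[OF f], of T]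
      by (intro continuous_map_into_subtopology) (auto simp: T_def)
    have Fc: "continuous_map (subtopology (Euclidean_space (mdim M)) S) (Euclidean_space (mdim N)) F"
      using continuous_map_compose[OF continuous_map_compose[OF a b] cC(4)] by (simp add: F_def comp_assoc)
    have FS: "F y \<in> V'" if "y \<in> S" for y
      using inv[OF that] fW by (auto simp: F_def V'_def T_def)
    have Fc': "continuous_map (subtopology (Euclidean_space (mdim M)) S) (subtopology (Euclidean_space (mdim N)) V') F"
      using Fc FS by (intro continuous_map_into_subtopology) auto
    have "smooth_coords (mdim M) (\<phi> ` (U \<inter> W \<inter> f -` C)) (mdim N) F"
      using f UV(1) C(1) unfolding smooth_on_def F_def by blast
    moreover have "S \<subseteq> \<phi> ` (U \<inter> W \<inter> f -` C)" by (auto simp: S_def T_def)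
    ultimately have F1: "Ck_on k (mdim M) S (\<lambda>x. F x i)" if "i < mdim N" for i
      using that Ck_on_subset unfolding smooth_coords_def by blast
    have G1: "Ck_on k (mdim N) V' (\<lambda>x. G x j)"
      using g UV(2) C(1) j unfolding smooth_on_def G_def V'_def smooth_coords_def by blast
    have "Ck_on k (mdim M) S (\<lambda>x. G (F x) j)"
      using Ck_on_compose[OF S V' Fc' F1 G1] .
    moreover have "(\<psi> \<circ> (g \<circ> f) \<circ> inv_into U \<phi>) y j = G (F y) j" if "y \<in> S" for y
      using inv[OF that] cC(3) by (simp add: G_def F_def T_def)
    ultimately have "Ck_on k (mdim M) S (\<lambda>x. (\<psi> \<circ> (g \<circ> f) \<circ> inv_into U \<phi>) x j)"
      by (rule Ck_on_eqI[OF S])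
    moreover have "\<phi> ` (U \<inter> W \<inter> (g \<circ> f) -` V) \<inter> S = S" by (auto simp: S_def T_def)
    moreover have "x \<in> S" using p C by (auto simp: S_def T_def)
    ultimately show "\<exists>V'. openin (Euclidean_space (mdim M)) V' \<and> x \<in> V' \<and>
      Ck_on k (mdim M) (\<phi> ` (U \<inter> W \<inter> (g \<circ> f) -` V) \<inter> V') (\<lambda>x. (\<psi> \<circ> (g \<circ> f) \<circ> inv_into U \<phi>) x j)"
      using S by (intro exI[of _ S]) simp
  qed
  then show "smooth_coords (mdim M) (\<phi> ` (U \<inter> W \<inter> (g \<circ> f) -` V)) (mdim L) (\<psi> \<circ> (g \<circ> f) \<circ> inv_into U \<phi>)"
    by (simp add: smooth_coords_def)
qed

text \<open>In contrast to \<open>local_diffeo_on\<close>, injectivity is required on all of \<open>W\<close>, so that a single inverse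
  \<open>inv_into W f\<close> is available.\<close>

definition diffeo_on :: "'a manifold \<Rightarrow> 'a set \<Rightarrow> 'b manifold \<Rightarrow> ('a \<Rightarrow> 'b) \<Rightarrow> bool" where
  "diffeo_on M W N f \<longleftrightarrow> openin (mtop M) W \<and> openin (mtop N) (f ` W) \<and> inj_on f W \<and>
    smooth_on M W N f \<and> smooth_on N (f ` W) M (inv_into W f)"

lemma diffeo_on_imp_local_diffeo_on: "diffeo_on M W N f \<Longrightarrow> local_diffeo_on M W N f"
  unfolding diffeo_on_def local_diffeo_on_def by blast

lemma diffeo_on_subset:
  assumes M: "smooth_manifold M" "smooth_manifold N"
    and f: "diffeo_on M W N f" and W': "openin (mtop M) W'" "W' \<subseteq> W"
  shows "diffeo_on M W' N f"
proof -
  have f': "openin (mtop N) (f ` W)" "inj_on f W" "smooth_on M W N f" "smooth_on N (f ` W) M (inv_into W f)"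
    using f by (auto simp: diffeo_on_def)
  have inj: "inj_on f W'" using f'(2) W'(2) by (rule inj_on_subset)
  have "f ` W \<inter> inv_into W f -` W' = f ` W'" using W'(2) f'(2) by (auto simp: subset_iff)
  then have op: "openin (mtop N) (f ` W')"
    using openin_preimage_on[OF f'(1) smooth_on_continuous[OF f'(4)] W'(1)] by simp
  have "smooth_on N (f ` W') M (inv_into W f)" using f'(4) W'(2) by (auto intro: smooth_on_subset)
  then have "smooth_on N (f ` W') M (inv_into W' f)"
    by (rule smooth_on_eqI[OF M(2,1) op]) (use f'(2) inj W'(2) in \<open>auto simp: subset_iff\<close>)
  then show ?thesis
    unfolding diffeo_on_def using W' op inj smooth_on_subset[OF f'(3) W'(2)] by blast
qed

text \<open>For \<open>s\<close> and \<open>t\<close> the source and target of an etale groupoid, the composite is the local diffeomorphism of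
  the space of objects that a small open set of arrows defines.\<close>

lemma diffeo_on_span:
  assumes M: "smooth_manifold M" "smooth_manifold N" "smooth_manifold L"
    and s: "diffeo_on M W N s" and t: "diffeo_on M W L t"
  shows "diffeo_on N (s ` W) L (t \<circ> inv_into W s)"
proof -
  have s': "openin (mtop M) W" "openin (mtop N) (s ` W)" "inj_on s W" "smooth_on M W N s" "smooth_on N (s ` W) M (inv_into W s)"
    using s by (auto simp: diffeo_on_def)
  have t': "openin (mtop L) (t ` W)" "inj_on t W" "smooth_on M W L t" "smooth_on L (t ` W) M (inv_into W t)"
    using t by (auto simp: diffeo_on_def)
  have im: "(t \<circ> inv_into W s) ` (s ` W) = t ` W" using s'(3) by (force simp: image_iff)
  have inj: "inj_on (t \<circ> inv_into W s) (s ` W)" using s'(3) t'(2) by (auto simp: inj_on_def)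
  have 1: "smooth_on N (s ` W) L (t \<circ> inv_into W s)"
    by (rule smooth_on_compose[OF M(2,1,3) s'(2,1) s'(5) t'(3)]) (use s'(3) in auto)
  have "smooth_on L (t ` W) N (s \<circ> inv_into W t)"
    by (rule smooth_on_compose[OF M(3,1,2) t'(1) s'(1) t'(4) s'(4)]) (use t'(2) in auto)
  moreover have "inv_into (s ` W) (t \<circ> inv_into W s) z = (s \<circ> inv_into W t) z" if "z \<in> t ` W" for z
  proof -
    from that obtain w where w: "w \<in> W" "z = t w" by blast
    have z: "z = (t \<circ> inv_into W s) (s w)" using w s'(3) by simp
    have "inv_into (s ` W) (t \<circ> inv_into W s) z = s w"
      unfolding z by (rule inv_into_f_f[OF inj]) (use w in blast)
    then show ?thesis using w t'(2) by simp
  qed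
  ultimately have 2: "smooth_on L (t ` W) N (inv_into (s ` W) (t \<circ> inv_into W s))"
    by (rule smooth_on_eqI[OF M(3,2) t'(1)])
  show ?thesis unfolding diffeo_on_def im by (intro conjI s'(2) t'(1) inj 1 2)
qed

section \<open>Topological groupoids and their torsors\<close>

lemma continuous_map_comp:
  "continuous_map X Y f \<Longrightarrow> continuous_map Y Z g \<Longrightarrow> continuous_map X Z (\<lambda>x. g (f x))"
  using continuous_map_compose[of X Y f Z g] by (simp add: o_def)

lemma openin_preimage:
  "continuous_map X Y f \<Longrightarrow> openin Y V \<Longrightarrow> openin X {x \<in> topspace X. f x \<in> V}"
  by (rule openin_continuous_map_preimage)

lemma continuous_map_sub_fst: "continuous_map (subtopology (prod_topology X Y) S) X fst"
  by (intro continuous_map_from_subtopology continuous_map_fst)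

lemma continuous_map_sub_snd: "continuous_map (subtopology (prod_topology X Y) S) Y snd"
  by (intro continuous_map_from_subtopology continuous_map_snd)

locale top_groupoid =
  fixes G :: "('o, 'a, 'z) groupoid_scheme"
  assumes G: "topological_groupoid G"
begin

lemma src_cont: "continuous_map (Arr G) (Obj G) (src G)" and tgt_cont: "continuous_map (Arr G) (Obj G) (tgt G)"
  and inv_cont: "continuous_map (Arr G) (Arr G) (ginv G)" and unit_cont: "continuous_map (Obj G) (Arr G) (gunit G)"
  and mult_cont: "continuous_map (subtopology (prod_topology (Arr G) (Arr G)) (composable G)) (Arr G) (\<lambda>(g, g'). gmult G g g')"
  using G unfolding topological_groupoid_def by simp_all

lemma src_in: "g \<in> arrows G \<Longrightarrow> src G g \<in> objects G" and tgt_in: "g \<in> arrows G \<Longrightarrow> tgt G g \<in> objects G"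
  and inv_in: "g \<in> arrows G \<Longrightarrow> ginv G g \<in> arrows G" and unit_in: "x \<in> objects G \<Longrightarrow> gunit G x \<in> arrows G"
  using src_cont tgt_cont inv_cont unit_cont by (auto simp: continuous_map_def)

lemma mult_in: "g \<in> arrows G \<Longrightarrow> h \<in> arrows G \<Longrightarrow> src G g = tgt G h \<Longrightarrow> gmult G g h \<in> arrows G"
  using continuous_map_image_subset_topspace[OF mult_cont] by (auto simp: composable_def)

lemma src_mult: "g \<in> arrows G \<Longrightarrow> h \<in> arrows G \<Longrightarrow> src G g = tgt G h \<Longrightarrow> src G (gmult G g h) = src G h"
  and tgt_mult: "g \<in> arrows G \<Longrightarrow> h \<in> arrows G \<Longrightarrow> src G g = tgt G h \<Longrightarrow> tgt G (gmult G g h) = tgt G g"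
  using G unfolding topological_groupoid_def composable_def by auto

lemma assoc: "g \<in> arrows G \<Longrightarrow> h \<in> arrows G \<Longrightarrow> k \<in> arrows G \<Longrightarrow> src G g = tgt G h \<Longrightarrow> src G h = tgt G k \<Longrightarrow>
    gmult G (gmult G g h) k = gmult G g (gmult G h k)"
  using G unfolding topological_groupoid_def composable_def by auto

lemma src_unit: "x \<in> objects G \<Longrightarrow> src G (gunit G x) = x" and tgt_unit: "x \<in> objects G \<Longrightarrow> tgt G (gunit G x) = x"
  and unit_l: "g \<in> arrows G \<Longrightarrow> gmult G (gunit G (tgt G g)) g = g"
  and unit_r: "g \<in> arrows G \<Longrightarrow> gmult G g (gunit G (src G g)) = g"
  and src_inv: "g \<in> arrows G \<Longrightarrow> src G (ginv G g) = tgt G g" and tgt_inv: "g \<in> arrows G \<Longrightarrow> tgt G (ginv G g) = src G g"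
  and inv_r: "g \<in> arrows G \<Longrightarrow> gmult G g (ginv G g) = gunit G (tgt G g)"
  and inv_l: "g \<in> arrows G \<Longrightarrow> gmult G (ginv G g) g = gunit G (src G g)"
  using G unfolding topological_groupoid_def by auto

lemmas closed = src_in tgt_in inv_in unit_in mult_in
lemmas st = src_mult tgt_mult src_unit tgt_unit src_inv tgt_inv

lemma inv_mult_cancel: "g \<in> arrows G \<Longrightarrow> h \<in> arrows G \<Longrightarrow> src G g = tgt G h \<Longrightarrow> gmult G (ginv G g) (gmult G g h) = h"
  by (subst assoc[symmetric]) (simp_all add: closed st inv_l unit_l)

lemma mult_inv_cancel: "g \<in> arrows G \<Longrightarrow> h \<in> arrows G \<Longrightarrow> tgt G g = tgt G h \<Longrightarrow> gmult G g (gmult G (ginv G g) h) = h"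
  by (subst assoc[symmetric]) (simp_all add: closed st inv_r unit_l)

lemma mult_left_imp_eq:
  assumes "g \<in> arrows G" "h \<in> arrows G" "k \<in> arrows G" "src G g = tgt G h" "src G g = tgt G k" "gmult G g h = gmult G g k"
  shows "h = k"
  by (rule trans[OF inv_mult_cancel[OF assms(1,2,4), symmetric] inv_mult_cancel[OF assms(1,3,5), folded assms(6)]])

lemma inv_unique:
  assumes "g \<in> arrows G" "h \<in> arrows G" "src G g = tgt G h" "gmult G g h = gunit G (tgt G g)"
  shows "h = ginv G g"
proof (rule mult_left_imp_eq[OF assms(1,2)])
  show "gmult G g h = gmult G g (ginv G g)" by (simp only: assms(4) inv_r[OF assms(1)])
qed (use assms(1,3) in \<open>simp_all add: closed st\<close>)

lemma inv_inv: "g \<in> arrows G \<Longrightarrow> ginv G (ginv G g) = g"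
  by (rule inv_unique[symmetric]) (simp_all add: closed st inv_l)

lemma inv_mult:
  assumes "g \<in> arrows G" "h \<in> arrows G" "src G g = tgt G h"
  shows "ginv G (gmult G g h) = gmult G (ginv G h) (ginv G g)"
proof (rule inv_unique[symmetric])
  show "gmult G (gmult G g h) (gmult G (ginv G h) (ginv G g)) = gunit G (tgt G (gmult G g h))"
    using assms by (simp add: assoc closed st mult_inv_cancel inv_r)
qed (use assms in \<open>simp_all add: closed st\<close>)

text \<open>Transition functions of bundles are quotients \<open>g\<inverse>h\<close> of arrows with a common target; this is their cocycle
  rule.\<close>

lemma div_trans:
  assumes "g \<in> arrows G" "h \<in> arrows G" "k \<in> arrows G" "tgt G g = tgt G h" "tgt G h = tgt G k"
  shows "gmult G (gmult G (ginv G g) h) (gmult G (ginv G h) k) = gmult G (ginv G g) k"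
  using assms by (simp add: assoc closed st mult_inv_cancel)

lemma div_inv:
  assumes "g \<in> arrows G" "h \<in> arrows G" "tgt G g = tgt G h"
  shows "ginv G (gmult G (ginv G g) h) = gmult G (ginv G h) g"
  using assms by (simp add: inv_mult closed st inv_inv)

lemma cont_mult:
  assumes "continuous_map Z (Arr G) f" "continuous_map Z (Arr G) g" "\<And>z. z \<in> topspace Z \<Longrightarrow> src G (f z) = tgt G (g z)"
  shows "continuous_map Z (Arr G) (\<lambda>z. gmult G (f z) (g z))"
proof -
  have "f z \<in> arrows G" "g z \<in> arrows G" if "z \<in> topspace Z" for z
    using assms(1,2) that by (auto simp: continuous_map_def)
  then have "continuous_map Z (subtopology (prod_topology (Arr G) (Arr G)) (composable G)) (\<lambda>z. (f z, g z))"
    using assms by (intro continuous_map_into_subtopology) (auto simp: continuous_map_pairedI composable_def)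
  from continuous_map_comp[OF this mult_cont] show ?thesis by simp
qed

lemma cont_inv: "continuous_map Z (Arr G) f \<Longrightarrow> continuous_map Z (Arr G) (\<lambda>z. ginv G (f z))"
  by (rule continuous_map_comp[OF _ inv_cont])

lemma cont_unit: "continuous_map Z (Obj G) f \<Longrightarrow> continuous_map Z (Arr G) (\<lambda>z. gunit G (f z))"
  by (rule continuous_map_comp[OF _ unit_cont])

lemma cont_src: "continuous_map Z (Arr G) f \<Longrightarrow> continuous_map Z (Obj G) (\<lambda>z. src G (f z))"
  by (rule continuous_map_comp[OF _ src_cont])

lemma cont_div:
  assumes "continuous_map Z (Arr G) f" "continuous_map Z (Arr G) g" "\<And>z. z \<in> topspace Z \<Longrightarrow> tgt G (f z) = tgt G (g z)"
  shows "continuous_map Z (Arr G) (\<lambda>z. gmult G (ginv G (f z)) (g z))"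
  by (intro cont_mult cont_inv assms) (use assms in \<open>auto simp: continuous_map_def st Pi_iff\<close>)

end

lemma unit_groupoid_sel [simp]:
  "Obj (unit_groupoid X) = X" "Arr (unit_groupoid X) = X" "src (unit_groupoid X) = id" "tgt (unit_groupoid X) = id"
  "gmult (unit_groupoid X) = (\<lambda>x y. x)" "ginv (unit_groupoid X) = id" "gunit (unit_groupoid X) = id"
  by (simp_all add: unit_groupoid_def)

lemma topological_unit_groupoid: "topological_groupoid (unit_groupoid X)"
  unfolding topological_groupoid_def composable_def
  using continuous_map_sub_fst[of X X] by (auto simp: case_prod_unfold fst_def[symmetric])

text \<open>The second component of the inverse of the homeomorphism \<open>(p, g) \<mapsto> (p, pg)\<close> of a principal bundle.\<close>

definition pdiv :: "('o, 'a, 'z) groupoid_scheme \<Rightarrow> ('p, 'y, 'h, 'o, 'a) bibundle \<Rightarrow> 'p \<Rightarrow> 'p \<Rightarrow> 'a" where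
  "pdiv G P p p' = (THE g. g \<in> arrows G \<and> eps P p = tgt G g \<and> ract P p g = p')"

text \<open>Over a unit groupoid the left action is determined, so this is a principal bundle over the space \<open>Y\<close>.\<close>

locale torsor = top_groupoid G for G :: "('o, 'a, 'z) groupoid_scheme" +
  fixes Y :: "'y topology" and P :: "('p, 'y, 'y, 'o, 'a) bibundle"
  assumes P: "principal_bundle G (unit_groupoid Y) P"
begin

lemma ra: "right_action G (Tot P) (eps P) (ract P)" and la: "left_action (unit_groupoid Y) (Tot P) (proj P) (lact P)"
  using P unfolding principal_bundle_def by simp_all

lemma proj_cont: "continuous_map (Tot P) Y (proj P)" and lact_triv: "p \<in> total_space P \<Longrightarrow> lact P (proj P p) p = p"
  using la unfolding left_action_def by auto

lemma eps_cont: "continuous_map (Tot P) (Obj G) (eps P)"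
  and act_cont: "continuous_map (subtopology (prod_topology (Tot P) (Arr G)) {(x, g). eps P x = tgt G g}) (Tot P) (\<lambda>(x, g). ract P x g)"
  and act_eps: "p \<in> total_space P \<Longrightarrow> g \<in> arrows G \<Longrightarrow> eps P p = tgt G g \<Longrightarrow> eps P (ract P p g) = src G g"
  and act_unit: "p \<in> total_space P \<Longrightarrow> ract P p (gunit G (eps P p)) = p"
  and act_assoc: "p \<in> total_space P \<Longrightarrow> g \<in> arrows G \<Longrightarrow> h \<in> arrows G \<Longrightarrow> eps P p = tgt G g \<Longrightarrow> src G g = tgt G h \<Longrightarrow>
    ract P (ract P p g) h = ract P p (gmult G g h)"
  using ra unfolding right_action_def by auto

lemma proj_in: "p \<in> total_space P \<Longrightarrow> proj P p \<in> topspace Y" and eps_in: "p \<in> total_space P \<Longrightarrow> eps P p \<in> objects G"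
  using proj_cont eps_cont by (auto simp: continuous_map_def)

lemma act_in: "p \<in> total_space P \<Longrightarrow> g \<in> arrows G \<Longrightarrow> eps P p = tgt G g \<Longrightarrow> ract P p g \<in> total_space P"
  using continuous_map_image_subset_topspace[OF act_cont] by auto

lemma act_proj: "p \<in> total_space P \<Longrightarrow> g \<in> arrows G \<Longrightarrow> eps P p = tgt G g \<Longrightarrow> proj P (ract P p g) = proj P p"
  using P unfolding principal_bundle_def by (elim conjE) blast

lemma local_section:
  assumes "y \<in> topspace Y"
  shows "\<exists>U \<sigma>. openin Y U \<and> y \<in> U \<and> continuous_map (subtopology Y U) (Tot P) \<sigma> \<and> (\<forall>z\<in>U. proj P (\<sigma> z) = z)"
proof -
  have "\<forall>y\<in>objects (unit_groupoid Y). \<exists>U \<sigma>. openin (Obj (unit_groupoid Y)) U \<and> y \<in> U \<and>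
        continuous_map (subtopology (Obj (unit_groupoid Y)) U) (Tot P) \<sigma> \<and> (\<forall>z\<in>U. proj P (\<sigma> z) = z)"
    using P unfolding principal_bundle_def by (elim conjE)
  then show ?thesis using assms by simp
qed

lemma local_section_in:
  assumes "y \<in> topspace Y"
  shows "\<exists>V \<sigma>. openin Y V \<and> y \<in> V \<and> continuous_map (subtopology Y V) (Tot P) \<sigma> \<and> (\<forall>z\<in>V. \<sigma> z \<in> total_space P \<and> proj P (\<sigma> z) = z)"
proof -
  obtain V \<sigma> where V: "openin Y V" "y \<in> V" "continuous_map (subtopology Y V) (Tot P) \<sigma>" "\<forall>z\<in>V. proj P (\<sigma> z) = z"
    using local_section[OF assms] by (elim exE conjE)
  have "\<sigma> z \<in> total_space P" if "z \<in> V" for z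
    using V(3) that openin_subset[OF V(1)] by (auto simp: continuous_map_def Pi_iff)
  then show ?thesis using V by blast
qed

lemma division_homeo: "homeomorphic_map
       (subtopology (prod_topology (Tot P) (Arr G)) {(p, g). eps P p = tgt G g})
       (subtopology (prod_topology (Tot P) (Tot P)) {(p, p'). proj P p = proj P p'})
       (\<lambda>(p, g). (p, ract P p g))"
  using P unfolding principal_bundle_def by (elim conjE)

lemma act_free:
  assumes "p \<in> total_space P" "g \<in> arrows G" "h \<in> arrows G" "eps P p = tgt G g" "eps P p = tgt G h" "ract P p g = ract P p h"
  shows "g = h"
  using inj_onD[OF homeomorphic_imp_injective_map[OF division_homeo], of "(p, g)" "(p, h)"] assms by auto

lemma act_trans:
  assumes "p \<in> total_space P" "p' \<in> total_space P" "proj P p = proj P p'"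
  shows "\<exists>g\<in>arrows G. eps P p = tgt G g \<and> ract P p g = p'"
proof -
  have "(p, p') \<in> (\<lambda>(p, g). (p, ract P p g)) ` topspace (subtopology (prod_topology (Tot P) (Arr G)) {(p, g). eps P p = tgt G g})"
    using homeomorphic_imp_surjective_map[OF division_homeo] assms by auto
  then show ?thesis by auto
qed

lemma pdiv_eq:
  assumes "p \<in> total_space P" "g \<in> arrows G" "eps P p = tgt G g"
  shows "pdiv G P p (ract P p g) = g"
  unfolding pdiv_def by (rule the_equality) (use assms act_free in auto)

lemma pdiv:
  assumes "p \<in> total_space P" "p' \<in> total_space P" "proj P p = proj P p'"
  shows "pdiv G P p p' \<in> arrows G" "tgt G (pdiv G P p p') = eps P p" "ract P p (pdiv G P p p') = p'"
    "src G (pdiv G P p p') = eps P p'"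
proof -
  obtain g where g: "g \<in> arrows G" "eps P p = tgt G g" "ract P p g = p'" using act_trans[OF assms] by blast
  then have "pdiv G P p p' = g" using pdiv_eq[OF assms(1), of g] by simp
  then show "pdiv G P p p' \<in> arrows G" "tgt G (pdiv G P p p') = eps P p" "ract P p (pdiv G P p p') = p'"
    "src G (pdiv G P p p') = eps P p'"
    using g act_eps[OF assms(1), of g] by auto
qed

lemma cont_act:
  assumes "continuous_map Z (Tot P) f" "continuous_map Z (Arr G) g" "\<And>z. z \<in> topspace Z \<Longrightarrow> eps P (f z) = tgt G (g z)"
  shows "continuous_map Z (Tot P) (\<lambda>z. ract P (f z) (g z))"
proof -
  have "continuous_map Z (subtopology (prod_topology (Tot P) (Arr G)) {(x, g). eps P x = tgt G g}) (\<lambda>z. (f z, g z))"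
    using assms by (intro continuous_map_into_subtopology) (auto simp: continuous_map_pairedI)
  from continuous_map_comp[OF this act_cont] show ?thesis by simp
qed

lemma cont_pdiv:
  assumes f: "continuous_map Z (Tot P) f" and f': "continuous_map Z (Tot P) f'"
    and eq: "\<And>z. z \<in> topspace Z \<Longrightarrow> proj P (f z) = proj P (f' z)"
  shows "continuous_map Z (Arr G) (\<lambda>z. pdiv G P (f z) (f' z))"
proof -
  let ?X = "subtopology (prod_topology (Tot P) (Arr G)) {(p, g). eps P p = tgt G g}"
  let ?X' = "subtopology (prod_topology (Tot P) (Tot P)) {(p, p'). proj P p = proj P p'}"
  obtain k where k: "homeomorphic_maps ?X ?X' (\<lambda>(p, g). (p, ract P p g)) k"
    using division_homeo homeomorphic_map_maps by blast
  have fin: "f z \<in> total_space P" "f' z \<in> total_space P" if "z \<in> topspace Z" for z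
    using f f' that by (auto simp: continuous_map_def)
  have kc: "continuous_map ?X' ?X k" using k by (simp add: homeomorphic_maps_def)
  have "continuous_map Z ?X' (\<lambda>z. (f z, f' z))"
    using f f' eq by (intro continuous_map_into_subtopology) (auto simp: continuous_map_pairedI)
  from continuous_map_comp[OF continuous_map_comp[OF this kc] continuous_map_sub_snd]
  have "continuous_map Z (Arr G) (\<lambda>z. snd (k (f z, f' z)))" .
  moreover have "snd (k (f z, f' z)) = pdiv G P (f z) (f' z)" if z: "z \<in> topspace Z" for z
  proof -
    have "k ((\<lambda>(p, g). (p, ract P p g)) (f z, pdiv G P (f z) (f' z))) = (f z, pdiv G P (f z) (f' z))"
    proof -
      have "\<forall>x\<in>topspace ?X. k ((\<lambda>(p, g). (p, ract P p g)) x) = x"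
        using k unfolding homeomorphic_maps_def by (elim conjE)
      moreover have "(f z, pdiv G P (f z) (f' z)) \<in> topspace ?X"
        using fin[OF z] pdiv[OF fin[OF z] eq[OF z]] by simp
      ultimately show ?thesis by (rule bspec)
    qed
    then show ?thesis using pdiv(3)[OF fin[OF z] eq[OF z]] by simp
  qed
  ultimately show ?thesis by (rule continuous_map_eq)
qed

lemma pdiv_mult:
  assumes "p \<in> total_space P" "p' \<in> total_space P" "p'' \<in> total_space P" "proj P p = proj P p'" "proj P p' = proj P p''"
  shows "gmult G (pdiv G P p p') (pdiv G P p' p'') = pdiv G P p p''"
proof -
  note 1 = pdiv[OF assms(1,2,4)] and 2 = pdiv[OF assms(2,3,5)]
  have "ract P p (gmult G (pdiv G P p p') (pdiv G P p' p'')) = p''"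
    using act_assoc[of p "pdiv G P p p'" "pdiv G P p' p''"] 1 2 assms by simp
  then show ?thesis
    using pdiv_eq[of p "gmult G (pdiv G P p p') (pdiv G P p' p'')"] 1 2 assms by (simp add: closed st)
qed

end

text \<open>A continuous division function \<open>d\<close> provides the inverse \<open>(p, p') \<mapsto> (p, d p p')\<close> of the map that has to be a
  homeomorphism.\<close>

lemma principal_bundle_unitI:
  fixes P :: "('p, 'y, 'y, 'o, 'a) bibundle"
  assumes G: "topological_groupoid G" and ra: "right_action G (Tot P) (eps P) (ract P)"
    and proj: "continuous_map (Tot P) Y (proj P)" and lact: "\<And>p. p \<in> total_space P \<Longrightarrow> lact P (proj P p) p = p"
    and sec: "\<And>y. y \<in> topspace Y \<Longrightarrow> \<exists>U \<sigma>. openin Y U \<and> y \<in> U \<and> continuous_map (subtopology Y U) (Tot P) \<sigma> \<and> (\<forall>z\<in>U. proj P (\<sigma> z) = z)"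
    and act_proj: "\<And>p g. p \<in> total_space P \<Longrightarrow> g \<in> arrows G \<Longrightarrow> eps P p = tgt G g \<Longrightarrow> proj P (ract P p g) = proj P p"
    and d: "continuous_map (subtopology (prod_topology (Tot P) (Tot P)) {(p, p'). proj P p = proj P p'}) (Arr G) (\<lambda>(p, p'). d p p')"
    and d1: "\<And>p p'. p \<in> total_space P \<Longrightarrow> p' \<in> total_space P \<Longrightarrow> proj P p = proj P p' \<Longrightarrow> eps P p = tgt G (d p p') \<and> ract P p (d p p') = p'"
    and d2: "\<And>p g. p \<in> total_space P \<Longrightarrow> g \<in> arrows G \<Longrightarrow> eps P p = tgt G g \<Longrightarrow> d p (ract P p g) = g"
  shows "principal_bundle G (unit_groupoid Y) P"
proof -
  have "left_action (unit_groupoid Y) (Tot P) (proj P) (lact P)"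
  proof -
    have "continuous_map (subtopology (prod_topology Y (Tot P)) {(h, x). h = proj P x}) (Tot P) (\<lambda>(h, x). lact P h x)"
      by (rule continuous_map_eq[OF continuous_map_sub_snd]) (auto simp: lact)
    then show ?thesis unfolding left_action_def using proj lact by simp
  qed
  moreover have "homeomorphic_map
       (subtopology (prod_topology (Tot P) (Arr G)) {(p, g). eps P p = tgt G g})
       (subtopology (prod_topology (Tot P) (Tot P)) {(p, p'). proj P p = proj P p'})
       (\<lambda>(p, g). (p, ract P p g))" (is "homeomorphic_map ?X ?X' ?f")
  proof -
    have actc: "continuous_map ?X (Tot P) (\<lambda>(x, g). ract P x g)" using ra by (simp add: right_action_def)
    then have act_in: "ract P p g \<in> total_space P" if "p \<in> total_space P" "g \<in> arrows G" "eps P p = tgt G g" for p g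
      using continuous_map_image_subset_topspace[OF actc] that by auto
    have "continuous_map ?X (prod_topology (Tot P) (Tot P)) (\<lambda>z. (fst z, (\<lambda>(x, g). ract P x g) z))"
      by (intro continuous_map_pairedI continuous_map_sub_fst actc)
    then have 1: "continuous_map ?X ?X' ?f"
      by (intro continuous_map_into_subtopology) (auto simp: act_proj case_prod_unfold)
    have "continuous_map ?X' (prod_topology (Tot P) (Arr G)) (\<lambda>z. (fst z, (\<lambda>(p, p'). d p p') z))"
      by (intro continuous_map_pairedI continuous_map_sub_fst d)
    then have 2: "continuous_map ?X' ?X (\<lambda>(p, p'). (p, d p p'))"
      by (intro continuous_map_into_subtopology) (auto simp: d1[THEN conjunct1, symmetric] case_prod_unfold)
    have "homeomorphic_maps ?X ?X' ?f (\<lambda>(p, p'). (p, d p p'))"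
      unfolding homeomorphic_maps_def using 1 2 d1 d2 by auto
    then show ?thesis by (rule homeomorphic_maps_map[THEN iffD1, THEN conjunct1])
  qed
  moreover have "lact P h (ract P p g) = ract P (lact P h p) g"
    if "p \<in> total_space P" "g \<in> arrows G" "eps P p = tgt G g" "h = proj P p" for p g h
  proof -
    have actc: "continuous_map (subtopology (prod_topology (Tot P) (Arr G)) {(p, g). eps P p = tgt G g}) (Tot P) (\<lambda>(x, g). ract P x g)"
      using ra by (simp add: right_action_def)
    have "ract P p g \<in> total_space P" using continuous_map_image_subset_topspace[OF actc] that by auto
    then show ?thesis using lact[of "ract P p g"] lact[of p] that act_proj by simp
  qed
  ultimately show ?thesis
    unfolding principal_bundle_def using G ra topological_unit_groupoid sec act_proj lact by simp
qed

lemma torsor_restrict: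
  assumes "torsor G Y P"
  shows "torsor G (subtopology Y S) (restrict_bundle S P)"
proof -
  interpret torsor G Y P by fact
  let ?T = "subtopology (Tot P) {p. proj P p \<in> S}"
  have [simp]: "Tot (restrict_bundle S P) = ?T" "eps (restrict_bundle S P) = eps P" "proj (restrict_bundle S P) = proj P"
    "ract (restrict_bundle S P) = ract P" "lact (restrict_bundle S P) = lact P"
    by (simp_all add: restrict_bundle_def)
  have "principal_bundle G (unit_groupoid (subtopology Y S)) (restrict_bundle S P)"
  proof (rule principal_bundle_unitI[OF G, where d = "pdiv G P"])
    show "right_action G (Tot (restrict_bundle S P)) (eps (restrict_bundle S P)) (ract (restrict_bundle S P))"
      unfolding right_action_def
    proof (intro conjI)
      show "continuous_map (Tot (restrict_bundle S P)) (Obj G) (eps (restrict_bundle S P))"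
        by (simp add: continuous_map_from_subtopology eps_cont)
      let ?Z = "subtopology (prod_topology ?T (Arr G)) {(x, g). eps P x = tgt G g}"
      have "continuous_map ?Z (Tot P) (\<lambda>z. ract P (fst z) (snd z))"
        by (intro cont_act continuous_map_sub_snd continuous_map_into_fulltopology[OF continuous_map_sub_fst[of ?T]]) auto
      then have "continuous_map ?Z ?T (\<lambda>z. ract P (fst z) (snd z))"
        by (intro continuous_map_into_subtopology) (auto simp: act_proj)
      then show "continuous_map (subtopology (prod_topology (Tot (restrict_bundle S P)) (Arr G)) {(x, g). eps (restrict_bundle S P) x = tgt G g})
          (Tot (restrict_bundle S P)) (\<lambda>(x, g). ract (restrict_bundle S P) x g)"
        by (simp add: case_prod_unfold)
    qed (auto simp: act_eps act_unit act_assoc)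
    show "continuous_map (Tot (restrict_bundle S P)) (subtopology Y S) (proj (restrict_bundle S P))"
      by (intro continuous_map_into_subtopology) (auto simp: continuous_map_from_subtopology proj_cont)
    fix y assume y: "y \<in> topspace (subtopology Y S)"
    then obtain U \<sigma> where U: "openin Y U" "y \<in> U" "continuous_map (subtopology Y U) (Tot P) \<sigma>" "\<forall>z\<in>U. proj P (\<sigma> z) = z"
      using local_section[of y] by auto
    have eq: "subtopology (subtopology Y S) (U \<inter> S) = subtopology Y (U \<inter> S)"
      by (simp add: subtopology_subtopology Int_ac)
    have "continuous_map (subtopology Y (U \<inter> S)) (Tot P) \<sigma>"
      using U(3) by (rule continuous_map_from_subtopology_mono) auto
    then have "continuous_map (subtopology Y (U \<inter> S)) ?T \<sigma>"
      by (intro continuous_map_into_subtopology) (use U in auto)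
    then show "\<exists>U \<sigma>. openin (subtopology Y S) U \<and> y \<in> U \<and> continuous_map (subtopology (subtopology Y S) U)
        (Tot (restrict_bundle S P)) \<sigma> \<and> (\<forall>z\<in>U. proj (restrict_bundle S P) (\<sigma> z) = z)"
      using U y openin_subtopology_Int[OF U(1), of S] eq by (intro exI[of _ "U \<inter> S"] exI[of _ \<sigma>]) auto
  next
    let ?Z = "subtopology (prod_topology ?T ?T) {(p, p'). proj P p = proj P p'}"
    have "continuous_map ?Z (Arr G) (\<lambda>z. pdiv G P (fst z) (snd z))"
      by (intro cont_pdiv continuous_map_into_fulltopology[OF continuous_map_sub_fst[of ?T]]
          continuous_map_into_fulltopology[OF continuous_map_sub_snd[of _ ?T]]) auto
    then show "continuous_map (subtopology (prod_topology (Tot (restrict_bundle S P)) (Tot (restrict_bundle S P)))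
        {(p, p'). proj (restrict_bundle S P) p = proj (restrict_bundle S P) p'}) (Arr G) (\<lambda>(p, p'). pdiv G P p p')"
      by (simp add: case_prod_unfold)
  qed (auto simp: act_proj lact_triv pdiv pdiv_eq)
  then show ?thesis by unfold_locales
qed

text \<open>Locally every point is \<open>p = \<sigma>(y) g\<close> with \<open>y\<close> the projection of \<open>p\<close> and \<open>g\<close> a continuous function of \<open>p\<close>, so
  that \<open>\<mu> p = \<mu>(\<sigma>(y)) E(g)\<close>.\<close>

lemma equivariant_continuous:
  assumes "torsor G Y P" "torsor Q Y P'"
    and E: "continuous_map (Arr G) (Arr Q) E" "\<And>g. g \<in> arrows G \<Longrightarrow> tgt Q (E g) = tgt G g"
    and \<mu>: "\<And>p. p \<in> total_space P \<Longrightarrow> eps P' (\<mu> p) = eps P p"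
    and eqv: "\<And>p g. p \<in> total_space P \<Longrightarrow> g \<in> arrows G \<Longrightarrow> eps P p = tgt G g \<Longrightarrow> \<mu> (ract P p g) = ract P' (\<mu> p) (E g)"
    and sec: "\<And>y. y \<in> topspace Y \<Longrightarrow> \<exists>V \<sigma>. openin Y V \<and> y \<in> V \<and> continuous_map (subtopology Y V) (Tot P) \<sigma> \<and>
      (\<forall>z\<in>V. proj P (\<sigma> z) = z) \<and> continuous_map (subtopology Y V) (Tot P') (\<lambda>z. \<mu> (\<sigma> z))"
  shows "continuous_map (Tot P) (Tot P') \<mu>"
proof (rule continuous_map_if_locally)
  interpret P: torsor G Y P by fact
  interpret P': torsor Q Y P' by fact
  fix p assume p: "p \<in> topspace (Tot P)"
  obtain V \<sigma> where V: "openin Y V" "proj P p \<in> V" "continuous_map (subtopology Y V) (Tot P) \<sigma>"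
    "\<forall>z\<in>V. proj P (\<sigma> z) = z" "continuous_map (subtopology Y V) (Tot P') (\<lambda>z. \<mu> (\<sigma> z))"
    using sec[OF P.proj_in[OF p]] by (elim exE conjE)
  have \<sigma>in: "\<sigma> z \<in> total_space P" if "z \<in> V" for z
    using V(3) that openin_subset[OF V(1)] by (auto simp: continuous_map_def Pi_iff)
  define U where "U = {p \<in> topspace (Tot P). proj P p \<in> V}"
  have U: "openin (Tot P) U" unfolding U_def by (rule openin_preimage[OF P.proj_cont V(1)])
  have pc: "continuous_map (subtopology (Tot P) U) (subtopology Y V) (proj P)"
    by (intro continuous_map_into_subtopology continuous_map_from_subtopology P.proj_cont) (auto simp: U_def)
  have idc: "continuous_map (subtopology (Tot P) U) (Tot P) (\<lambda>p. p)" by (simp add: continuous_map_from_subtopology)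
  have s: "\<sigma> (proj P q) \<in> total_space P" "q \<in> total_space P" "proj P (\<sigma> (proj P q)) = proj P q" if "q \<in> U" for q
    using that V(4) \<sigma>in by (auto simp: U_def)
  have dc: "continuous_map (subtopology (Tot P) U) (Arr G) (\<lambda>q. pdiv G P (\<sigma> (proj P q)) q)"
    by (rule P.cont_pdiv[OF continuous_map_comp[OF pc V(3)] idc]) (use s in auto)
  have "continuous_map (subtopology (Tot P) U) (Tot P') (\<lambda>q. ract P' (\<mu> (\<sigma> (proj P q))) (E (pdiv G P (\<sigma> (proj P q)) q)))"
  proof (rule P'.cont_act[OF continuous_map_comp[OF pc V(5)] continuous_map_comp[OF dc E(1)]])
    fix q assume "q \<in> topspace (subtopology (Tot P) U)"
    then have q: "q \<in> U" by simp
    show "eps P' (\<mu> (\<sigma> (proj P q))) = tgt Q (E (pdiv G P (\<sigma> (proj P q)) q))"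
      using P.pdiv[OF s[OF q]] \<mu>[OF s(1)[OF q]] by (simp add: E(2))
  qed
  then have "continuous_map (subtopology (Tot P) U) (Tot P') \<mu>"
  proof (rule continuous_map_eq)
    fix q assume "q \<in> topspace (subtopology (Tot P) U)"
    then have q: "q \<in> U" by simp
    note d = P.pdiv[OF s[OF q]]
    show "ract P' (\<mu> (\<sigma> (proj P q))) (E (pdiv G P (\<sigma> (proj P q)) q)) = \<mu> q"
      using eqv[OF s(1)[OF q] d(1) d(2)[symmetric]] d(3) by simp
  qed
  then show "\<exists>U. openin (Tot P) U \<and> p \<in> U \<and> continuous_map (subtopology (Tot P) U) (Tot P') \<mu>"
    using U p V(2) by (intro exI[of _ U]) (auto simp: U_def)
qed

text \<open>On each fibre \<open>f\<close> is an equivariant map between simply transitive orbits, hence bijective. Its inverse is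
  again equivariant and is continuous along the sections \<open>f \<circ> \<sigma>\<close>.\<close>

lemma torsor_iso:
  fixes f :: "'p \<Rightarrow> 'q"
  assumes P: "torsor G Y P" and P': "torsor G Y P'"
    and f: "\<And>p. p \<in> total_space P \<Longrightarrow> f p \<in> total_space P' \<and> proj P' (f p) = proj P p \<and> eps P' (f p) = eps P p"
    and eqv: "\<And>p g. p \<in> total_space P \<Longrightarrow> g \<in> arrows G \<Longrightarrow> eps P p = tgt G g \<Longrightarrow> f (ract P p g) = ract P' (f p) g"
    and sec: "\<And>y. y \<in> topspace Y \<Longrightarrow> \<exists>V \<sigma>. openin Y V \<and> y \<in> V \<and> continuous_map (subtopology Y V) (Tot P) \<sigma> \<and>
      (\<forall>z\<in>V. proj P (\<sigma> z) = z) \<and> continuous_map (subtopology Y V) (Tot P') (\<lambda>z. f (\<sigma> z))"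
  shows "bundle_iso G (unit_groupoid Y) P P' f"
proof -
  interpret P: torsor G Y P by fact
  interpret P': torsor G Y P' by fact
  have inj: "inj_on f (total_space P)"
  proof (rule inj_onI)
    fix p p' assume p: "p \<in> total_space P" "p' \<in> total_space P" "f p = f p'"
    have pr: "proj P p = proj P p'" using f[OF p(1)] f[OF p(2)] p(3) by simp
    note d = P.pdiv[OF p(1,2) pr]
    have "ract P' (f p) (pdiv G P p p') = f p'" using eqv[OF p(1) d(1)] d(2,3) by simp
    moreover have "ract P' (f p) (gunit G (eps P' (f p))) = f p" using P'.act_unit f[OF p(1)] by blast
    ultimately have "pdiv G P p p' = gunit G (eps P' (f p))"
      using f[OF p(1)] d p by (intro P'.act_free[of "f p"]) (auto simp: P.closed P.st P.eps_in)
    then have "ract P p (gunit G (eps P p)) = p'" using d(3) f[OF p(1)] by simp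
    then show "p = p'" using P.act_unit[OF p(1)] by simp
  qed
  define k where "k = inv_into (total_space P) f"
  have kf: "k (f p) = p" if "p \<in> total_space P" for p using that inj by (simp add: k_def)
  have fk: "k p' \<in> total_space P \<and> f (k p') = p'" if p': "p' \<in> total_space P'" for p'
  proof -
    obtain V \<sigma> where V: "proj P' p' \<in> V" "\<forall>z\<in>V. \<sigma> z \<in> total_space P \<and> proj P (\<sigma> z) = z"
      using P.local_section_in[OF P'.proj_in[OF p']] by (elim exE conjE)
    define s where "s = \<sigma> (proj P' p')"
    have s: "s \<in> total_space P" "proj P s = proj P' p'" using V by (auto simp: s_def)
    have d: "pdiv G P' (f s) p' \<in> arrows G" "tgt G (pdiv G P' (f s) p') = eps P s" "ract P' (f s) (pdiv G P' (f s) p') = p'"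
      using P'.pdiv[of "f s" p'] f[OF s(1)] s p' by auto
    have "ract P s (pdiv G P' (f s) p') \<in> total_space P" "f (ract P s (pdiv G P' (f s) p')) = p'"
      using P.act_in[OF s(1) d(1)] eqv[OF s(1) d(1)] d(2,3) by auto
    then have "p' \<in> f ` total_space P" by (metis imageI)
    then show ?thesis unfolding k_def by (simp add: inv_into_into f_inv_into_f)
  qed
  have k: "proj P (k p') = proj P' p'" "eps P (k p') = eps P' p'" if "p' \<in> total_space P'" for p'
    using f[of "k p'"] fk[OF that] by auto
  have fcont: "continuous_map (Tot P) (Tot P') f"
    by (rule equivariant_continuous[OF P P', where E = "\<lambda>g. g", OF _ _ _ eqv sec]) (simp_all add: f)
  have "continuous_map (Tot P') (Tot P) k"
  proof (rule equivariant_continuous[OF P' P, where E = "\<lambda>g. g"])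
    fix p' g assume p': "p' \<in> total_space P'" and g: "g \<in> arrows G" "eps P' p' = tgt G g"
    have "f (ract P (k p') g) = ract P' p' g" "ract P (k p') g \<in> total_space P"
      using eqv[of "k p'" g] P.act_in[of "k p'" g] fk[OF p'] k[OF p'] g by auto
    then show "k (ract P' p' g) = ract P (k p') g" using kf[of "ract P (k p') g"] by simp
  next
    fix y assume y: "y \<in> topspace Y"
    obtain V \<sigma> where V: "openin Y V" "y \<in> V" "continuous_map (subtopology Y V) (Tot P) \<sigma>"
      "\<forall>z\<in>V. proj P (\<sigma> z) = z" "continuous_map (subtopology Y V) (Tot P') (\<lambda>z. f (\<sigma> z))"
      using sec[OF y] by (elim exE conjE)
    have \<sigma>in: "\<sigma> z \<in> total_space P" if "z \<in> V" for z
      using V(3) that openin_subset[OF V(1)] by (auto simp: continuous_map_def Pi_iff)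
    have "continuous_map (subtopology Y V) (Tot P) (\<lambda>z. k (f (\<sigma> z)))"
      by (rule continuous_map_eq[OF V(3)]) (simp add: kf \<sigma>in)
    then show "\<exists>V \<sigma>. openin Y V \<and> y \<in> V \<and> continuous_map (subtopology Y V) (Tot P') \<sigma> \<and>
        (\<forall>z\<in>V. proj P' (\<sigma> z) = z) \<and> continuous_map (subtopology Y V) (Tot P) (\<lambda>z. k (\<sigma> z))"
      using V f \<sigma>in by (intro exI[of _ V] exI[of _ "\<lambda>z. f (\<sigma> z)"]) simp
  qed (simp_all add: k)
  with fcont have "homeomorphic_maps (Tot P) (Tot P') f k"
    unfolding homeomorphic_maps_def by (simp add: kf fk)
  then have "homeomorphic_map (Tot P) (Tot P') f" by (rule homeomorphic_maps_map[THEN iffD1, THEN conjunct1])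
  then show ?thesis
    unfolding bundle_iso_def using f eqv P.lact_triv P'.lact_triv by force
qed

section \<open>The bundle of a family of local trivializations\<close>

definition trivialization_domain :: "('o, 'a, 'z) groupoid_scheme \<Rightarrow> 'y topology \<Rightarrow> 'y set \<Rightarrow> ('y \<Rightarrow> 'o) \<Rightarrow> ('y \<times> 'a) topology" where
  "trivialization_domain G Y V e = subtopology (prod_topology Y (Arr G)) {(y, g). y \<in> V \<and> tgt G g = e y}"

text \<open>The finest topology for which all maps \<open>(y, g) \<mapsto> (y, r(y) g)\<close> with \<open>(V, r)\<close> in the family are continuous.\<close>

definition glued_open :: "('o, 'a, 'z) groupoid_scheme \<Rightarrow> 'y topology \<Rightarrow> ('y \<Rightarrow> 'o) \<Rightarrow> ('y set \<times> ('y \<Rightarrow> 'a)) set \<Rightarrow> ('y \<times> 'a) set \<Rightarrow> bool" where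
  "glued_open G Y e \<R> S \<longleftrightarrow> S \<subseteq> {(y, g). y \<in> topspace Y \<and> g \<in> arrows G \<and> tgt G g = e y} \<and>
    (\<forall>(V, r)\<in>\<R>. openin (trivialization_domain G Y V (\<lambda>y. src G (r y)))
      {z \<in> topspace (trivialization_domain G Y V (\<lambda>y. src G (r y))). (fst z, gmult G (r (fst z)) (snd z)) \<in> S})"

text \<open>The set of points and the action depend on \<open>e\<close> only; the family of trivializations merely selects a
  topology.\<close>

definition glued_bundle :: "('o, 'a, 'z) groupoid_scheme \<Rightarrow> 'y topology \<Rightarrow> ('y \<Rightarrow> 'o) \<Rightarrow> ('y set \<times> ('y \<Rightarrow> 'a)) set \<Rightarrow>
    ('y \<times> 'a, 'y, 'y, 'o, 'a) bibundle" where
  "glued_bundle G Y e \<R> = \<lparr>Tot = topology (glued_open G Y e \<R>), proj = fst, eps = (\<lambda>z. src G (snd z)),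
    lact = (\<lambda>_ z. z), ract = (\<lambda>z g. (fst z, gmult G (snd z) g))\<rparr>"

lemma glued_bundle_sel [simp]:
  "proj (glued_bundle G Y e \<R>) = fst" "eps (glued_bundle G Y e \<R>) = (\<lambda>z. src G (snd z))"
  "lact (glued_bundle G Y e \<R>) = (\<lambda>_ z. z)" "ract (glued_bundle G Y e \<R>) = (\<lambda>z g. (fst z, gmult G (snd z) g))"
  by (simp_all add: glued_bundle_def)

locale trivializations = top_groupoid G for G :: "('o, 'a, 'z) groupoid_scheme" +
  fixes Y :: "'y topology" and e :: "'y \<Rightarrow> 'o" and \<R> :: "('y set \<times> ('y \<Rightarrow> 'a)) set"
  assumes open_dom: "(V, r) \<in> \<R> \<Longrightarrow> openin Y V"
    and valid: "(V, r) \<in> \<R> \<Longrightarrow> y \<in> V \<Longrightarrow> r y \<in> arrows G \<and> tgt G (r y) = e y"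
    and compat: "(V, r) \<in> \<R> \<Longrightarrow> (V', r') \<in> \<R> \<Longrightarrow>
      continuous_map (subtopology Y (V \<inter> V')) (Arr G) (\<lambda>y. gmult G (ginv G (r y)) (r' y))"
    and cover: "y \<in> topspace Y \<Longrightarrow> \<exists>V r. (V, r) \<in> \<R> \<and> y \<in> V"
begin

abbreviation B where "B \<equiv> glued_bundle G Y e \<R>"
abbreviation D where "D V r \<equiv> trivialization_domain G Y V (\<lambda>y. src G (r y))"
abbreviation \<tau> where "\<tau> r \<equiv> \<lambda>z. (fst z, gmult G (r (fst z)) (snd z))"

lemma openin_glued: "openin (Tot B) S \<longleftrightarrow> glued_open G Y e \<R> S"
proof -
  have "istopology (glued_open G Y e \<R>)"
    unfolding istopology_def
  proof (intro conjI allI impI)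
    fix S T assume S: "glued_open G Y e \<R> S" and T: "glued_open G Y e \<R> T"
    have "openin (D V r) {z \<in> topspace (D V r). \<tau> r z \<in> S \<inter> T}" if "(V, r) \<in> \<R>" for V r
    proof -
      have "openin (D V r) ({z \<in> topspace (D V r). \<tau> r z \<in> S} \<inter> {z \<in> topspace (D V r). \<tau> r z \<in> T})"
        using S T that unfolding glued_open_def by (intro openin_Int) auto
      then show ?thesis by (rule back_subst) auto
    qed
    then show "glued_open G Y e \<R> (S \<inter> T)" using S unfolding glued_open_def by auto
  next
    fix \<K> assume K: "\<forall>S\<in>\<K>. glued_open G Y e \<R> S"
    have "openin (D V r) {z \<in> topspace (D V r). \<tau> r z \<in> \<Union>\<K>}" if "(V, r) \<in> \<R>" for V r
    proof -
      have "openin (D V r) (\<Union>S\<in>\<K>. {z \<in> topspace (D V r). \<tau> r z \<in> S})"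
        using K that unfolding glued_open_def by (intro openin_Union) auto
      then show ?thesis by (rule back_subst) auto
    qed
    then show "glued_open G Y e \<R> (\<Union>\<K>)" using K unfolding glued_open_def by (auto simp: split_beta)
  qed
  then show ?thesis by (simp add: glued_bundle_def topology_inverse')
qed

lemma topspace_D: "topspace (D V r) = {(y, g). y \<in> topspace Y \<and> y \<in> V \<and> g \<in> arrows G \<and> tgt G g = src G (r y)}"
  by (auto simp: trivialization_domain_def)

lemma topspace_glued: "total_space B = {(y, g). y \<in> topspace Y \<and> g \<in> arrows G \<and> tgt G g = e y}" (is "_ = ?S")
proof
  show "total_space B \<subseteq> ?S" using openin_glued[of "total_space B"] by (simp add: glued_open_def)
  have "glued_open G Y e \<R> ?S" unfolding glued_open_def
  proof (intro conjI subset_refl ballI, clarify)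
    fix V r assume Vr: "(V, r) \<in> \<R>"
    have "{z \<in> topspace (D V r). \<tau> r z \<in> ?S} = topspace (D V r)"
      using valid[OF Vr] by (auto simp: topspace_D closed st)
    then show "openin (D V r) {z \<in> topspace (D V r). \<tau> r z \<in> ?S}" by simp
  qed
  then show "?S \<subseteq> total_space B" using openin_glued openin_subset by blast
qed

lemma chart_cont: "(V, r) \<in> \<R> \<Longrightarrow> continuous_map (D V r) (Tot B) (\<tau> r)"
  unfolding continuous_map_def
proof (intro conjI allI impI)
  assume Vr: "(V, r) \<in> \<R>"
  show "\<tau> r \<in> topspace (D V r) \<rightarrow> total_space B"
    using valid[OF Vr] by (auto simp: topspace_D topspace_glued closed st)
  fix S assume "openin (Tot B) S"
  then show "openin (D V r) {z \<in> topspace (D V r). \<tau> r z \<in> S}"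
    using Vr unfolding openin_glued glued_open_def by auto
qed

text \<open>By \<open>compat\<close> for a trivialization and itself, the units at the sources of \<open>r y\<close> vary continuously.\<close>

lemma src_chart_cont:
  assumes "(V, r) \<in> \<R>"
  shows "continuous_map (subtopology Y V) (Obj G) (\<lambda>y. src G (r y))"
proof -
  have "continuous_map (subtopology Y V) (Obj G) (\<lambda>y. src G (gmult G (ginv G (r y)) (r y)))"
    using cont_src[OF compat[OF assms assms]] by simp
  then show ?thesis by (rule continuous_map_eq) (use valid[OF assms] in \<open>auto simp: closed st\<close>)
qed

lemma openin_chart: "(V, r) \<in> \<R> \<Longrightarrow> openin (Tot B) {z \<in> total_space B. fst z \<in> V}"
  unfolding openin_glued glued_open_def
proof (intro conjI ballI, goal_cases)
  case 1
  then show ?case by (auto simp: topspace_glued)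
next
  case (2 c)
  obtain V' r' where c: "c = (V', r')" by (cases c)
  have eq: "{z \<in> topspace (D V' r'). \<tau> r' z \<in> {z \<in> total_space B. fst z \<in> V}} = {z \<in> topspace (D V' r'). fst z \<in> V}"
    using 2 valid[of V' r'] c by (auto simp: topspace_D topspace_glued closed st)
  have "continuous_map (D V' r') Y fst" unfolding trivialization_domain_def by (rule continuous_map_sub_fst)
  from openin_preimage[OF this open_dom[OF 2(1)]]
  show ?case unfolding c by (simp only: prod.case eq)
qed

text \<open>Read in another trivialization \<open>r'\<close>, this map multiplies by the transition function \<open>r\<inverse>r'\<close>. Hence
  trivializations are homeomorphisms onto open sets.\<close>

lemma coord_cont:
  assumes Vr: "(V, r) \<in> \<R>"
  shows "continuous_map (subtopology (Tot B) {z \<in> total_space B. fst z \<in> V}) (D V r) (\<lambda>z. (fst z, gmult G (ginv G (r (fst z))) (snd z)))"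
    (is "continuous_map ?A _ ?k")
  unfolding continuous_map_def
proof (intro conjI allI impI)
  show "?k \<in> topspace ?A \<rightarrow> topspace (D V r)"
    using valid[OF Vr] by (auto simp: topspace_D topspace_glued closed st)
  fix O' assume O': "openin (D V r) O'"
  let ?S = "{z \<in> topspace ?A. ?k z \<in> O'}"
  have "glued_open G Y e \<R> ?S" unfolding glued_open_def
  proof (intro conjI ballI)
    show "?S \<subseteq> {(y, g). y \<in> topspace Y \<and> g \<in> arrows G \<and> tgt G g = e y}" by (auto simp: topspace_glued)
    fix c assume "c \<in> \<R>"
    then obtain V' r' where c: "c = (V', r')" and Vr': "(V', r') \<in> \<R>" by (cases c) auto
    define W where "W = {z \<in> topspace (D V' r'). fst z \<in> V}"
    have fstc: "continuous_map (D V' r') Y fst" and sndc: "continuous_map (D V' r') (Arr G) snd"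
      unfolding trivialization_domain_def by (rule continuous_map_sub_fst, rule continuous_map_sub_snd)
    have W: "openin (D V' r') W" unfolding W_def by (rule openin_preimage[OF fstc open_dom[OF Vr]])
    have f1: "continuous_map (subtopology (D V' r') W) (subtopology Y (V \<inter> V')) fst"
      by (intro continuous_map_into_subtopology continuous_map_from_subtopology fstc) (auto simp: W_def topspace_D)
    have "continuous_map (subtopology (D V' r') W) (Arr G) (\<lambda>z. gmult G (gmult G (ginv G (r (fst z))) (r' (fst z))) (snd z))"
    proof (rule cont_mult)
      show "continuous_map (subtopology (D V' r') W) (Arr G) (\<lambda>z. gmult G (ginv G (r (fst z))) (r' (fst z)))"
        by (rule continuous_map_comp[OF f1 compat[OF Vr Vr']])
      show "continuous_map (subtopology (D V' r') W) (Arr G) snd" by (rule continuous_map_from_subtopology[OF sndc])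
      show "src G (gmult G (ginv G (r (fst z))) (r' (fst z))) = tgt G (snd z)" if "z \<in> topspace (subtopology (D V' r') W)" for z
        using that valid[OF Vr, of "fst z"] valid[OF Vr', of "fst z"] by (auto simp: W_def topspace_D closed st)
    qed
    then have "continuous_map (subtopology (D V' r') W) (prod_topology Y (Arr G))
        (\<lambda>z. (fst z, gmult G (gmult G (ginv G (r (fst z))) (r' (fst z))) (snd z)))" (is "continuous_map _ _ ?l")
      by (intro continuous_map_pairedI continuous_map_from_subtopology[OF fstc])
    then have "continuous_map (subtopology (D V' r') W) (D V r) ?l"
      unfolding trivialization_domain_def[of G Y V]
    proof (rule continuous_map_into_subtopology, intro funcsetI)
      fix z assume "z \<in> topspace (subtopology (D V' r') W)"
      then show "?l z \<in> {(y, g). y \<in> V \<and> tgt G g = src G (r y)}"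
        using valid[OF Vr, of "fst z"] valid[OF Vr', of "fst z"] by (auto simp: W_def topspace_D closed st)
    qed
    from openin_preimage[OF this O']
    have "openin (subtopology (D V' r') W) {z \<in> topspace (subtopology (D V' r') W). ?l z \<in> O'}" .
    then have "openin (D V' r') {z \<in> topspace (subtopology (D V' r') W). ?l z \<in> O'}"
      using W openin_trans_full by blast
    moreover have "?k (\<tau> r' z) = ?l z" if "z \<in> W" for z
      using that valid[OF Vr, of "fst z"] valid[OF Vr', of "fst z"] by (auto simp: W_def topspace_D closed st assoc)
    then have "{z \<in> topspace (subtopology (D V' r') W). ?l z \<in> O'} = {z \<in> topspace (D V' r'). \<tau> r' z \<in> ?S}"
      using valid[OF Vr'] by (auto simp: W_def topspace_D topspace_glued closed st)
    ultimately show "case c of (V, r) \<Rightarrow> openin (D V r) {z \<in> topspace (D V r). \<tau> r z \<in> ?S}" by (simp add: c)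
  qed
  then have "openin (Tot B) ?S" by (simp add: openin_glued)
  then show "openin ?A ?S" unfolding openin_subtopology by (intro exI[of _ ?S]) auto
qed

lemma glued_fst_cont: "continuous_map (Tot B) Y fst"
proof (rule continuous_map_if_locally)
  fix z assume z: "z \<in> topspace (Tot B)"
  then obtain V r where Vr: "(V, r) \<in> \<R>" "fst z \<in> V" using cover[of "fst z"] by (auto simp: topspace_glued)
  have "continuous_map (D V r) Y fst" unfolding trivialization_domain_def by (rule continuous_map_sub_fst)
  from continuous_map_comp[OF coord_cont[OF Vr(1)] this]
  show "\<exists>U. openin (Tot B) U \<and> z \<in> U \<and> continuous_map (subtopology (Tot B) U) Y fst"
    using openin_chart[OF Vr(1)] z Vr(2) by (intro exI[of _ "{z \<in> total_space B. fst z \<in> V}"]) simp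
qed

lemma coord2_cont:
  assumes Vr: "(V, r) \<in> \<R>"
  shows "continuous_map (subtopology (Tot B) {z \<in> total_space B. fst z \<in> V}) (Arr G) (\<lambda>z. gmult G (ginv G (r (fst z))) (snd z))"
proof -
  have "continuous_map (D V r) (Arr G) snd" unfolding trivialization_domain_def by (rule continuous_map_sub_snd)
  from continuous_map_comp[OF coord_cont[OF Vr] this] show ?thesis by simp
qed

lemma cont_into_glued:
  assumes Vr: "(V, r) \<in> \<R>" and f: "continuous_map Z (subtopology Y V) f" and g: "continuous_map Z (Arr G) g"
    and eq: "\<And>z. z \<in> topspace Z \<Longrightarrow> src G (r (f z)) = tgt G (g z)"
  shows "continuous_map Z (Tot B) (\<lambda>z. (f z, gmult G (r (f z)) (g z)))"
proof -
  have "continuous_map Z (prod_topology Y (Arr G)) (\<lambda>z. (f z, g z))"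
    using f g by (intro continuous_map_pairedI) (auto simp: continuous_map_in_subtopology)
  then have "continuous_map Z (D V r) (\<lambda>z. (f z, g z))" unfolding trivialization_domain_def
    by (rule continuous_map_into_subtopology) (use f eq in \<open>auto simp: continuous_map_in_subtopology\<close>)
  from continuous_map_comp[OF this chart_cont[OF Vr]] show ?thesis by simp
qed

lemma glued_chart_section:
  assumes Vr: "(V, r) \<in> \<R>"
  shows "continuous_map (subtopology Y V) (Tot B) (\<lambda>y. (y, r y))"
proof -
  have "continuous_map (subtopology Y V) (Tot B) (\<lambda>y. (y, gmult G (r y) (gunit G (src G (r y)))))"
  proof (rule cont_into_glued[OF Vr])
    show "continuous_map (subtopology Y V) (subtopology Y V) (\<lambda>y. y)" by simp
    show "continuous_map (subtopology Y V) (Arr G) (\<lambda>y. gunit G (src G (r y)))"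
      by (rule cont_unit[OF src_chart_cont[OF Vr]])
    show "src G (r y) = tgt G (gunit G (src G (r y)))" if "y \<in> topspace (subtopology Y V)" for y
      using that valid[OF Vr] by (simp add: closed st)
  qed
  then show ?thesis by (rule continuous_map_eq) (use valid[OF Vr] in \<open>auto simp: unit_r\<close>)
qed

text \<open>In a trivialization the common factor \<open>r\<close> of both points cancels.\<close>

lemma glued_division_cont:
  assumes f: "continuous_map Z (Tot B) f" and g: "continuous_map Z (Tot B) g"
    and eq: "\<And>z. z \<in> topspace Z \<Longrightarrow> fst (f z) = fst (g z)"
  shows "continuous_map Z (Arr G) (\<lambda>z. gmult G (ginv G (snd (f z))) (snd (g z)))"
proof (rule continuous_map_if_locally)
  fix z assume z: "z \<in> topspace Z"
  have fB: "f w \<in> total_space B" and gB: "g w \<in> total_space B" if "w \<in> topspace Z" for w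
    using f g that by (auto simp: continuous_map_def)
  obtain V r where Vr: "(V, r) \<in> \<R>" "fst (f z) \<in> V" using cover[of "fst (f z)"] fB[OF z] by (auto simp: topspace_glued)
  define U where "U = {w \<in> topspace Z. fst (f w) \<in> V}"
  let ?A = "subtopology (Tot B) {z \<in> total_space B. fst z \<in> V}"
  have U: "openin Z U" unfolding U_def
    by (rule openin_preimage[OF continuous_map_comp[OF f glued_fst_cont] open_dom[OF Vr(1)]])
  have fA: "continuous_map (subtopology Z U) ?A f" and gA: "continuous_map (subtopology Z U) ?A g"
    by (intro continuous_map_into_subtopology continuous_map_from_subtopology f g; use fB gB eq in \<open>auto simp: U_def\<close>)+
  have m: "r (fst (f w)) \<in> arrows G \<and> tgt G (r (fst (f w))) = e (fst (f w)) \<and> snd (f w) \<in> arrows G \<and> snd (g w) \<in> arrows G \<and>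
     tgt G (snd (f w)) = e (fst (f w)) \<and> tgt G (snd (g w)) = e (fst (f w))" if "w \<in> U" for w
    using that fB[of w] gB[of w] valid[OF Vr(1), of "fst (f w)"] eq[of w] by (auto simp: U_def topspace_glued)
  have "continuous_map (subtopology Z U) (Arr G)
      (\<lambda>w. gmult G (ginv G (gmult G (ginv G (r (fst (f w)))) (snd (f w)))) (gmult G (ginv G (r (fst (g w)))) (snd (g w))))"
    by (rule cont_div[OF continuous_map_comp[OF fA coord2_cont[OF Vr(1)]] continuous_map_comp[OF gA coord2_cont[OF Vr(1)]]])
      (use m eq in \<open>auto simp: U_def closed st\<close>)
  moreover have "gmult G (ginv G (gmult G (ginv G (r (fst (f w)))) (snd (f w)))) (gmult G (ginv G (r (fst (g w)))) (snd (g w))) =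
      gmult G (ginv G (snd (f w))) (snd (g w))" if "w \<in> U" for w
    using m[OF that] eq[of w] that
      div_inv[of "r (fst (f w))" "snd (f w)"] div_trans[of "snd (f w)" "r (fst (f w))" "snd (g w)"] by (simp add: U_def)
  ultimately have "continuous_map (subtopology Z U) (Arr G) (\<lambda>z. gmult G (ginv G (snd (f z))) (snd (g z)))"
    by (rule continuous_map_eq) auto
  then show "\<exists>U. openin Z U \<and> z \<in> U \<and> continuous_map (subtopology Z U) (Arr G) (\<lambda>z. gmult G (ginv G (snd (f z))) (snd (g z)))"
    using U z Vr(2) by (intro exI[of _ U]) (auto simp: U_def)
qed

lemma glued_action_cont:
  assumes f: "continuous_map Z (Tot B) f" and g: "continuous_map Z (Arr G) g"
    and eq: "\<And>z. z \<in> topspace Z \<Longrightarrow> src G (snd (f z)) = tgt G (g z)"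
  shows "continuous_map Z (Tot B) (\<lambda>z. (fst (f z), gmult G (snd (f z)) (g z)))"
proof (rule continuous_map_if_locally)
  fix z assume z: "z \<in> topspace Z"
  have fB: "f w \<in> total_space B" and gA: "g w \<in> arrows G" if "w \<in> topspace Z" for w
    using f g that by (auto simp: continuous_map_def)
  obtain V r where Vr: "(V, r) \<in> \<R>" "fst (f z) \<in> V" using cover[of "fst (f z)"] fB[OF z] by (auto simp: topspace_glued)
  define U where "U = {w \<in> topspace Z. fst (f w) \<in> V}"
  let ?A = "subtopology (Tot B) {z \<in> total_space B. fst z \<in> V}"
  have U: "openin Z U" unfolding U_def
    by (rule openin_preimage[OF continuous_map_comp[OF f glued_fst_cont] open_dom[OF Vr(1)]])
  have fA: "continuous_map (subtopology Z U) ?A f"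
    by (intro continuous_map_into_subtopology continuous_map_from_subtopology f; use fB in \<open>auto simp: U_def\<close>)
  have f1: "continuous_map (subtopology Z U) (subtopology Y V) (\<lambda>w. fst (f w))"
    by (intro continuous_map_into_subtopology continuous_map_from_subtopology continuous_map_comp[OF f glued_fst_cont]) (auto simp: U_def)
  have m: "r (fst (f w)) \<in> arrows G \<and> tgt G (r (fst (f w))) = e (fst (f w)) \<and> snd (f w) \<in> arrows G \<and> g w \<in> arrows G \<and>
     tgt G (snd (f w)) = e (fst (f w)) \<and> src G (snd (f w)) = tgt G (g w)" if "w \<in> U" for w
    using that fB[of w] gA[of w] valid[OF Vr(1), of "fst (f w)"] eq[of w] by (auto simp: U_def topspace_glued)
  have k: "continuous_map (subtopology Z U) (Arr G) (\<lambda>w. gmult G (gmult G (ginv G (r (fst (f w)))) (snd (f w))) (g w))"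
    by (rule cont_mult[OF continuous_map_comp[OF fA coord2_cont[OF Vr(1)]] continuous_map_from_subtopology[OF g]])
      (use m in \<open>auto simp: closed st\<close>)
  have "continuous_map (subtopology Z U) (Tot B)
      (\<lambda>w. (fst (f w), gmult G (r (fst (f w))) (gmult G (gmult G (ginv G (r (fst (f w)))) (snd (f w))) (g w))))"
    by (rule cont_into_glued[OF Vr(1) f1 k]) (use m in \<open>auto simp: closed st\<close>)
  then have "continuous_map (subtopology Z U) (Tot B) (\<lambda>z. (fst (f z), gmult G (snd (f z)) (g z)))"
    by (rule continuous_map_eq) (use m in \<open>auto simp: closed st assoc mult_inv_cancel\<close>)
  then show "\<exists>U. openin Z U \<and> z \<in> U \<and> continuous_map (subtopology Z U) (Tot B) (\<lambda>z. (fst (f z), gmult G (snd (f z)) (g z)))"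
    using U z Vr(2) by (intro exI[of _ U]) (auto simp: U_def)
qed

lemma glued_torsor: "torsor G Y B"
proof -
  have "principal_bundle G (unit_groupoid Y) B"
  proof (rule principal_bundle_unitI[OF G, where d = "\<lambda>p q. gmult G (ginv G (snd p)) (snd q)"])
    have idc: "continuous_map (Tot B) (Tot B) (\<lambda>z. z)" by simp
    have "continuous_map (Tot B) (Obj G) (\<lambda>z. src G (snd z))"
    proof (rule continuous_map_if_locally)
      fix z assume z: "z \<in> topspace (Tot B)"
      then obtain V r where Vr: "(V, r) \<in> \<R>" "fst z \<in> V" using cover[of "fst z"] by (auto simp: topspace_glued)
      have "continuous_map (subtopology (Tot B) {z \<in> total_space B. fst z \<in> V}) (Obj G) (\<lambda>z. src G (snd z))"
        by (rule continuous_map_eq[OF cont_src[OF coord2_cont[OF Vr(1)]]])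
          (use valid[OF Vr(1)] in \<open>auto simp: topspace_glued closed st\<close>)
      then show "\<exists>U. openin (Tot B) U \<and> z \<in> U \<and> continuous_map (subtopology (Tot B) U) (Obj G) (\<lambda>z. src G (snd z))"
        using openin_chart[OF Vr(1)] z Vr(2) by (intro exI[of _ "{z \<in> total_space B. fst z \<in> V}"]) simp
    qed
    moreover have "continuous_map (subtopology (prod_topology (Tot B) (Arr G)) {(z, g). src G (snd z) = tgt G g}) (Tot B)
        (\<lambda>w. (fst (fst w), gmult G (snd (fst w)) (snd w)))"
      by (rule glued_action_cont[OF continuous_map_sub_fst continuous_map_sub_snd]) auto
    ultimately show "right_action G (Tot B) (eps B) (ract B)"
      unfolding right_action_def by (auto simp: topspace_glued case_prod_unfold closed st unit_r assoc)
    show "continuous_map (Tot B) Y (proj B)" using glued_fst_cont by simp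
    show "\<exists>U \<sigma>. openin Y U \<and> y \<in> U \<and> continuous_map (subtopology Y U) (Tot B) \<sigma> \<and> (\<forall>z\<in>U. proj B (\<sigma> z) = z)"
      if y: "y \<in> topspace Y" for y
    proof -
      obtain V r where Vr: "(V, r) \<in> \<R>" "y \<in> V" using cover[OF y] by blast
      then show ?thesis using open_dom[OF Vr(1)] glued_chart_section[OF Vr(1)]
        by (intro exI[of _ V] exI[of _ "\<lambda>y. (y, r y)"]) simp
    qed
    have "continuous_map (subtopology (prod_topology (Tot B) (Tot B)) {(p, p'). fst p = fst p'}) (Arr G)
        (\<lambda>w. gmult G (ginv G (snd (fst w))) (snd (snd w)))"
      by (rule glued_division_cont[OF continuous_map_sub_fst continuous_map_sub_snd]) auto
    then show "continuous_map (subtopology (prod_topology (Tot B) (Tot B)) {(p, p'). proj B p = proj B p'}) (Arr G)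
        (\<lambda>(p, q). gmult G (ginv G (snd p)) (snd q))"
      by (simp add: case_prod_unfold)
  qed (auto simp: topspace_glued closed st mult_inv_cancel inv_mult_cancel)
  then show ?thesis by unfold_locales
qed

end

section \<open>Lifting paths and homotopies of arrows\<close>

lemma openin_prod_box:
  "openin (prod_topology X Y) S \<Longrightarrow> (x, y) \<in> S \<Longrightarrow>
    \<exists>U V. openin X U \<and> openin Y V \<and> x \<in> U \<and> y \<in> V \<and> U \<times> V \<subseteq> S"
  by (simp add: openin_prod_topology_alt)

lemma openin_interval_ball:
  fixes J :: "real set"
  assumes "openin (top_of_set S) J" "t \<in> J"
  shows "\<exists>d>0. S \<inter> ball t d \<subseteq> J"
  using assms by (auto simp: openin_contains_ball Int_commute)

text \<open>Evenly covered neighbourhoods are expressed by sections: through each arrow over \<open>V\<close> there is a section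
  of \<open>E\<close> that is defined on all of \<open>V\<close>. That sections through different arrows are disjoint is replaced by
  local injectivity and the Hausdorff property, which make lifts of paths unique.\<close>

locale covering_functor =
  fixes G :: "('o, 'a, 'z) groupoid_scheme" and Q :: "('o, 'b, 'w) groupoid_scheme" and E :: "'a \<Rightarrow> 'b"
  assumes G_top: "topological_groupoid G" and Q_top: "topological_groupoid Q" and Obj_Q: "Obj Q = Obj G"
    and E_src: "g \<in> arrows G \<Longrightarrow> src Q (E g) = src G g" and E_tgt: "g \<in> arrows G \<Longrightarrow> tgt Q (E g) = tgt G g"
    and E_mult: "g \<in> arrows G \<Longrightarrow> h \<in> arrows G \<Longrightarrow> src G g = tgt G h \<Longrightarrow> E (gmult G g h) = gmult Q (E g) (E h)"
    and E_unit: "x \<in> objects G \<Longrightarrow> E (gunit G x) = gunit Q x"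
    and E_cont: "continuous_map (Arr G) (Arr Q) E" and E_onto: "E ` arrows G = arrows Q"
    and arr_Hausdorff: "Hausdorff_space (Arr G)"
    and E_locally_injective: "g \<in> arrows G \<Longrightarrow> \<exists>U. openin (Arr G) U \<and> g \<in> U \<and> inj_on E U"
    and E_sheets: "b \<in> arrows Q \<Longrightarrow> \<exists>V. openin (Arr Q) V \<and> b \<in> V \<and> (\<forall>g\<in>arrows G. E g \<in> V \<longrightarrow>
      (\<exists>s. continuous_map (subtopology (Arr Q) V) (Arr G) s \<and> (\<forall>v\<in>V. E (s v) = v) \<and> s (E g) = g))"

sublocale covering_functor \<subseteq> G: top_groupoid G by unfold_locales (rule G_top)
sublocale covering_functor \<subseteq> Q: top_groupoid Q by unfold_locales (rule Q_top)

context covering_functor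
begin

lemma E_in: "g \<in> arrows G \<Longrightarrow> E g \<in> arrows Q" using E_onto by blast

lemma E_inv: "g \<in> arrows G \<Longrightarrow> E (ginv G g) = ginv Q (E g)"
  using E_mult[of g "ginv G g"]
  by (intro Q.inv_unique) (auto simp: E_in E_src E_tgt G.closed G.st G.inv_r E_unit)

lemma E_div:
  "g \<in> arrows G \<Longrightarrow> h \<in> arrows G \<Longrightarrow> tgt G g = tgt G h \<Longrightarrow> E (gmult G (ginv G g) h) = gmult Q (ginv Q (E g)) (E h)"
  by (simp add: E_mult E_inv G.closed G.st)

text \<open>The set of times at which the lifts agree is open since \<open>E\<close> is locally injective, and closed since the
  space of arrows is Hausdorff.\<close>

lemma lift_unique:
  fixes S :: "real set"
  assumes S: "connected S" and f: "continuous_map (top_of_set S) (Arr G) f" and g: "continuous_map (top_of_set S) (Arr G) g"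
    and E: "\<And>t. t \<in> S \<Longrightarrow> E (f t) = E (g t)" and a: "a \<in> S" "f a = g a" and b: "b \<in> S"
  shows "f b = g b"
proof (rule connected_induction_simple[where P = "\<lambda>t. f t = g t", OF S a(1) b a(2)])
  fix t assume t: "t \<in> S"
  have ft: "f t \<in> arrows G" and gt: "g t \<in> arrows G" using f g t by (auto simp: continuous_map_def)
  have op: "openin (top_of_set S) ({t \<in> topspace (top_of_set S). f t \<in> U} \<inter> {t \<in> topspace (top_of_set S). g t \<in> V})"
    if "openin (Arr G) U" "openin (Arr G) V" for U V
    by (intro openin_Int openin_preimage[OF f] openin_preimage[OF g] that)
  show "\<exists>T. openin (top_of_set S) T \<and> t \<in> T \<and> (\<forall>x\<in>T. \<forall>y\<in>T. f x = g x \<longrightarrow> f y = g y)"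
  proof (cases "f t = g t")
    case True
    obtain U where U: "openin (Arr G) U" "f t \<in> U" "inj_on E U" using E_locally_injective[OF ft] by blast
    define T where "T = {t \<in> topspace (top_of_set S). f t \<in> U} \<inter> {t \<in> topspace (top_of_set S). g t \<in> U}"
    have "f y = g y" if "y \<in> T" for y
      by (rule inj_onD[OF U(3) E]) (use that in \<open>auto simp: T_def\<close>)
    moreover have "t \<in> T" using U(2) True t by (simp add: T_def)
    ultimately show ?thesis using op[OF U(1) U(1)] unfolding T_def[symmetric] by blast
  next
    case False
    have "\<exists>U V. openin (Arr G) U \<and> openin (Arr G) V \<and> f t \<in> U \<and> g t \<in> V \<and> disjnt U V"
      using arr_Hausdorff ft gt False by (simp add: Hausdorff_space_def)
    then obtain U V where U: "openin (Arr G) U" "openin (Arr G) V" "f t \<in> U" "g t \<in> V" "disjnt U V"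
      by (elim exE conjE)
    define T where "T = {t \<in> topspace (top_of_set S). f t \<in> U} \<inter> {t \<in> topspace (top_of_set S). g t \<in> V}"
    have "f y \<noteq> g y" if "y \<in> T" for y using that U(5) by (auto simp: T_def disjnt_iff)
    moreover have "t \<in> T" using U t by (simp add: T_def)
    ultimately show ?thesis using op[OF U(1) U(2)] unfolding T_def[symmetric] by blast
  qed
qed

text \<open>A lift that exists up to some time extends through any interval around this time that is mapped into one
  evenly covered set, by composing the path with the section through the endpoint of the lift.\<close>

lemma lift_path:
  fixes a b :: real
  assumes ab: "a \<le> b" and \<gamma>: "continuous_map (top_of_set {a..b}) (Arr Q) \<gamma>" and g: "g \<in> arrows G" "E g = \<gamma> a"
  shows "\<exists>\<phi>. continuous_map (top_of_set {a..b}) (Arr G) \<phi> \<and> \<phi> a = g \<and> (\<forall>t\<in>{a..b}. E (\<phi> t) = \<gamma> t)"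
proof -
  define L where "L t \<phi> \<longleftrightarrow> continuous_map (top_of_set {a..t}) (Arr G) \<phi> \<and> \<phi> a = g \<and> (\<forall>s\<in>{a..t}. E (\<phi> s) = \<gamma> s)" for t \<phi>
  have "\<exists>\<phi>. L b \<phi>"
  proof (rule connected_induction_simple[of "{a..b}" a b])
    show "\<exists>\<phi>. L a \<phi>" unfolding L_def using g by (intro exI[of _ "\<lambda>_. g"]) auto
  next
    fix t assume t: "t \<in> {a..b}"
    then have "\<gamma> t \<in> arrows Q" using \<gamma> by (auto simp: continuous_map_def)
    from E_sheets[OF this] obtain V where V: "openin (Arr Q) V" "\<gamma> t \<in> V"
      and sheets: "\<forall>g\<in>arrows G. E g \<in> V \<longrightarrow>
      (\<exists>s. continuous_map (subtopology (Arr Q) V) (Arr G) s \<and> (\<forall>v\<in>V. E (s v) = v) \<and> s (E g) = g)"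
      by (elim exE conjE)
    have "openin (top_of_set {a..b}) {t \<in> topspace (top_of_set {a..b}). \<gamma> t \<in> V}" by (rule openin_preimage[OF \<gamma> V(1)])
    moreover have "t \<in> {t \<in> topspace (top_of_set {a..b}). \<gamma> t \<in> V}" using t V(2) by simp
    ultimately obtain d where d: "d > 0" "{a..b} \<inter> ball t d \<subseteq> {t \<in> topspace (top_of_set {a..b}). \<gamma> t \<in> V}"
      using openin_interval_ball by blast
    have "\<exists>\<phi>. L y \<phi>" if x: "x \<in> {a..b} \<inter> ball t d" and y: "y \<in> {a..b} \<inter> ball t d" and "L x \<phi>" for x y \<phi>
    proof (cases "y \<le> x")
      case True
      then have "L y \<phi>" using \<open>L x \<phi>\<close> unfolding L_def
        by (auto intro: continuous_map_from_subtopology_mono)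
      then show ?thesis by blast
    next
      case False
      have \<phi>: "continuous_map (top_of_set {a..x}) (Arr G) \<phi>" "\<phi> a = g" "\<And>s. s\<in>{a..x} \<Longrightarrow> E (\<phi> s) = \<gamma> s"
        using \<open>L x \<phi>\<close> by (auto simp: L_def)
      have inV: "\<gamma> s \<in> V" if "x \<le> s" "s \<le> y" for s
      proof -
        have "s \<in> {a..b} \<inter> ball t d" using that x y by (auto simp: dist_real_def)
        then show ?thesis using d(2) by blast
      qed
      have "\<phi> x \<in> arrows G" using \<phi>(1) x by (auto simp: continuous_map_def)
      moreover have "E (\<phi> x) = \<gamma> x" using \<phi>(3) x by auto
      ultimately obtain s where s: "continuous_map (subtopology (Arr Q) V) (Arr G) s" "\<forall>v\<in>V. E (s v) = v" "s (\<gamma> x) = \<phi> x"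
        using sheets[rule_format, of "\<phi> x"] inV[of x] False by auto
      have "continuous_map (top_of_set {a..y}) (Arr G) (\<lambda>u. if u \<le> x then \<phi> u else s (\<gamma> u))"
      proof (rule continuous_map_cases_le)
        show "continuous_map (top_of_set {a..y}) euclideanreal (\<lambda>u. u)" "continuous_map (top_of_set {a..y}) euclideanreal (\<lambda>u. x)"
          by (auto simp: continuous_map_from_subtopology)
        have "subtopology (top_of_set {a..y}) {u \<in> topspace (top_of_set {a..y}). u \<le> x} = top_of_set {a..x}"
          unfolding subtopology_subtopology using False by (intro arg_cong[of _ _ top_of_set]) auto
        then show "continuous_map (subtopology (top_of_set {a..y}) {u \<in> topspace (top_of_set {a..y}). u \<le> x}) (Arr G) \<phi>"
          using \<phi>(1) by simp
        have eq: "subtopology (top_of_set {a..y}) {u \<in> topspace (top_of_set {a..y}). x \<le> u} = top_of_set {x..y}"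
          unfolding subtopology_subtopology using x by (intro arg_cong[of _ _ top_of_set]) auto
        have "continuous_map (top_of_set {x..y}) (Arr Q) \<gamma>"
          using \<gamma> by (rule continuous_map_from_subtopology_mono) (use x y in auto)
        then have "continuous_map (top_of_set {x..y}) (subtopology (Arr Q) V) \<gamma>"
          by (rule continuous_map_into_subtopology) (use inV in auto)
        from continuous_map_comp[OF this s(1)]
        show "continuous_map (subtopology (top_of_set {a..y}) {u \<in> topspace (top_of_set {a..y}). x \<le> u}) (Arr G) (\<lambda>u. s (\<gamma> u))"
          unfolding eq .
        show "\<phi> u = s (\<gamma> u)" if "u = x" for u using s(3) that by simp
      qed
      then have "L y (\<lambda>u. if u \<le> x then \<phi> u else s (\<gamma> u))"
        unfolding L_def using \<phi>(2,3) x s(2) inV by auto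
      then show ?thesis by blast
    qed
    then show "\<exists>T. openin (top_of_set {a..b}) T \<and> t \<in> T \<and> (\<forall>x\<in>T. \<forall>y\<in>T. (\<exists>\<phi>. L x \<phi>) \<longrightarrow> (\<exists>\<phi>. L y \<phi>))"
      using t d(1) by (intro exI[of _ "{a..b} \<inter> ball t d"]) (auto simp: openin_open_Int)
  qed (use ab in auto)
  then show ?thesis unfolding L_def .
qed

text \<open>Near \<open>(w0, t)\<close> the map \<open>H\<close> takes values in an evenly covered set. If at a single time \<open>t1\<close> close to \<open>t\<close> the
  lifts are continuous in \<open>w\<close> near \<open>w0\<close>, then for \<open>w\<close> near \<open>w0\<close> they agree at \<open>t1\<close> with \<open>s \<circ> H\<close> for one section \<open>s\<close>,
  by local injectivity, and then at all times close to \<open>t\<close>, by uniqueness. So continuity near \<open>w0\<close>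
  propagates along the connected interval, from the initial time on.\<close>

lemma lift_family_cont:
  fixes W :: "'v topology" and a b :: real
  assumes ab: "a \<le> b" and H: "continuous_map (prod_topology W (top_of_set {a..b})) (Arr Q) H"
    and path: "\<And>w. w \<in> topspace W \<Longrightarrow> continuous_map (top_of_set {a..b}) (Arr G) (\<lambda>t. \<phi> (w, t))"
    and lifts: "\<And>w t. w \<in> topspace W \<Longrightarrow> t \<in> {a..b} \<Longrightarrow> E (\<phi> (w, t)) = H (w, t)"
    and start: "continuous_map W (Arr G) (\<lambda>w. \<phi> (w, a))"
  shows "continuous_map (prod_topology W (top_of_set {a..b})) (Arr G) \<phi>"
proof (rule continuous_map_if_locally)
  let ?I = "top_of_set {a..b}"
  fix y assume y: "y \<in> topspace (prod_topology W ?I)"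
  obtain w0 t0 where y0: "y = (w0, t0)" "w0 \<in> topspace W" "t0 \<in> {a..b}" using y by auto
  define P where "P t \<longleftrightarrow> (\<exists>N. openin W N \<and> w0 \<in> N \<and> continuous_map (subtopology W N) (Arr G) (\<lambda>w. \<phi> (w, t)))" for t
  have local: "\<exists>J. openin ?I J \<and> t \<in> J \<and> (\<forall>t1\<in>J. P t1 \<longrightarrow> (\<exists>N. openin W N \<and> w0 \<in> N \<and>
      continuous_map (subtopology (prod_topology W ?I) (N \<times> J)) (Arr G) \<phi>))" if t: "t \<in> {a..b}" for t
  proof -
    have "H (w0, t) \<in> arrows Q" using H y0(2) t by (auto simp: continuous_map_def Pi_iff)
    from E_sheets[OF this] obtain V where V: "openin (Arr Q) V" "H (w0, t) \<in> V"
      and sheets: "\<forall>g\<in>arrows G. E g \<in> V \<longrightarrow>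
      (\<exists>s. continuous_map (subtopology (Arr Q) V) (Arr G) s \<and> (\<forall>v\<in>V. E (s v) = v) \<and> s (E g) = g)"
      by (elim exE conjE)
    have "openin (prod_topology W ?I) {z \<in> topspace (prod_topology W ?I). H z \<in> V}" by (rule openin_preimage[OF H V(1)])
    moreover have "(w0, t) \<in> {z \<in> topspace (prod_topology W ?I). H z \<in> V}" using y0(2) t V(2) by simp
    ultimately have "\<exists>N0 J0. openin W N0 \<and> openin ?I J0 \<and> w0 \<in> N0 \<and> t \<in> J0 \<and>
        N0 \<times> J0 \<subseteq> {z \<in> topspace (prod_topology W ?I). H z \<in> V}" by (rule openin_prod_box)
    then obtain N0 J0 where N0: "openin W N0" "openin ?I J0" "w0 \<in> N0" "t \<in> J0"
        "N0 \<times> J0 \<subseteq> {z \<in> topspace (prod_topology W ?I). H z \<in> V}" by (elim exE conjE)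
    obtain d where d: "d > 0" "{a..b} \<inter> ball t d \<subseteq> J0" using openin_interval_ball[OF N0(2,4)] by blast
    define J where "J = {a..b} \<inter> ball t d"
    have J: "openin ?I J" "t \<in> J" "connected J"
      using t d(1) unfolding J_def by (auto intro!: convex_connected convex_Int simp: openin_open_Int)
    have JV: "H (w, s) \<in> V" if "w \<in> N0" "s \<in> J" for w s
    proof -
      have "(w, s) \<in> N0 \<times> J0" using that d(2) unfolding J_def by blast
      then show ?thesis using N0(5) by blast
    qed
    have N0W: "N0 \<subseteq> topspace W" by (rule openin_subset[OF N0(1)])
    have "\<exists>N. openin W N \<and> w0 \<in> N \<and> continuous_map (subtopology (prod_topology W ?I) (N \<times> J)) (Arr G) \<phi>"
      if t1: "t1 \<in> J" and "P t1" for t1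
    proof -
      have t1I: "t1 \<in> {a..b}" using t1 by (simp add: J_def)
      obtain N1 where N1: "openin W N1" "w0 \<in> N1" "continuous_map (subtopology W N1) (Arr G) (\<lambda>w. \<phi> (w, t1))"
        using \<open>P t1\<close> by (auto simp: P_def)
      have e: "\<phi> (w0, t1) \<in> arrows G" using path[OF y0(2)] t1I by (auto simp: continuous_map_def Pi_iff)
      have "E (\<phi> (w0, t1)) = H (w0, t1)" using lifts y0(2) t1I by simp
      then obtain s where s: "continuous_map (subtopology (Arr Q) V) (Arr G) s" "\<forall>v\<in>V. E (s v) = v"
        "s (H (w0, t1)) = \<phi> (w0, t1)"
        using sheets[rule_format, OF e] JV[OF N0(3) t1] by auto
      obtain U where U: "openin (Arr G) U" "\<phi> (w0, t1) \<in> U" "inj_on E U" using E_locally_injective[OF e] by blast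
      define N2 where "N2 = N0 \<inter> N1"
      have N2: "openin W N2" "w0 \<in> N2" using N0 N1 by (auto simp: N2_def)
      have "continuous_map (subtopology W N2) (prod_topology W ?I) (\<lambda>w. (w, t1))"
        using t1I by (intro continuous_map_pairedI) (auto simp: continuous_map_from_subtopology)
      from continuous_map_comp[OF this H] have "continuous_map (subtopology W N2) (subtopology (Arr Q) V) (\<lambda>w. H (w, t1))"
        by (rule continuous_map_into_subtopology) (use JV t1 in \<open>auto simp: N2_def\<close>)
      from continuous_map_comp[OF this s(1)] have c1: "continuous_map (subtopology W N2) (Arr G) (\<lambda>w. s (H (w, t1)))" .
      have c2: "continuous_map (subtopology W N2) (Arr G) (\<lambda>w. \<phi> (w, t1))"
        by (rule continuous_map_from_subtopology_mono[OF N1(3)]) (auto simp: N2_def)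
      define N where "N = (N2 \<inter> (\<lambda>w. s (H (w, t1))) -` U) \<inter> (N2 \<inter> (\<lambda>w. \<phi> (w, t1)) -` U)"
      have pre: "openin W (N2 \<inter> f -` U)" if "continuous_map (subtopology W N2) (Arr G) f" for f
      proof -
        have "openin (subtopology W N2) {x \<in> topspace (subtopology W N2). f x \<in> U}" by (rule openin_preimage[OF that U(1)])
        moreover have "{x \<in> topspace (subtopology W N2). f x \<in> U} = N2 \<inter> f -` U" using openin_subset[OF N2(1)] by auto
        ultimately show ?thesis using N2(1) openin_trans_full by metis
      qed
      have N: "openin W N" "w0 \<in> N" unfolding N_def using pre[OF c1] pre[OF c2] N2(2) U(2) s(3) by (auto intro: openin_Int)
      have eq: "s (H (w, u)) = \<phi> (w, u)" if w: "w \<in> N" and u: "u \<in> J" for w u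
      proof (rule lift_unique[OF J(3) _ _ _ t1 _ u])
        have wW: "w \<in> topspace W" "w \<in> N0" using w N0W by (auto simp: N_def N2_def)
        have "continuous_map (top_of_set J) (prod_topology W ?I) (\<lambda>u. (w, u))"
          using wW by (intro continuous_map_pairedI continuous_map_into_subtopology) (auto simp: J_def)
        from continuous_map_comp[OF this H] have "continuous_map (top_of_set J) (subtopology (Arr Q) V) (\<lambda>u. H (w, u))"
          by (rule continuous_map_into_subtopology) (use JV wW in auto)
        from continuous_map_comp[OF this s(1)] show "continuous_map (top_of_set J) (Arr G) (\<lambda>u. s (H (w, u)))" .
        show "continuous_map (top_of_set J) (Arr G) (\<lambda>u. \<phi> (w, u))"
          by (rule continuous_map_from_subtopology_mono[OF path[OF wW(1)]]) (auto simp: J_def)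
        show "E (s (H (w, u))) = E (\<phi> (w, u))" if "u \<in> J" for u
          using s(2) JV[OF wW(2) that] lifts[OF wW(1)] that by (simp add: J_def)
        have "E (s (H (w, t1))) = E (\<phi> (w, t1))"
          using s(2) JV[OF wW(2) t1] lifts[OF wW(1)] t1I by simp
        then show "s (H (w, t1)) = \<phi> (w, t1)"
          using w U(3) by (auto simp: N_def dest: inj_onD)
      qed
      have "continuous_map (subtopology (prod_topology W ?I) (N \<times> J)) (subtopology (Arr Q) V) H"
        by (intro continuous_map_into_subtopology continuous_map_from_subtopology H)
          (use JV in \<open>auto simp: N_def N2_def\<close>)
      from continuous_map_comp[OF this s(1)]
      have "continuous_map (subtopology (prod_topology W ?I) (N \<times> J)) (Arr G) \<phi>"
        by (rule continuous_map_eq) (use eq in auto)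
      then show ?thesis using N by blast
    qed
    then show ?thesis using J by blast
  qed
  have fibre: "P u" if "openin W N" "w0 \<in> N" "continuous_map (subtopology (prod_topology W ?I) (N \<times> J)) (Arr G) \<phi>" "u \<in> J" "u \<in> {a..b}" for N J u
  proof -
    have "continuous_map (subtopology W N) (prod_topology W ?I) (\<lambda>w. (w, u))"
      using that by (intro continuous_map_pairedI) (auto simp: continuous_map_from_subtopology)
    then have "continuous_map (subtopology W N) (subtopology (prod_topology W ?I) (N \<times> J)) (\<lambda>w. (w, u))"
      by (rule continuous_map_into_subtopology) (use that in auto)
    from continuous_map_comp[OF this that(3)] show ?thesis unfolding P_def using that(1,2) by blast
  qed
  have "P t0"
  proof (rule connected_induction_simple[of "{a..b}" a t0 P])
    show "P a" unfolding P_def using start y0(2) by (intro exI[of _ "topspace W"]) simp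
    fix t assume t: "t \<in> {a..b}"
    obtain J where J: "openin ?I J" "t \<in> J" "\<And>t1. t1\<in>J \<Longrightarrow> P t1 \<Longrightarrow> \<exists>N. openin W N \<and> w0 \<in> N \<and>
      continuous_map (subtopology (prod_topology W ?I) (N \<times> J)) (Arr G) \<phi>" using local[OF t] by blast
    have "P v" if "u \<in> J" "v \<in> J" "P u" for u v
    proof -
      have "v \<in> {a..b}" using that(2) openin_subset[OF J(1)] by auto
      then show ?thesis using J(3)[OF that(1,3)] fibre that(2) by blast
    qed
    then show "\<exists>T. openin ?I T \<and> t \<in> T \<and> (\<forall>x\<in>T. \<forall>y\<in>T. P x \<longrightarrow> P y)" using J(1,2) by blast
  qed (use ab y0 in auto)
  then obtain J N where J: "openin ?I J" "t0 \<in> J" "openin W N" "w0 \<in> N" "continuous_map (subtopology (prod_topology W ?I) (N \<times> J)) (Arr G) \<phi>"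
    using local[OF y0(3)] by blast
  then show "\<exists>U. openin (prod_topology W ?I) U \<and> y \<in> U \<and> continuous_map (subtopology (prod_topology W ?I) U) (Arr G) \<phi>"
    using y0 by (intro exI[of _ "N \<times> J"]) (simp add: openin_prod_Times_iff)
qed

end

section \<open>Extending a lift in time\<close>

text \<open>The point \<open>c y\<close> over \<open>y\<close> is chosen without continuity. The points of the lift over \<open>y\<close> are going to be the
  arrows \<open>g\<close> with target \<open>\<epsilon>(c y)\<close>, and \<open>g\<close> lies over the point \<open>c y E(g)\<close> of \<open>\<beta>\<close>.\<close>

locale lift_problem = covering_functor G Q E
  for G :: "('o, 'a, 'z) groupoid_scheme" and Q :: "('o, 'b, 'w) groupoid_scheme" and E :: "'a \<Rightarrow> 'b" +
  fixes X :: "'x topology" and \<beta> :: "('r, 'x \<times> real, 'x \<times> real, 'o, 'b) bibundle" and c :: "'x \<times> real \<Rightarrow> 'r"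
  assumes X_compact: "compact_space X"
    and \<beta>: "torsor Q (prod_topology X (top_of_set {0..1})) \<beta>"
    and c: "y \<in> topspace (prod_topology X (top_of_set {0..1})) \<Longrightarrow> c y \<in> total_space \<beta> \<and> proj \<beta> (c y) = y"

sublocale lift_problem \<subseteq> \<beta>: torsor Q "prod_topology X (top_of_set {0..1})" \<beta> by (rule \<beta>)

context lift_problem
begin

abbreviation Y where "Y \<equiv> prod_topology X (top_of_set {0..1::real})"
abbreviation mult (infixl "\<cdot>" 70) where "g \<cdot> h \<equiv> gmult G g h"
abbreviation below where "below a \<equiv> {y::'x \<times> real. snd y \<le> a}"

text \<open>The arrow \<open>r y\<close> is a point of the lift over \<open>y\<close>, and \<open>y \<mapsto> r y\<close> is a section of the lift; its continuity is
  tested by its image in \<open>\<beta>\<close> here, and by the transition functions below.\<close>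

definition chart :: "('x \<times> real) set \<Rightarrow> ('x \<times> real \<Rightarrow> 'a) \<Rightarrow> bool" where
  "chart V r \<longleftrightarrow> V \<subseteq> topspace Y \<and> (\<forall>y\<in>V. r y \<in> arrows G \<and> tgt G (r y) = eps \<beta> (c y)) \<and>
    continuous_map (subtopology Y V) (Tot \<beta>) (\<lambda>y. ract \<beta> (c y) (E (r y)))"

text \<open>The sets need not be open in \<open>Y\<close>, so that also charts of lifts that are defined up to some time only can be
  compared.\<close>

definition compat :: "('x \<times> real) set \<Rightarrow> ('x \<times> real \<Rightarrow> 'a) \<Rightarrow> ('x \<times> real) set \<Rightarrow> ('x \<times> real \<Rightarrow> 'a) \<Rightarrow> bool" where
  "compat V r V' r' \<longleftrightarrow> continuous_map (subtopology Y (V \<inter> V')) (Arr G) (\<lambda>y. ginv G (r y) \<cdot> r' y)"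

definition atlas_upto :: "real \<Rightarrow> (('x \<times> real) set \<times> ('x \<times> real \<Rightarrow> 'a)) set \<Rightarrow> bool" where
  "atlas_upto a \<R> \<longleftrightarrow>
    (\<forall>V r. (V, r) \<in> \<R> \<longrightarrow> chart V r \<and> openin (subtopology Y (below a)) V) \<and>
    (\<forall>V r V' r'. (V, r) \<in> \<R> \<longrightarrow> (V', r') \<in> \<R> \<longrightarrow> compat V r V' r') \<and>
    (\<forall>y\<in>topspace Y. snd y \<le> a \<longrightarrow> (\<exists>V r. (V, r) \<in> \<R> \<and> y \<in> V))"

lemma chartD:
  assumes "chart V r"
  shows "V \<subseteq> topspace Y" "y \<in> V \<Longrightarrow> r y \<in> arrows G" "y \<in> V \<Longrightarrow> tgt G (r y) = eps \<beta> (c y)"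
    "continuous_map (subtopology Y V) (Tot \<beta>) (\<lambda>y. ract \<beta> (c y) (E (r y)))"
  using assms unfolding chart_def by auto

lemma chart_subset: "chart V r \<Longrightarrow> V' \<subseteq> V \<Longrightarrow> chart V' r"
  unfolding chart_def using continuous_map_from_subtopology_mono by blast

lemma compat_subset: "compat V r V' r' \<Longrightarrow> W \<subseteq> V \<Longrightarrow> W' \<subseteq> V' \<Longrightarrow> compat W r W' r'"
  unfolding compat_def by (erule continuous_map_from_subtopology_mono) blast

lemma compat_cong: "compat V r V' r' \<Longrightarrow> (\<And>y. y \<in> V \<Longrightarrow> y \<in> V' \<Longrightarrow> r y = s y \<and> r' y = s' y) \<Longrightarrow> compat V s V' s'"
  unfolding compat_def by (erule continuous_map_eq) simp

lemma compat_sym: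
  assumes "chart V r" "chart V' r'" "compat V r V' r'"
  shows "compat V' r' V r"
proof -
  have "continuous_map (subtopology Y (V \<inter> V')) (Arr G) (\<lambda>y. ginv G (ginv G (r y) \<cdot> r' y))"
    using assms(3) unfolding compat_def by (rule G.cont_inv)
  then have "continuous_map (subtopology Y (V \<inter> V')) (Arr G) (\<lambda>y. ginv G (r' y) \<cdot> r y)"
    by (rule continuous_map_eq) (use chartD(2,3)[OF assms(1)] chartD(2,3)[OF assms(2)] in \<open>auto simp: G.div_inv\<close>)
  then show ?thesis by (simp add: compat_def Int_commute)
qed

text \<open>Locally on the overlap the transition function factors as \<open>r\<inverse>r' = (r\<inverse>\<rho>)(\<rho>\<inverse>r')\<close> through a chart \<open>\<rho>\<close> of the
  atlas.\<close>

lemma compat_trans: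
  assumes r: "chart V r" and r': "chart V' r'" and A: "atlas_upto a \<R>" and sub: "V \<inter> V' \<subseteq> below a"
    and 1: "\<And>U \<rho>. (U, \<rho>) \<in> \<R> \<Longrightarrow> compat V r U \<rho>" and 2: "\<And>U \<rho>. (U, \<rho>) \<in> \<R> \<Longrightarrow> compat U \<rho> V' r'"
  shows "compat V r V' r'"
  unfolding compat_def
proof (rule continuous_map_on_local)
  fix y assume y: "y \<in> V \<inter> V'" "y \<in> topspace Y"
  then have "snd y \<le> a" using sub by blast
  then obtain U \<rho> where U: "(U, \<rho>) \<in> \<R>" "y \<in> U" using A y(2) unfolding atlas_upto_def by blast
  have Uc: "chart U \<rho>" and Uo: "openin (subtopology Y (below a)) U" using A U(1) unfolding atlas_upto_def by blast+
  obtain O' where O': "openin Y O'" "U = O' \<inter> below a" using Uo unfolding openin_subtopology by blast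
  let ?S = "V \<inter> V' \<inter> O'"
  have SU: "?S \<subseteq> V \<inter> U" "?S \<subseteq> U \<inter> V'" using O'(2) sub by auto
  have c1: "continuous_map (subtopology Y ?S) (Arr G) (\<lambda>y. ginv G (r y) \<cdot> \<rho> y)"
    using 1[OF U(1)] SU(1) unfolding compat_def by (rule continuous_map_from_subtopology_mono)
  have c2: "continuous_map (subtopology Y ?S) (Arr G) (\<lambda>y. ginv G (\<rho> y) \<cdot> r' y)"
    using 2[OF U(1)] SU(2) unfolding compat_def by (rule continuous_map_from_subtopology_mono)
  have m: "r y \<in> arrows G \<and> r' y \<in> arrows G \<and> \<rho> y \<in> arrows G \<and> tgt G (r y) = tgt G (\<rho> y) \<and> tgt G (\<rho> y) = tgt G (r' y)"
    if "y \<in> ?S" for y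
    using that SU chartD(2,3)[OF r, of y] chartD(2,3)[OF r', of y] chartD(2,3)[OF Uc, of y] by auto
  have "continuous_map (subtopology Y ?S) (Arr G) (\<lambda>y. (ginv G (r y) \<cdot> \<rho> y) \<cdot> (ginv G (\<rho> y) \<cdot> r' y))"
    by (rule G.cont_mult[OF c1 c2]) (use m in \<open>auto simp: G.closed G.st\<close>)
  then have "continuous_map (subtopology Y ?S) (Arr G) (\<lambda>y. ginv G (r y) \<cdot> r' y)"
    by (rule continuous_map_eq) (use m G.div_trans in auto)
  then show "\<exists>O'. openin Y O' \<and> y \<in> O' \<and> continuous_map (subtopology Y (V \<inter> V' \<inter> O')) (Arr G) (\<lambda>y. ginv G (r y) \<cdot> r' y)"
    using O' U(2) by blast
qed

text \<open>A Lebesgue number in the direction of time: finitely many boxes of half the admissible duration cover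
  \<open>Y\<close>, and the shortest of these durations works everywhere.\<close>

lemma uniform_slabs:
  "\<exists>\<epsilon>>0. \<forall>x\<in>topspace X. \<forall>s\<in>{0..1}. \<exists>N \<sigma>. openin X N \<and> x \<in> N \<and>
    continuous_map (subtopology Y (N \<times> {t. \<bar>t - s\<bar> < \<epsilon>})) (Tot \<beta>) \<sigma> \<and>
    (\<forall>y\<in>topspace Y. fst y \<in> N \<longrightarrow> \<bar>snd y - s\<bar> < \<epsilon> \<longrightarrow> proj \<beta> (\<sigma> y) = y)"
proof -
  have "\<exists>N d \<sigma>. openin X N \<and> x \<in> N \<and> d > 0 \<and> continuous_map (subtopology Y (N \<times> {u. \<bar>u - t\<bar> < 2 * d})) (Tot \<beta>) \<sigma> \<and>
    (\<forall>y\<in>topspace Y. fst y \<in> N \<longrightarrow> \<bar>snd y - t\<bar> < 2 * d \<longrightarrow> proj \<beta> (\<sigma> y) = y)"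
    if xt: "(x, t) \<in> topspace Y" for x t
  proof -
    obtain U \<sigma> where U: "openin Y U" "(x, t) \<in> U" "continuous_map (subtopology Y U) (Tot \<beta>) \<sigma>" "\<forall>z\<in>U. proj \<beta> (\<sigma> z) = z"
      using \<beta>.local_section[OF xt] by blast
    from openin_prod_box[OF U(1,2)]
    obtain N J where N: "openin X N" "openin (top_of_set {0..1::real}) J" "x \<in> N" "t \<in> J" "N \<times> J \<subseteq> U"
      by (elim exE conjE)
    obtain d where d: "d > 0" "{0..1} \<inter> ball t d \<subseteq> J" using openin_interval_ball[OF N(2,4)] by blast
    have inU: "y \<in> U" if "y \<in> topspace Y" "fst y \<in> N" "\<bar>snd y - t\<bar> < 2 * (d / 2)" for y
    proof -
      have "snd y \<in> {0..1} \<inter> ball t d" using that by (auto simp: dist_real_def)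
      then have "(fst y, snd y) \<in> N \<times> J" using d(2) that(2) by blast
      then show ?thesis using N(5) by auto
    qed
    have "subtopology Y (N \<times> {u. \<bar>u - t\<bar> < 2 * (d / 2)}) = subtopology Y (topspace Y \<inter> N \<times> {u. \<bar>u - t\<bar> < 2 * (d / 2)})"
      by (metis subtopology_restrict)
    moreover have "continuous_map (subtopology Y (topspace Y \<inter> N \<times> {u. \<bar>u - t\<bar> < 2 * (d / 2)})) (Tot \<beta>) \<sigma>"
      by (rule continuous_map_from_subtopology_mono[OF U(3)]) (use inU in auto)
    ultimately show ?thesis using N(1,3) d(1) U(4) inU
      by (intro exI[of _ N] exI[of _ "d / 2"] exI[of _ \<sigma>]) auto
  qed
  then have "\<forall>z\<in>topspace Y. \<exists>N d \<sigma>. openin X N \<and> fst z \<in> N \<and> d > 0 \<and> continuous_map (subtopology Y (N \<times> {u. \<bar>u - snd z\<bar> < 2 * d})) (Tot \<beta>) \<sigma> \<and>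
    (\<forall>y\<in>topspace Y. fst y \<in> N \<longrightarrow> \<bar>snd y - snd z\<bar> < 2 * d \<longrightarrow> proj \<beta> (\<sigma> y) = y)" by (metis prod.collapse)
  then obtain N d \<sigma> where N: "\<And>z. z\<in>topspace Y \<Longrightarrow> openin X (N z) \<and> fst z \<in> N z \<and> d z > 0 \<and>
      continuous_map (subtopology Y (N z \<times> {u. \<bar>u - snd z\<bar> < 2 * d z})) (Tot \<beta>) (\<sigma> z) \<and>
    (\<forall>y\<in>topspace Y. fst y \<in> N z \<longrightarrow> \<bar>snd y - snd z\<bar> < 2 * d z \<longrightarrow> proj \<beta> (\<sigma> z y) = y)" by metis
  define B where "B z = N z \<times> ({0..1} \<inter> ball (snd z) (d z))" for z
  have "compact_space Y" using X_compact by (simp add: compact_space_prod_topology compact_space_subtopology)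
  moreover have "openin Y U" if "U \<in> B ` topspace Y" for U
    using that N by (auto simp: B_def openin_prod_Times_iff openin_open_Int)
  moreover have "topspace Y \<subseteq> \<Union>(B ` topspace Y)"
  proof
    fix z assume z: "z \<in> topspace Y"
    have "z \<in> B z" using N[OF z] z by (cases z) (auto simp: B_def)
    then show "z \<in> \<Union>(B ` topspace Y)" using z by blast
  qed
  ultimately have "\<exists>\<F>. finite \<F> \<and> \<F> \<subseteq> B ` topspace Y \<and> topspace Y \<subseteq> \<Union>\<F>" unfolding compact_space_alt by blast
  then obtain F where F: "finite F" "F \<subseteq> topspace Y" "topspace Y \<subseteq> \<Union>(B ` F)"
    by (metis finite_subset_image)
  define \<epsilon> where "\<epsilon> = Min (insert 1 (d ` F))"
  have \<epsilon>: "\<epsilon> > 0" "\<And>z. z \<in> F \<Longrightarrow> \<epsilon> \<le> d z"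
    unfolding \<epsilon>_def using F N by (auto simp: Min_gr_iff)
  have "\<exists>N \<sigma>. openin X N \<and> x \<in> N \<and> continuous_map (subtopology Y (N \<times> {t. \<bar>t - s\<bar> < \<epsilon>})) (Tot \<beta>) \<sigma> \<and>
    (\<forall>y\<in>topspace Y. fst y \<in> N \<longrightarrow> \<bar>snd y - s\<bar> < \<epsilon> \<longrightarrow> proj \<beta> (\<sigma> y) = y)"
    if x: "x \<in> topspace X" and s: "s \<in> {0..1}" for x s
  proof -
    have "(x, s) \<in> topspace Y" using x s by simp
    then obtain z where z: "z \<in> F" "(x, s) \<in> B z" using F(3) by blast
    have zY: "z \<in> topspace Y" using z F by blast
    have near: "\<bar>u - snd z\<bar> < 2 * d z" if "\<bar>u - s\<bar> < \<epsilon>" for u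
      using z(2) that \<epsilon>(2)[OF z(1)] by (auto simp: B_def dist_real_def)
    have "continuous_map (subtopology Y (N z \<times> {t. \<bar>t - s\<bar> < \<epsilon>})) (Tot \<beta>) (\<sigma> z)"
      by (rule continuous_map_from_subtopology_mono[of _ "N z \<times> {u. \<bar>u - snd z\<bar> < 2 * d z}"])
        (use N[OF zY] near in auto)
    then show ?thesis using N[OF zY] near z(2) by (intro exI[of _ "N z"] exI[of _ "\<sigma> z"]) (auto simp: B_def)
  qed
  then show ?thesis using \<epsilon>(1) by blast
qed

text \<open>An old chart \<open>r1\<close> near \<open>(x, a)\<close> gives a section \<open>p\<close> of \<open>\<beta>\<close> over times up to \<open>a\<close>, which differs from \<open>\<sigma>\<close> by a
  continuous function \<open>e\<close> to the arrows of \<open>Q\<close>. Multiplying \<open>r1\<close> by a local lift of \<open>e\<close> yields a chart over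
  \<open>\<sigma>\<close>, and \<open>\<sigma>\<close> continues beyond time \<open>a\<close>.\<close>

lemma chart_at_frontier:
  assumes A: "atlas_upto a \<R>" and a: "0 \<le> a" "a \<le> 1" and x: "x \<in> topspace X" and \<epsilon>: "\<epsilon> > 0"
    and N1: "openin X N1" "x \<in> N1" and \<sigma>: "continuous_map (subtopology Y (N1 \<times> {t. \<bar>t - a\<bar> < \<epsilon>})) (Tot \<beta>) \<sigma>"
    and \<sigma>_proj: "\<forall>y\<in>topspace Y. fst y \<in> N1 \<longrightarrow> \<bar>snd y - a\<bar> < \<epsilon> \<longrightarrow> proj \<beta> (\<sigma> y) = y"
  shows "\<exists>N \<delta> r. openin X N \<and> x \<in> N \<and> N \<subseteq> N1 \<and> 0 < \<delta> \<and> \<delta> \<le> \<epsilon> \<and>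
    chart {y \<in> topspace Y. fst y \<in> N \<and> a - \<delta> < snd y \<and> snd y \<le> a} r \<and>
    (\<forall>y\<in>topspace Y. fst y \<in> N \<longrightarrow> a - \<delta> < snd y \<longrightarrow> snd y \<le> a \<longrightarrow> ract \<beta> (c y) (E (r y)) = \<sigma> y) \<and>
    (\<forall>U \<rho>. (U, \<rho>) \<in> \<R> \<longrightarrow> compat {y \<in> topspace Y. fst y \<in> N \<and> a - \<delta> < snd y \<and> snd y \<le> a} r U \<rho>)"
proof -
  have xa: "(x, a) \<in> topspace Y" using x a by simp
  have "\<exists>V r. (V, r) \<in> \<R> \<and> (x, a) \<in> V" using A xa unfolding atlas_upto_def by auto
  then obtain V r1 where V: "(V, r1) \<in> \<R>" "(x, a) \<in> V" by blast
  have Vc: "chart V r1" and Vo: "openin (subtopology Y (below a)) V" using A V(1) unfolding atlas_upto_def by blast+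
  define S where "S = V \<inter> (N1 \<times> {t. \<bar>t - a\<bar> < \<epsilon>})"
  have SY: "S \<subseteq> topspace Y" using chartD(1)[OF Vc] by (auto simp: S_def)
  have xaS: "(x, a) \<in> S" using V N1 \<epsilon> by (simp add: S_def)
  define p where "p y = ract \<beta> (c y) (E (r1 y))" for y
  have r1: "r1 y \<in> arrows G" "tgt G (r1 y) = eps \<beta> (c y)" if "y \<in> S" for y
    using chartD(2,3)[OF Vc, of y] that by (auto simp: S_def)
  have cy: "c y \<in> total_space \<beta>" "proj \<beta> (c y) = y" if "y \<in> S" for y using c[of y] that SY by auto
  have p: "p y \<in> total_space \<beta>" "proj \<beta> (p y) = y" "eps \<beta> (p y) = src G (r1 y)" if "y \<in> S" for y
    using cy[OF that] r1[OF that] E_in[of "r1 y"]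
    by (auto simp: p_def E_src E_tgt \<beta>.act_in \<beta>.act_proj \<beta>.act_eps)
  have pc: "continuous_map (subtopology Y S) (Tot \<beta>) p"
    unfolding p_def by (rule continuous_map_from_subtopology_mono[OF chartD(4)[OF Vc]]) (auto simp: S_def)
  have \<sigma>c: "continuous_map (subtopology Y S) (Tot \<beta>) \<sigma>"
    by (rule continuous_map_from_subtopology_mono[OF \<sigma>]) (auto simp: S_def)
  have \<sigma>t: "\<sigma> y \<in> total_space \<beta>" "proj \<beta> (\<sigma> y) = y" if "y \<in> S" for y
    using \<sigma>c \<sigma>_proj[rule_format, of y] that SY by (auto simp: continuous_map_def Pi_iff S_def)
  define e where "e y = pdiv Q \<beta> (p y) (\<sigma> y)" for y
  have ec: "continuous_map (subtopology Y S) (Arr Q) e"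
    unfolding e_def by (rule \<beta>.cont_pdiv[OF pc \<sigma>c]) (simp add: p \<sigma>t)
  have e: "e y \<in> arrows Q" "tgt Q (e y) = src G (r1 y)" "ract \<beta> (p y) (e y) = \<sigma> y" if "y \<in> S" for y
    using \<beta>.pdiv[of "p y" "\<sigma> y"] p[OF that] \<sigma>t[OF that] by (auto simp: e_def)
  obtain VQ where VQ: "openin (Arr Q) VQ" "e (x, a) \<in> VQ"
    and sheets: "\<forall>g\<in>arrows G. E g \<in> VQ \<longrightarrow> (\<exists>s. continuous_map (subtopology (Arr Q) VQ) (Arr G) s \<and> (\<forall>v\<in>VQ. E (s v) = v) \<and> s (E g) = g)"
    using E_sheets[OF e(1)[OF xaS]] by (elim exE conjE)
  have "e (x, a) \<in> E ` arrows G" using e(1)[OF xaS] E_onto by simp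
  then obtain g0 where g0: "e (x, a) = E g0" "g0 \<in> arrows G" by (rule imageE)
  have "E g0 \<in> VQ" using VQ(2) g0(1) by simp
  from sheets[rule_format, OF g0(2) this]
  obtain s where s: "continuous_map (subtopology (Arr Q) VQ) (Arr G) s" "\<forall>v\<in>VQ. E (s v) = v"
    by (elim exE conjE)
  have s_in: "s v \<in> arrows G" if "v \<in> VQ" for v
    using s(1) that openin_subset[OF VQ(1)] by (auto simp: continuous_map_def Pi_iff)
  define S' where "S' = {y \<in> topspace (subtopology Y S). e y \<in> VQ}"
  have "openin (subtopology Y S) S'" unfolding S'_def by (rule openin_preimage[OF ec VQ(1)])
  then obtain O1 where O1: "openin Y O1" "S' = O1 \<inter> S" unfolding openin_subtopology by blast
  obtain O2 where O2: "openin Y O2" "V = O2 \<inter> below a" using Vo unfolding openin_subtopology by blast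
  have "openin Y (O1 \<inter> O2)" using O1 O2 by blast
  moreover have "(x, a) \<in> O1 \<inter> O2" using O1(2) O2(2) V(2) xaS VQ(2) SY by (auto simp: S'_def)
  ultimately have "\<exists>N2 J. openin X N2 \<and> openin (top_of_set {0..1::real}) J \<and> x \<in> N2 \<and> a \<in> J \<and> N2 \<times> J \<subseteq> O1 \<inter> O2"
    by (rule openin_prod_box)
  then obtain N2 J where N2: "openin X N2" "openin (top_of_set {0..1::real}) J" "x \<in> N2" "a \<in> J" "N2 \<times> J \<subseteq> O1 \<inter> O2"
    by (elim exE conjE)
  obtain d where d: "d > 0" "{0..1} \<inter> ball a d \<subseteq> J" using openin_interval_ball[OF N2(2,4)] by blast
  define \<delta> where "\<delta> = min d \<epsilon>"
  define N where "N = N1 \<inter> N2"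
  define V0 where "V0 = {y \<in> topspace Y. fst y \<in> N \<and> a - \<delta> < snd y \<and> snd y \<le> a}"
  have V0: "V0 \<subseteq> S'"
  proof
    fix y assume y: "y \<in> V0"
    then have "snd y \<in> {0..1} \<inter> ball a d" by (auto simp: V0_def \<delta>_def dist_real_def)
    then have "(fst y, snd y) \<in> N2 \<times> J" using d(2) y by (auto simp: V0_def N_def)
    then have "y \<in> O1 \<inter> O2" using N2(5) by auto
    moreover have "y \<in> N1 \<times> {t. \<bar>t - a\<bar> < \<epsilon>}" using y by (cases y) (auto simp: V0_def N_def \<delta>_def)
    ultimately have "y \<in> O1 \<inter> S" using y O2(2) by (auto simp: S_def V0_def)
    then show "y \<in> S'" using O1(2) by simp
  qed
  have V0S: "y \<in> S" "e y \<in> VQ" if "y \<in> V0" for y using V0 that by (auto simp: S'_def)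
  define r where "r y = r1 y \<cdot> s (e y)" for y
  have k: "s (e y) \<in> arrows G" "E (s (e y)) = e y" "tgt G (s (e y)) = src G (r1 y)" if "y \<in> V0" for y
    using s_in[OF V0S(2)[OF that]] s(2) V0S(2)[OF that] e(2)[OF V0S(1)[OF that]] E_tgt[of "s (e y)"] by auto
  have r: "r y \<in> arrows G" "tgt G (r y) = eps \<beta> (c y)" "ract \<beta> (c y) (E (r y)) = \<sigma> y" if y: "y \<in> V0" for y
  proof -
    note r1y = r1[OF V0S(1)[OF y]] and ky = k[OF y] and cyy = cy[OF V0S(1)[OF y]]
    show "r y \<in> arrows G" "tgt G (r y) = eps \<beta> (c y)" using r1y ky by (auto simp: r_def G.closed G.st)
    have "ract \<beta> (c y) (E (r y)) = ract \<beta> (p y) (e y)"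
      using \<beta>.act_assoc[OF cyy(1), of "E (r1 y)" "e y"] r1y ky e[OF V0S(1)[OF y]]
      by (simp add: r_def p_def E_mult E_in E_src E_tgt)
    then show "ract \<beta> (c y) (E (r y)) = \<sigma> y" using e(3)[OF V0S(1)[OF y]] by simp
  qed
  have chart: "chart V0 r" unfolding chart_def
  proof (intro conjI ballI)
    show "V0 \<subseteq> topspace Y" by (auto simp: V0_def)
    have "continuous_map (subtopology Y V0) (Tot \<beta>) \<sigma>"
      by (rule continuous_map_from_subtopology_mono[OF \<sigma>c]) (use V0S in auto)
    then show "continuous_map (subtopology Y V0) (Tot \<beta>) (\<lambda>y. ract \<beta> (c y) (E (r y)))"
      by (rule continuous_map_eq) (simp add: r)
  qed (auto simp: r)
  have "continuous_map (subtopology Y V0) (subtopology (Arr Q) VQ) e"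
    by (rule continuous_map_into_subtopology[OF continuous_map_from_subtopology_mono[OF ec]]) (use V0S in auto)
  from continuous_map_comp[OF this s(1)] have sec: "continuous_map (subtopology Y V0) (Arr G) (\<lambda>y. s (e y))" .
  have "compat V0 r U \<rho>" if U: "(U, \<rho>) \<in> \<R>" for U \<rho>
  proof -
    have Uc: "chart U \<rho>" and VU: "compat V r1 U \<rho>" using A U V(1) unfolding atlas_upto_def by blast+
    have VV: "V0 \<inter> U \<subseteq> V \<inter> U" using V0S by (auto simp: S_def)
    have c1: "continuous_map (subtopology Y (V0 \<inter> U)) (Arr G) (\<lambda>y. ginv G (r1 y) \<cdot> \<rho> y)"
      using VU VV unfolding compat_def by (rule continuous_map_from_subtopology_mono)
    have c2: "continuous_map (subtopology Y (V0 \<inter> U)) (Arr G) (\<lambda>y. s (e y))"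
      by (rule continuous_map_from_subtopology_mono[OF sec]) auto
    have m: "r1 y \<in> arrows G \<and> \<rho> y \<in> arrows G \<and> s (e y) \<in> arrows G \<and> tgt G (r1 y) = tgt G (\<rho> y) \<and> tgt G (s (e y)) = src G (r1 y)"
      if "y \<in> V0 \<inter> U" for y
      using that r1[OF V0S(1)] chartD(2,3)[OF Uc, of y] k[of y] by auto
    have "continuous_map (subtopology Y (V0 \<inter> U)) (Arr G) (\<lambda>y. ginv G (s (e y)) \<cdot> (ginv G (r1 y) \<cdot> \<rho> y))"
      by (rule G.cont_mult[OF G.cont_inv[OF c2] c1]) (use m in \<open>auto simp: G.closed G.st\<close>)
    then show ?thesis unfolding compat_def
      by (rule continuous_map_eq) (use m in \<open>auto simp: r_def G.inv_mult G.assoc G.closed G.st\<close>)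
  qed
  then show ?thesis
    using chart r N1(1,2) N2(1,3) d(1) \<epsilon> unfolding V0_def
    by (intro exI[of _ N] exI[of _ \<delta>] exI[of _ r]) (auto simp: N_def \<delta>_def)
qed


text \<open>Each \<open>x\<close> gets a section \<open>\<sigma> x\<close> of \<open>\<beta>\<close> on a box across time \<open>a\<close>, and a chart \<open>r x\<close> over \<open>\<sigma> x\<close> up to time \<open>a\<close>. For
  later times the transition functions of the charts are dictated by those at time \<open>a\<close> and by path
  lifting, and charts with these transition functions are easily constructed because the lift is still a
  mere set there. The last clause makes it possible to keep the atlas compatible with the given one over
  the face.\<close>

lemma atlas_step:
  assumes A: "atlas_upto a \<R>" and a: "0 \<le> a" and b: "a < b" "b \<le> 1" "b < a + \<epsilon>"
    and slabs: "\<forall>x\<in>topspace X. \<exists>N \<sigma>. openin X N \<and> x \<in> N \<and>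
      continuous_map (subtopology Y (N \<times> {t. \<bar>t - a\<bar> < \<epsilon>})) (Tot \<beta>) \<sigma> \<and>
      (\<forall>y\<in>topspace Y. fst y \<in> N \<longrightarrow> \<bar>snd y - a\<bar> < \<epsilon> \<longrightarrow> proj \<beta> (\<sigma> y) = y)"
  shows "\<exists>\<R>'. atlas_upto b \<R>' \<and> (\<forall>V r. chart V r \<longrightarrow> V \<subseteq> below a \<longrightarrow>
    (\<forall>U \<rho>. (U, \<rho>) \<in> \<R> \<longrightarrow> compat U \<rho> V r) \<longrightarrow> (\<forall>U \<rho>. (U, \<rho>) \<in> \<R>' \<longrightarrow> compat U \<rho> V r))"
proof -
  have a1: "a \<le> 1" and \<epsilon>: "\<epsilon> > 0" using b by auto
  define V0 where "V0 N \<delta> = {y \<in> topspace Y. fst y \<in> N \<and> a - \<delta> < snd y \<and> snd y \<le> a}" for N and \<delta> :: real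
  define good where "good x N \<delta> \<sigma> r \<longleftrightarrow> openin X N \<and> x \<in> N \<and> 0 < \<delta> \<and> \<delta> \<le> \<epsilon> \<and>
     continuous_map (subtopology Y (N \<times> {t. \<bar>t - a\<bar> < \<epsilon>})) (Tot \<beta>) \<sigma> \<and>
     (\<forall>y\<in>topspace Y. fst y \<in> N \<longrightarrow> \<bar>snd y - a\<bar> < \<epsilon> \<longrightarrow> proj \<beta> (\<sigma> y) = y) \<and>
     chart (V0 N \<delta>) r \<and> (\<forall>y\<in>V0 N \<delta>. ract \<beta> (c y) (E (r y)) = \<sigma> y) \<and>
     (\<forall>U \<rho>. (U, \<rho>) \<in> \<R> \<longrightarrow> compat (V0 N \<delta>) r U \<rho>)" for x N \<delta> \<sigma> r
  have "\<exists>D. good x (fst D) (fst (snd D)) (fst (snd (snd D))) (snd (snd (snd D)))" if x: "x \<in> topspace X" for x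
  proof -
    obtain N1 \<sigma> where N1: "openin X N1" "x \<in> N1" "continuous_map (subtopology Y (N1 \<times> {t. \<bar>t - a\<bar> < \<epsilon>})) (Tot \<beta>) \<sigma>"
      "\<forall>y\<in>topspace Y. fst y \<in> N1 \<longrightarrow> \<bar>snd y - a\<bar> < \<epsilon> \<longrightarrow> proj \<beta> (\<sigma> y) = y"
      using slabs[rule_format, OF x] by (elim exE conjE)
    from chart_at_frontier[OF A a a1 x \<epsilon> N1]
    obtain N \<delta> r where N: "openin X N" "x \<in> N" "N \<subseteq> N1" "0 < \<delta>" "\<delta> \<le> \<epsilon>" "chart (V0 N \<delta>) r"
       "\<forall>y\<in>topspace Y. fst y \<in> N \<longrightarrow> a - \<delta> < snd y \<longrightarrow> snd y \<le> a \<longrightarrow> ract \<beta> (c y) (E (r y)) = \<sigma> y"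
       "\<forall>U \<rho>. (U, \<rho>) \<in> \<R> \<longrightarrow> compat (V0 N \<delta>) r U \<rho>"
      unfolding V0_def by (elim exE conjE)
    have "continuous_map (subtopology Y (N \<times> {t. \<bar>t - a\<bar> < \<epsilon>})) (Tot \<beta>) \<sigma>"
      by (rule continuous_map_from_subtopology_mono[OF N1(3)]) (use N(3) in auto)
    then have "good x N \<delta> \<sigma> r" unfolding good_def using N N1(4) by (auto simp: V0_def)
    then show ?thesis by (intro exI[of _ "(N, \<delta>, \<sigma>, r)"]) simp
  qed
  then have "\<forall>x. \<exists>D. x \<in> topspace X \<longrightarrow> good x (fst D) (fst (snd D)) (fst (snd (snd D))) (snd (snd (snd D)))" by blast
  from choice[OF this] obtain D where D: "\<forall>x. x \<in> topspace X \<longrightarrow> good x (fst (D x)) (fst (snd (D x))) (fst (snd (snd (D x)))) (snd (snd (snd (D x))))"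
    by (elim exE)
  define N \<delta> \<sigma> r where "N x = fst (D x)" and "\<delta> x = fst (snd (D x))" and "\<sigma> x = fst (snd (snd (D x)))"
    and "r x = snd (snd (snd (D x)))" for x
  have g: "good x (N x) (\<delta> x) (\<sigma> x) (r x)" if "x \<in> topspace X" for x
    using D[rule_format, OF that] by (simp add: N_def \<delta>_def \<sigma>_def r_def)
  have N: "openin X (N x)" "x \<in> N x" and \<delta>: "0 < \<delta> x" "\<delta> x \<le> \<epsilon>"
    and \<sigma>c: "continuous_map (subtopology Y (N x \<times> {t. \<bar>t - a\<bar> < \<epsilon>})) (Tot \<beta>) (\<sigma> x)"
    and r_chart: "chart (V0 (N x) (\<delta> x)) (r x)" if "x \<in> topspace X" for x
    using g[OF that] unfolding good_def by auto
  have \<sigma>_proj: "proj \<beta> (\<sigma> x y) = y" if "x \<in> topspace X" "y \<in> topspace Y" "fst y \<in> N x" "\<bar>snd y - a\<bar> < \<epsilon>" for x y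
    using g[OF that(1)] that unfolding good_def by blast
  have r_lift: "ract \<beta> (c y) (E (r x y)) = \<sigma> x y" if "x \<in> topspace X" "y \<in> V0 (N x) (\<delta> x)" for x y
    using g[OF that(1)] that(2) unfolding good_def by blast
  have r_compat: "compat (V0 (N x) (\<delta> x)) (r x) U \<rho>" if "x \<in> topspace X" "(U, \<rho>) \<in> \<R>" for x U \<rho>
    using g[OF that(1)] that(2) unfolding good_def by blast
  have NX: "N x \<subseteq> topspace X" if "x \<in> topspace X" for x by (rule openin_subset[OF N(1)[OF that]])
  have \<sigma>_in: "\<sigma> x y \<in> total_space \<beta>" if "x \<in> topspace X" "y \<in> topspace Y" "fst y \<in> N x" "\<bar>snd y - a\<bar> < \<epsilon>" for x y
    using \<sigma>c[OF that(1)] that(2-4) by (cases y) (auto simp: continuous_map_def Pi_iff)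
  have chart_old: "chart U \<rho>" "openin (subtopology Y (below a)) U" if "(U, \<rho>) \<in> \<R>" for U \<rho>
    using A that unfolding atlas_upto_def by blast+
  have compat_old: "compat U \<rho> U' \<rho>'" if "(U, \<rho>) \<in> \<R>" "(U', \<rho>') \<in> \<R>" for U \<rho> U' \<rho>'
    using A that unfolding atlas_upto_def by blast
  have r_r: "compat (V0 (N x) (\<delta> x)) (r x) (V0 (N x') (\<delta> x')) (r x')" if "x \<in> topspace X" "x' \<in> topspace X" for x x'
    by (rule compat_trans[OF r_chart[OF that(1)] r_chart[OF that(2)] A _ r_compat[OF that(1)]
        compat_sym[OF r_chart[OF that(2)] chart_old(1) r_compat[OF that(2)]]]) (auto simp: V0_def)
  have near: "\<bar>t - a\<bar> < \<epsilon>" if "t \<in> {a..b}" for t using that b by auto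
  have inY: "(x, t) \<in> topspace Y" if "x \<in> topspace X" "t \<in> {a..b}" for x t using that a b by auto
  have aV0: "(x, a) \<in> V0 (N x') (\<delta> x')" if "x' \<in> topspace X" "x \<in> N x'" for x x'
    using that \<delta>[OF that(1)] NX[OF that(1)] a a1 by (auto simp: V0_def)
  note ra = chartD(2,3)[OF r_chart aV0]
  \<comment> \<open>Over a fixed \<open>x\<close> the sections \<open>\<sigma> x\<close> and \<open>\<sigma> x'\<close> differ by a path of arrows of \<open>Q\<close> on \<open>[a, b]\<close>; at
    time \<open>a\<close> it is already lifted, by the transition function of the charts \<open>r x\<close> and \<open>r x'\<close>.\<close>
  define \<gamma> where "\<gamma> x x' t = pdiv Q \<beta> (\<sigma> x (x, t)) (\<sigma> x' (x, t))" for x x' t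
  have s_in: "\<sigma> x' (x, t) \<in> total_space \<beta>" "proj \<beta> (\<sigma> x' (x, t)) = (x, t)"
    if "x' \<in> topspace X" "x \<in> N x'" "t \<in> {a..b}" for x x' t
    using \<sigma>_in[OF that(1) inY[OF _ that(3)], of x] \<sigma>_proj[OF that(1) inY[OF _ that(3)], of x] NX[OF that(1)] that near by auto
  have \<sigma>_path: "continuous_map (top_of_set {a..b}) (Tot \<beta>) (\<lambda>t. \<sigma> x' (x, t))" if "x' \<in> topspace X" "x \<in> N x'" for x x'
  proof -
    have "continuous_map (top_of_set {a..b}) Y (\<lambda>t. (x, t))"
      using that NX a b by (intro continuous_map_pairedI continuous_map_into_subtopology) auto
    then have "continuous_map (top_of_set {a..b}) (subtopology Y (N x' \<times> {t. \<bar>t - a\<bar> < \<epsilon>})) (\<lambda>t. (x, t))"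
      by (rule continuous_map_into_subtopology) (use that near in auto)
    from continuous_map_comp[OF this \<sigma>c[OF that(1)]] show ?thesis .
  qed
  define \<theta> where "\<theta> x x' = ginv G (r x (x, a)) \<cdot> r x' (x, a)" for x x'
  have \<theta>: "\<theta> x x' \<in> arrows G" "E (\<theta> x x') = \<gamma> x x' a" if x: "x \<in> topspace X" "x' \<in> topspace X" "x \<in> N x'" for x x'
  proof -
    note 1 = ra[OF x(1) x(1) N(2)[OF x(1)]] and 2 = ra[OF x(2) x(2) x(3)]
    have xa: "(x, a) \<in> topspace Y" using x(1) a a1 by simp
    note cx = c[OF xa]
    show th: "\<theta> x x' \<in> arrows G" using 1 2 by (auto simp: \<theta>_def G.closed G.st)
    have s1: "ract \<beta> (c (x, a)) (E (r x (x, a))) = \<sigma> x (x, a)" by (rule r_lift[OF x(1) aV0[OF x(1) N(2)[OF x(1)]]])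
    have s2: "ract \<beta> (c (x, a)) (E (r x' (x, a))) = \<sigma> x' (x, a)" by (rule r_lift[OF x(2) aV0[OF x(2,3)]])
    have mul: "gmult G (r x (x, a)) (\<theta> x x') = r x' (x, a)" using 1 2 by (simp add: \<theta>_def G.mult_inv_cancel)
    have st: "src G (r x (x, a)) = tgt G (\<theta> x x')" using 1 2 by (simp add: \<theta>_def G.closed G.st)
    have "E (r x' (x, a)) = gmult Q (E (r x (x, a))) (E (\<theta> x x'))"
      using E_mult[OF 1(1) th st] mul by simp
    then have "ract \<beta> (\<sigma> x (x, a)) (E (\<theta> x x')) = \<sigma> x' (x, a)"
      using \<beta>.act_assoc[of "c (x, a)" "E (r x (x, a))" "E (\<theta> x x')"] s1 s2 cx 1 th st
      by (simp add: E_in E_src E_tgt)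
    moreover have "eps \<beta> (\<sigma> x (x, a)) = tgt Q (E (\<theta> x x'))"
      using \<beta>.act_eps[of "c (x, a)" "E (r x (x, a))"] s1 cx 1 th st by (simp add: E_in E_src E_tgt)
    ultimately show "E (\<theta> x x') = \<gamma> x x' a"
      using \<beta>.pdiv_eq[of "\<sigma> x (x, a)" "E (\<theta> x x')"] s_in(1)[OF x(1) N(2)[OF x(1)], of a] b th E_in
      unfolding \<gamma>_def by auto
  qed
  have "\<exists>\<phi>. continuous_map (top_of_set {a..b}) (Arr G) \<phi> \<and> \<phi> a = \<theta> x x' \<and> (\<forall>t\<in>{a..b}. E (\<phi> t) = \<gamma> x x' t)"
    if x: "x \<in> topspace X" "x' \<in> topspace X" "x \<in> N x'" for x x'
  proof (rule lift_path)
    show "continuous_map (top_of_set {a..b}) (Arr Q) (\<gamma> x x')" unfolding \<gamma>_def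
      by (rule \<beta>.cont_pdiv[OF \<sigma>_path[OF x(1) N(2)[OF x(1)]] \<sigma>_path[OF x(2,3)]])
        (use s_in[OF x(1) N(2)[OF x(1)]] s_in[OF x(2,3)] in auto)
  qed (use b \<theta>[OF x] in auto)
  then have "\<forall>x x'. \<exists>\<phi>. x \<in> topspace X \<longrightarrow> x' \<in> topspace X \<longrightarrow> x \<in> N x' \<longrightarrow>
      continuous_map (top_of_set {a..b}) (Arr G) \<phi> \<and> \<phi> a = \<theta> x x' \<and> (\<forall>t\<in>{a..b}. E (\<phi> t) = \<gamma> x x' t)" by blast
  then obtain \<phi> where \<phi>_all: "\<forall>x x'. x \<in> topspace X \<longrightarrow> x' \<in> topspace X \<longrightarrow> x \<in> N x' \<longrightarrow>
      continuous_map (top_of_set {a..b}) (Arr G) (\<phi> x x') \<and> \<phi> x x' a = \<theta> x x' \<and> (\<forall>t\<in>{a..b}. E (\<phi> x x' t) = \<gamma> x x' t)"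
    unfolding choice_iff by (elim exE)
  have \<phi>c: "continuous_map (top_of_set {a..b}) (Arr G) (\<phi> x x')" and \<phi>a: "\<phi> x x' a = \<theta> x x'"
    and \<phi>E: "\<And>t. t \<in> {a..b} \<Longrightarrow> E (\<phi> x x' t) = \<gamma> x x' t"
    if "x \<in> topspace X" "x' \<in> topspace X" "x \<in> N x'" for x x'
    using \<phi>_all[rule_format, OF that] by blast+
  \<comment> \<open>After time \<open>a\<close> nothing ties the lifts at different points together yet: over \<open>(x, t)\<close> an
    arbitrary lift \<open>rb\<close> of the section \<open>\<sigma> x\<close> centred at \<open>x\<close> itself is chosen, and the other charts are
    obtained from it by the lifted paths.\<close>
  define rb where "rb y = (if snd y \<le> a then r (fst y) y else (SOME g. g \<in> arrows G \<and> tgt G g = eps \<beta> (c y) \<and> ract \<beta> (c y) (E g) = \<sigma> (fst y) y))" for y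
  have rb: "rb (x, t) \<in> arrows G \<and> tgt G (rb (x, t)) = eps \<beta> (c (x, t)) \<and> ract \<beta> (c (x, t)) (E (rb (x, t))) = \<sigma> x (x, t)"
    if x: "x \<in> topspace X" "t \<in> {a..b}" for x t
  proof (cases "t \<le> a")
    case True
    then have "t = a" using x(2) by simp
    then show ?thesis using ra[OF x(1) x(1) N(2)[OF x(1)]] r_lift[OF x(1) aV0[OF x(1) N(2)[OF x(1)]]] by (simp add: rb_def)
  next
    case False
    note cx = c[OF inY[OF x]] and sx = s_in[OF x(1) N(2)[OF x(1)] x(2)]
    note d = \<beta>.pdiv[of "c (x, t)" "\<sigma> x (x, t)"]
    have d': "pdiv Q \<beta> (c (x, t)) (\<sigma> x (x, t)) \<in> arrows Q" "tgt Q (pdiv Q \<beta> (c (x, t)) (\<sigma> x (x, t))) = eps \<beta> (c (x, t))"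
      "ract \<beta> (c (x, t)) (pdiv Q \<beta> (c (x, t)) (\<sigma> x (x, t))) = \<sigma> x (x, t)"
      using d cx sx by auto
    have "pdiv Q \<beta> (c (x, t)) (\<sigma> x (x, t)) \<in> E ` arrows G" using d'(1) E_onto by simp
    then obtain h where h: "pdiv Q \<beta> (c (x, t)) (\<sigma> x (x, t)) = E h" "h \<in> arrows G" by (rule imageE)
    have "h \<in> arrows G \<and> tgt G h = eps \<beta> (c (x, t)) \<and> ract \<beta> (c (x, t)) (E h) = \<sigma> x (x, t)"
      using d' h E_tgt[of h] by simp
    from someI[of "\<lambda>g. g \<in> arrows G \<and> tgt G g = eps \<beta> (c (x, t)) \<and> ract \<beta> (c (x, t)) (E g) = \<sigma> x (x, t)", OF this]
    show ?thesis using False by (simp add: rb_def)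
  qed
  define R where "R x' y = (if snd y \<le> a then r x' y else rb y \<cdot> \<phi> (fst y) x' (snd y))" for x' y
  have \<phi>_in: "\<phi> x x' t \<in> arrows G" "tgt G (\<phi> x x' t) = src G (rb (x, t))"
    if x: "x \<in> topspace X" "x' \<in> topspace X" "x \<in> N x'" and t: "t \<in> {a..b}" for x x' t
  proof -
    show in': "\<phi> x x' t \<in> arrows G" using \<phi>c[OF x] t by (auto simp: continuous_map_def)
    note s1 = s_in[OF x(1) N(2)[OF x(1)] t] and s2 = s_in[OF x(2,3) t] and cx = c[OF inY[OF x(1) t]] and rbx = rb[OF x(1) t]
    have "tgt G (\<phi> x x' t) = tgt Q (\<gamma> x x' t)" using E_tgt[OF in'] \<phi>E[OF x t] by simp
    also have "\<dots> = eps \<beta> (\<sigma> x (x, t))" unfolding \<gamma>_def using s1 s2 by (intro \<beta>.pdiv) auto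
    also have "\<dots> = src G (rb (x, t))"
      using \<beta>.act_eps[of "c (x, t)" "E (rb (x, t))"] cx rbx by (simp add: E_in E_src E_tgt)
    finally show "tgt G (\<phi> x x' t) = src G (rb (x, t))" .
  qed
  have R_eq: "R x' (x, t) = rb (x, t) \<cdot> \<phi> x x' t"
    if x: "x \<in> topspace X" "x' \<in> topspace X" "x \<in> N x'" and t: "t \<in> {a..b}" for x x' t
  proof (cases "t \<le> a")
    case True
    then have ta: "t = a" using t by simp
    show ?thesis using ra[OF x(1) x(1) N(2)[OF x(1)]] ra[OF x(2) x(2) x(3)] \<phi>a[OF x]
      by (simp add: ta R_def rb_def \<theta>_def G.mult_inv_cancel)
  qed (simp add: R_def)
  define V1 where "V1 x = {y \<in> topspace Y. fst y \<in> N x \<and> a - \<delta> x < snd y \<and> snd y \<le> b}" for x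
  have R_valid: "R x' y \<in> arrows G \<and> tgt G (R x' y) = eps \<beta> (c y) \<and> ract \<beta> (c y) (E (R x' y)) = \<sigma> x' y"
    if x': "x' \<in> topspace X" and y: "y \<in> V1 x'" for x' y
  proof (cases "snd y \<le> a")
    case True
    then have yV: "y \<in> V0 (N x') (\<delta> x')" using y by (auto simp: V0_def V1_def)
    show ?thesis using chartD(2,3)[OF r_chart[OF x'] yV] r_lift[OF x' yV] True by (simp add: R_def)
  next
    case False
    obtain x t where xt: "y = (x, t)" by (cases y)
    have x: "x \<in> topspace X" "x' \<in> topspace X" "x \<in> N x'" and t: "t \<in> {a..b}"
      using y x' False by (auto simp: V1_def xt)
    note rbx = rb[OF x(1) t] and \<phi>x = \<phi>_in[OF x t] and cx = c[OF inY[OF x(1) t]]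
    have gQ: "\<gamma> x x' t \<in> arrows Q" "tgt Q (\<gamma> x x' t) = src G (rb (x, t))"
      using E_in[OF \<phi>x(1)] E_tgt[OF \<phi>x(1)] \<phi>E[OF x t] \<phi>x(2) by simp_all
    have "ract \<beta> (c y) (E (R x' y)) = ract \<beta> (\<sigma> x (x, t)) (\<gamma> x x' t)"
      using \<beta>.act_assoc[of "c (x, t)" "E (rb (x, t))" "E (\<phi> x x' t)"] rbx \<phi>x cx \<phi>E[OF x t] gQ
      by (simp add: xt R_eq[OF x t] E_mult E_in E_src E_tgt)
    also have "\<dots> = \<sigma> x' (x, t)"
      unfolding \<gamma>_def using s_in[OF x(1) N(2)[OF x(1)] t] s_in[OF x(2,3) t] by (intro \<beta>.pdiv) auto
    finally show ?thesis using rbx \<phi>x by (simp add: xt R_eq[OF x t] G.closed G.st)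
  qed
  have R_chart: "chart (V1 x) (R x)" if x: "x \<in> topspace X" for x
    unfolding chart_def
  proof (intro conjI ballI)
    have "V1 x \<subseteq> N x \<times> {t. \<bar>t - a\<bar> < \<epsilon>}"
      using \<delta>(2)[OF x] b(3) by (auto simp: V1_def abs_less_iff)
    from continuous_map_from_subtopology_mono[OF \<sigma>c[OF x] this]
    show "continuous_map (subtopology Y (V1 x)) (Tot \<beta>) (\<lambda>y. ract \<beta> (c y) (E (R x y)))"
      by (rule continuous_map_eq) (simp add: R_valid[OF x])
  qed (use R_valid[OF x] in \<open>auto simp: V1_def\<close>)
  have V1_open: "openin (subtopology Y (below b)) (V1 x)" if x: "x \<in> topspace X" for x
  proof -
    have "openin (top_of_set {0..1::real}) ({0..1} \<inter> {a - \<delta> x<..})" by (simp add: openin_open_Int)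
    then have "openin Y (N x \<times> ({0..1} \<inter> {a - \<delta> x<..}))" using N(1)[OF x] by (simp add: openin_prod_Times_iff)
    moreover have "V1 x = (N x \<times> ({0..1} \<inter> {a - \<delta> x<..})) \<inter> below b"
      using NX[OF x] by (auto simp: V1_def)
    ultimately show ?thesis unfolding openin_subtopology by blast
  qed
  have V1_V0: "V1 x \<inter> below a = V0 (N x) (\<delta> x)" for x using b by (auto simp: V0_def V1_def)
  have R_R: "compat (V1 x0) (R x0) (V1 x1) (R x1)" if x: "x0 \<in> topspace X" "x1 \<in> topspace X" for x0 x1
  proof -
    \<comment> \<open>The centre drops out after time \<open>a\<close>: the transition function is the quotient \<open>\<psi>\<close> of two
      lifted paths, hence for each \<open>v\<close> the lift of \<open>pdiv (\<sigma> x0) (\<sigma> x1)\<close> with the right initial value.\<close>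
    let ?S = "V1 x0 \<inter> V1 x1"
    let ?f = "\<lambda>y. ginv G (R x0 y) \<cdot> R x1 y"
    define W where "W = N x0 \<inter> N x1"
    have WX: "W \<subseteq> topspace X" using NX[OF x(1)] by (auto simp: W_def)
    have w: "w \<in> topspace X" "w \<in> N x0" "w \<in> N x1" if "w \<in> W" for w using that WX by (auto simp: W_def)
    have "continuous_map (subtopology Y ?S) (Arr G) (\<lambda>y. if snd y \<le> a then ?f y else ?f y)"
    proof (rule continuous_map_cases_le)
      have "continuous_map Y (top_of_set {0..1::real}) snd" by (rule continuous_map_snd)
      then show "continuous_map (subtopology Y ?S) euclideanreal snd"
        using continuous_map_into_fulltopology by (blast intro: continuous_map_from_subtopology)
      show "continuous_map (subtopology Y ?S) euclideanreal (\<lambda>_. a)" by simp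
      have "compat (V0 (N x0) (\<delta> x0)) (R x0) (V0 (N x1) (\<delta> x1)) (R x1)"
        by (rule compat_cong[OF r_r[OF x]]) (auto simp: R_def V0_def)
      moreover have "subtopology (subtopology Y ?S) {y \<in> topspace (subtopology Y ?S). snd y \<le> a} =
          subtopology Y (V0 (N x0) (\<delta> x0) \<inter> V0 (N x1) (\<delta> x1))"
        unfolding subtopology_subtopology V1_V0[symmetric]
        by (intro arg_cong[of _ _ "subtopology Y"]) (auto simp: V1_def)
      ultimately show "continuous_map (subtopology (subtopology Y ?S) {y \<in> topspace (subtopology Y ?S). snd y \<le> a}) (Arr G) ?f"
        by (simp add: compat_def)
      have "{y \<in> topspace (subtopology Y ?S). a \<le> snd y} = W \<times> {a..b}"
        using WX a b \<delta>(1)[OF x(1)] \<delta>(1)[OF x(2)] by (auto simp: V1_def W_def)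
      moreover have "?S \<inter> (W \<times> {a..b}) = W \<times> {a..b}"
        using WX a b \<delta>(1)[OF x(1)] \<delta>(1)[OF x(2)] by (auto simp: V1_def W_def)
      moreover have "subtopology Y (W \<times> {a..b}) = prod_topology (subtopology X W) (top_of_set {a..b})"
      proof -
        have "{0..1} \<inter> {a..b} = {a..b}" using a b by auto
        then have "subtopology (top_of_set {0..1}) {a..b} = top_of_set {a..b}" by (simp only: subtopology_subtopology)
        then show ?thesis by (simp only: subtopology_Times)
      qed
      ultimately have eq: "subtopology (subtopology Y ?S) {y \<in> topspace (subtopology Y ?S). a \<le> snd y} =
          prod_topology (subtopology X W) (top_of_set {a..b})"
        by (simp add: subtopology_subtopology)
      have cs: "continuous_map (prod_topology (subtopology X W) (top_of_set {a..b})) (Tot \<beta>) (\<sigma> x')"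
        if x': "x' \<in> topspace X" "W \<subseteq> N x'" for x'
      proof -
        have "continuous_map (prod_topology (subtopology X W) (top_of_set {a..b})) Y (\<lambda>y. y)"
        proof -
          have "continuous_map (subtopology Y (W \<times> {a..b})) Y (\<lambda>y. y)" by (simp add: continuous_map_from_subtopology)
          then show ?thesis using \<open>subtopology Y (W \<times> {a..b}) = _\<close> by simp
        qed
        then have "continuous_map (prod_topology (subtopology X W) (top_of_set {a..b})) (subtopology Y (N x' \<times> {t. \<bar>t - a\<bar> < \<epsilon>})) (\<lambda>y. y)"
          by (rule continuous_map_into_subtopology) (use x'(2) near in auto)
        from continuous_map_comp[OF this \<sigma>c[OF x'(1)]] show ?thesis .
      qed
      define \<psi> where "\<psi> y = ginv G (\<phi> (fst y) x0 (snd y)) \<cdot> \<phi> (fst y) x1 (snd y)" for y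
      have "continuous_map (prod_topology (subtopology X W) (top_of_set {a..b})) (Arr G) \<psi>"
      proof (rule lift_family_cont)
        show "continuous_map (prod_topology (subtopology X W) (top_of_set {a..b})) (Arr Q) (\<lambda>y. pdiv Q \<beta> (\<sigma> x0 y) (\<sigma> x1 y))"
          by (rule \<beta>.cont_pdiv[OF cs[OF x(1)] cs[OF x(2)]])
            (use s_in[OF x(1)] s_in[OF x(2)] in \<open>auto simp: W_def\<close>)
        fix v assume "v \<in> topspace (subtopology X W)"
        then have v: "v \<in> topspace X" "v \<in> N x0" "v \<in> N x1" using w by auto
        show "continuous_map (top_of_set {a..b}) (Arr G) (\<lambda>t. \<psi> (v, t))" unfolding \<psi>_def fst_conv snd_conv
          by (rule G.cont_div[OF \<phi>c[OF v(1) x(1) v(2)] \<phi>c[OF v(1) x(2) v(3)]])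
            (use \<phi>_in(2)[OF v(1) x(1) v(2)] \<phi>_in(2)[OF v(1) x(2) v(3)] in auto)
        fix t assume t: "t \<in> {a..b}"
        note sv = s_in[OF v(1) N(2)[OF v(1)] t] and s0 = s_in[OF x(1) v(2) t] and s1 = s_in[OF x(2) v(3) t]
        have d0: "pdiv Q \<beta> (\<sigma> v (v, t)) (\<sigma> x0 (v, t)) \<in> arrows Q" "src Q (pdiv Q \<beta> (\<sigma> v (v, t)) (\<sigma> x0 (v, t))) = eps \<beta> (\<sigma> x0 (v, t))"
          using sv s0 by (intro \<beta>.pdiv; simp)+
        have d1: "pdiv Q \<beta> (\<sigma> x0 (v, t)) (\<sigma> x1 (v, t)) \<in> arrows Q" "tgt Q (pdiv Q \<beta> (\<sigma> x0 (v, t)) (\<sigma> x1 (v, t))) = eps \<beta> (\<sigma> x0 (v, t))"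
          using s0 s1 by (intro \<beta>.pdiv; simp)+
        have "E (\<psi> (v, t)) = gmult Q (ginv Q (\<gamma> v x0 t)) (\<gamma> v x1 t)"
          unfolding \<psi>_def fst_conv snd_conv
          using E_div[of "\<phi> v x0 t" "\<phi> v x1 t"] \<phi>_in[OF v(1) x(1) v(2) t] \<phi>_in[OF v(1) x(2) v(3) t]
            \<phi>E[OF v(1) x(1) v(2) t] \<phi>E[OF v(1) x(2) v(3) t] by simp
        also have "\<gamma> v x1 t = gmult Q (\<gamma> v x0 t) (pdiv Q \<beta> (\<sigma> x0 (v, t)) (\<sigma> x1 (v, t)))"
          unfolding \<gamma>_def using sv s0 s1 by (intro \<beta>.pdiv_mult[symmetric]) auto
        also have "gmult Q (ginv Q (\<gamma> v x0 t)) (gmult Q (\<gamma> v x0 t) (pdiv Q \<beta> (\<sigma> x0 (v, t)) (\<sigma> x1 (v, t)))) =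
            pdiv Q \<beta> (\<sigma> x0 (v, t)) (\<sigma> x1 (v, t))"
          unfolding \<gamma>_def by (rule Q.inv_mult_cancel) (simp_all add: d0 d1)
        finally show "E (\<psi> (v, t)) = pdiv Q \<beta> (\<sigma> x0 (v, t)) (\<sigma> x1 (v, t))" .
      next
        have "continuous_map (subtopology X W) Y (\<lambda>v. (v, a))"
          using a a1 by (intro continuous_map_pairedI) (auto simp: continuous_map_from_subtopology)
        then have "continuous_map (subtopology X W) (subtopology Y (V0 (N x0) (\<delta> x0) \<inter> V0 (N x1) (\<delta> x1))) (\<lambda>v. (v, a))"
          by (rule continuous_map_into_subtopology) (use aV0[OF x(1)] aV0[OF x(2)] in \<open>auto simp: W_def\<close>)
        from continuous_map_comp[OF this r_r[OF x, unfolded compat_def]]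
        have "continuous_map (subtopology X W) (Arr G) (\<lambda>v. ginv G (r x0 (v, a)) \<cdot> r x1 (v, a))" .
        then show "continuous_map (subtopology X W) (Arr G) (\<lambda>v. \<psi> (v, a))"
        proof (rule continuous_map_eq)
          fix v assume "v \<in> topspace (subtopology X W)"
          then have v: "v \<in> topspace X" "v \<in> N x0" "v \<in> N x1" using w by auto
          note 0 = ra[OF v(1) v(1) N(2)[OF v(1)]] and 1 = ra[OF x(1) x(1) v(2)] and 2 = ra[OF x(2) x(2) v(3)]
          have "\<psi> (v, a) = ginv G (ginv G (r v (v, a)) \<cdot> r x0 (v, a)) \<cdot> (ginv G (r v (v, a)) \<cdot> r x1 (v, a))"
            by (simp add: \<psi>_def \<phi>a[OF v(1) x(1) v(2)] \<phi>a[OF v(1) x(2) v(3)] \<theta>_def)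
          then show "ginv G (r x0 (v, a)) \<cdot> r x1 (v, a) = \<psi> (v, a)"
            using G.div_inv[of "r v (v, a)" "r x0 (v, a)"] G.div_trans[of "r x0 (v, a)" "r v (v, a)" "r x1 (v, a)"] 0 1 2 by simp
        qed
      qed (use b in auto)
      then show "continuous_map (subtopology (subtopology Y ?S) {y \<in> topspace (subtopology Y ?S). a \<le> snd y}) (Arr G) ?f"
        unfolding eq
      proof (rule continuous_map_eq)
        fix y assume "y \<in> topspace (prod_topology (subtopology X W) (top_of_set {a..b}))"
        then obtain v t where y: "y = (v, t)" "v \<in> W" "t \<in> {a..b}" by (cases y) auto
        note v = w[OF y(2)]
        have m: "rb (v, t) \<in> arrows G" using rb[OF v(1) y(3)] by blast
        note p0 = \<phi>_in[OF v(1) x(1) v(2) y(3)] and p1 = \<phi>_in[OF v(1) x(2) v(3) y(3)]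
        have "?f y = (ginv G (\<phi> v x0 t) \<cdot> ginv G (rb (v, t))) \<cdot> (rb (v, t) \<cdot> \<phi> v x1 t)"
          using m p0 by (simp add: y(1) R_eq[OF v(1) x(1) v(2) y(3)] R_eq[OF v(1) x(2) v(3) y(3)] G.inv_mult)
        also have "\<dots> = \<psi> y"
          using m p0 p1 by (simp add: \<psi>_def y(1) G.assoc G.closed G.st G.inv_mult_cancel)
        finally show "\<psi> y = ?f y" by simp
      qed
    qed simp
    then show ?thesis unfolding compat_def by simp
  qed
  \<comment> \<open>The old charts are open only relative to \<open>t \<le> a\<close> and therefore are cut down to \<open>t < a\<close>; the
    frontier \<open>t = a\<close> is covered by the new ones.\<close>
  define \<R>' where "\<R>' = {(U \<inter> {y. snd y < a}, \<rho>) |U \<rho>. (U, \<rho>) \<in> \<R>} \<union> {(V1 x, R x) |x. x \<in> topspace X}"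
  have R_old: "compat (V1 x) (R x) (U \<inter> {y. snd y < a}) \<rho>" if x: "x \<in> topspace X" "(U, \<rho>) \<in> \<R>" for x U \<rho>
  proof -
    have "compat (V0 (N x) (\<delta> x)) (R x) (U \<inter> {y. snd y < a}) \<rho>"
      by (rule compat_subset[OF compat_cong[OF r_compat[OF x]]]) (auto simp: R_def V0_def)
    moreover have "V1 x \<inter> (U \<inter> {y. snd y < a}) = V0 (N x) (\<delta> x) \<inter> (U \<inter> {y. snd y < a})"
      unfolding V1_V0[symmetric] by auto
    ultimately show ?thesis by (simp add: compat_def)
  qed
  have old_chart: "chart (U \<inter> {y. snd y < a}) \<rho>" if "(U, \<rho>) \<in> \<R>" for U \<rho>
    by (rule chart_subset[OF chart_old(1)[OF that]]) auto
  have "atlas_upto b \<R>'" unfolding atlas_upto_def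
  proof (intro conjI allI impI ballI)
    fix V r' assume "(V, r') \<in> \<R>'"
    then consider (old) U where "V = U \<inter> {y. snd y < a}" "(U, r') \<in> \<R>" | (new) x where "V = V1 x" "r' = R x" "x \<in> topspace X"
      unfolding \<R>'_def by blast
    then show "chart V r'"
    proof cases
      case old then show ?thesis using old_chart by simp
    next
      case new then show ?thesis using R_chart by simp
    qed
  next
    fix V r' assume "(V, r') \<in> \<R>'"
    then consider (old) U where "V = U \<inter> {y. snd y < a}" "(U, r') \<in> \<R>" | (new) x where "V = V1 x" "r' = R x" "x \<in> topspace X"
      unfolding \<R>'_def by blast
    then show "openin (subtopology Y (below b)) V"
    proof cases
      case old
      obtain O' where O': "openin Y O'" "U = O' \<inter> below a" using chart_old(2)[OF old(2)] unfolding openin_subtopology by blast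
      have "openin (top_of_set {0..1::real}) ({0..1} \<inter> {..<a})" by (simp add: openin_open_Int)
      then have "openin Y (topspace X \<times> ({0..1} \<inter> {..<a}))" by (simp add: openin_prod_Times_iff)
      then have "openin Y (O' \<inter> (topspace X \<times> ({0..1} \<inter> {..<a})))" using O'(1) by blast
      moreover have "V = (O' \<inter> (topspace X \<times> ({0..1} \<inter> {..<a}))) \<inter> below b"
        using openin_subset[OF O'(1)] O'(2) old(1) b by auto
      ultimately show ?thesis unfolding openin_subtopology by blast
    next
      case new then show ?thesis using V1_open by simp
    qed
  next
    fix V r1 V' r2 assume "(V, r1) \<in> \<R>'" and "(V', r2) \<in> \<R>'"
    then consider (oo) U U' where "V = U \<inter> {y. snd y < a}" "(U, r1) \<in> \<R>" "V' = U' \<inter> {y. snd y < a}" "(U', r2) \<in> \<R>"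
      | (on) U x where "V = U \<inter> {y. snd y < a}" "(U, r1) \<in> \<R>" "V' = V1 x" "r2 = R x" "x \<in> topspace X"
      | (no) U x where "V' = U \<inter> {y. snd y < a}" "(U, r2) \<in> \<R>" "V = V1 x" "r1 = R x" "x \<in> topspace X"
      | (nn) x x' where "V = V1 x" "r1 = R x" "x \<in> topspace X" "V' = V1 x'" "r2 = R x'" "x' \<in> topspace X"
      unfolding \<R>'_def by blast
    then show "compat V r1 V' r2"
    proof cases
      case oo then show ?thesis using compat_subset[OF compat_old[OF oo(2,4)]] by blast
    next
      case on then show ?thesis using compat_sym[OF R_chart[OF on(5)] old_chart[OF on(2)] R_old[OF on(5,2)]] by simp
    next
      case no then show ?thesis using R_old[OF no(5,2)] by simp
    next
      case nn then show ?thesis using R_R[OF nn(3,6)] by simp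
    qed
  next
    fix y assume y: "y \<in> topspace Y" "snd y \<le> b"
    show "\<exists>V r. (V, r) \<in> \<R>' \<and> y \<in> V"
    proof (cases "snd y < a")
      case True
      then obtain U \<rho> where "(U, \<rho>) \<in> \<R>" "y \<in> U" using A y(1) unfolding atlas_upto_def by (metis less_imp_le)
      then show ?thesis using True by (intro exI[of _ "U \<inter> {y. snd y < a}"] exI[of _ \<rho>]) (auto simp: \<R>'_def)
    next
      case False
      have "fst y \<in> topspace X" using y(1) by auto
      then show ?thesis using False y N(2) \<delta>(1)[of "fst y"]
        by (intro exI[of _ "V1 (fst y)"] exI[of _ "R (fst y)"]) (auto simp: \<R>'_def V1_def)
    qed
  qed
  moreover have "compat U \<rho> V r0" if V: "chart V r0" "V \<subseteq> below a" "\<forall>U \<rho>. (U, \<rho>) \<in> \<R> \<longrightarrow> compat U \<rho> V r0"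
    and U: "(U, \<rho>) \<in> \<R>'" for V r0 U \<rho>
  proof -
    consider (old) U' where "U = U' \<inter> {y. snd y < a}" "(U', \<rho>) \<in> \<R>" | (new) x where "U = V1 x" "\<rho> = R x" "x \<in> topspace X"
      using U unfolding \<R>'_def by blast
    then show ?thesis
    proof cases
      case old
      then show ?thesis using compat_subset[OF V(3)[rule_format, OF old(2)]] by blast
    next
      case new
      have "compat (V0 (N x) (\<delta> x)) (r x) V r0"
        by (rule compat_trans[OF r_chart[OF new(3)] V(1) A _ r_compat[OF new(3)] V(3)[rule_format]]) (auto simp: V0_def)
      then have "compat (V0 (N x) (\<delta> x)) (R x) V r0" by (rule compat_cong) (auto simp: R_def V0_def)
      moreover have "V1 x \<inter> V = V0 (N x) (\<delta> x) \<inter> V" using V(2) unfolding V1_V0[symmetric] by auto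
      ultimately show ?thesis by (simp add: compat_def new)
    qed
  qed
  ultimately show ?thesis by blast
qed

lemma extend_atlas:
  assumes A: "atlas_upto 0 \<R>0"
  shows "\<exists>\<R>. atlas_upto 1 \<R> \<and> (\<forall>V r U \<rho>. (V, r) \<in> \<R>0 \<longrightarrow> (U, \<rho>) \<in> \<R> \<longrightarrow> compat U \<rho> V r)"
proof -
  from uniform_slabs obtain \<epsilon> where \<epsilon>: "\<epsilon> > 0" and slabs: "\<forall>x\<in>topspace X. \<forall>s\<in>{0..1}. \<exists>N \<sigma>. openin X N \<and> x \<in> N \<and>
    continuous_map (subtopology Y (N \<times> {t. \<bar>t - s\<bar> < \<epsilon>})) (Tot \<beta>) \<sigma> \<and>
    (\<forall>y\<in>topspace Y. fst y \<in> N \<longrightarrow> \<bar>snd y - s\<bar> < \<epsilon> \<longrightarrow> proj \<beta> (\<sigma> y) = y)" by (elim exE conjE)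
  define good where "good a \<R> \<longleftrightarrow> atlas_upto a \<R> \<and> (\<forall>V r U \<rho>. (V, r) \<in> \<R>0 \<longrightarrow> (U, \<rho>) \<in> \<R> \<longrightarrow> compat U \<rho> V r)" for a \<R>
  have init: "chart V r" "V \<subseteq> below 0" if "(V, r) \<in> \<R>0" for V r
  proof -
    have "chart V r" "openin (subtopology Y (below 0)) V" using A that unfolding atlas_upto_def by blast+
    then show "chart V r" "V \<subseteq> below 0" unfolding openin_subtopology by auto
  qed
  have "\<exists>\<R>. good (min 1 (real k * (\<epsilon> / 2))) \<R>" for k
  proof (induction k)
    case 0
    have "good 0 \<R>0" unfolding good_def using A unfolding atlas_upto_def by blast
    then show ?case by (intro exI[of _ \<R>0]) simp
  next
    case (Suc k)
    define a where "a = min 1 (real k * (\<epsilon> / 2))"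
    define b where "b = min 1 (real (Suc k) * (\<epsilon> / 2))"
    obtain \<R> where \<R>: "good a \<R>" using Suc.IH unfolding a_def by blast
    have a: "0 \<le> a" "a \<le> 1" using \<epsilon> by (auto simp: a_def)
    show ?case
    proof (cases "a = 1")
      case True
      then have "b = a" unfolding a_def b_def using \<epsilon> by (auto simp: min_def algebra_simps split: if_splits)
      then show ?thesis using \<R> unfolding b_def by auto
    next
      case False
      then have ab: "a < b" "b \<le> 1" "b < a + \<epsilon>" using a \<epsilon> by (auto simp: a_def b_def min_def algebra_simps split: if_splits)
      have At: "atlas_upto a \<R>" and Ac: "\<forall>V r U \<rho>. (V, r) \<in> \<R>0 \<longrightarrow> (U, \<rho>) \<in> \<R> \<longrightarrow> compat U \<rho> V r"
        using \<R> by (auto simp: good_def)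
      have "\<forall>x\<in>topspace X. \<exists>N \<sigma>. openin X N \<and> x \<in> N \<and>
        continuous_map (subtopology Y (N \<times> {t. \<bar>t - a\<bar> < \<epsilon>})) (Tot \<beta>) \<sigma> \<and>
        (\<forall>y\<in>topspace Y. fst y \<in> N \<longrightarrow> \<bar>snd y - a\<bar> < \<epsilon> \<longrightarrow> proj \<beta> (\<sigma> y) = y)"
        using slabs a by simp
      from atlas_step[OF At a(1) ab this]
      obtain \<R>' where R': "atlas_upto b \<R>'" "\<forall>V r. chart V r \<longrightarrow> V \<subseteq> below a \<longrightarrow>
        (\<forall>U \<rho>. (U, \<rho>) \<in> \<R> \<longrightarrow> compat U \<rho> V r) \<longrightarrow> (\<forall>U \<rho>. (U, \<rho>) \<in> \<R>' \<longrightarrow> compat U \<rho> V r)" by (elim exE conjE)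
      have "compat U \<rho> V r" if "(V, r) \<in> \<R>0" "(U, \<rho>) \<in> \<R>'" for V r U \<rho>
      proof -
        have "V \<subseteq> below a" using init(2)[OF that(1)] a(1) by auto
        moreover have "\<forall>U \<rho>. (U, \<rho>) \<in> \<R> \<longrightarrow> compat U \<rho> V r" using Ac that(1) by blast
        ultimately show ?thesis using R'(2)[rule_format, OF init(1)[OF that(1)]] that(2) by simp
      qed
      then have "good b \<R>'" using R'(1) unfolding good_def by blast
      then show ?thesis unfolding b_def by blast
    qed
  qed
  moreover obtain k :: nat where "2 / \<epsilon> \<le> real k" using real_arch_simple by blast
  then have "min 1 (real k * (\<epsilon> / 2)) = 1" using \<epsilon> by (simp add: field_simps)
  ultimately have "\<exists>\<R>. good 1 \<R>" by metis
  then show ?thesis unfolding good_def .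
qed

end

section \<open>Germs\<close>

lemma germ_eqI:
  assumes "openin X W" "x \<in> W" "\<And>y. y \<in> W \<Longrightarrow> f y = g y"
  shows "germ X x f = germ X x g"
proof -
  have "(\<exists>V. openin X V \<and> x \<in> V \<and> (\<forall>y\<in>V. h y = f y)) \<longleftrightarrow> (\<exists>V. openin X V \<and> x \<in> V \<and> (\<forall>y\<in>V. h y = g y))" for h
  proof
    assume "\<exists>V. openin X V \<and> x \<in> V \<and> (\<forall>y\<in>V. h y = f y)"
    then obtain V where "openin X V" "x \<in> V" "\<forall>y\<in>V. h y = f y" by blast
    then show "\<exists>V. openin X V \<and> x \<in> V \<and> (\<forall>y\<in>V. h y = g y)" using assms by (intro exI[of _ "V \<inter> W"]) auto
  next
    assume "\<exists>V. openin X V \<and> x \<in> V \<and> (\<forall>y\<in>V. h y = g y)"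
    then obtain V where "openin X V" "x \<in> V" "\<forall>y\<in>V. h y = g y" by blast
    then show "\<exists>V. openin X V \<and> x \<in> V \<and> (\<forall>y\<in>V. h y = f y)" using assms by (intro exI[of _ "V \<inter> W"]) auto
  qed
  then show ?thesis by (simp add: germ_def)
qed

lemma germ_eqD:
  assumes "x \<in> topspace X" "germ X x f = germ X x g"
  shows "\<exists>W. openin X W \<and> x \<in> W \<and> (\<forall>y\<in>W. f y = g y)"
proof -
  have "f \<in> snd (germ X x f)" using assms(1) by (auto simp: germ_def)
  then have "f \<in> snd (germ X x g)" using assms(2) by simp
  then show ?thesis by (simp add: germ_def)
qed

lemma fst_germ [simp]: "fst (germ X x f) = x" by (simp add: germ_def)

lemma germ_rep:
  assumes "x \<in> topspace X"
  shows "\<exists>W. openin X W \<and> x \<in> W \<and> (\<forall>y\<in>W. germ_rep (germ X x f) y = f y)"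
proof -
  have "f \<in> snd (germ X x f)" using assms by (auto simp: germ_def)
  then have "germ_rep (germ X x f) \<in> snd (germ X x f)" unfolding germ_rep_def by (rule someI[of "\<lambda>h. h \<in> snd (germ X x f)"])
  then show ?thesis by (simp add: germ_def)
qed

text \<open>The representatives that are used in \<open>germ_comp\<close> agree with \<open>f\<close> and \<open>g\<close> near \<open>x\<close> and \<open>f x\<close>, and \<open>f\<close> maps points
  near \<open>x\<close> to points near \<open>f x\<close>.\<close>

lemma germ_comp_germ:
  assumes W: "openin X W" "x \<in> W" and f: "continuous_map (subtopology X W) X f"
  shows "germ_comp X (germ X (f x) g) (germ X x f) = germ X x (g \<circ> f)"
proof -
  have x: "x \<in> topspace X" using W openin_subset by blast
  then have fx: "f x \<in> topspace X" using f W(2) by (auto simp: continuous_map_def Pi_iff)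
  obtain V where V: "openin X V" "x \<in> V" "\<forall>y\<in>V. germ_rep (germ X x f) y = f y" using germ_rep[OF x, of f] by (elim exE conjE)
  obtain V' where V': "openin X V'" "f x \<in> V'" "\<forall>y\<in>V'. germ_rep (germ X (f x) g) y = g y" using germ_rep[OF fx, of g] by (elim exE conjE)
  have "openin X (V \<inter> (W \<inter> f -` V'))" using openin_preimage_on[OF W(1) f V'(1)] V(1) by (simp add: openin_Int)
  then show ?thesis unfolding germ_comp_def germ_src_def fst_germ
    by (rule germ_eqI) (use V V' W in auto)
qed

section \<open>Quotient groupoids\<close>

text \<open>Being open, \<open>E\<close> and \<open>E \<times> E\<close> restricted to composable pairs are quotient maps, so the structure maps of \<open>Q\<close>
  are continuous because those of \<open>G\<close> are.\<close>

lemma quotient_groupoid_topological: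
  fixes G :: "('o, 'a, 'z) groupoid_scheme" and Q :: "('o, 'b, 'w) groupoid_scheme" and E :: "'a \<Rightarrow> 'b"
  assumes G: "topological_groupoid G" and Obj_Q: "Obj Q = Obj G"
    and src: "\<And>g. g \<in> arrows G \<Longrightarrow> src Q (E g) = src G g" and tgt: "\<And>g. g \<in> arrows G \<Longrightarrow> tgt Q (E g) = tgt G g"
    and mult: "\<And>g h. g \<in> arrows G \<Longrightarrow> h \<in> arrows G \<Longrightarrow> src G g = tgt G h \<Longrightarrow> gmult Q (E g) (E h) = E (gmult G g h)"
    and inv: "\<And>g. g \<in> arrows G \<Longrightarrow> ginv Q (E g) = E (ginv G g)"
    and unit: "\<And>x. x \<in> objects G \<Longrightarrow> gunit Q x = E (gunit G x)"
    and E: "continuous_map (Arr G) (Arr Q) E" and E_open: "open_map (Arr G) (Arr Q) E" and E_onto: "E ` arrows G = arrows Q"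
  shows "topological_groupoid Q"
proof -
  interpret top_groupoid G by unfold_locales (rule G)
  have qE: "quotient_map (Arr G) (Arr Q) E" by (rule continuous_open_imp_quotient_map[OF E E_open E_onto])
  have cmap: "continuous_map (Arr Q) Z f" if "continuous_map (Arr G) Z (\<lambda>g. f (E g))" for Z :: "'c topology" and f
    using continuous_compose_quotient_map[OF qE, of Z f] that by (simp add: o_def)
  have arr: "\<exists>g\<in>arrows G. q = E g" if "q \<in> arrows Q" for q using that E_onto by blast
  have c1: "continuous_map (Arr Q) (Obj Q) (src Q)" unfolding Obj_Q
    by (rule cmap, rule continuous_map_eq[OF src_cont]) (simp add: src)
  have c2: "continuous_map (Arr Q) (Obj Q) (tgt Q)" unfolding Obj_Q
    by (rule cmap, rule continuous_map_eq[OF tgt_cont]) (simp add: tgt)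
  have c3: "continuous_map (Arr Q) (Arr Q) (ginv Q)"
    by (rule cmap, rule continuous_map_eq[OF continuous_map_comp[OF inv_cont E]]) (simp add: inv)
  have c4: "continuous_map (Obj Q) (Arr Q) (gunit Q)" unfolding Obj_Q
    by (rule continuous_map_eq[OF continuous_map_comp[OF unit_cont E]]) (simp add: unit)
  let ?X = "subtopology (prod_topology (Arr G) (Arr G)) (composable G)"
  let ?X' = "subtopology (prod_topology (Arr Q) (Arr Q)) (composable Q)"
  let ?E = "\<lambda>z. (E (fst z), E (snd z))"
  have E_in: "E g \<in> arrows Q" if "g \<in> arrows G" for g using that E_onto by blast
  have open2: "open_map (prod_topology (Arr G) (Arr G)) (prod_topology (Arr Q) (Arr Q)) ?E"
    unfolding open_map_def
  proof (intro allI impI)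
    fix S assume S: "openin (prod_topology (Arr G) (Arr G)) S"
    show "openin (prod_topology (Arr Q) (Arr Q)) (?E ` S)"
      unfolding openin_prod_topology_alt
    proof (intro allI impI)
      fix q q' assume "(q, q') \<in> ?E ` S"
      then obtain g g' where g: "(g, g') \<in> S" "q = E g" "q' = E g'" by auto
      from openin_prod_box[OF S g(1)]
      obtain U V where UV: "openin (Arr G) U" "openin (Arr G) V" "g \<in> U" "g' \<in> V" "U \<times> V \<subseteq> S" by (elim exE conjE)
      have "E ` U \<times> E ` V \<subseteq> ?E ` S"
      proof clarify
        fix u v assume "u \<in> U" "v \<in> V"
        then have "(u, v) \<in> S" using UV(5) by blast
        then show "(E u, E v) \<in> ?E ` S" by force
      qed
      moreover have "openin (Arr Q) (E ` U)" "openin (Arr Q) (E ` V)" using E_open UV(1,2) by (auto simp: open_map_def)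
      ultimately show "\<exists>U V. openin (Arr Q) U \<and> openin (Arr Q) V \<and> q \<in> U \<and> q' \<in> V \<and> U \<times> V \<subseteq> ?E ` S"
        using UV(3,4) g(2,3) by blast
    qed
  qed
  have pre: "{z \<in> topspace (prod_topology (Arr G) (Arr G)). ?E z \<in> composable Q} = composable G"
    by (auto simp: composable_def src tgt E_in)
  have o: "open_map ?X ?X' ?E" by (rule open_map_restriction[OF open2 pre])
  have "continuous_map ?X (prod_topology (Arr Q) (Arr Q)) ?E"
    by (intro continuous_map_pairedI continuous_map_comp[OF continuous_map_sub_fst E] continuous_map_comp[OF continuous_map_sub_snd E])
  then have c: "continuous_map ?X ?X' ?E"
    by (rule continuous_map_into_subtopology) (auto simp: composable_def src tgt E_in)
  have onto: "?E ` topspace ?X = topspace ?X'"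
  proof
    show "?E ` topspace ?X \<subseteq> topspace ?X'" using c by (rule continuous_map_image_subset_topspace)
    show "topspace ?X' \<subseteq> ?E ` topspace ?X"
    proof clarify
      fix q q' assume q: "(q, q') \<in> topspace ?X'"
      then obtain g g' where g: "g \<in> arrows G" "g' \<in> arrows G" "q = E g" "q' = E g'" using arr[of q] arr[of q'] by auto
      then have "(g, g') \<in> topspace ?X" using q by (auto simp: composable_def src tgt)
      then show "(q, q') \<in> ?E ` topspace ?X" using g by force
    qed
  qed
  have q2: "quotient_map ?X ?X' ?E" by (rule continuous_open_imp_quotient_map[OF c o onto])
  have "continuous_map ?X (Arr Q) ((\<lambda>(g, g'). gmult Q g g') \<circ> ?E)"
    by (rule continuous_map_eq[OF continuous_map_comp[OF mult_cont E]]) (auto simp: composable_def mult)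
  then have c5: "continuous_map ?X' (Arr Q) (\<lambda>(g, g'). gmult Q g g')" by (rule continuous_compose_quotient_map[OF q2])
  have comp: "(E g, E g') \<in> composable Q \<longleftrightarrow> src G g = tgt G g'" if "g \<in> arrows G" "g' \<in> arrows G" for g g'
    using that by (auto simp: composable_def src tgt E_in)
  have compE: "\<exists>g\<in>arrows G. \<exists>g'\<in>arrows G. q = E g \<and> q' = E g' \<and> src G g = tgt G g'" if q: "(q, q') \<in> composable Q" for q q'
  proof -
    obtain g g' where g: "g \<in> arrows G" "g' \<in> arrows G" "q = E g" "q' = E g'"
      using arr[of q] arr[of q'] q by (auto simp: composable_def)
    then show ?thesis using q comp by blast
  qed
  have a1: "src Q (gmult Q q q') = src Q q' \<and> tgt Q (gmult Q q q') = tgt Q q" if qq: "(q, q') \<in> composable Q" for q q'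
  proof -
    obtain g g' where "g \<in> arrows G" "g' \<in> arrows G" "q = E g" "q' = E g'" "src G g = tgt G g'"
      using compE[OF qq] by blast
    then show ?thesis by (simp add: mult src tgt closed st)
  qed
  have a2: "gmult Q (gmult Q q q') q'' = gmult Q q (gmult Q q' q'')"
    if q: "(q, q') \<in> composable Q" "(q', q'') \<in> composable Q" for q q' q''
  proof -
    obtain g where g: "g \<in> arrows G" "q = E g" using q arr by (auto simp: composable_def)
    obtain g' where g': "g' \<in> arrows G" "q' = E g'" using q arr by (auto simp: composable_def)
    obtain g'' where g'': "g'' \<in> arrows G" "q'' = E g''" using q arr by (auto simp: composable_def)
    have "src G g = tgt G g'" "src G g' = tgt G g''" using q comp g g' g'' by auto
    then show ?thesis using g g' g'' by (simp add: mult closed st assoc)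
  qed
  have a3: "src Q (gunit Q x) = x \<and> tgt Q (gunit Q x) = x" if "x \<in> objects Q" for x
    using that by (simp add: Obj_Q unit src tgt closed st)
  have a4: "gmult Q (gunit Q (tgt Q q)) q = q \<and> gmult Q q (gunit Q (src Q q)) = q" if qq: "q \<in> arrows Q" for q
  proof -
    obtain g where "g \<in> arrows G" "q = E g" using arr[OF qq] by blast
    then show ?thesis by (simp add: unit src tgt mult closed st unit_l unit_r)
  qed
  have a5: "src Q (ginv Q q) = tgt Q q \<and> tgt Q (ginv Q q) = src Q q \<and>
      gmult Q q (ginv Q q) = gunit Q (tgt Q q) \<and> gmult Q (ginv Q q) q = gunit Q (src Q q)" if qq: "q \<in> arrows Q" for q
  proof -
    obtain g where "g \<in> arrows G" "q = E g" using arr[OF qq] by blast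
    then show ?thesis by (simp add: unit src tgt mult inv closed st inv_l inv_r)
  qed
  show ?thesis unfolding topological_groupoid_def
    using c1 c2 c3 c4 c5 a1 a2 a3 a4 a5 by (intro conjI ballI allI impI) auto
qed

section \<open>The effect of an arrow\<close>

lemma mtop_obj_manifold [simp]: "mtop (obj_manifold G) = Obj G" and mtop_arr_manifold [simp]: "mtop (arr_manifold G) = Arr G"
  by (simp_all add: obj_manifold_def arr_manifold_def)

locale etale_groupoid = top_groupoid G for G :: "('o, 'a, 'z) lie_groupoid_scheme" +
  assumes etale: "etale_lie_groupoid G"
begin

lemma objM: "smooth_manifold (obj_manifold G)" and arrM: "smooth_manifold (arr_manifold G)"
  and src_local_diffeo: "local_diffeo (arr_manifold G) (obj_manifold G) (src G)"
  and tgt_local_diffeo: "local_diffeo (arr_manifold G) (obj_manifold G) (tgt G)"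
  using etale unfolding etale_lie_groupoid_def by simp_all

definition bisection :: "'a set \<Rightarrow> bool" where
  "bisection U \<longleftrightarrow> diffeo_on (arr_manifold G) U (obj_manifold G) (src G) \<and> diffeo_on (arr_manifold G) U (obj_manifold G) (tgt G)"

lemma bisectionD:
  assumes "bisection U"
  shows "openin (Arr G) U" "openin (Obj G) (src G ` U)" "openin (Obj G) (tgt G ` U)" "inj_on (src G) U" "inj_on (tgt G) U"
    "continuous_map (subtopology (Obj G) (src G ` U)) (Arr G) (inv_into U (src G))"
    "continuous_map (subtopology (Obj G) (tgt G ` U)) (Arr G) (inv_into U (tgt G))"
  using assms smooth_on_continuous[of "obj_manifold G" "src G ` U" "arr_manifold G" "inv_into U (src G)"]
    smooth_on_continuous[of "obj_manifold G" "tgt G ` U" "arr_manifold G" "inv_into U (tgt G)"]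
  unfolding bisection_def diffeo_on_def by simp_all

lemma bisection_subset: "bisection U \<Longrightarrow> openin (Arr G) U' \<Longrightarrow> U' \<subseteq> U \<Longrightarrow> bisection U'"
  unfolding bisection_def
  using diffeo_on_subset[OF arrM objM, of U "src G" U'] diffeo_on_subset[OF arrM objM, of U "tgt G" U'] by simp

lemma bisection_exists:
  assumes g: "g \<in> arrows G"
  shows "\<exists>U. bisection U \<and> g \<in> U"
proof -
  have "\<exists>W. g \<in> W \<and> diffeo_on (arr_manifold G) W (obj_manifold G) f"
    if "local_diffeo (arr_manifold G) (obj_manifold G) f" for f
    using that g unfolding local_diffeo_on_def diffeo_on_def by auto
  from this[OF src_local_diffeo] this[OF tgt_local_diffeo] obtain W W' where
    W: "g \<in> W" "diffeo_on (arr_manifold G) W (obj_manifold G) (src G)" and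
    W': "g \<in> W'" "diffeo_on (arr_manifold G) W' (obj_manifold G) (tgt G)" by (elim exE conjE)
  have "openin (Arr G) (W \<inter> W')" using W(2) W'(2) by (auto simp: diffeo_on_def)
  then have "bisection (W \<inter> W')" unfolding bisection_def
    using diffeo_on_subset[OF arrM objM W(2), of "W \<inter> W'"] diffeo_on_subset[OF arrM objM W'(2), of "W \<inter> W'"] by simp
  then show ?thesis using W(1) W'(1) by blast
qed

text \<open>The effect can be computed from any local section of the source map. With suitable sections this gives the
  effects of products, units and inverses.\<close>

lemma effect_section:
  assumes g: "g \<in> arrows G" and W: "openin (Obj G) W" "src G g \<in> W"
    and \<sigma>: "continuous_map (subtopology (Obj G) W) (Arr G) \<sigma>" "\<And>y. y \<in> W \<Longrightarrow> src G (\<sigma> y) = y" "\<sigma> (src G g) = g"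
  shows "effect G g = germ (Obj G) (src G g) (tgt G \<circ> \<sigma>)"
proof -
  define U where "U = (SOME U. openin (Arr G) U \<and> g \<in> U \<and> inj_on (src G) U \<and> inj_on (tgt G) U)"
  obtain U0 where U0: "bisection U0" "g \<in> U0" using bisection_exists[OF g] by blast
  have "openin (Arr G) U \<and> g \<in> U \<and> inj_on (src G) U \<and> inj_on (tgt G) U"
    unfolding U_def by (rule someI[of _ U0]) (use U0 bisectionD[OF U0(1)] in simp)
  then have U: "openin (Arr G) U" "g \<in> U" "inj_on (src G) U" by blast+
  have "openin (Obj G) (W \<inter> \<sigma> -` U)" by (rule openin_preimage_on[OF W(1) \<sigma>(1) U(1)])
  then have "germ (Obj G) (src G g) (tgt G \<circ> inv_into U (src G)) = germ (Obj G) (src G g) (tgt G \<circ> \<sigma>)"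
  proof (rule germ_eqI)
    show "src G g \<in> W \<inter> \<sigma> -` U" using W \<sigma>(3) U(2) by simp
    fix y assume y: "y \<in> W \<inter> \<sigma> -` U"
    then have "inv_into U (src G) (src G (\<sigma> y)) = \<sigma> y" using U(3) by (intro inv_into_f_f) auto
    then show "(tgt G \<circ> inv_into U (src G)) y = (tgt G \<circ> \<sigma>) y" using \<sigma>(2)[of y] y by simp
  qed
  then show ?thesis by (simp add: effect_def U_def)
qed

text \<open>The local diffeomorphism of the space of objects whose germs are the effects of the arrows in \<open>U\<close>.\<close>

definition \<tau> :: "'a set \<Rightarrow> 'o \<Rightarrow> 'o" where "\<tau> U = tgt G \<circ> inv_into U (src G)"

lemma \<tau>_src: "bisection U \<Longrightarrow> u \<in> U \<Longrightarrow> \<tau> U (src G u) = tgt G u"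
  using bisectionD(4) by (simp add: \<tau>_def)

lemma effect_bisection:
  assumes "bisection U" "u \<in> U"
  shows "effect G u = germ (Obj G) (src G u) (\<tau> U)"
  unfolding \<tau>_def
  by (rule effect_section[where W = "src G ` U"])
    (use assms bisectionD[OF assms(1)] openin_subset[of "Arr G" U] in \<open>auto simp: f_inv_into_f\<close>)

lemma \<tau>_diffeo: "bisection U \<Longrightarrow> diffeo_on (obj_manifold G) (src G ` U) (obj_manifold G) (\<tau> U)"
  unfolding \<tau>_def bisection_def by (intro diffeo_on_span[OF arrM objM objM]) auto

lemma \<tau>_cont: "bisection U \<Longrightarrow> continuous_map (subtopology (Obj G) (src G ` U)) (Obj G) (\<tau> U)"
  using \<tau>_diffeo[of U] smooth_on_continuous[of "obj_manifold G" "src G ` U" "obj_manifold G" "\<tau> U"]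
  by (simp add: diffeo_on_def)

abbreviation Q where "Q \<equiv> effect_groupoid G"
abbreviation E where "E \<equiv> effect G"

lemma Q_sel: "Obj Q = Obj G" "Arr Q = subtopology (germ_topology (obj_manifold G)) (E ` arrows G)"
  "src Q = germ_src" "tgt Q = germ_tgt" "gmult Q = germ_comp (Obj G)" "ginv Q = germ_inverse (Obj G)"
  "gunit Q = (\<lambda>x. germ (Obj G) x id)"
  by (simp_all add: effect_groupoid_def)

text \<open>The effects of the arrows in a bisection are the germs of one local diffeomorphism, so they form a basic
  open set of the sheaf topology.\<close>

lemma effect_image_open:
  assumes S: "openin (Arr G) S"
  shows "openin (germ_topology (obj_manifold G)) (E ` S)"
proof (subst openin_subopen, intro ballI)
  fix q assume "q \<in> E ` S"
  then obtain g where g: "g \<in> S" "q = E g" by blast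
  have "g \<in> arrows G" using g(1) openin_subset[OF S] by blast
  then obtain U where U: "bisection U" "g \<in> U" using bisection_exists by blast
  have US: "bisection (U \<inter> S)" by (rule bisection_subset[OF U(1)]) (use bisectionD(1)[OF U(1)] S in auto)
  have "E ` (U \<inter> S) = (\<lambda>y. germ (Obj G) y (\<tau> (U \<inter> S))) ` (src G ` (U \<inter> S))"
    using effect_bisection[OF US] by (auto simp: image_iff)
  moreover have "openin (germ_topology (obj_manifold G)) ((\<lambda>y. germ (Obj G) y (\<tau> (U \<inter> S))) ` (src G ` (U \<inter> S)))"
    unfolding germ_topology_def
    by (rule topology_generated_by_Basis)
      (use diffeo_on_imp_local_diffeo_on[OF \<tau>_diffeo[OF US]] bisectionD(2)[OF US] in auto)
  ultimately have "openin (germ_topology (obj_manifold G)) (E ` (U \<inter> S))" by simp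
  then show "\<exists>T. openin (germ_topology (obj_manifold G)) T \<and> q \<in> T \<and> T \<subseteq> E ` S"
    using g U(2) by (intro exI[of _ "E ` (U \<inter> S)"]) auto
qed

lemma arrows_Q: "arrows Q = E ` arrows G"
  using effect_image_open[of "arrows G"] openin_subset by (auto simp: Q_sel)

lemma effect_open: "open_map (Arr G) (Arr Q) E"
  unfolding open_map_def
proof (intro allI impI)
  fix S assume S: "openin (Arr G) S"
  have "E ` S = E ` S \<inter> E ` arrows G" using openin_subset[OF S] by blast
  then show "openin (Arr Q) (E ` S)"
    unfolding Q_sel openin_subtopology using effect_image_open[OF S] by blast
qed

lemma effect_cont: "continuous_map (Arr G) (Arr Q) E"
proof -
  have "continuous_map (Arr G) (germ_topology (obj_manifold G)) E"
    unfolding germ_topology_def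
  proof (rule continuous_on_generated_topo)
    fix B assume "B \<in> {(\<lambda>y. germ (mtop (obj_manifold G)) y f) ` V |V f.
        openin (mtop (obj_manifold G)) V \<and> local_diffeo_on (obj_manifold G) V (obj_manifold G) f}"
    then obtain V f where B: "B = (\<lambda>y. germ (Obj G) y f) ` V" and V: "openin (Obj G) V" by auto
    show "openin (Arr G) (E -` B \<inter> topspace (Arr G))"
    proof (subst openin_subopen, intro ballI)
      fix g assume g: "g \<in> E -` B \<inter> topspace (Arr G)"
      then obtain y where y: "y \<in> V" "E g = germ (Obj G) y f" by (auto simp: B)
      obtain U where U: "bisection U" "g \<in> U" using bisection_exists g by blast
      have Eg: "E g = germ (Obj G) (src G g) (\<tau> U)" by (rule effect_bisection[OF U])
      then have ys: "y = src G g" using y(2) by (metis fst_germ)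
      have "src G g \<in> topspace (Obj G)" using g by (simp add: src_in)
      moreover have "germ (Obj G) (src G g) (\<tau> U) = germ (Obj G) (src G g) f" using Eg y(2) ys by simp
      ultimately have "\<exists>W. openin (Obj G) W \<and> src G g \<in> W \<and> (\<forall>y\<in>W. \<tau> U y = f y)" by (rule germ_eqD)
      then obtain W where W: "openin (Obj G) W" "src G g \<in> W" "\<forall>y\<in>W. \<tau> U y = f y"
        by (elim exE conjE)
      define N where "N = U \<inter> {u \<in> topspace (Arr G). src G u \<in> W \<inter> V}"
      have "openin (Arr G) N" unfolding N_def
        using bisectionD(1)[OF U(1)] openin_preimage[OF src_cont, of "W \<inter> V"] W(1) V by (intro openin_Int) auto
      moreover have "g \<in> N" using U(2) g W(2) y ys by (simp add: N_def)
      moreover have "E u \<in> B" if u: "u \<in> N" for u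
      proof -
        have "E u = germ (Obj G) (src G u) (\<tau> U)" using u by (intro effect_bisection[OF U(1)]) (simp add: N_def)
        also have "\<dots> = germ (Obj G) (src G u) f" by (rule germ_eqI[OF W(1)]) (use u W(3) in \<open>auto simp: N_def\<close>)
        finally show ?thesis using u by (auto simp: B N_def)
      qed
      ultimately show "\<exists>T. openin (Arr G) T \<and> g \<in> T \<and> T \<subseteq> E -` B \<inter> topspace (Arr G)"
        by (intro exI[of _ N]) (auto simp: N_def)
    qed
  next
    have "E ` arrows G \<subseteq> topspace (germ_topology (obj_manifold G))"
      using effect_image_open[of "arrows G"] openin_subset by blast
    then show "E ` topspace (Arr G) \<subseteq> \<Union>{(\<lambda>y. germ (mtop (obj_manifold G)) y f) ` V |V f.
        openin (mtop (obj_manifold G)) V \<and> local_diffeo_on (obj_manifold G) V (obj_manifold G) f}"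
      unfolding germ_topology_def topology_generated_by_topspace .
  qed
  then show ?thesis unfolding Q_sel by (rule continuous_map_into_subtopology) auto
qed

lemma effect_src: "g \<in> arrows G \<Longrightarrow> src Q (E g) = src G g"
  using bisection_exists[of g] effect_bisection by (auto simp: Q_sel germ_src_def)

lemma effect_tgt:
  assumes g: "g \<in> arrows G"
  shows "tgt Q (E g) = tgt G g"
proof -
  obtain U where U: "bisection U" "g \<in> U" using bisection_exists[OF g] by blast
  have x: "src G g \<in> topspace (Obj G)" using g by (simp add: src_in)
  obtain W where W: "src G g \<in> W" "\<forall>y\<in>W. germ_rep (germ (Obj G) (src G g) (\<tau> U)) y = \<tau> U y"
    using germ_rep[OF x] by blast
  then have "germ_rep (germ (Obj G) (src G g) (\<tau> U)) (src G g) = tgt G g" using \<tau>_src[OF U] by simp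
  then show ?thesis by (simp add: Q_sel germ_tgt_def effect_bisection[OF U])
qed

text \<open>The product of the local sections of two bisections is a local section of the source map through the
  product arrow.\<close>

lemma effect_mult:
  assumes g: "g \<in> arrows G" and h: "h \<in> arrows G" and gh: "src G g = tgt G h"
  shows "gmult Q (E g) (E h) = E (gmult G g h)"
proof -
  obtain U where U: "bisection U" "g \<in> U" using bisection_exists[OF g] by blast
  obtain V where V: "bisection V" "h \<in> V" using bisection_exists[OF h] by blast
  note bU = bisectionD[OF U(1)] and bV = bisectionD[OF V(1)]
  define W where "W = src G ` V \<inter> \<tau> V -` (src G ` U)"
  have W: "openin (Obj G) W" unfolding W_def by (rule openin_preimage_on[OF bV(2) \<tau>_cont[OF V(1)] bU(2)])
  have hW: "src G h \<in> W" using V(2) imageI[OF U(2), of "src G"] \<tau>_src[OF V] gh by (simp add: W_def)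
  define \<sigma> where "\<sigma> y = gmult G (inv_into U (src G) (\<tau> V y)) (inv_into V (src G) y)" for y
  have iV: "inv_into V (src G) y \<in> V" "src G (inv_into V (src G) y) = y" if "y \<in> W" for y
    using that by (auto simp: W_def inv_into_into f_inv_into_f)
  have iU: "inv_into U (src G) (\<tau> V y) \<in> U" "src G (inv_into U (src G) (\<tau> V y)) = \<tau> V y" if "y \<in> W" for y
    using that by (auto simp: W_def inv_into_into f_inv_into_f)
  have m: "inv_into V (src G) y \<in> arrows G \<and> inv_into U (src G) (\<tau> V y) \<in> arrows G \<and>
      src G (inv_into U (src G) (\<tau> V y)) = tgt G (inv_into V (src G) y)" if "y \<in> W" for y
    using iU[OF that] iV[OF that] openin_subset[OF bU(1)] openin_subset[OF bV(1)] by (auto simp: \<tau>_def)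
  have cV: "continuous_map (subtopology (Obj G) W) (Arr G) (inv_into V (src G))"
    by (rule continuous_map_from_subtopology_mono[OF bV(6)]) (auto simp: W_def)
  have "continuous_map (subtopology (Obj G) W) (Obj G) (\<tau> V)"
    by (rule continuous_map_from_subtopology_mono[OF \<tau>_cont[OF V(1)]]) (auto simp: W_def)
  then have "continuous_map (subtopology (Obj G) W) (subtopology (Obj G) (src G ` U)) (\<tau> V)"
    by (rule continuous_map_into_subtopology) (auto simp: W_def)
  from continuous_map_comp[OF this bU(6)]
  have \<sigma>c: "continuous_map (subtopology (Obj G) W) (Arr G) \<sigma>"
    unfolding \<sigma>_def using cV by (rule cont_mult) (use m in auto)
  have "E (gmult G g h) = germ (Obj G) (src G (gmult G g h)) (tgt G \<circ> \<sigma>)"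
  proof (rule effect_section[OF _ W _ \<sigma>c])
    show "gmult G g h \<in> arrows G" using g h gh by (rule mult_in)
    have s: "src G (gmult G g h) = src G h" using g h gh by (rule src_mult)
    show "src G (gmult G g h) \<in> W" using s hW by simp
    show "src G (\<sigma> y) = y" if "y \<in> W" for y using m[OF that] iV[OF that] by (simp add: \<sigma>_def st)
    have "inv_into U (src G) (\<tau> V (src G h)) = g"
      using \<tau>_src[OF V] gh[symmetric] inv_into_f_f[OF bU(4) U(2)] by simp
    then show "\<sigma> (src G (gmult G g h)) = gmult G g h"
      using inv_into_f_f[OF bV(4) V(2)] by (simp add: s \<sigma>_def)
  qed
  also have "\<dots> = germ (Obj G) (src G h) (\<tau> U \<circ> \<tau> V)"
  proof -
    have "germ (Obj G) (src G h) (tgt G \<circ> \<sigma>) = germ (Obj G) (src G h) (\<tau> U \<circ> \<tau> V)"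
      by (rule germ_eqI[OF W hW]) (use m in \<open>simp add: \<sigma>_def st \<tau>_def[of U]\<close>)
    then show ?thesis using g h gh by (simp add: src_mult)
  qed
  also have "\<dots> = germ_comp (Obj G) (germ (Obj G) (\<tau> V (src G h)) (\<tau> U)) (germ (Obj G) (src G h) (\<tau> V))"
    by (rule germ_comp_germ[symmetric, OF bV(2) _ \<tau>_cont[OF V(1)]]) (use V(2) in blast)
  also have "\<dots> = gmult Q (E g) (E h)"
    using \<tau>_src[OF V] gh by (simp add: Q_sel effect_bisection[OF U] effect_bisection[OF V])
  finally show ?thesis by simp
qed

lemma effect_unit:
  assumes x: "x \<in> objects G"
  shows "gunit Q x = E (gunit G x)"
proof -
  have "E (gunit G x) = germ (Obj G) (src G (gunit G x)) (tgt G \<circ> gunit G)"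
    by (rule effect_section[where W = "topspace (Obj G)"]) (use x in \<open>auto simp: closed st unit_cont\<close>)
  also have "\<dots> = germ (Obj G) x id"
    using x by (simp add: st) (rule germ_eqI[OF openin_topspace], auto simp: st)
  finally show ?thesis by (simp add: Q_sel)
qed

text \<open>Inverting the arrows of a bisection \<open>U\<close> gives a section \<open>\<sigma>\<close> for which \<open>tgt G \<circ> \<sigma>\<close> is the inverse of \<open>\<tau> U\<close>. A
  function is left inverse to \<open>\<tau> U\<close> near the source of \<open>g\<close> iff it agrees with this inverse near the target.\<close>

lemma effect_inv:
  assumes g: "g \<in> arrows G"
  shows "ginv Q (E g) = E (ginv G g)"
proof -
  obtain U where U: "bisection U" "g \<in> U" using bisection_exists[OF g] by blast
  note b = bisectionD[OF U(1)]
  have UA: "U \<subseteq> arrows G" by (rule openin_subset[OF b(1)])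
  define \<sigma> where "\<sigma> z = ginv G (inv_into U (tgt G) z)" for z
  have iU: "inv_into U (tgt G) z \<in> U" "tgt G (inv_into U (tgt G) z) = z" if "z \<in> tgt G ` U" for z
    using that by (auto simp: inv_into_into f_inv_into_f)
  have \<sigma>c: "continuous_map (subtopology (Obj G) (tgt G ` U)) (Arr G) \<sigma>"
    unfolding \<sigma>_def by (rule cont_inv[OF b(7)])
  have Ei: "E (ginv G g) = germ (Obj G) (src G (ginv G g)) (tgt G \<circ> \<sigma>)"
  proof (rule effect_section[OF _ b(3) _ \<sigma>c])
    show "src G (\<sigma> y) = y" if "y \<in> tgt G ` U" for y using iU[OF that] UA by (auto simp: \<sigma>_def st)
    show "\<sigma> (src G (ginv G g)) = ginv G g" using g inv_into_f_f[OF b(5) U(2)] by (simp add: \<sigma>_def st)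
  qed (use g U(2) in \<open>auto simp: closed st\<close>)
  have x: "src G g \<in> topspace (Obj G)" using g by (rule src_in)
  let ?rep = "germ_rep (E g)"
  obtain W0 where W0: "openin (Obj G) W0" "src G g \<in> W0" "\<forall>y\<in>W0. ?rep y = \<tau> U y"
    using germ_rep[OF x, of "\<tau> U"] unfolding effect_bisection[OF U] by (elim exE conjE)
  have undo: "(tgt G \<circ> \<sigma>) (\<tau> U y) = y" "\<tau> U y \<in> tgt G ` U" if y: "y \<in> src G ` U" for y
  proof -
    obtain u where u: "u \<in> U" "y = src G u" using y by blast
    then have "u \<in> arrows G" using UA by blast
    then show "(tgt G \<circ> \<sigma>) (\<tau> U y) = y" "\<tau> U y \<in> tgt G ` U"
      using u \<tau>_src[OF U(1) u(1)] inv_into_f_f[OF b(5) u(1)] by (auto simp: \<sigma>_def st)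
  qed
  have "(\<exists>W. openin (Obj G) W \<and> src G g \<in> W \<and> (\<forall>y\<in>W. k (?rep y) = y)) \<longleftrightarrow>
      (\<exists>W. openin (Obj G) W \<and> tgt G g \<in> W \<and> (\<forall>z\<in>W. k z = (tgt G \<circ> \<sigma>) z))" for k
  proof
    assume "\<exists>W. openin (Obj G) W \<and> src G g \<in> W \<and> (\<forall>y\<in>W. k (?rep y) = y)"
    then obtain W where W: "openin (Obj G) W" "src G g \<in> W" "\<forall>y\<in>W. k (?rep y) = y" by (elim exE conjE)
    define U' where "U' = U \<inter> {u \<in> topspace (Arr G). src G u \<in> W \<inter> W0}"
    have "openin (Arr G) U'" unfolding U'_def
      using b(1) openin_preimage[OF src_cont, of "W \<inter> W0"] W(1) W0(1) by (intro openin_Int) auto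
    then have "bisection U'" by (rule bisection_subset[OF U(1)]) (auto simp: U'_def)
    then have "openin (Obj G) (tgt G ` U')" by (rule bisectionD(3))
    moreover have "tgt G g \<in> tgt G ` U'" using U(2) g W(2) W0(2) by (auto simp: U'_def)
    moreover have "k z = (tgt G \<circ> \<sigma>) z" if z: "z \<in> tgt G ` U'" for z
    proof -
      obtain u where u: "u \<in> U" "src G u \<in> W" "src G u \<in> W0" "z = tgt G u" using z by (auto simp: U'_def)
      have "z = \<tau> U (src G u)" using u \<tau>_src[OF U(1)] by simp
      then have "k z = src G u" "(tgt G \<circ> \<sigma>) z = src G u" using W(3) W0(3) u undo(1)[of "src G u"] by auto
      then show ?thesis by simp
    qed
    ultimately show "\<exists>W. openin (Obj G) W \<and> tgt G g \<in> W \<and> (\<forall>z\<in>W. k z = (tgt G \<circ> \<sigma>) z)" by blast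
  next
    assume "\<exists>W. openin (Obj G) W \<and> tgt G g \<in> W \<and> (\<forall>z\<in>W. k z = (tgt G \<circ> \<sigma>) z)"
    then obtain W where W: "openin (Obj G) W" "tgt G g \<in> W" "\<forall>z\<in>W. k z = (tgt G \<circ> \<sigma>) z" by (elim exE conjE)
    have "openin (Obj G) (W0 \<inter> (src G ` U \<inter> \<tau> U -` W))"
      using W0(1) openin_preimage_on[OF b(2) \<tau>_cont[OF U(1)] W(1)] by (rule openin_Int)
    moreover have "src G g \<in> W0 \<inter> (src G ` U \<inter> \<tau> U -` W)" using W0(2) U(2) W(2) \<tau>_src[OF U] by auto
    moreover have "k (?rep y) = y" if y: "y \<in> W0 \<inter> (src G ` U \<inter> \<tau> U -` W)" for y
      using y W0(3) W(3) undo(1)[of y] by auto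
    ultimately show "\<exists>W. openin (Obj G) W \<and> src G g \<in> W \<and> (\<forall>y\<in>W. k (?rep y) = y)" by blast
  qed
  then have "germ_inverse (Obj G) (E g) = germ (Obj G) (tgt G g) (tgt G \<circ> \<sigma>)"
    using effect_src[OF g] effect_tgt[OF g] by (simp add: germ_inverse_def germ_def Q_sel)
  then show ?thesis using Ei g by (simp add: Q_sel st)
qed

lemma effect_groupoid_topological: "topological_groupoid Q"
  by (rule quotient_groupoid_topological[OF G Q_sel(1) effect_src effect_tgt effect_mult effect_inv effect_unit
        effect_cont effect_open arrows_Q[symmetric]])


lemma effect_eq_unitD:
  assumes g: "bisection U" "g \<in> U" and eq: "src G g = tgt G g" "E g = E (gunit G (src G g))"
  shows "\<exists>W. openin (Obj G) W \<and> src G g \<in> W \<and> (\<forall>y\<in>W. \<tau> U y = y)"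
proof -
  have gA: "g \<in> arrows G" using g bisectionD(1) openin_subset by blast
  then have x: "src G g \<in> topspace (Obj G)" by (rule src_in)
  have "germ (Obj G) (src G g) (\<tau> U) = germ (Obj G) (src G g) id"
    using eq(2) effect_bisection[OF g] effect_unit[OF x] by (simp add: Q_sel)
  from germ_eqD[OF x this] show ?thesis by simp
qed

primrec arrow_power :: "'a \<Rightarrow> nat \<Rightarrow> 'a" where
  "arrow_power k 0 = gunit G (src G k)"
| "arrow_power k (Suc n) = gmult G (arrow_power k n) k"

lemma arrow_power_in:
  assumes "k \<in> arrows G" "src G k = tgt G k"
  shows "arrow_power k n \<in> arrows G \<and> src G (arrow_power k n) = src G k \<and> tgt G (arrow_power k n) = src G k"
  by (induction n) (use assms in \<open>simp_all add: closed st\<close>)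

lemma arrow_power_add:
  assumes "k \<in> arrows G" "src G k = tgt G k"
  shows "arrow_power k (m + n) = gmult G (arrow_power k m) (arrow_power k n)"
proof (induction n)
  case 0
  then show ?case using arrow_power_in[OF assms, of m] unit_r[of "arrow_power k m"] by simp
next
  case (Suc n)
  then show ?case
    using arrow_power_in[OF assms, of m] arrow_power_in[OF assms, of n] assms by (simp add: assoc)
qed

lemma effect_arrow_power:
  assumes k: "bisection U" "k \<in> U" and eq: "src G k = tgt G k"
  shows "E (arrow_power k n) = germ (Obj G) (src G k) (\<tau> U ^^ n)"
proof (induction n)
  case 0
  have "k \<in> arrows G" using k bisectionD(1) openin_subset by blast
  then have "src G k \<in> objects G" by (rule src_in)
  then show ?case using effect_unit[of "src G k"] by (simp add: Q_sel id_def)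
next
  case (Suc n)
  note b = bisectionD[OF k(1)]
  have kA: "k \<in> arrows G" using k b(1) openin_subset by blast
  have fix1: "\<tau> U (src G k) = src G k" using \<tau>_src[OF k] eq by simp
  have "E (arrow_power k (Suc n)) = germ_comp (Obj G) (E (arrow_power k n)) (E k)"
    using effect_mult[of "arrow_power k n" k] arrow_power_in[OF kA eq, of n] kA eq by (simp add: Q_sel)
  also have "\<dots> = germ_comp (Obj G) (germ (Obj G) (\<tau> U (src G k)) (\<tau> U ^^ n)) (germ (Obj G) (src G k) (\<tau> U))"
    by (simp add: Suc.IH effect_bisection[OF k] fix1)
  also have "\<dots> = germ (Obj G) (src G k) (\<tau> U ^^ n \<circ> \<tau> U)"
    by (rule germ_comp_germ[OF b(2) _ \<tau>_cont[OF k(1)]]) (use k(2) in blast)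
  also have "\<tau> U ^^ n \<circ> \<tau> U = \<tau> U ^^ Suc n" by (simp only: funpow_Suc_right)
  finally show ?case .
qed

text \<open>In a chart at the base point, \<open>k\<close> acts by a map of finite order, and an arrow near \<open>k\<close> with trivial effect
  makes this map the identity near the source of that arrow.\<close>

lemma effect_trivial_of_accumulation:
  assumes k: "k \<in> arrows G" and iso: "src G k = tgt G k" and m: "m > 0" "arrow_power k m = gunit G (src G k)"
    and acc: "\<And>N. openin (Arr G) N \<Longrightarrow> k \<in> N \<Longrightarrow> \<exists>u\<in>N. src G u = tgt G u \<and> E u = E (gunit G (src G u))"
  shows "E k = E (gunit G (src G k))"
proof -
  let ?M = "obj_manifold G"
  let ?X = "Obj G"
  define n where "n = mdim ?M"
  let ?R = "Euclidean_space n"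
  define x where "x = src G k"
  obtain U where U: "bisection U" "k \<in> U" using bisection_exists[OF k] by blast
  note b = bisectionD[OF U(1)]
  define V where "V = src G ` U"
  define f where "f = \<tau> U"
  have V: "openin ?X V" "x \<in> V" using b(2) U(2) by (auto simp: V_def x_def)
  have fc: "continuous_map (subtopology ?X V) ?X f" unfolding V_def f_def by (rule \<tau>_cont[OF U(1)])
  have fx: "f x = x" using \<tau>_src[OF U] iso by (simp add: f_def x_def)
  have xX: "x \<in> topspace ?X" using k by (simp add: x_def src_in)
  obtain C \<psi> where C: "(C, \<psi>) \<in> atlas ?M" "x \<in> C" using chart_exists[OF objM, of x] xX by auto
  note ch = chart_facts[OF objM C(1), unfolded mtop_obj_manifold n_def[symmetric]]
  have img: "openin ?R (\<psi> ` S)" if "openin ?X S" "S \<subseteq> C" for S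
    using chart_open_image[OF objM C(1)] that by (simp add: n_def)
  have inv: "inv_into C \<psi> (\<psi> y) = y" if "y \<in> C" for y using ch(3) that by simp
  define T where "T = C \<inter> (V \<inter> f -` C)"
  have T: "openin ?X T" "T \<subseteq> C" "x \<in> T"
    unfolding T_def using openin_preimage_on[OF V(1) fc ch(1)] ch(1) C(2) V(2) fx by (auto intro: openin_Int)
  define S where "S = \<psi> ` T"
  define F where "F = \<psi> \<circ> f \<circ> inv_into C \<psi>"
  have S: "openin ?R S" "\<psi> x \<in> S" unfolding S_def using img[OF T(1,2)] T(3) by auto
  have F\<psi>: "F (\<psi> y) = \<psi> (f y)" if "y \<in> C" for y using inv[OF that] by (simp add: F_def)
  have "smooth_on ?M V ?M f" unfolding V_def f_def using \<tau>_diffeo[OF U(1)] by (simp add: diffeo_on_def)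
  then have "smooth_coords (mdim ?M) (\<psi> ` (C \<inter> V \<inter> f -` C)) (mdim ?M) F"
    using C(1) unfolding smooth_on_def F_def by blast
  then have C1: "Ck_on (Suc 0) n S (\<lambda>u. F u j)" if "j < n" for j
    using that unfolding smooth_coords_def S_def T_def n_def Int_assoc by blast
  have Fc: "continuous_map (subtopology ?R S) ?R F"
  proof -
    have "continuous_map (subtopology ?R S) (subtopology ?X C) (inv_into C \<psi>)"
      by (rule continuous_map_from_subtopology_mono[OF ch(5)]) (use T(2) in \<open>auto simp: S_def\<close>)
    then have "continuous_map (subtopology ?R S) ?X (inv_into C \<psi>)" using continuous_map_in_subtopology by blast
    then have a: "continuous_map (subtopology ?R S) (subtopology ?X T) (inv_into C \<psi>)"
      by (rule continuous_map_into_subtopology) (use inv T(2) in \<open>auto simp: S_def subset_iff\<close>)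
    have "continuous_map (subtopology ?X T) ?X f"
      by (rule continuous_map_from_subtopology_mono[OF fc]) (auto simp: T_def)
    then have c: "continuous_map (subtopology ?X T) (subtopology ?X C) f"
      by (rule continuous_map_into_subtopology) (auto simp: T_def)
    show ?thesis using continuous_map_compose[OF continuous_map_compose[OF a c] ch(4)] by (simp add: F_def comp_assoc)
  qed
  have "germ ?X x (f ^^ m) = germ ?X x id"
    using effect_arrow_power[OF U iso, of m] m(2) effect_unit[OF xX] by (simp add: f_def x_def Q_sel)
  from germ_eqD[OF xX this] obtain W where W: "openin ?X W" "x \<in> W" "\<forall>y\<in>W. (f ^^ m) y = id y" by (elim exE conjE)
  have T': "T \<subseteq> V" by (auto simp: T_def)
  from iterates_stay_near_fixed_point[OF fc V(1) T(1) T(3) T' fx, of m]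
  obtain N' where N': "openin ?X N'" "x \<in> N'" "N' \<subseteq> T" "\<forall>v\<in>N'. \<forall>i\<le>m. (f ^^ i) v \<in> T" by (elim exE conjE)
  have Fpow: "(F ^^ i) (\<psi> y) = \<psi> ((f ^^ i) y)" if "y \<in> N'" "i \<le> m" for y i
    using that(2)
  proof (induction i)
    case (Suc i)
    have "(f ^^ i) y \<in> C" using N'(4) that(1) Suc.prems T(2) by auto
    then show ?case using Suc F\<psi> by simp
  qed simp
  define N0 where "N0 = \<psi> ` (N' \<inter> W)"
  have N0: "openin ?R N0" "\<psi> x \<in> N0"
  proof -
    have "openin ?X (N' \<inter> W)" using N'(1) W(1) by (rule openin_Int)
    moreover have "N' \<inter> W \<subseteq> C" using N'(3) T(2) by blast
    ultimately show "openin ?R N0" unfolding N0_def by (rule img)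
    show "\<psi> x \<in> N0" unfolding N0_def using N'(2) W(2) by blast
  qed
  have Fm: "(F ^^ m) u = u" if "u \<in> N0" for u
    using that Fpow[of _ m] W(3) by (auto simp: N0_def)
  have Facc: "\<exists>O'. openin ?R O' \<and> O' \<inter> N \<noteq> {} \<and> (\<forall>u\<in>O'. F u = u)" if N: "openin ?R N" "\<psi> x \<in> N" for N
  proof -
    define N1 where "N1 = C \<inter> \<psi> -` N"
    have N1: "openin ?X N1" unfolding N1_def by (rule openin_preimage_on[OF ch(1,4) N(1)])
    define U' where "U' = U \<inter> {u \<in> topspace (Arr G). src G u \<in> N1}"
    have "openin (Arr G) U'" unfolding U'_def using b(1) openin_preimage[OF src_cont N1] by (rule openin_Int)
    moreover have "k \<in> U'" using U(2) k C(2) N(2) by (simp add: U'_def N1_def x_def)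
    ultimately obtain u where u: "u \<in> U'" "src G u = tgt G u" "E u = E (gunit G (src G u))" using acc by blast
    have uU: "u \<in> U" "src G u \<in> N1" using u(1) by (auto simp: U'_def)
    from effect_eq_unitD[OF U(1) uU(1) u(2,3)]
    obtain W' where W': "openin ?X W'" "src G u \<in> W'" "\<forall>y\<in>W'. \<tau> U y = y" by (elim exE conjE)
    have "openin ?R (\<psi> ` (W' \<inter> C))" using W'(1) ch(1) by (intro img) auto
    moreover have "\<psi> (src G u) \<in> \<psi> ` (W' \<inter> C) \<inter> N" using W'(2) uU(2) by (auto simp: N1_def)
    moreover have "\<forall>v\<in>\<psi> ` (W' \<inter> C). F v = v" using F\<psi> W'(3) by (auto simp: f_def)
    ultimately show ?thesis by blast
  qed
  have F0: "F (\<psi> x) = \<psi> x" using F\<psi>[OF C(2)] fx by simp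
  have "\<exists>N. openin ?R N \<and> \<psi> x \<in> N \<and> (\<forall>u\<in>N. F u = u)"
    by (rule finite_order_eq_id_near[OF S Fc C1 F0 m(1) N0 Fm Facc])
  then obtain N where N: "openin ?R N" "\<psi> x \<in> N" "\<forall>u\<in>N. F u = u" by (elim exE conjE)
  define Z where "Z = T \<inter> (C \<inter> \<psi> -` N)"
  have Z: "openin ?X Z" "x \<in> Z"
    unfolding Z_def using T openin_preimage_on[OF ch(1,4) N(1)] C(2) N(2) by (auto intro: openin_Int)
  have "f y = y" if "y \<in> Z" for y
  proof -
    have "y \<in> C" "f y \<in> C" "\<psi> y \<in> N" using that by (auto simp: Z_def T_def)
    then have "\<psi> (f y) = \<psi> y" using N(3) F\<psi> by auto
    then show ?thesis using ch(3) \<open>y \<in> C\<close> \<open>f y \<in> C\<close> by (auto dest: inj_onD)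
  qed
  then have "germ ?X x f = germ ?X x id" by (intro germ_eqI[OF Z]) auto
  then show ?thesis using effect_bisection[OF U] effect_unit[OF xX] by (simp add: f_def x_def Q_sel)
qed

end

section \<open>The effect functor of a proper groupoid is a covering\<close>

locale proper_etale_groupoid = etale_groupoid G for G :: "('o, 'a, 'z) lie_groupoid_scheme" +
  assumes proper: "proper_groupoid G"
begin

lemma Hausdorff_arr: "Hausdorff_space (Arr G)"
  and proper_st: "proper_map (Arr G) (prod_topology (Obj G) (Obj G)) (\<lambda>g. (src G g, tgt G g))"
  using proper by (simp_all add: proper_groupoid_def)

text \<open>The set is compact by properness and discrete since the source map is locally injective.\<close>

lemma finite_hom_set:
  assumes "x \<in> objects G" "y \<in> objects G"
  shows "finite {g \<in> arrows G. src G g = x \<and> tgt G g = y}" (is "finite ?F")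
proof -
  have "compactin (Arr G) {g \<in> topspace (Arr G). (src G g, tgt G g) = (x, y)}"
    using proper_st assms unfolding proper_map_def by simp
  moreover have "{g \<in> topspace (Arr G). (src G g, tgt G g) = (x, y)} = ?F" by auto
  ultimately have comp: "compactin (Arr G) ?F" by simp
  have "?F \<subseteq> \<Union>{U. bisection U}" using bisection_exists by blast
  then obtain \<F> where \<F>: "finite \<F>" "\<F> \<subseteq> {U. bisection U}" "?F \<subseteq> \<Union>\<F>"
    using compactinD[OF comp, of "{U. bisection U}"] bisectionD(1) by auto
  have "finite (?F \<inter> U)" if "U \<in> \<F>" for U
  proof (cases "?F \<inter> U = {}")
    case False
    then obtain g where g: "g \<in> ?F \<inter> U" by blast
    have "bisection U" using that \<F>(2) by blast
    then have "inj_on (src G) U" by (rule bisectionD(4))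
    then have "?F \<inter> U \<subseteq> {g}" using g by (auto dest: inj_onD)
    then show ?thesis using finite_subset by blast
  qed simp
  then have "finite (\<Union>U\<in>\<F>. ?F \<inter> U)" using \<F>(1) by blast
  moreover have "?F \<subseteq> (\<Union>U\<in>\<F>. ?F \<inter> U)" using \<F>(3) by blast
  ultimately show ?thesis by (rule finite_subset[rotated])
qed

text \<open>The powers of \<open>k\<close> lie in a finite set.\<close>

lemma isotropy_finite_order:
  assumes k: "k \<in> arrows G" "src G k = tgt G k"
  shows "\<exists>m>0. arrow_power k m = gunit G (src G k)"
proof -
  have "range (arrow_power k) \<subseteq> {g \<in> arrows G. src G g = src G k \<and> tgt G g = src G k}"
    using arrow_power_in[OF k] by auto
  then have "finite (range (arrow_power k))"
    using finite_hom_set[OF src_in[OF k(1)] src_in[OF k(1)]] finite_subset by blast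
  then have "\<not> inj (arrow_power k)" using finite_imageD infinite_UNIV_nat by blast
  then obtain i j where ij: "arrow_power k i = arrow_power k j" "i < j"
    unfolding inj_def by (metis linorder_neqE_nat)
  define m where "m = j - i"
  have eq: "gmult G (arrow_power k i) (arrow_power k m) = gmult G (arrow_power k i) (gunit G (src G k))"
    using arrow_power_add[OF k, of i m] arrow_power_in[OF k, of i] unit_r[of "arrow_power k i"] ij by (simp add: m_def)
  note x = src_in[OF k(1)]
  have "arrow_power k m = gunit G (src G k)"
    by (rule mult_left_imp_eq[OF _ _ _ _ _ eq])
      (simp_all add: arrow_power_in[OF k] unit_in[OF x] tgt_unit[OF x])
  then show ?thesis using ij(2) by (intro exI[of _ m]) (simp add: m_def)
qed

text \<open>The isotropy arrow \<open>f\<inverse>g\<close> has nontrivial effect, and so do all isotropy arrows near it. By continuity of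
  division, arrows near \<open>f\<close> and arrows near \<open>g\<close> have different effects.\<close>

lemma effect_separated:
  assumes f: "f \<in> arrows G" and g: "g \<in> arrows G" and st_eq: "src G f = src G g" "tgt G f = tgt G g" and ne: "E f \<noteq> E g"
  shows "\<exists>U V. openin (Arr G) U \<and> f \<in> U \<and> openin (Arr Q) V \<and> E g \<in> V \<and> (\<forall>u\<in>U. E u \<notin> V)"
proof -
  define k where "k = gmult G (ginv G f) g"
  have k: "k \<in> arrows G" "src G k = src G g" "tgt G k = src G g"
    using f g st_eq by (auto simp: k_def closed st)
  have fk: "gmult G f k = g" using f g st_eq by (simp add: k_def mult_inv_cancel)
  have nontrivial: "E k \<noteq> E (gunit G (src G k))"
  proof
    assume "E k = E (gunit G (src G k))"
    then have "E (gmult G f k) = E (gmult G f (gunit G (src G k)))"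
      using effect_mult[of f k] effect_mult[of f "gunit G (src G k)"] f g k st_eq src_in[OF k(1)] by (simp add: st closed)
    then show False using ne fk k(2) st_eq(1) unit_r[OF f] by simp
  qed
  have iso: "src G k = tgt G k" using k by simp
  obtain m where m: "m > 0" "arrow_power k m = gunit G (src G k)" using isotropy_finite_order[OF k(1) iso] by blast
  have "\<exists>N. openin (Arr G) N \<and> k \<in> N \<and> (\<forall>u\<in>N. src G u = tgt G u \<longrightarrow> E u \<noteq> E (gunit G (src G u)))"
  proof (rule ccontr)
    assume none: "\<nexists>N. openin (Arr G) N \<and> k \<in> N \<and> (\<forall>u\<in>N. src G u = tgt G u \<longrightarrow> E u \<noteq> E (gunit G (src G u)))"
    have "E k = E (gunit G (src G k))"
    proof (rule effect_trivial_of_accumulation[OF k(1) iso m])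
      fix N assume "openin (Arr G) N" "k \<in> N"
      then show "\<exists>u\<in>N. src G u = tgt G u \<and> E u = E (gunit G (src G u))" using none by blast
    qed
    then show False using nontrivial by simp
  qed
  then obtain N where N: "openin (Arr G) N" "k \<in> N" "\<forall>u\<in>N. src G u = tgt G u \<longrightarrow> E u \<noteq> E (gunit G (src G u))"
    by (elim exE conjE)
  let ?X = "subtopology (prod_topology (Arr G) (Arr G)) {(u, v). tgt G u = tgt G v}"
  have dc: "continuous_map ?X (Arr G) (\<lambda>z. gmult G (ginv G (fst z)) (snd z))"
    by (rule cont_div[OF continuous_map_sub_fst continuous_map_sub_snd]) auto
  have "openin ?X {z \<in> topspace ?X. gmult G (ginv G (fst z)) (snd z) \<in> N}" by (rule openin_preimage[OF dc N(1)])
  then obtain O' where O': "openin (prod_topology (Arr G) (Arr G)) O'"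
      "{z \<in> topspace ?X. gmult G (ginv G (fst z)) (snd z) \<in> N} = O' \<inter> {(u, v). tgt G u = tgt G v}"
    unfolding openin_subtopology by (elim exE conjE)
  have "(f, g) \<in> {z \<in> topspace ?X. gmult G (ginv G (fst z)) (snd z) \<in> N}" using f g st_eq N(2) by (simp add: k_def)
  then have "(f, g) \<in> O'" using O'(2) by blast
  from openin_prod_box[OF O'(1) this]
  obtain U V where UV: "openin (Arr G) U" "openin (Arr G) V" "f \<in> U" "g \<in> V" "U \<times> V \<subseteq> O'" by (elim exE conjE)
  have sep: "E u \<notin> E ` V" if u: "u \<in> U" for u
  proof
    assume "E u \<in> E ` V"
    then obtain v where v: "E u = E v" "v \<in> V" by (rule imageE)
    have uv: "u \<in> arrows G" "v \<in> arrows G" using u v(2) openin_subset[OF UV(1)] openin_subset[OF UV(2)] by auto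
    have s: "src G u = src G v" "tgt G u = tgt G v"
      using effect_src[OF uv(1)] effect_src[OF uv(2)] effect_tgt[OF uv(1)] effect_tgt[OF uv(2)] v(1) by auto
    define w where "w = gmult G (ginv G u) v"
    have w: "w \<in> arrows G" "src G w = src G v" "tgt G w = src G v" using uv s by (auto simp: w_def closed st)
    have "(u, v) \<in> O' \<inter> {(u, v). tgt G u = tgt G v}" using UV(5) u v(2) s by blast
    then have "w \<in> N" unfolding O'(2)[symmetric] by (simp add: w_def)
    moreover have "E w = E (gunit G (src G w))"
    proof -
      have "E w = gmult Q (E (ginv G u)) (E v)" unfolding w_def
        using effect_mult[of "ginv G u" v] uv s by (simp add: closed st)
      also have "\<dots> = E (gmult G (ginv G v) v)"
        using effect_mult[of "ginv G v" v] effect_inv[OF uv(1)] effect_inv[OF uv(2)] v(1) uv by (simp add: closed st)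
      finally show ?thesis using uv w by (simp add: inv_l)
    qed
    ultimately show False using N(3) w by auto
  qed
  have opV: "openin (Arr Q) (E ` V)" using effect_open UV(2) by (simp add: open_map_def)
  show ?thesis
    by (intro exI[of _ U] exI[of _ "E ` V"] conjI ballI, rule UV(1), rule UV(3), rule opV, rule imageI[OF UV(4)], rule sep)
qed

lemma effect_inj_on_bisection: "bisection U \<Longrightarrow> inj_on E U"
proof (rule inj_onI)
  fix u v assume U: "bisection U" "u \<in> U" "v \<in> U" "E u = E v"
  have "u \<in> arrows G" "v \<in> arrows G" using U openin_subset[OF bisectionD(1)[OF U(1)]] by auto
  then have "src G u = src G v" using effect_src U(4) by metis
  then show "u = v" using bisectionD(4)[OF U(1)] U(2,3) by (auto dest: inj_onD)
qed

lemma effect_local_section: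
  assumes U: "bisection U"
  shows "continuous_map (subtopology (Arr Q) (E ` U)) (Arr G) (inv_into U E)"
proof (subst continuous_map_def, intro conjI allI impI)
  have UA: "U \<subseteq> arrows G" by (rule openin_subset[OF bisectionD(1)[OF U]])
  show "inv_into U E \<in> topspace (subtopology (Arr Q) (E ` U)) \<rightarrow> arrows G"
  proof (rule funcsetI)
    fix q assume "q \<in> topspace (subtopology (Arr Q) (E ` U))"
    then have "q \<in> E ` U" by simp
    from inv_into_into[OF this] UA show "inv_into U E q \<in> arrows G" by blast
  qed
  fix S assume S: "openin (Arr G) S"
  have inv: "inv_into U E (E u) = u" if "u \<in> U" for u by (rule inv_into_f_f[OF effect_inj_on_bisection[OF U] that])
  have "{q \<in> topspace (subtopology (Arr Q) (E ` U)). inv_into U E q \<in> S} = E ` (U \<inter> S)"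
  proof
    show "{q \<in> topspace (subtopology (Arr Q) (E ` U)). inv_into U E q \<in> S} \<subseteq> E ` (U \<inter> S)"
      using inv by auto
    show "E ` (U \<inter> S) \<subseteq> {q \<in> topspace (subtopology (Arr Q) (E ` U)). inv_into U E q \<in> S}"
      using inv UA by (auto simp: arrows_Q)
  qed
  moreover have "openin (Arr Q) (E ` (U \<inter> S))"
    using effect_open bisectionD(1)[OF U] S by (simp add: open_map_def openin_Int)
  ultimately show "openin (subtopology (Arr Q) (E ` U)) {q \<in> topspace (subtopology (Arr Q) (E ` U)). inv_into U E q \<in> S}"
    by (auto simp: openin_subtopology)
qed

text \<open>Finitely many arrows have the same endpoints as \<open>q\<close>. Around those with effect \<open>q\<close> choose bisections, on
  which \<open>E\<close> is a homeomorphism onto a neighbourhood of \<open>q\<close>; around the others choose open sets whose effects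
  avoid a neighbourhood of \<open>q\<close>. By properness these open sets contain all arrows with endpoints close to those
  of \<open>q\<close>, so an arrow with effect close to \<open>q\<close> lies in one of the bisections.\<close>

lemma effect_sheets:
  assumes q: "q \<in> arrows Q"
  shows "\<exists>V. openin (Arr Q) V \<and> q \<in> V \<and> (\<forall>g\<in>arrows G. E g \<in> V \<longrightarrow>
    (\<exists>s. continuous_map (subtopology (Arr Q) V) (Arr G) s \<and> (\<forall>v\<in>V. E (s v) = v) \<and> s (E g) = g))"
proof -
  obtain g0 where g0: "q = E g0" "g0 \<in> arrows G" using q arrows_Q by auto
  define F where "F = {g \<in> arrows G. src G g = src G g0 \<and> tgt G g = tgt G g0}"
  have finF: "finite F" unfolding F_def by (rule finite_hom_set) (use g0(2) closed in auto)
  define P where "P f U V \<longleftrightarrow> openin (Arr G) U \<and> f \<in> U \<and> openin (Arr Q) V \<and> q \<in> V \<and>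
    (if E f = q then bisection U \<and> V = E ` U else (\<forall>u\<in>U. E u \<notin> V))" for f U V
  have "\<exists>U V. P f U V" if f: "f \<in> F" for f
  proof (cases "E f = q")
    case True
    obtain U where U: "bisection U" "f \<in> U" using bisection_exists[of f] f by (auto simp: F_def)
    have "openin (Arr Q) (E ` U)" using effect_open bisectionD(1)[OF U(1)] by (simp add: open_map_def)
    then have "P f U (E ` U)" unfolding P_def using U True bisectionD(1)[OF U(1)] by auto
    then show ?thesis by blast
  next
    case False
    have "\<exists>U V. openin (Arr G) U \<and> f \<in> U \<and> openin (Arr Q) V \<and> E g0 \<in> V \<and> (\<forall>u\<in>U. E u \<notin> V)"
      by (rule effect_separated) (use f g0 False in \<open>auto simp: F_def\<close>)
    then show ?thesis unfolding P_def using False g0(1) by simp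
  qed
  then have "\<forall>f. \<exists>UV. f \<in> F \<longrightarrow> P f (fst UV) (snd UV)" by auto
  from choice[OF this] obtain UV where UV: "\<forall>f. f \<in> F \<longrightarrow> P f (fst (UV f)) (snd (UV f))" by (elim exE)
  define U V where "U f = fst (UV f)" and "V f = snd (UV f)" for f
  have UVP: "P f (U f) (V f)" if "f \<in> F" for f using UV that by (simp add: U_def V_def)
  let ?st = "\<lambda>g. (src G g, tgt G g)"
  define N where "N = (\<Union>f\<in>F. U f)"
  have N: "openin (Arr G) N" unfolding N_def using UVP by (intro openin_Union) (auto simp: P_def)
  define D where "D = topspace (prod_topology (Obj G) (Obj G)) - ?st ` (arrows G - N)"
  have "closedin (prod_topology (Obj G) (Obj G)) (?st ` (arrows G - N))"
    using proper_imp_closed_map[OF proper_st] N by (auto simp: closed_map_def)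
  then have D: "openin (prod_topology (Obj G) (Obj G)) D" unfolding D_def by (rule openin_diff[OF openin_topspace])
  have D_N: "g \<in> N" if "g \<in> arrows G" "?st g \<in> D" for g using that by (auto simp: D_def)
  interpret Q: top_groupoid Q by unfold_locales (rule effect_groupoid_topological)
  let ?stQ = "\<lambda>q. (src Q q, tgt Q q)"
  have "continuous_map (Arr Q) (prod_topology (Obj G) (Obj G)) ?stQ"
    using Q.src_cont Q.tgt_cont unfolding Q_sel(1) by (rule continuous_map_pairedI)
  from openin_preimage[OF this D] have DQ: "openin (Arr Q) {q \<in> arrows Q. ?stQ q \<in> D}" .
  define V0 where "V0 = {q \<in> arrows Q. ?stQ q \<in> D} \<inter> \<Inter>(V ` F)"
  have g0F: "g0 \<in> F" using g0(2) by (simp add: F_def)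
  have "openin (Arr Q) (\<Inter>(V ` F))" using finF g0F UVP by (intro openin_Inter) (auto simp: P_def)
  then have V0: "openin (Arr Q) V0" unfolding V0_def using DQ by (intro openin_Int)
  have "?st g0 \<in> D"
  proof -
    have "g \<in> N" if "g \<in> arrows G" "?st g = ?st g0" for g
    proof -
      have "g \<in> F" using that by (simp add: F_def)
      then show ?thesis using UVP[of g] by (auto simp: N_def P_def)
    qed
    then show ?thesis using g0(2) closed by (auto simp: D_def)
  qed
  then have "q \<in> V0" unfolding V0_def using q g0 effect_src[OF g0(2)] effect_tgt[OF g0(2)] UVP by (auto simp: P_def)
  moreover have "\<exists>s. continuous_map (subtopology (Arr Q) V0) (Arr G) s \<and> (\<forall>v\<in>V0. E (s v) = v) \<and> s (E g) = g"
    if g: "g \<in> arrows G" "E g \<in> V0" for g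
  proof -
    have "?st g \<in> D" using g effect_src[OF g(1)] effect_tgt[OF g(1)] by (simp add: V0_def)
    then have "g \<in> N" using g(1) by (intro D_N)
    then obtain f where f: "f \<in> F" "g \<in> U f" by (auto simp: N_def)
    have "E g \<in> V f" using g(2) f(1) by (auto simp: V0_def)
    then have Uf: "bisection (U f)" "V f = E ` U f" using UVP[OF f(1)] f(2) unfolding P_def by (auto split: if_splits)
    have V0f: "V0 \<subseteq> E ` U f" using f(1) Uf(2) by (auto simp: V0_def)
    have "continuous_map (subtopology (Arr Q) V0) (Arr G) (inv_into (U f) E)"
      by (rule continuous_map_from_subtopology_mono[OF effect_local_section[OF Uf(1)] V0f])
    moreover have "\<forall>v\<in>V0. E (inv_into (U f) E v) = v" using V0f by (auto simp: f_inv_into_f)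
    moreover have "inv_into (U f) E (E g) = g" using effect_inj_on_bisection[OF Uf(1)] f(2) by simp
    ultimately show ?thesis by blast
  qed
  ultimately show ?thesis using V0 by (intro exI[of _ V0] conjI ballI impI)
qed

lemma effect_covering: "covering_functor G Q E"
proof
  show "topological_groupoid G" by (rule G)
  show "topological_groupoid Q" by (rule effect_groupoid_topological)
  show "Obj Q = Obj G" by (rule Q_sel)
  show "E ` arrows G = arrows Q" by (rule arrows_Q[symmetric])
  show "E (gunit G x) = gunit Q x" if "x \<in> objects G" for x using effect_unit[OF that] by simp
  show "\<exists>U. openin (Arr G) U \<and> g \<in> U \<and> inj_on E U" if "g \<in> arrows G" for g
    using bisection_exists[OF that] effect_inj_on_bisection bisectionD(1) by blast
qed (simp_all add: effect_src effect_tgt effect_mult effect_cont Hausdorff_arr effect_sheets)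

end

section \<open>Tensor products with the bundle of a functor\<close>

context covering_functor
begin

abbreviation FB where "FB \<equiv> functor_bundle Q G id E"

lemma FB_sel: "Tot FB = subtopology (prod_topology (Obj G) (Arr Q)) {(y, e). y = tgt Q e}"
  "proj FB = fst" "eps FB = (\<lambda>p. src Q (snd p))" "lact FB = (\<lambda>h p. (tgt G h, gmult Q (E h) (snd p)))"
  "ract FB = (\<lambda>p e. (fst p, gmult Q (snd p) e))"
  by (auto simp: functor_bundle_def fun_eq_iff)

lemma topspace_FB: "total_space FB = {(y, e). e \<in> arrows Q \<and> y = tgt Q e}"
  using Q.tgt_in by (auto simp: FB_sel Obj_Q)

lemma tgt_Q_in: "e \<in> arrows Q \<Longrightarrow> tgt Q e \<in> objects G"
  using Q.tgt_in by (simp add: Obj_Q)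

lemma FB_fst_cont: "continuous_map (Tot FB) (Obj G) fst" and FB_snd_cont: "continuous_map (Tot FB) (Arr Q) snd"
  unfolding FB_sel by (rule continuous_map_sub_fst, rule continuous_map_sub_snd)

lemma cont_into_FB:
  assumes "continuous_map Z (Obj G) f" "continuous_map Z (Arr Q) g" "\<And>z. z \<in> topspace Z \<Longrightarrow> f z = tgt Q (g z)"
  shows "continuous_map Z (Tot FB) (\<lambda>z. (f z, g z))"
  unfolding FB_sel using assms by (intro continuous_map_into_subtopology) (auto simp: continuous_map_pairedI)

lemma functor_bundle_principal: "principal_bundle Q G FB"
proof -
  have "left_action G (Tot FB) (proj FB) (lact FB)"
    unfolding left_action_def
  proof (intro conjI)
    show "continuous_map (Tot FB) (Obj G) (proj FB)" unfolding FB_sel(2) by (rule FB_fst_cont)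
    let ?Z = "subtopology (prod_topology (Arr G) (Tot FB)) {(h, x). src G h = proj FB x}"
    have h: "continuous_map ?Z (Arr G) fst" by (rule continuous_map_sub_fst)
    have e: "continuous_map ?Z (Arr Q) (\<lambda>z. snd (snd z))" by (rule continuous_map_comp[OF continuous_map_sub_snd FB_snd_cont])
    have m: "continuous_map ?Z (Arr Q) (\<lambda>z. gmult Q (E (fst z)) (snd (snd z)))"
      by (rule Q.cont_mult[OF continuous_map_comp[OF h E_cont] e]) (auto simp: topspace_FB FB_sel(2) E_src)
    have "continuous_map ?Z (Tot FB) (\<lambda>z. (tgt G (fst z), gmult Q (E (fst z)) (snd (snd z))))"
      by (rule cont_into_FB[OF continuous_map_comp[OF h G.tgt_cont] m]) (auto simp: topspace_FB FB_sel(2) E_src E_tgt E_in Q.st)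
    then show "continuous_map ?Z (Tot FB) (\<lambda>(h, x). lact FB h x)" by (simp add: FB_sel(4) case_prod_unfold)
  qed (auto simp: FB_sel(2,4) topspace_FB E_src E_tgt E_in E_mult Q.assoc E_unit tgt_Q_in Q.unit_l G.st)
  moreover have "right_action Q (Tot FB) (eps FB) (ract FB)"
    unfolding right_action_def
  proof (intro conjI)
    show "continuous_map (Tot FB) (Obj Q) (eps FB)" unfolding FB_sel(3) by (rule Q.cont_src[OF FB_snd_cont])
    let ?Z = "subtopology (prod_topology (Tot FB) (Arr Q)) {(x, g). eps FB x = tgt Q g}"
    have p: "continuous_map ?Z (Tot FB) fst" and g: "continuous_map ?Z (Arr Q) snd"
      by (rule continuous_map_sub_fst, rule continuous_map_sub_snd)
    have m: "continuous_map ?Z (Arr Q) (\<lambda>z. gmult Q (snd (fst z)) (snd z))"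
      by (rule Q.cont_mult[OF continuous_map_comp[OF p FB_snd_cont] g]) (auto simp: FB_sel(3))
    have "continuous_map ?Z (Tot FB) (\<lambda>z. (fst (fst z), gmult Q (snd (fst z)) (snd z)))"
      by (rule cont_into_FB[OF continuous_map_comp[OF p FB_fst_cont] m]) (auto simp: topspace_FB FB_sel(3) Q.st)
    then show "continuous_map ?Z (Tot FB) (\<lambda>(x, g). ract FB x g)" by (simp add: FB_sel(5) case_prod_unfold)
  qed (auto simp: FB_sel(3,5) topspace_FB Q.st Q.unit_r Q.assoc)
  moreover have "\<forall>y\<in>objects G. \<exists>U \<sigma>. openin (Obj G) U \<and> y \<in> U \<and>
        continuous_map (subtopology (Obj G) U) (Tot FB) \<sigma> \<and> (\<forall>z\<in>U. proj FB (\<sigma> z) = z)"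
  proof
    fix y assume y: "y \<in> objects G"
    have "continuous_map (Obj G) (Tot FB) (\<lambda>y. (y, gunit Q y))"
      using Q.unit_cont by (intro cont_into_FB) (auto simp: Obj_Q Q.st)
    then show "\<exists>U \<sigma>. openin (Obj G) U \<and> y \<in> U \<and>
        continuous_map (subtopology (Obj G) U) (Tot FB) \<sigma> \<and> (\<forall>z\<in>U. proj FB (\<sigma> z) = z)"
      using y by (intro exI[of _ "topspace (Obj G)"] exI[of _ "\<lambda>y. (y, gunit Q y)"]) (simp add: FB_sel(2))
  qed
  moreover have "homeomorphic_map
       (subtopology (prod_topology (Tot FB) (Arr Q)) {(p, g). eps FB p = tgt Q g})
       (subtopology (prod_topology (Tot FB) (Tot FB)) {(p, p'). proj FB p = proj FB p'})
       (\<lambda>(p, g). (p, ract FB p g))" (is "homeomorphic_map ?X ?X' ?f")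
  proof -
    let ?k = "\<lambda>(p, p'). (p, gmult Q (ginv Q (snd p)) (snd p'))"
    have p: "continuous_map ?X (Tot FB) fst" and g: "continuous_map ?X (Arr Q) snd"
      by (rule continuous_map_sub_fst, rule continuous_map_sub_snd)
    have m: "continuous_map ?X (Arr Q) (\<lambda>z. gmult Q (snd (fst z)) (snd z))"
      by (rule Q.cont_mult[OF continuous_map_comp[OF p FB_snd_cont] g]) (auto simp: FB_sel(3))
    have r: "continuous_map ?X (Tot FB) (\<lambda>z. (fst (fst z), gmult Q (snd (fst z)) (snd z)))"
      by (rule cont_into_FB[OF continuous_map_comp[OF p FB_fst_cont] m]) (auto simp: topspace_FB FB_sel(3) Q.st)
    have "continuous_map ?X (prod_topology (Tot FB) (Tot FB)) ?f"
      using continuous_map_pairedI[OF p r] by (simp add: case_prod_unfold FB_sel(5))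
    then have 1: "continuous_map ?X ?X' ?f"
      by (rule continuous_map_into_subtopology) (auto simp: FB_sel(2,5))
    have p': "continuous_map ?X' (Tot FB) fst" and p'': "continuous_map ?X' (Tot FB) snd"
      by (rule continuous_map_sub_fst, rule continuous_map_sub_snd)
    have d: "continuous_map ?X' (Arr Q) (\<lambda>z. gmult Q (ginv Q (snd (fst z))) (snd (snd z)))"
      by (rule Q.cont_div[OF continuous_map_comp[OF p' FB_snd_cont] continuous_map_comp[OF p'' FB_snd_cont]])
        (auto simp: topspace_FB FB_sel(2))
    have "continuous_map ?X' (prod_topology (Tot FB) (Arr Q)) ?k"
      using continuous_map_pairedI[OF p' d] by (simp add: case_prod_unfold)
    then have 2: "continuous_map ?X' ?X ?k"
      by (rule continuous_map_into_subtopology) (auto simp: topspace_FB FB_sel(2,3) Q.closed Q.st)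
    have "homeomorphic_maps ?X ?X' ?f ?k" unfolding homeomorphic_maps_def
      using 1 2 by (auto simp: topspace_FB FB_sel(2,3,5) Q.inv_mult_cancel Q.mult_inv_cancel)
    then show ?thesis by (rule homeomorphic_maps_map[THEN iffD1, THEN conjunct1])
  qed
  ultimately show ?thesis
    unfolding principal_bundle_def using G_top Q_top
    by (auto simp: FB_sel(2-5) topspace_FB E_src E_tgt E_in Q.st Q.assoc)
qed

end

locale tensor_torsor = covering_functor G Q E + \<alpha>: torsor G Z \<alpha>
  for G :: "('o, 'a, 'z) groupoid_scheme" and Q :: "('o, 'b, 'w) groupoid_scheme" and E :: "'a \<Rightarrow> 'b"
    and Z :: "'y topology" and \<alpha> :: "('q, 'y, 'y, 'o, 'a) bibundle"
begin

abbreviation D where "D \<equiv> tensor_domain \<alpha> FB"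
abbreviation rel where "rel \<equiv> tensor_rel G \<alpha> FB"
abbreviation cls where "cls \<equiv> tensor_class G \<alpha> FB"
abbreviation T where "T \<equiv> tensor G \<alpha> FB"

lemma D_iff: "(a, y, e) \<in> D \<longleftrightarrow> a \<in> total_space \<alpha> \<and> e \<in> arrows Q \<and> tgt Q e = eps \<alpha> a \<and> y = eps \<alpha> a"
  by (auto simp: tensor_domain_def topspace_FB FB_sel(2))

lemma rel_iff: "(z, (a', y', e')) \<in> rel \<longleftrightarrow>
    (\<exists>h e. a' \<in> total_space \<alpha> \<and> h \<in> arrows G \<and> eps \<alpha> a' = tgt G h \<and> e \<in> arrows Q \<and> tgt Q e = src G h \<and>
      z = (ract \<alpha> a' h, src G h, e) \<and> y' = tgt G h \<and> e' = gmult Q (E h) e)"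
  unfolding tensor_rel_def by (auto simp: topspace_FB FB_sel(2,4))

lemma relI:
  assumes "a \<in> total_space \<alpha>" "h \<in> arrows G" "eps \<alpha> a = tgt G h" "e \<in> arrows Q" "tgt Q e = src G h"
  shows "((ract \<alpha> a h, src G h, e), (a, tgt G h, gmult Q (E h) e)) \<in> rel"
  using assms unfolding rel_iff by blast

lemma rel_equiv: "equiv D rel"
proof (rule equivI)
  show sub: "rel \<subseteq> D \<times> D"
  proof clarify
    fix a y e a' y' e' assume "((a, y, e), (a', y', e')) \<in> rel"
    then obtain h where h: "a' \<in> total_space \<alpha>" "h \<in> arrows G" "eps \<alpha> a' = tgt G h" "e \<in> arrows Q" "tgt Q e = src G h"
        "a = ract \<alpha> a' h" "y = src G h" "y' = tgt G h" "e' = gmult Q (E h) e"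
      unfolding rel_iff by blast
    then show "(a, y, e) \<in> D \<and> (a', y', e') \<in> D"
      by (auto simp: D_iff \<alpha>.act_in \<alpha>.act_eps E_src E_tgt E_in Q.closed Q.st)
  qed
  show "refl_on D rel"
  proof (rule refl_onI)
    fix z assume z: "z \<in> D"
    obtain a y e where zz: "z = (a, y, e)" by (cases z)
    have d: "a \<in> total_space \<alpha>" "e \<in> arrows Q" "tgt Q e = eps \<alpha> a" "y = eps \<alpha> a" using z unfolding zz D_iff by auto
    have u: "eps \<alpha> a \<in> objects G" by (rule \<alpha>.eps_in[OF d(1)])
    have "gmult Q (gunit Q (tgt Q e)) e = e" by (rule Q.unit_l[OF d(2)])
    then show "(z, z) \<in> rel"
      using relI[of a "gunit G (eps \<alpha> a)" e] d u by (simp add: zz G.closed G.st \<alpha>.act_unit E_unit)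
  qed
  show "sym rel"
  proof (rule symI, clarify)
    fix a y e a' y' e' assume "((a, y, e), (a', y', e')) \<in> rel"
    then obtain h where h: "a' \<in> total_space \<alpha>" "h \<in> arrows G" "eps \<alpha> a' = tgt G h" "e \<in> arrows Q" "tgt Q e = src G h"
        "a = ract \<alpha> a' h" "y = src G h" "y' = tgt G h" "e' = gmult Q (E h) e"
      unfolding rel_iff by blast
    have a: "a \<in> total_space \<alpha>" "eps \<alpha> a = src G h" using h by (auto simp: \<alpha>.act_in \<alpha>.act_eps)
    have e': "e' \<in> arrows Q" "tgt Q e' = tgt G h" using h by (auto simp: E_src E_tgt E_in Q.closed Q.st)
    have "ract \<alpha> a (ginv G h) = a'"
      using \<alpha>.act_assoc[of a' h "ginv G h"] \<alpha>.act_unit[of a'] h by (simp add: G.closed G.st G.inv_r)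
    moreover have "gmult Q (E (ginv G h)) e' = e"
      using Q.inv_mult_cancel[of "E h" e] h by (simp add: E_inv E_in E_src)
    ultimately show "((a', y', e'), (a, y, e)) \<in> rel"
      using relI[of a "ginv G h" e'] a e' h by (simp add: G.closed G.st)
  qed
  show "trans rel"
  proof (rule transI, clarify)
    fix a y e a' y' e' a'' y'' e'' assume r: "((a, y, e), (a', y', e')) \<in> rel" "((a', y', e'), (a'', y'', e'')) \<in> rel"
    obtain h where h: "a' \<in> total_space \<alpha>" "h \<in> arrows G" "eps \<alpha> a' = tgt G h" "e \<in> arrows Q" "tgt Q e = src G h"
        "a = ract \<alpha> a' h" "y = src G h" "y' = tgt G h" "e' = gmult Q (E h) e"
      using r(1) unfolding rel_iff by blast
    obtain k where k: "a'' \<in> total_space \<alpha>" "k \<in> arrows G" "eps \<alpha> a'' = tgt G k" "e' \<in> arrows Q" "tgt Q e' = src G k"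
        "a' = ract \<alpha> a'' k" "y' = src G k" "y'' = tgt G k" "e'' = gmult Q (E k) e'"
      using r(2) unfolding rel_iff by blast
    have kh: "src G k = tgt G h" using h(8) k(7) by simp
    show "((a, y, e), (a'', y'', e'')) \<in> rel"
      using relI[of a'' "gmult G k h" e] h k kh
      by (simp add: G.closed G.st \<alpha>.act_assoc E_mult Q.assoc E_in E_src E_tgt)
  qed
qed

lemma cls_eq: "(z, z') \<in> rel \<Longrightarrow> cls z = cls z'"
  unfolding tensor_class_def by (rule equiv_class_eq[OF rel_equiv])

lemma topspace_domain: "topspace (subtopology (prod_topology (Tot \<alpha>) (Tot FB)) D) = D"
  by (auto simp: tensor_domain_def)

lemma openin_T: "openin (Tot T) S \<longleftrightarrow> S \<subseteq> cls ` D \<and> openin (subtopology (prod_topology (Tot \<alpha>) (Tot FB)) D) {z \<in> D. cls z \<in> S}"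
proof -
  have quot: "D // rel = cls ` D" by (auto simp: quotient_def tensor_class_def)
  show ?thesis unfolding tensor_def bibundle.select_convs openin_quotient_topology topspace_domain quot
    by (simp add: tensor_class_def)
qed

lemma topspace_T: "total_space T = cls ` D"
proof -
  have "openin (subtopology (prod_topology (Tot \<alpha>) (Tot FB)) D) D"
    using openin_topspace[of "subtopology (prod_topology (Tot \<alpha>) (Tot FB)) D"] unfolding topspace_domain .
  moreover have "{z \<in> D. cls z \<in> cls ` D} = D" by blast
  ultimately have "openin (Tot T) (cls ` D)" unfolding openin_T by simp
  moreover have "total_space T \<subseteq> cls ` D" using openin_topspace[of "Tot T"] unfolding openin_T by blast
  ultimately show ?thesis using openin_subset by blast
qed

lemma cls_cont: "continuous_map (subtopology (prod_topology (Tot \<alpha>) (Tot FB)) D) (Tot T) cls"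
  unfolding continuous_map_def topspace_domain topspace_T by (auto simp: openin_T)

lemma rep:
  assumes "z \<in> D"
  shows "(z, SOME z'. z' \<in> cls z) \<in> rel"
proof -
  have "z \<in> cls z" using assms rel_equiv by (auto simp: tensor_class_def equiv_def refl_on_def)
  then have "(SOME z'. z' \<in> cls z) \<in> cls z" by (rule someI[of "\<lambda>z'. z' \<in> cls z"])
  then show ?thesis by (simp add: tensor_class_def)
qed

text \<open>The structure of the tensor product is defined by a chosen representative; this exhibits the chosen
  representative of a class in terms of a given one.\<close>

lemma rep_cases:
  assumes "(a, y, e) \<in> D"
  obtains a' h where "a' \<in> total_space \<alpha>" "h \<in> arrows G" "eps \<alpha> a' = tgt G h" "src G h = tgt Q e" "a = ract \<alpha> a' h"
    "(SOME z'. z' \<in> cls (a, y, e)) = (a', tgt G h, gmult Q (E h) e)"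
proof -
  obtain a' y' e' where z': "(SOME z'. z' \<in> cls (a, y, e)) = (a', y', e')" by (cases "SOME z'. z' \<in> cls (a, y, e)")
  have "((a, y, e), (a', y', e')) \<in> rel" using rep[OF assms] unfolding z' .
  then show thesis unfolding rel_iff using that z' by auto
qed

lemma T_proj: "(a, y, e) \<in> D \<Longrightarrow> proj T (cls (a, y, e)) = proj \<alpha> a"
  by (erule rep_cases) (simp add: tensor_def \<alpha>.act_proj)

lemma T_eps:
  assumes d: "(a, y, e) \<in> D"
  shows "eps T (cls (a, y, e)) = src Q e"
proof -
  obtain a' h where r: "a' \<in> total_space \<alpha>" "h \<in> arrows G" "eps \<alpha> a' = tgt G h" "src G h = tgt Q e" "a = ract \<alpha> a' h"
    "(SOME z'. z' \<in> cls (a, y, e)) = (a', tgt G h, gmult Q (E h) e)" by (rule rep_cases[OF d])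
  have "e \<in> arrows Q" using d by (simp add: D_iff)
  then show ?thesis using r by (simp add: tensor_def FB_sel(3) E_src E_in Q.st)
qed

lemma T_ract:
  assumes d: "(a, y, e) \<in> D" and g: "g \<in> arrows Q" "src Q e = tgt Q g"
  shows "ract T (cls (a, y, e)) g = cls (a, y, gmult Q e g)"
proof -
  obtain a' h where r: "a' \<in> total_space \<alpha>" "h \<in> arrows G" "eps \<alpha> a' = tgt G h" "src G h = tgt Q e" "a = ract \<alpha> a' h"
    "(SOME z'. z' \<in> cls (a, y, e)) = (a', tgt G h, gmult Q (E h) e)" by (rule rep_cases[OF d])
  have e: "e \<in> arrows Q" "y = src G h" using d r by (auto simp: D_iff)
  have "ract T (cls (a, y, e)) g = cls (a', tgt G h, gmult Q (gmult Q (E h) e) g)"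
    using r by (simp add: tensor_def FB_sel(5))
  also have "\<dots> = cls (a, y, gmult Q e g)"
    using cls_eq[OF relI[of a' h "gmult Q e g"]] r e g by (simp add: E_in E_src Q.assoc Q.closed Q.st)
  finally show ?thesis .
qed

lemma T_lact:
  assumes d: "(a, y, e) \<in> D"
  shows "lact T (proj \<alpha> a) (cls (a, y, e)) = cls (a, y, e)"
proof -
  obtain a' h where r: "a' \<in> total_space \<alpha>" "h \<in> arrows G" "eps \<alpha> a' = tgt G h" "src G h = tgt Q e" "a = ract \<alpha> a' h"
    "(SOME z'. z' \<in> cls (a, y, e)) = (a', tgt G h, gmult Q (E h) e)" by (rule rep_cases[OF d])
  have "lact \<alpha> (proj \<alpha> a) a' = a'" using \<alpha>.lact_triv[OF r(1)] r by (simp add: \<alpha>.act_proj)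
  then have "lact T (proj \<alpha> a) (cls (a, y, e)) = cls (a', tgt G h, gmult Q (E h) e)"
    using r(6) by (simp add: tensor_def)
  also have "\<dots> = cls (a, y, e)"
    using cls_eq[OF relI[of a' h e]] r d by (simp add: D_iff)
  finally show ?thesis .
qed

lemma T_map:
  assumes A: "tensor_torsor G Q E Z A" and d: "(a, y, e) \<in> D"
    and f: "\<And>p. p \<in> total_space \<alpha> \<Longrightarrow> f p \<in> total_space A \<and> eps A (f p) = eps \<alpha> p"
    and eqv: "\<And>p g. p \<in> total_space \<alpha> \<Longrightarrow> g \<in> arrows G \<Longrightarrow> eps \<alpha> p = tgt G g \<Longrightarrow> f (ract \<alpha> p g) = ract A (f p) g"
  shows "tensor_map G A FB f (cls (a, y, e)) = tensor_class G A FB (f a, y, e)"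
proof -
  interpret A: tensor_torsor G Q E Z A by (rule A)
  obtain a' h where r: "a' \<in> total_space \<alpha>" "h \<in> arrows G" "eps \<alpha> a' = tgt G h" "src G h = tgt Q e" "a = ract \<alpha> a' h"
    "(SOME z'. z' \<in> cls (a, y, e)) = (a', tgt G h, gmult Q (E h) e)" by (rule rep_cases[OF d])
  have e: "e \<in> arrows Q" "y = src G h" using d r by (auto simp: D_iff)
  have "tensor_map G A FB f (cls (a, y, e)) = tensor_class G A FB (f a', tgt G h, gmult Q (E h) e)"
    using r(6) by (simp add: tensor_map_def)
  also have "\<dots> = tensor_class G A FB (f a, y, e)"
    using A.cls_eq[OF A.relI[of "f a'" h e]] r e f[OF r(1)] eqv[OF r(1,2,3)] by simp
  finally show ?thesis .
qed

definition extension :: "('r, 'y, 'y, 'o, 'b) bibundle \<Rightarrow> ('q \<Rightarrow> 'r) \<Rightarrow> ('q \<times> 'o \<times> 'b) set \<Rightarrow> 'r" where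
  "extension \<beta> \<mu> c = (let z = (SOME z. z \<in> c) in ract \<beta> (\<mu> (fst z)) (snd (snd z)))"

text \<open>On representatives the map is \<open>(a, y, e) \<mapsto> \<mu>(a) e\<close>. If two representatives have the same image, then the arrow
  that relates their first components makes them equivalent. A local section \<open>\<sigma>\<close> of \<open>\<alpha>\<close> gives the continuous
  local inverse \<open>b \<mapsto> [\<sigma>, d]\<close>, where \<open>d\<close> is the quotient of \<open>b\<close> by \<open>\<mu>(\<sigma>)\<close>.\<close>

lemma extension_iso:
  fixes \<beta> :: "('r, 'y, 'y, 'o, 'b) bibundle"
  assumes \<beta>: "torsor Q Z \<beta>"
    and \<mu>: "\<And>p. p \<in> total_space \<alpha> \<Longrightarrow> \<mu> p \<in> total_space \<beta> \<and> proj \<beta> (\<mu> p) = proj \<alpha> p \<and> eps \<beta> (\<mu> p) = eps \<alpha> p"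
    and eqv: "\<And>p g. p \<in> total_space \<alpha> \<Longrightarrow> g \<in> arrows G \<Longrightarrow> eps \<alpha> p = tgt G g \<Longrightarrow> \<mu> (ract \<alpha> p g) = ract \<beta> (\<mu> p) (E g)"
    and sec: "\<And>y. y \<in> topspace Z \<Longrightarrow> \<exists>V \<sigma>. openin Z V \<and> y \<in> V \<and> continuous_map (subtopology Z V) (Tot \<alpha>) \<sigma> \<and>
      (\<forall>z\<in>V. proj \<alpha> (\<sigma> z) = z) \<and> continuous_map (subtopology Z V) (Tot \<beta>) (\<lambda>z. \<mu> (\<sigma> z))"
  shows "bundle_iso Q (unit_groupoid Z) T \<beta> (extension \<beta> \<mu>)"
    "\<And>a y e. (a, y, e) \<in> D \<Longrightarrow> extension \<beta> \<mu> (cls (a, y, e)) = ract \<beta> (\<mu> a) e"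
proof -
  interpret \<beta>: torsor Q Z \<beta> by (rule \<beta>)
  let ?DD = "subtopology (prod_topology (Tot \<alpha>) (Tot FB)) D"
  define \<kappa> where "\<kappa> z = ract \<beta> (\<mu> (fst z)) (snd (snd z))" for z :: "'q \<times> 'o \<times> 'b"
  have ext: "extension \<beta> \<mu> (cls (a, y, e)) = ract \<beta> (\<mu> a) e" if d: "(a, y, e) \<in> D" for a y e
  proof -
    obtain a' h where r: "a' \<in> total_space \<alpha>" "h \<in> arrows G" "eps \<alpha> a' = tgt G h" "src G h = tgt Q e" "a = ract \<alpha> a' h"
      "(SOME z'. z' \<in> cls (a, y, e)) = (a', tgt G h, gmult Q (E h) e)" by (rule rep_cases[OF d])
    have e: "e \<in> arrows Q" using d by (simp add: D_iff)
    have "extension \<beta> \<mu> (cls (a, y, e)) = ract \<beta> (\<mu> a') (gmult Q (E h) e)"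
      using r(6) by (simp add: extension_def)
    also have "\<dots> = ract \<beta> (\<mu> a) e"
      using eqv[OF r(1,2,3)] \<beta>.act_assoc[of "\<mu> a'" "E h" e] \<mu>[OF r(1)] r e by (simp add: E_in E_src E_tgt)
    finally show ?thesis .
  qed
  then show "\<And>a y e. (a, y, e) \<in> D \<Longrightarrow> extension \<beta> \<mu> (cls (a, y, e)) = ract \<beta> (\<mu> a) e" .
  have ext\<kappa>: "extension \<beta> \<mu> (cls z) = \<kappa> z" if "z \<in> D" for z using ext that by (cases z) (auto simp: \<kappa>_def)
  have \<mu>D: "\<mu> a \<in> total_space \<beta>" "eps \<beta> (\<mu> a) = tgt Q e" "proj \<beta> (\<mu> a) = proj \<alpha> a" "e \<in> arrows Q" "a \<in> total_space \<alpha>"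
    if "(a, y, e) \<in> D" for a y e using that \<mu>[of a] by (auto simp: D_iff)
  have K: "ract \<beta> (\<mu> a) e \<in> total_space \<beta>" "proj \<beta> (ract \<beta> (\<mu> a) e) = proj \<alpha> a" "eps \<beta> (ract \<beta> (\<mu> a) e) = src Q e"
    if "(a, y, e) \<in> D" for a y e
    using \<mu>D[OF that] by (auto simp: \<beta>.act_in \<beta>.act_proj \<beta>.act_eps)
  have \<mu>c: "continuous_map (Tot \<alpha>) (Tot \<beta>) \<mu>"
    by (rule equivariant_continuous[OF \<alpha>.torsor_axioms \<beta> E_cont E_tgt _ eqv sec]) (simp_all add: \<mu>)
  have \<kappa>c: "continuous_map ?DD (Tot \<beta>) \<kappa>"
    unfolding \<kappa>_def
  proof (rule \<beta>.cont_act[OF continuous_map_comp[OF continuous_map_sub_fst \<mu>c] continuous_map_comp[OF continuous_map_sub_snd FB_snd_cont]])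
    fix z assume "z \<in> topspace ?DD"
    then have "z \<in> D" unfolding topspace_domain .
    then show "eps \<beta> (\<mu> (fst z)) = tgt Q (snd (snd z))" using \<mu>D(2) by (cases z) auto
  qed
  have Kc: "continuous_map (Tot T) (Tot \<beta>) (extension \<beta> \<mu>)"
    unfolding continuous_map_def
  proof (intro conjI allI impI)
    show "extension \<beta> \<mu> \<in> total_space T \<rightarrow> total_space \<beta>" using ext K(1) by (auto simp: topspace_T)
    fix S assume "openin (Tot \<beta>) S"
    then have "openin ?DD {z \<in> topspace ?DD. \<kappa> z \<in> S}" by (rule openin_preimage[OF \<kappa>c])
    moreover have "{z \<in> topspace ?DD. \<kappa> z \<in> S} = {z \<in> D. cls z \<in> {c \<in> total_space T. extension \<beta> \<mu> c \<in> S}}"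
      unfolding topspace_domain topspace_T using ext\<kappa> by auto
    ultimately show "openin (Tot T) {c \<in> total_space T. extension \<beta> \<mu> c \<in> S}"
      unfolding openin_T by (auto simp: topspace_T)
  qed
  have inj: "inj_on (extension \<beta> \<mu>) (total_space T)"
  proof (rule inj_onI)
    fix c c' assume c: "c \<in> total_space T" "c' \<in> total_space T" "extension \<beta> \<mu> c = extension \<beta> \<mu> c'"
    obtain a y e where z: "c = cls (a, y, e)" "(a, y, e) \<in> D" using c(1) by (auto simp: topspace_T)
    obtain a' y' e' where z': "c' = cls (a', y', e')" "(a', y', e') \<in> D" using c(2) by (auto simp: topspace_T)
    have eq: "ract \<beta> (\<mu> a) e = ract \<beta> (\<mu> a') e'" using c(3) ext z z' by simp
    have pr: "proj \<alpha> a' = proj \<alpha> a" using K(2)[OF z(2)] K(2)[OF z'(2)] eq by simp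
    note m = \<mu>D[OF z(2)] and m' = \<mu>D[OF z'(2)]
    note g = \<alpha>.pdiv[OF m'(5) m(5) pr]
    let ?g = "pdiv G \<alpha> a' a"
    have e: "tgt Q e = src G ?g" using g(4) z(2) by (simp add: D_iff)
    have "ract \<beta> (\<mu> a) e = ract \<beta> (\<mu> a') (gmult Q (E ?g) e)"
      using eqv[OF m'(5) g(1) g(2)[symmetric]] g \<beta>.act_assoc[of "\<mu> a'" "E ?g" e] m m' e \<mu>[OF m'(5)]
      by (simp add: E_in E_src E_tgt)
    then have "gmult Q (E ?g) e = e'"
      using eq m m' g e \<mu>[OF m'(5)] by (intro \<beta>.act_free[of "\<mu> a'"]) (auto simp: E_in E_src E_tgt Q.closed Q.st)
    then show "c = c'"
      using cls_eq[OF relI[of a' ?g e]] g m m' e z z' by (simp add: D_iff)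
  qed
  have pre: "(s, eps \<alpha> s, pdiv Q \<beta> (\<mu> s) b) \<in> D \<and> ract \<beta> (\<mu> s) (pdiv Q \<beta> (\<mu> s) b) = b"
    if s: "s \<in> total_space \<alpha>" "b \<in> total_space \<beta>" "proj \<alpha> s = proj \<beta> b" for s b
    using \<beta>.pdiv[of "\<mu> s" b] \<mu>[OF s(1)] s by (simp add: D_iff)
  define k where "k = inv_into (total_space T) (extension \<beta> \<mu>)"
  have k: "k b = cls (s, eps \<alpha> s, pdiv Q \<beta> (\<mu> s) b)" if s: "s \<in> total_space \<alpha>" "b \<in> total_space \<beta>" "proj \<alpha> s = proj \<beta> b" for s b
  proof -
    note p = pre[OF s]
    have "extension \<beta> \<mu> (cls (s, eps \<alpha> s, pdiv Q \<beta> (\<mu> s) b)) = b" using ext p by simp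
    moreover have "cls (s, eps \<alpha> s, pdiv Q \<beta> (\<mu> s) b) \<in> total_space T" using p by (simp add: topspace_T)
    ultimately show ?thesis unfolding k_def using inv_into_f_f[OF inj, of "cls (s, eps \<alpha> s, pdiv Q \<beta> (\<mu> s) b)"] by simp
  qed
  have loc: "\<exists>V \<sigma>. openin Z V \<and> proj \<beta> b \<in> V \<and> continuous_map (subtopology Z V) (Tot \<alpha>) \<sigma> \<and> (\<forall>z\<in>V. proj \<alpha> (\<sigma> z) = z \<and> \<sigma> z \<in> total_space \<alpha>)"
    if b: "b \<in> total_space \<beta>" for b
  proof -
    obtain V \<sigma> where V: "openin Z V" "proj \<beta> b \<in> V" "continuous_map (subtopology Z V) (Tot \<alpha>) \<sigma>"
      "\<forall>z\<in>V. proj \<alpha> (\<sigma> z) = z" using sec[OF \<beta>.proj_in[OF b]] by (elim exE conjE)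
    have "\<sigma> z \<in> total_space \<alpha>" if "z \<in> V" for z
      using V(3) that openin_subset[OF V(1)] by (auto simp: continuous_map_def Pi_iff)
    then show ?thesis using V by blast
  qed
  have Kk: "extension \<beta> \<mu> (k b) = b \<and> k b \<in> total_space T" if b: "b \<in> total_space \<beta>" for b
  proof -
    obtain V \<sigma> where V: "proj \<beta> b \<in> V" "\<forall>z\<in>V. proj \<alpha> (\<sigma> z) = z \<and> \<sigma> z \<in> total_space \<alpha>" using loc[OF b] by (elim exE conjE)
    have s: "\<sigma> (proj \<beta> b) \<in> total_space \<alpha>" "proj \<alpha> (\<sigma> (proj \<beta> b)) = proj \<beta> b" using V by auto
    show ?thesis using k[OF s(1) b s(2)] pre[OF s(1) b s(2)] ext by (simp add: topspace_T)
  qed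
  have kc: "continuous_map (Tot \<beta>) (Tot T) k"
  proof (rule continuous_map_if_locally)
    fix b assume b: "b \<in> topspace (Tot \<beta>)"
    obtain V \<sigma> where V: "openin Z V" "proj \<beta> b \<in> V" "continuous_map (subtopology Z V) (Tot \<alpha>) \<sigma>"
      "\<forall>z\<in>V. proj \<alpha> (\<sigma> z) = z \<and> \<sigma> z \<in> total_space \<alpha>" using loc[OF b] by (elim exE conjE)
    define U where "U = {b \<in> topspace (Tot \<beta>). proj \<beta> b \<in> V}"
    have U: "openin (Tot \<beta>) U" unfolding U_def by (rule openin_preimage[OF \<beta>.proj_cont V(1)])
    have pc: "continuous_map (subtopology (Tot \<beta>) U) (subtopology Z V) (proj \<beta>)"
      by (intro continuous_map_into_subtopology continuous_map_from_subtopology \<beta>.proj_cont) (auto simp: U_def)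
    have idc: "continuous_map (subtopology (Tot \<beta>) U) (Tot \<beta>) (\<lambda>p. p)" by (simp add: continuous_map_from_subtopology)
    have s: "\<sigma> (proj \<beta> q) \<in> total_space \<alpha>" "q \<in> total_space \<beta>" "proj \<alpha> (\<sigma> (proj \<beta> q)) = proj \<beta> q" if "q \<in> U" for q
      using that V(4) by (auto simp: U_def)
    have sc: "continuous_map (subtopology (Tot \<beta>) U) (Tot \<alpha>) (\<lambda>q. \<sigma> (proj \<beta> q))" by (rule continuous_map_comp[OF pc V(3)])
    have dc: "continuous_map (subtopology (Tot \<beta>) U) (Arr Q) (\<lambda>q. pdiv Q \<beta> (\<mu> (\<sigma> (proj \<beta> q))) q)"
      by (rule \<beta>.cont_pdiv[OF continuous_map_comp[OF sc \<mu>c] idc]) (use s \<mu> in auto)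
    have "continuous_map (subtopology (Tot \<beta>) U) (Tot FB) (\<lambda>q. (eps \<alpha> (\<sigma> (proj \<beta> q)), pdiv Q \<beta> (\<mu> (\<sigma> (proj \<beta> q))) q))"
    proof (rule cont_into_FB[OF continuous_map_comp[OF sc \<alpha>.eps_cont] dc])
      fix q assume "q \<in> topspace (subtopology (Tot \<beta>) U)"
      then have q: "q \<in> U" by simp
      show "eps \<alpha> (\<sigma> (proj \<beta> q)) = tgt Q (pdiv Q \<beta> (\<mu> (\<sigma> (proj \<beta> q))) q)" using pre[OF s[OF q]] by (simp add: D_iff)
    qed
    then have "continuous_map (subtopology (Tot \<beta>) U) (prod_topology (Tot \<alpha>) (Tot FB))
        (\<lambda>q. (\<sigma> (proj \<beta> q), eps \<alpha> (\<sigma> (proj \<beta> q)), pdiv Q \<beta> (\<mu> (\<sigma> (proj \<beta> q))) q))"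
      by (intro continuous_map_pairedI sc)
    then have "continuous_map (subtopology (Tot \<beta>) U) ?DD
        (\<lambda>q. (\<sigma> (proj \<beta> q), eps \<alpha> (\<sigma> (proj \<beta> q)), pdiv Q \<beta> (\<mu> (\<sigma> (proj \<beta> q))) q))"
      by (rule continuous_map_into_subtopology) (use pre[OF s] in auto)
    from continuous_map_comp[OF this cls_cont]
    have "continuous_map (subtopology (Tot \<beta>) U) (Tot T) k"
      by (rule continuous_map_eq) (use k[OF s] in auto)
    then show "\<exists>U. openin (Tot \<beta>) U \<and> b \<in> U \<and> continuous_map (subtopology (Tot \<beta>) U) (Tot T) k"
      using U b V(2) by (intro exI[of _ U]) (auto simp: U_def)
  qed
  have "homeomorphic_maps (Tot T) (Tot \<beta>) (extension \<beta> \<mu>) k"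
    unfolding homeomorphic_maps_def using Kc kc Kk inj by (auto simp: k_def)
  then have homeo: "homeomorphic_map (Tot T) (Tot \<beta>) (extension \<beta> \<mu>)" by (rule homeomorphic_maps_map[THEN iffD1, THEN conjunct1])
  show "bundle_iso Q (unit_groupoid Z) T \<beta> (extension \<beta> \<mu>)"
    unfolding bundle_iso_def
  proof (intro conjI ballI impI homeo)
    fix c assume "c \<in> total_space T"
    then obtain a y e where c: "c = cls (a, y, e)" and d: "(a, y, e) \<in> D" by (auto simp: topspace_T)
    show "proj \<beta> (extension \<beta> \<mu> c) = proj T c" "eps \<beta> (extension \<beta> \<mu> c) = eps T c"
      using K[OF d] ext[OF d] T_proj[OF d] T_eps[OF d] by (simp_all add: c)
    show "extension \<beta> \<mu> (ract T c g) = ract \<beta> (extension \<beta> \<mu> c) g" if g: "g \<in> arrows Q" "eps T c = tgt Q g" for g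
    proof -
      have sg: "src Q e = tgt Q g" using g(2) T_eps[OF d] c by simp
      have "(a, y, gmult Q e g) \<in> D" using d g(1) sg by (simp add: D_iff Q.closed Q.st)
      then show ?thesis
        using ext[OF d] ext[of a y "gmult Q e g"] T_ract[OF d g(1) sg] \<beta>.act_assoc[of "\<mu> a" e g] \<mu>D[OF d] g(1) sg by (simp add: c)
    qed
    show "extension \<beta> \<mu> (lact T h c) = lact \<beta> h (extension \<beta> \<mu> c)"
      if h: "h \<in> arrows (unit_groupoid Z)" "src (unit_groupoid Z) h = proj T c" for h
    proof -
      have hp: "h = proj \<alpha> a" using h(2) T_proj[OF d] c by simp
      have "lact \<beta> (proj \<beta> (ract \<beta> (\<mu> a) e)) (ract \<beta> (\<mu> a) e) = ract \<beta> (\<mu> a) e" by (rule \<beta>.lact_triv[OF K(1)[OF d]])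
      then show ?thesis using T_lact[OF d] ext[OF d] K(2)[OF d] by (simp add: c hp)
    qed
  qed
qed

end

section \<open>Cubes\<close>

lemma topspace_cube: "topspace (cube n) = {x. (\<forall>i\<ge>n. x i = 0) \<and> (\<forall>i<n. 0 \<le> x i \<and> x i \<le> 1)}"
  by (auto simp: cube_def topspace_Euclidean_space)

lemma compact_cube: "compact_space (cube n)"
proof -
  have "cube n = subtopology (powertop_real UNIV) (Pi\<^sub>E UNIV (\<lambda>i. if i < n then {0..1} else {0}))"
    unfolding cube_def Euclidean_space_def subtopology_subtopology
    by (rule arg_cong[of _ _ "subtopology (powertop_real UNIV)"]) (auto simp: PiE_iff split: if_splits)
  moreover have "compactin (powertop_real UNIV) (Pi\<^sub>E UNIV (\<lambda>i. if i < n then {0..1} else {0::real}))"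
    by (simp add: compactin_PiE)
  ultimately show ?thesis by (simp add: compact_space_subtopology)
qed

lemma cube_coordinate: "continuous_map (cube n) euclideanreal (\<lambda>x. x i)"
  unfolding cube_def by (intro continuous_map_from_subtopology continuous_map_Euclidean_coordinate)

lemma cube_product:
  "homeomorphic_maps (cube (Suc n)) (prod_topology (cube n) (top_of_set {0..1})) (\<lambda>y. (y(n := 0), y n)) (\<lambda>z. (fst z)(n := snd z))"
  (is "homeomorphic_maps ?Y ?X ?\<Phi> ?\<Psi>")
proof -
  have "continuous_map ?Y (Euclidean_space n) (\<lambda>y i. if i < n then y i else 0)"
    unfolding continuous_map_componentwise_Euclidean_space using cube_coordinate by blast
  then have "continuous_map ?Y (cube n) (\<lambda>y i. if i < n then y i else 0)"
    unfolding cube_def[of n] by (rule continuous_map_into_subtopology) (auto simp: topspace_cube)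
  then have 1: "continuous_map ?Y (cube n) (\<lambda>y. y(n := 0))"
    by (rule continuous_map_eq) (auto simp: topspace_cube fun_eq_iff)
  have "continuous_map ?Y (top_of_set {0..1}) (\<lambda>y. y n)"
    by (rule continuous_map_into_subtopology[OF cube_coordinate]) (auto simp: topspace_cube)
  with 1 have \<Phi>: "continuous_map ?Y ?X ?\<Phi>" by (rule continuous_map_pairedI)
  have s: "continuous_map ?X euclideanreal snd"
    by (rule continuous_map_into_fulltopology[OF continuous_map_snd])
  have "continuous_map ?X (Euclidean_space (Suc n)) (\<lambda>z i. if i < Suc n then (if i < n then fst z i else snd z) else 0)"
    unfolding continuous_map_componentwise_Euclidean_space
  proof (intro allI impI)
    fix i assume "i < Suc n"
    show "continuous_map ?X euclideanreal (\<lambda>z. if i < n then fst z i else snd z)"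
      using continuous_map_comp[OF continuous_map_fst cube_coordinate] s by (cases "i < n") simp_all
  qed
  then have "continuous_map ?X ?Y (\<lambda>z i. if i < Suc n then (if i < n then fst z i else snd z) else 0)"
    unfolding cube_def[of "Suc n"] by (rule continuous_map_into_subtopology) (auto simp: topspace_cube)
  then have \<Psi>: "continuous_map ?X ?Y ?\<Psi>"
    by (rule continuous_map_eq) (auto simp: topspace_cube fun_eq_iff)
  show ?thesis unfolding homeomorphic_maps_def using \<Phi> \<Psi> by (auto simp: topspace_cube fun_eq_iff)
qed

lemma cube_face_subset: "topspace (cube n) = {x \<in> topspace (cube (Suc n)). x n = 0}"
  using arg_cong[OF cube_face[of n], of topspace] by auto

lemma cube_face_topspace: "subtopology (cube (Suc n)) (topspace (cube n)) = cube n"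
proof -
  have "topspace (cube n) = topspace (cube (Suc n)) \<inter> {x. x n = 0}" unfolding cube_face_subset[of n] by blast
  then show ?thesis using subtopology_restrict[of "cube (Suc n)" "{x. x n = 0}"] cube_face by metis
qed

section \<open>Changing the base and the type of a torsor\<close>

lemma torsor_relabel:
  assumes "torsor G Y P" and homeo: "homeomorphic_maps Y Y' \<Phi> \<Psi>"
  shows "torsor G Y' \<lparr>Tot = Tot P, proj = \<Phi> \<circ> proj P, eps = eps P, lact = (\<lambda>_ p. p), ract = ract P\<rparr>"
proof -
  interpret torsor G Y P by fact
  let ?P = "\<lparr>Tot = Tot P, proj = \<Phi> \<circ> proj P, eps = eps P, lact = (\<lambda>_ p. p), ract = ract P\<rparr>"
  have \<Phi>: "continuous_map Y Y' \<Phi>" and \<Psi>: "continuous_map Y' Y \<Psi>" and \<Psi>\<Phi>: "\<And>y. y \<in> topspace Y \<Longrightarrow> \<Psi> (\<Phi> y) = y"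
    and \<Phi>\<Psi>: "\<And>y. y \<in> topspace Y' \<Longrightarrow> \<Phi> (\<Psi> y) = y"
    using homeo by (auto simp: homeomorphic_maps_def)
  have inj: "\<Phi> (proj P p) = \<Phi> (proj P p') \<longleftrightarrow> proj P p = proj P p'" if "p \<in> total_space P" "p' \<in> total_space P" for p p'
    using \<Psi>\<Phi>[OF proj_in[OF that(1)]] \<Psi>\<Phi>[OF proj_in[OF that(2)]] by metis
  have "principal_bundle G (unit_groupoid Y') ?P"
  proof (rule principal_bundle_unitI[OF G, where d = "pdiv G P"])
    show "right_action G (Tot ?P) (eps ?P) (ract ?P)" using ra by simp
    show "continuous_map (Tot ?P) Y' (proj ?P)" using continuous_map_compose[OF proj_cont \<Phi>] by simp
    show "\<exists>U \<sigma>. openin Y' U \<and> y \<in> U \<and> continuous_map (subtopology Y' U) (Tot ?P) \<sigma> \<and> (\<forall>z\<in>U. proj ?P (\<sigma> z) = z)"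
      if y: "y \<in> topspace Y'" for y
    proof -
      have "\<Psi> y \<in> topspace Y" using \<Psi> y by (auto simp: continuous_map_def)
      from local_section[OF this] obtain U \<sigma> where U: "openin Y U" "\<Psi> y \<in> U" "continuous_map (subtopology Y U) (Tot P) \<sigma>" "\<forall>z\<in>U. proj P (\<sigma> z) = z"
        by (elim exE conjE)
      define U' where "U' = {y \<in> topspace Y'. \<Psi> y \<in> U}"
      have "openin Y' U'" unfolding U'_def by (rule openin_preimage[OF \<Psi> U(1)])
      moreover have "continuous_map (subtopology Y' U') (subtopology Y U) \<Psi>"
        by (intro continuous_map_into_subtopology continuous_map_from_subtopology \<Psi>) (auto simp: U'_def)
      from continuous_map_comp[OF this U(3)] have "continuous_map (subtopology Y' U') (Tot P) (\<lambda>y. \<sigma> (\<Psi> y))" .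
      ultimately show ?thesis using y U(2,4) \<Phi>\<Psi> by (intro exI[of _ U'] exI[of _ "\<lambda>y. \<sigma> (\<Psi> y)"]) (auto simp: U'_def)
    qed
    let ?Z = "subtopology (prod_topology (Tot P) (Tot P)) {(p, p'). (\<Phi> \<circ> proj P) p = (\<Phi> \<circ> proj P) p'}"
    have "continuous_map ?Z (Arr G) (\<lambda>z. pdiv G P (fst z) (snd z))"
      by (rule cont_pdiv[OF continuous_map_sub_fst continuous_map_sub_snd]) (auto simp: inj)
    then show "continuous_map (subtopology (prod_topology (Tot ?P) (Tot ?P)) {(p, p'). proj ?P p = proj ?P p'}) (Arr G) (\<lambda>(p, p'). pdiv G P p p')"
      by (simp add: case_prod_unfold)
  qed (auto simp: act_proj inj pdiv pdiv_eq)
  then show ?thesis by unfold_locales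
qed

context torsor
begin

text \<open>An isomorphic copy of \<open>P\<close> whose points are pairs of a base point and an arrow: the point \<open>c(y) g\<close> is encoded
  by \<open>(y, g)\<close>. This is how the given bundle \<open>\<beta>\<close> of arbitrary type is moved to the type required in the definition of
  a Serre fibration.\<close>

definition normal_form :: "('y \<Rightarrow> 'p) \<Rightarrow> ('y \<times> 'a, 'y, 'y, 'o, 'a) bibundle" where
  "normal_form c = glued_bundle G Y (\<lambda>y. eps P (c y)) {(V, \<lambda>y. pdiv G P (c y) (\<sigma> y)) |V \<sigma>. openin Y V \<and>
    continuous_map (subtopology Y V) (Tot P) \<sigma> \<and> (\<forall>z\<in>V. \<sigma> z \<in> total_space P \<and> proj P (\<sigma> z) = z)}"

lemma pdiv_quotient:
  assumes "p \<in> total_space P" "p' \<in> total_space P" "p'' \<in> total_space P" "proj P p' = proj P p" "proj P p'' = proj P p"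
  shows "gmult G (ginv G (pdiv G P p p')) (pdiv G P p p'') = pdiv G P p' p''"
proof -
  have "pdiv G P p p'' = gmult G (pdiv G P p p') (pdiv G P p' p'')" using assms by (intro pdiv_mult[symmetric]) auto
  then show ?thesis using pdiv[of p p'] pdiv[of p' p''] assms by (simp add: inv_mult_cancel)
qed

lemma normal_form_trivializations:
  assumes c: "\<And>y. y \<in> topspace Y \<Longrightarrow> c y \<in> total_space P \<and> proj P (c y) = y"
  shows "trivializations G Y (\<lambda>y. eps P (c y)) {(V, \<lambda>y. pdiv G P (c y) (\<sigma> y)) |V \<sigma>. openin Y V \<and>
    continuous_map (subtopology Y V) (Tot P) \<sigma> \<and> (\<forall>z\<in>V. \<sigma> z \<in> total_space P \<and> proj P (\<sigma> z) = z)}" (is "trivializations _ _ _ ?R")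
proof
  fix V r assume "(V, r) \<in> ?R"
  then obtain \<sigma> where V: "r = (\<lambda>y. pdiv G P (c y) (\<sigma> y))" "openin Y V" "continuous_map (subtopology Y V) (Tot P) \<sigma>"
      "\<forall>z\<in>V. \<sigma> z \<in> total_space P \<and> proj P (\<sigma> z) = z" by blast
  show "openin Y V" by (rule V(2))
  have VY: "V \<subseteq> topspace Y" by (rule openin_subset[OF V(2)])
  show "r y \<in> arrows G \<and> tgt G (r y) = eps P (c y)" if "y \<in> V" for y
    using pdiv[of "c y" "\<sigma> y"] c[of y] V(4) that VY by (auto simp: V(1))
  fix V' r' assume "(V', r') \<in> ?R"
  then obtain \<sigma>' where V': "r' = (\<lambda>y. pdiv G P (c y) (\<sigma>' y))" "openin Y V'" "continuous_map (subtopology Y V') (Tot P) \<sigma>'"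
      "\<forall>z\<in>V'. \<sigma>' z \<in> total_space P \<and> proj P (\<sigma>' z) = z" by blast
  have "continuous_map (subtopology Y (V \<inter> V')) (Arr G) (\<lambda>y. pdiv G P (\<sigma> y) (\<sigma>' y))"
  proof (rule cont_pdiv)
    show "continuous_map (subtopology Y (V \<inter> V')) (Tot P) \<sigma>" by (rule continuous_map_from_subtopology_mono[OF V(3)]) blast
    show "continuous_map (subtopology Y (V \<inter> V')) (Tot P) \<sigma>'" by (rule continuous_map_from_subtopology_mono[OF V'(3)]) blast
  qed (use V(4) V'(4) in simp)
  then show "continuous_map (subtopology Y (V \<inter> V')) (Arr G) (\<lambda>y. gmult G (ginv G (r y)) (r' y))"
    by (rule continuous_map_eq) (use V(4) V'(4) c in \<open>simp add: V(1) V'(1) pdiv_quotient\<close>)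
next
  fix y assume "y \<in> topspace Y"
  from local_section_in[OF this] show "\<exists>V r. (V, r) \<in> ?R \<and> y \<in> V" by blast
qed

lemma normal_form_torsor:
  assumes c: "\<And>y. y \<in> topspace Y \<Longrightarrow> c y \<in> total_space P \<and> proj P (c y) = y"
  shows "torsor G Y (normal_form c)" "bundle_iso G (unit_groupoid Y) P (normal_form c) (\<lambda>p. (proj P p, pdiv G P (c (proj P p)) p))"
proof -
  let ?R = "{(V, \<lambda>y. pdiv G P (c y) (\<sigma> y)) |V \<sigma>. openin Y V \<and>
    continuous_map (subtopology Y V) (Tot P) \<sigma> \<and> (\<forall>z\<in>V. \<sigma> z \<in> total_space P \<and> proj P (\<sigma> z) = z)}"
  interpret N: trivializations G Y "\<lambda>y. eps P (c y)" ?R by (rule normal_form_trivializations[OF c])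
  have B: "normal_form c = N.B" by (simp add: normal_form_def)
  show t: "torsor G Y (normal_form c)" unfolding B by (rule N.glued_torsor)
  have d: "pdiv G P (c (proj P p)) p \<in> arrows G" "tgt G (pdiv G P (c (proj P p)) p) = eps P (c (proj P p))"
     "ract P (c (proj P p)) (pdiv G P (c (proj P p)) p) = p" "src G (pdiv G P (c (proj P p)) p) = eps P p"
    if "p \<in> total_space P" for p
    using pdiv[of "c (proj P p)" p] c[OF proj_in[OF that]] that by auto
  show "bundle_iso G (unit_groupoid Y) P (normal_form c) (\<lambda>p. (proj P p, pdiv G P (c (proj P p)) p))"
  proof (rule torsor_iso[OF torsor_axioms t])
    fix p assume p: "p \<in> total_space P"
    show "(proj P p, pdiv G P (c (proj P p)) p) \<in> total_space (normal_form c) \<and>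
        proj (normal_form c) (proj P p, pdiv G P (c (proj P p)) p) = proj P p \<and>
        eps (normal_form c) (proj P p, pdiv G P (c (proj P p)) p) = eps P p"
      using d[OF p] proj_in[OF p] by (simp add: B N.topspace_glued)
    fix g assume g: "g \<in> arrows G" "eps P p = tgt G g"
    have "pdiv G P (c (proj P p)) (ract P p g) = gmult G (pdiv G P (c (proj P p)) p) g"
      using pdiv_eq[of "c (proj P p)" "gmult G (pdiv G P (c (proj P p)) p) g"]
        act_assoc[of "c (proj P p)" "pdiv G P (c (proj P p)) p" g] d[OF p] c[OF proj_in[OF p]] g by (simp add: closed st)
    then show "(proj P (ract P p g), pdiv G P (c (proj P (ract P p g))) (ract P p g)) =
        ract (normal_form c) (proj P p, pdiv G P (c (proj P p)) p) g"
      using p g by (simp add: B act_proj)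
  next
    fix y assume "y \<in> topspace Y"
    from local_section_in[OF this] obtain V \<sigma> where V: "openin Y V" "y \<in> V" "continuous_map (subtopology Y V) (Tot P) \<sigma>"
        "\<forall>z\<in>V. \<sigma> z \<in> total_space P \<and> proj P (\<sigma> z) = z" by (elim exE conjE)
    have "(V, \<lambda>y. pdiv G P (c y) (\<sigma> y)) \<in> ?R" using V by blast
    from N.glued_chart_section[OF this]
    have "continuous_map (subtopology Y V) (Tot (normal_form c)) (\<lambda>z. (proj P (\<sigma> z), pdiv G P (c (proj P (\<sigma> z))) (\<sigma> z)))"
      unfolding B by (rule continuous_map_eq) (use V(4) in simp)
    then show "\<exists>V \<sigma>. openin Y V \<and> y \<in> V \<and> continuous_map (subtopology Y V) (Tot P) \<sigma> \<and> (\<forall>z\<in>V. proj P (\<sigma> z) = z) \<and>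
        continuous_map (subtopology Y V) (Tot (normal_form c)) (\<lambda>z. (proj P (\<sigma> z), pdiv G P (c (proj P (\<sigma> z))) (\<sigma> z)))"
      using V by blast
  qed
qed

end

section \<open>The lifting property\<close>

context covering_functor
begin

text \<open>The atlas of \<open>\<alpha>\<close> over the face extends to an atlas over the cube, which glues to the lift \<open>A\<close>. By the choice
  of \<open>c\<close> over the face, \<open>\<alpha>\<close> is identified with the restriction of \<open>A\<close> by writing each of its points as \<open>as x g\<close>, and
  this identification commutes with the maps to \<open>\<beta>\<close>.\<close>

lemma lifting_property:
  fixes \<alpha> :: "('q, nat \<Rightarrow> real, nat \<Rightarrow> real, 'o, 'a) bibundle"
    and \<beta> :: "('r, nat \<Rightarrow> real, nat \<Rightarrow> real, 'o, 'b) bibundle"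
  assumes \<alpha>: "principal_bundle G (unit_groupoid (cube n)) \<alpha>"
    and \<beta>: "principal_bundle Q (unit_groupoid (cube (Suc n))) \<beta>"
    and h: "bundle_iso Q (unit_groupoid (cube n)) (tensor G \<alpha> FB) (restrict_bundle (topspace (cube n)) \<beta>) h"
  shows "\<exists>(A :: ((nat \<Rightarrow> real) \<times> 'a, nat \<Rightarrow> real, nat \<Rightarrow> real, 'o, 'a) bibundle)
    (B :: ((nat \<Rightarrow> real) \<times> 'b, nat \<Rightarrow> real, nat \<Rightarrow> real, 'o, 'b) bibundle) K q R.
    principal_bundle G (unit_groupoid (cube (Suc n))) A \<and>
    principal_bundle Q (unit_groupoid (cube (Suc n))) B \<and>
    bundle_iso Q (unit_groupoid (cube (Suc n))) (tensor G A FB) B K \<and>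
    bundle_iso G (unit_groupoid (cube n)) \<alpha> (restrict_bundle (topspace (cube n)) A) q \<and>
    bundle_iso Q (unit_groupoid (cube (Suc n))) \<beta> B R \<and>
    (\<forall>z\<in>total_space (tensor G \<alpha> FB).
       K (tensor_map G (restrict_bundle (topspace (cube n)) A) FB q z) = R (h z))"
proof -
  let ?X = "cube n" and ?Y = "cube (Suc n)" and ?I = "top_of_set {0..1::real}"
  interpret \<alpha>: tensor_torsor G Q E ?X \<alpha> by unfold_locales (rule \<alpha>)
  interpret \<beta>: torsor Q ?Y \<beta> by unfold_locales (rule \<beta>)
  have XY: "x \<in> topspace ?Y" "x n = 0" if "x \<in> topspace ?X" for x
    using that cube_face_subset[of n] by auto

  \<comment> \<open>The isomorphism \<open>h\<close> is determined by the equivariant map \<open>a \<mapsto> h [a, 1]\<close>.\<close>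
  define \<mu>0 where "\<mu>0 a = h (\<alpha>.cls (a, eps \<alpha> a, gunit Q (eps \<alpha> a)))" for a
  have hc: "continuous_map (Tot \<alpha>.T) (Tot \<beta>) h"
    using h homeomorphic_imp_continuous_map unfolding bundle_iso_def restrict_bundle_def
    by (auto intro: continuous_map_into_fulltopology)
  have h_in: "h z \<in> total_space \<beta>" "proj \<beta> (h z) = proj \<alpha>.T z" "eps \<beta> (h z) = eps \<alpha>.T z" if "z \<in> total_space \<alpha>.T" for z
    using h that hc by (auto simp: bundle_iso_def restrict_bundle_def continuous_map_def)
  have h_ract: "h (ract \<alpha>.T z g) = ract \<beta> (h z) g" if "z \<in> total_space \<alpha>.T" "g \<in> arrows Q" "eps \<alpha>.T z = tgt Q g" for z g
    using h that by (simp add: bundle_iso_def restrict_bundle_def)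
  have unitD: "(a, eps \<alpha> a, gunit Q (eps \<alpha> a)) \<in> \<alpha>.D" if "a \<in> total_space \<alpha>" for a
    using that \<alpha>.\<alpha>.eps_in[OF that] by (simp add: \<alpha>.D_iff Obj_Q Q.closed Q.st)
  have \<mu>0: "\<mu>0 a \<in> total_space \<beta>" "proj \<beta> (\<mu>0 a) = proj \<alpha> a" "eps \<beta> (\<mu>0 a) = eps \<alpha> a" if a: "a \<in> total_space \<alpha>" for a
    using h_in[of "\<alpha>.cls (a, eps \<alpha> a, gunit Q (eps \<alpha> a))"] unitD[OF a] \<alpha>.T_proj[OF unitD[OF a]] \<alpha>.T_eps[OF unitD[OF a]]
      \<alpha>.\<alpha>.eps_in[OF a] by (auto simp: \<mu>0_def \<alpha>.topspace_T Obj_Q Q.st)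
  have h_\<mu>0: "h (\<alpha>.cls (a, y, e)) = ract \<beta> (\<mu>0 a) e" if d: "(a, y, e) \<in> \<alpha>.D" for a y e
  proof -
    have a: "a \<in> total_space \<alpha>" "e \<in> arrows Q" "tgt Q e = eps \<alpha> a" "y = eps \<alpha> a" using d by (auto simp: \<alpha>.D_iff)
    have u: "src Q (gunit Q (eps \<alpha> a)) = tgt Q e" using \<alpha>.\<alpha>.eps_in[OF a(1)] a(3) by (simp add: Obj_Q Q.st)
    have "gmult Q (gunit Q (eps \<alpha> a)) e = e" using Q.unit_l[OF a(2)] a(3) by simp
    then have "\<alpha>.cls (a, y, e) = ract \<alpha>.T (\<alpha>.cls (a, eps \<alpha> a, gunit Q (eps \<alpha> a))) e"
      using \<alpha>.T_ract[OF unitD[OF a(1)] a(2) u] a(4) by simp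
    moreover have "\<alpha>.cls (a, eps \<alpha> a, gunit Q (eps \<alpha> a)) \<in> total_space \<alpha>.T"
      using unitD[OF a(1)] by (simp add: \<alpha>.topspace_T)
    ultimately show ?thesis using h_ract a(2) \<alpha>.T_eps[OF unitD[OF a(1)]] u by (simp add: \<mu>0_def)
  qed
  have \<mu>0_eqv: "\<mu>0 (ract \<alpha> a g) = ract \<beta> (\<mu>0 a) (E g)" if a: "a \<in> total_space \<alpha>" "g \<in> arrows G" "eps \<alpha> a = tgt G g" for a g
  proof -
    have s: "src G g \<in> objects G" using a by (simp add: G.closed)
    have "((ract \<alpha> a g, src G g, gunit Q (src G g)), (a, tgt G g, gmult Q (E g) (gunit Q (src G g)))) \<in> \<alpha>.rel"
      using a s by (intro \<alpha>.relI) (auto simp: Obj_Q Q.closed Q.st)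
    moreover have "gmult Q (E g) (gunit Q (src G g)) = E g" using Q.unit_r[OF E_in[OF a(2)]] a(2) by (simp add: E_src)
    ultimately have "\<mu>0 (ract \<alpha> a g) = h (\<alpha>.cls (a, tgt G g, E g))"
      using \<alpha>.cls_eq a by (simp add: \<mu>0_def \<alpha>.\<alpha>.act_eps)
    also have "\<dots> = ract \<beta> (\<mu>0 a) (E g)" using a by (intro h_\<mu>0) (simp add: \<alpha>.D_iff E_in E_tgt)
    finally show ?thesis .
  qed
  have \<mu>0c: "continuous_map (Tot \<alpha>) (Tot \<beta>) \<mu>0"
  proof -
    have u: "continuous_map (Tot \<alpha>) (Arr Q) (\<lambda>a. gunit Q (eps \<alpha> a))"
      using \<alpha>.\<alpha>.eps_cont by (intro Q.cont_unit) (simp add: Obj_Q)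
    have "continuous_map (Tot \<alpha>) (Tot FB) (\<lambda>a. (eps \<alpha> a, gunit Q (eps \<alpha> a)))"
      by (rule cont_into_FB[OF \<alpha>.\<alpha>.eps_cont u]) (use \<alpha>.\<alpha>.eps_in in \<open>simp add: Obj_Q Q.st\<close>)
    then have "continuous_map (Tot \<alpha>) (prod_topology (Tot \<alpha>) (Tot FB)) (\<lambda>a. (a, eps \<alpha> a, gunit Q (eps \<alpha> a)))"
      by (intro continuous_map_pairedI) simp_all
    then have "continuous_map (Tot \<alpha>) (subtopology (prod_topology (Tot \<alpha>) (Tot FB)) \<alpha>.D) (\<lambda>a. (a, eps \<alpha> a, gunit Q (eps \<alpha> a)))"
      by (rule continuous_map_into_subtopology) (use unitD in auto)
    from continuous_map_comp[OF continuous_map_comp[OF this \<alpha>.cls_cont] hc] show ?thesis unfolding \<mu>0_def .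
  qed

  \<comment> \<open>Identify the big cube with the product of its face and the interval.\<close>
  define \<Phi> where "\<Phi> y = (y(n := 0), y n)" for y :: "nat \<Rightarrow> real"
  define \<Psi> where "\<Psi> z = (fst z)(n := snd z)" for z :: "(nat \<Rightarrow> real) \<times> real"
  have homeo: "homeomorphic_maps ?Y (prod_topology ?X ?I) \<Phi> \<Psi>" unfolding \<Phi>_def \<Psi>_def by (rule cube_product)
  have \<Phi>c: "continuous_map ?Y (prod_topology ?X ?I) \<Phi>" and \<Psi>\<Phi>: "\<And>y. y \<in> topspace ?Y \<Longrightarrow> \<Psi> (\<Phi> y) = y"
    and \<Psi>c: "continuous_map (prod_topology ?X ?I) ?Y \<Psi>" and \<Phi>\<Psi>: "\<And>z. z \<in> topspace (prod_topology ?X ?I) \<Longrightarrow> \<Phi> (\<Psi> z) = z"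
    using homeo unfolding homeomorphic_maps_def by blast+
  have \<Phi>_in: "\<Phi> y \<in> topspace (prod_topology ?X ?I)" if "y \<in> topspace ?Y" for y using \<Phi>c that by (auto simp: continuous_map_def Pi_iff)
  have \<Psi>_in: "\<Psi> z \<in> topspace ?Y" if "z \<in> topspace (prod_topology ?X ?I)" for z using \<Psi>c that unfolding continuous_map_def by blast
  have \<Phi>X: "\<Phi> x = (x, 0)" if "x \<in> topspace ?X" for x using XY(2)[OF that] by (auto simp: \<Phi>_def fun_eq_iff)
  have \<Psi>X: "\<Psi> (x, 0) = x" if "x \<in> topspace ?X" for x using XY(2)[OF that] by (auto simp: \<Psi>_def fun_eq_iff)
  define \<beta>' where "\<beta>' = \<lparr>Tot = Tot \<beta>, proj = \<Phi> \<circ> proj \<beta>, eps = eps \<beta>, lact = (\<lambda>(_ :: (nat \<Rightarrow> real) \<times> real) p. p), ract = ract \<beta>\<rparr>"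
  have \<beta>'_sel: "Tot \<beta>' = Tot \<beta>" "proj \<beta>' = \<Phi> \<circ> proj \<beta>" "eps \<beta>' = eps \<beta>" "ract \<beta>' = ract \<beta>" by (simp_all add: \<beta>'_def)
  have t\<beta>': "torsor Q (prod_topology ?X ?I) \<beta>'" unfolding \<beta>'_def by (rule torsor_relabel[OF \<beta>.torsor_axioms homeo])
  define as where "as x = (SOME a. a \<in> total_space \<alpha> \<and> proj \<alpha> a = x)" for x
  have as: "as x \<in> total_space \<alpha>" "proj \<alpha> (as x) = x" if "x \<in> topspace ?X" for x
  proof -
    have "\<exists>a. a \<in> total_space \<alpha> \<and> proj \<alpha> a = x" using \<alpha>.\<alpha>.local_section_in[OF that] by blast
    from someI_ex[OF this] show "as x \<in> total_space \<alpha>" "proj \<alpha> (as x) = x" unfolding as_def by blast+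
  qed
  define c where "c z = (if snd z = 0 then \<mu>0 (as (fst z)) else (SOME b. b \<in> total_space \<beta> \<and> proj \<beta> b = \<Psi> z))" for z
  have c: "c z \<in> total_space \<beta>" "proj \<beta> (c z) = \<Psi> z" if z: "z \<in> topspace (prod_topology ?X ?I)" for z
  proof -
    have "c z \<in> total_space \<beta> \<and> proj \<beta> (c z) = \<Psi> z"
    proof (cases "snd z = 0")
      case True
      then obtain x where x: "z = (x, 0)" "x \<in> topspace ?X" using z by (cases z) auto
      show ?thesis using \<mu>0[OF as(1)[OF x(2)]] as(2)[OF x(2)] \<Psi>X[OF x(2)] by (simp add: c_def x)
    next
      case False
      have "\<exists>b. b \<in> total_space \<beta> \<and> proj \<beta> b = \<Psi> z" using \<beta>.local_section_in[OF \<Psi>_in[OF z]] by blast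
      from someI_ex[OF this] show ?thesis using False by (simp add: c_def)
    qed
    then show "c z \<in> total_space \<beta>" "proj \<beta> (c z) = \<Psi> z" by blast+
  qed
  interpret L: lift_problem G Q E ?X \<beta>' c
  proof
    show "compact_space ?X" by (rule compact_cube)
    show "principal_bundle Q (unit_groupoid (prod_topology ?X ?I)) \<beta>'" using t\<beta>' by (rule torsor.P)
    show "c z \<in> total_space \<beta>' \<and> proj \<beta>' (c z) = z" if "z \<in> topspace (prod_topology ?X ?I)" for z
      using c[OF that] \<Phi>\<Psi>[OF that] by (simp add: \<beta>'_sel)
  qed

  \<comment> \<open>The bundle \<open>\<alpha>\<close> as a system of charts over the face.\<close>
  define sec where "sec U \<sigma> \<longleftrightarrow> openin ?X U \<and> continuous_map (subtopology ?X U) (Tot \<alpha>) \<sigma> \<and>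
    (\<forall>z\<in>U. \<sigma> z \<in> total_space \<alpha> \<and> proj \<alpha> (\<sigma> z) = z)" for U \<sigma>
  define \<rho> where "\<rho> \<sigma> z = pdiv G \<alpha> (as (fst z)) (\<sigma> (fst z))" for \<sigma> and z :: "(nat \<Rightarrow> real) \<times> real"
  define \<R>0 where "\<R>0 = {(U \<times> {0::real}, \<rho> \<sigma>) |U \<sigma>. sec U \<sigma>}"
  have \<rho>: "\<rho> \<sigma> z \<in> arrows G" "tgt G (\<rho> \<sigma> z) = eps \<beta> (c z)" "ract \<beta> (c z) (E (\<rho> \<sigma> z)) = \<mu>0 (\<sigma> (fst z))"
    "src G (\<rho> \<sigma> z) = eps \<alpha> (\<sigma> (fst z))"
    if s: "sec U \<sigma>" and z: "z \<in> U \<times> {0}" for U \<sigma> z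
  proof -
    have x: "fst z \<in> U" "snd z = 0" using z by auto
    have xX: "fst z \<in> topspace ?X" using x(1) s openin_subset unfolding sec_def by blast
    have \<sigma>x: "\<sigma> (fst z) \<in> total_space \<alpha>" "proj \<alpha> (\<sigma> (fst z)) = fst z" using s x(1) unfolding sec_def by blast+
    have pr: "proj \<alpha> (as (fst z)) = proj \<alpha> (\<sigma> (fst z))" using as(2)[OF xX] \<sigma>x(2) by simp
    note d = \<alpha>.\<alpha>.pdiv[OF as(1)[OF xX] \<sigma>x(1) pr]
    show "\<rho> \<sigma> z \<in> arrows G" "src G (\<rho> \<sigma> z) = eps \<alpha> (\<sigma> (fst z))" using d by (simp_all add: \<rho>_def)
    show "tgt G (\<rho> \<sigma> z) = eps \<beta> (c z)" using d(2) \<mu>0(3)[OF as(1)[OF xX]] x(2) by (simp add: \<rho>_def c_def)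
    show "ract \<beta> (c z) (E (\<rho> \<sigma> z)) = \<mu>0 (\<sigma> (fst z))"
      using \<mu>0_eqv[OF as(1)[OF xX] d(1) d(2)[symmetric]] d(3) x(2) by (simp add: \<rho>_def c_def)
  qed
  have A0: "L.atlas_upto 0 \<R>0"
    unfolding L.atlas_upto_def
  proof (intro conjI allI impI ballI)
    fix V r assume "(V, r) \<in> \<R>0"
    then obtain U \<sigma> where V: "V = U \<times> {0}" "r = \<rho> \<sigma>" and s: "sec U \<sigma>" unfolding \<R>0_def by blast
    have U: "openin ?X U" "continuous_map (subtopology ?X U) (Tot \<alpha>) \<sigma>" using s by (auto simp: sec_def)
    show "L.chart V r" unfolding L.chart_def
    proof (intro conjI ballI)
      show "V \<subseteq> topspace L.Y" using openin_subset[OF U(1)] by (auto simp: V)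
      show "r y \<in> arrows G" "tgt G (r y) = eps \<beta>' (c y)" if "y \<in> V" for y
        using \<rho>[OF s] that by (auto simp: V \<beta>'_sel)
      have "continuous_map (subtopology L.Y V) (subtopology ?X U) fst"
        by (intro continuous_map_into_subtopology continuous_map_from_subtopology continuous_map_fst) (auto simp: V)
      from continuous_map_comp[OF continuous_map_comp[OF this U(2)] \<mu>0c]
      show "continuous_map (subtopology L.Y V) (Tot \<beta>') (\<lambda>y. ract \<beta>' (c y) (E (r y)))"
        unfolding \<beta>'_sel by (rule continuous_map_eq) (use \<rho>(3)[OF s] in \<open>auto simp: V\<close>)
    qed
    have "openin L.Y (U \<times> {0..1})" using U(1) by (simp add: openin_prod_Times_iff)
    moreover have "V = (U \<times> {0..1}) \<inter> {y. snd y \<le> 0}" by (auto simp: V)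
    ultimately show "openin (subtopology L.Y {y. snd y \<le> 0}) V" unfolding openin_subtopology by blast
  next
    fix V r V' r' assume "(V, r) \<in> \<R>0" "(V', r') \<in> \<R>0"
    then obtain U \<sigma> U' \<sigma>' where V: "V = U \<times> {0}" "r = \<rho> \<sigma>" "V' = U' \<times> {0}" "r' = \<rho> \<sigma>'" and s: "sec U \<sigma>" "sec U' \<sigma>'"
      unfolding \<R>0_def by blast
    have f: "continuous_map (subtopology L.Y (V \<inter> V')) (subtopology ?X U) fst" "continuous_map (subtopology L.Y (V \<inter> V')) (subtopology ?X U') fst"
      by (intro continuous_map_into_subtopology continuous_map_from_subtopology continuous_map_fst; auto simp: V)+
    have sc: "continuous_map (subtopology ?X U) (Tot \<alpha>) \<sigma>" "continuous_map (subtopology ?X U') (Tot \<alpha>) \<sigma>'"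
      using s by (auto simp: sec_def)
    have "continuous_map (subtopology L.Y (V \<inter> V')) (Arr G) (\<lambda>y. pdiv G \<alpha> (\<sigma> (fst y)) (\<sigma>' (fst y)))"
      by (rule \<alpha>.\<alpha>.cont_pdiv[OF continuous_map_comp[OF f(1) sc(1)] continuous_map_comp[OF f(2) sc(2)]])
        (use s in \<open>auto simp: V sec_def\<close>)
    then show "L.compat V r V' r'" unfolding L.compat_def
    proof (rule continuous_map_eq)
      fix y assume "y \<in> topspace (subtopology L.Y (V \<inter> V'))"
      then have y: "fst y \<in> U" "fst y \<in> U'" "fst y \<in> topspace ?X" by (auto simp: V)
      show "pdiv G \<alpha> (\<sigma> (fst y)) (\<sigma>' (fst y)) = gmult G (ginv G (r y)) (r' y)"
        unfolding V(2,4) \<rho>_def using s y as[OF y(3)] by (intro \<alpha>.\<alpha>.pdiv_quotient[symmetric]) (auto simp: sec_def)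
    qed
  next
    fix y assume y: "y \<in> topspace L.Y" "snd y \<le> 0"
    then have "fst y \<in> topspace ?X" "snd y = 0" by auto
    from \<alpha>.\<alpha>.local_section_in[OF this(1)] obtain U \<sigma> where "sec U \<sigma>" "fst y \<in> U" unfolding sec_def by (elim exE conjE) blast
    then show "\<exists>V r. (V, r) \<in> \<R>0 \<and> y \<in> V"
      using \<open>snd y = 0\<close> by (intro exI[of _ "U \<times> {0}"] exI[of _ "\<rho> \<sigma>"]) (cases y, auto simp: \<R>0_def)
  qed
  obtain \<R> where \<R>: "L.atlas_upto 1 \<R>" and \<R>0_compat: "\<forall>V r U \<rho>. (V, r) \<in> \<R>0 \<longrightarrow> (U, \<rho>) \<in> \<R> \<longrightarrow> L.compat U \<rho> V r"
    using L.extend_atlas[OF A0] by (elim exE conjE)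
  have \<R>_chart: "L.chart V r" and \<R>_open: "openin L.Y V" if "(V, r) \<in> \<R>" for V r
  proof -
    show "L.chart V r" using \<R> that unfolding L.atlas_upto_def by blast
    have "openin (subtopology L.Y {y. snd y \<le> 1}) V" using \<R> that unfolding L.atlas_upto_def by blast
    moreover have "subtopology L.Y {y. snd y \<le> 1} = L.Y"
      by (rule subtopology_superset) auto
    ultimately show "openin L.Y V" by simp
  qed
  have \<R>_compat: "L.compat V r V' r'" if "(V, r) \<in> \<R>" "(V', r') \<in> \<R>" for V r V' r'
    using \<R> that unfolding L.atlas_upto_def by blast
  have \<R>_cover: "\<exists>V r. (V, r) \<in> \<R> \<and> z \<in> V" if "z \<in> topspace L.Y" for z
    using \<R> that unfolding L.atlas_upto_def by auto

  \<comment> \<open>Glue the atlas, read over the cube, to the extension of \<open>\<alpha>\<close>.\<close>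
  define e where "e y = eps \<beta> (c (\<Phi> y))" for y
  define W where "W V = {y \<in> topspace ?Y. \<Phi> y \<in> V}" for V
  define \<R>' where "\<R>' = {(W V, \<lambda>y. r (\<Phi> y)) |V r. (V, r) \<in> \<R>}"
  have \<Phi>W: "continuous_map (subtopology ?Y (W V)) (subtopology L.Y V) \<Phi>" for V
    by (intro continuous_map_into_subtopology continuous_map_from_subtopology \<Phi>c) (auto simp: W_def)
  interpret A: trivializations G ?Y e \<R>'
  proof
    fix V' r' assume "(V', r') \<in> \<R>'"
    then obtain V r where V: "V' = W V" "r' = (\<lambda>y. r (\<Phi> y))" "(V, r) \<in> \<R>" unfolding \<R>'_def by blast
    show "openin ?Y V'" unfolding V(1) W_def by (rule openin_preimage[OF \<Phi>c \<R>_open[OF V(3)]])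
    show "r' y \<in> arrows G \<and> tgt G (r' y) = e y" if "y \<in> V'" for y
      using L.chartD(2,3)[OF \<R>_chart[OF V(3)], of "\<Phi> y"] that by (simp add: V W_def e_def \<beta>'_sel)
    fix V2' r2' assume "(V2', r2') \<in> \<R>'"
    then obtain V2 r2 where V2: "V2' = W V2" "r2' = (\<lambda>y. r2 (\<Phi> y))" "(V2, r2) \<in> \<R>" unfolding \<R>'_def by blast
    have "W V \<inter> W V2 = W (V \<inter> V2)" by (auto simp: W_def)
    then show "continuous_map (subtopology ?Y (V' \<inter> V2')) (Arr G) (\<lambda>y. gmult G (ginv G (r' y)) (r2' y))"
      using continuous_map_comp[OF \<Phi>W[of "V \<inter> V2"] \<R>_compat[OF V(3) V2(3), unfolded L.compat_def]] by (simp add: V V2)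
  next
    fix y assume y: "y \<in> topspace ?Y"
    obtain V r where "(V, r) \<in> \<R>" "\<Phi> y \<in> V" using \<R>_cover[OF \<Phi>_in[OF y]] by blast
    then show "\<exists>V r. (V, r) \<in> \<R>' \<and> y \<in> V"
      using y by (intro exI[of _ "W V"] exI[of _ "\<lambda>y. r (\<Phi> y)"]) (auto simp: \<R>'_def W_def)
  qed
  have tA: "torsor G ?Y A.B" by (rule A.glued_torsor)
  interpret TA: tensor_torsor G Q E ?Y A.B by unfold_locales (rule torsor.P[OF tA])
  have A_iff: "(y, g) \<in> total_space A.B \<longleftrightarrow> y \<in> topspace ?Y \<and> g \<in> arrows G \<and> tgt G g = e y" for y g
    by (simp add: A.topspace_glued)
  define c' where "c' y = c (\<Phi> y)" for y
  have c': "c' y \<in> total_space \<beta> \<and> proj \<beta> (c' y) = y" if "y \<in> topspace ?Y" for y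
    using c[OF \<Phi>_in[OF that]] \<Psi>\<Phi>[OF that] by (simp add: c'_def)
  define B where "B = \<beta>.normal_form c'"
  define R where "R p = (proj \<beta> p, pdiv Q \<beta> (c' (proj \<beta> p)) p)" for p
  have tB: "torsor Q ?Y B" unfolding B_def by (rule \<beta>.normal_form_torsor(1)[OF c'])
  have R: "bundle_iso Q (unit_groupoid ?Y) \<beta> B R" unfolding B_def R_def by (rule \<beta>.normal_form_torsor(2)[OF c'])
  have Rc: "continuous_map (Tot \<beta>) (Tot B) R" using R homeomorphic_imp_continuous_map unfolding bundle_iso_def by blast
  have R_in: "R p \<in> total_space B" "proj B (R p) = proj \<beta> p" "eps B (R p) = eps \<beta> p" if "p \<in> total_space \<beta>" for p
    using R Rc that by (auto simp: bundle_iso_def continuous_map_def)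
  have R_eqv: "R (ract \<beta> p g) = ract B (R p) g" if "p \<in> total_space \<beta>" "g \<in> arrows Q" "eps \<beta> p = tgt Q g" for p g
    using R that by (simp add: bundle_iso_def)
  define \<mu> where "\<mu> p = ract \<beta> (c' (fst p)) (E (snd p))" for p
  have \<mu>: "\<mu> p \<in> total_space \<beta>" "proj \<beta> (\<mu> p) = fst p" "eps \<beta> (\<mu> p) = src G (snd p)" if p: "p \<in> total_space A.B" for p
  proof -
    have "fst p \<in> topspace ?Y" "snd p \<in> arrows G" "tgt G (snd p) = eps \<beta> (c' (fst p))"
      using p A_iff[of "fst p" "snd p"] by (auto simp: e_def c'_def)
    then show "\<mu> p \<in> total_space \<beta>" "proj \<beta> (\<mu> p) = fst p" "eps \<beta> (\<mu> p) = src G (snd p)"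
      using c'[of "fst p"] by (auto simp: \<mu>_def \<beta>.act_in \<beta>.act_proj \<beta>.act_eps E_in E_src E_tgt)
  qed
  have \<mu>_eqv: "\<mu> (ract A.B p g) = ract \<beta> (\<mu> p) (E g)" if p: "p \<in> total_space A.B" "g \<in> arrows G" "eps A.B p = tgt G g" for p g
  proof -
    have "fst p \<in> topspace ?Y" "snd p \<in> arrows G" "tgt G (snd p) = eps \<beta> (c' (fst p))"
      using p(1) A_iff[of "fst p" "snd p"] by (auto simp: e_def c'_def)
    then show ?thesis using p c'[of "fst p"] \<beta>.act_assoc[of "c' (fst p)" "E (snd p)" "E g"]
      by (simp add: \<mu>_def E_mult E_in E_src E_tgt)
  qed
  have A_sec: "\<exists>V \<sigma>. openin ?Y V \<and> y \<in> V \<and> continuous_map (subtopology ?Y V) (Tot A.B) \<sigma> \<and>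
      (\<forall>z\<in>V. proj A.B (\<sigma> z) = z) \<and> continuous_map (subtopology ?Y V) (Tot B) (\<lambda>z. R (\<mu> (\<sigma> z)))" if y: "y \<in> topspace ?Y" for y
  proof -
    obtain V r where V: "(V, r) \<in> \<R>" "\<Phi> y \<in> V" using \<R>_cover[OF \<Phi>_in[OF y]] by blast
    have VR: "(W V, \<lambda>y. r (\<Phi> y)) \<in> \<R>'" using V(1) by (auto simp: \<R>'_def)
    have "continuous_map (subtopology ?Y (W V)) (Tot \<beta>) (\<lambda>z. \<mu> (z, r (\<Phi> z)))"
      using continuous_map_comp[OF \<Phi>W[of V] L.chartD(4)[OF \<R>_chart[OF V(1)]]] by (simp add: \<beta>'_sel \<mu>_def c'_def)
    from continuous_map_comp[OF this Rc]
    have "continuous_map (subtopology ?Y (W V)) (Tot B) (\<lambda>z. R (\<mu> (z, r (\<Phi> z))))" .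
    moreover have "y \<in> W V" using y V(2) by (simp add: W_def)
    ultimately show ?thesis using A.open_dom[OF VR] A.glued_chart_section[OF VR]
      by (intro exI[of _ "W V"] exI[of _ "\<lambda>z. (z, r (\<Phi> z))"]) simp
  qed
  have K: "bundle_iso Q (unit_groupoid ?Y) TA.T B (TA.extension B (\<lambda>p. R (\<mu> p)))"
    and K_eq: "\<And>a y e. (a, y, e) \<in> TA.D \<Longrightarrow> TA.extension B (\<lambda>p. R (\<mu> p)) (TA.cls (a, y, e)) = ract B (R (\<mu> a)) e"
    using TA.extension_iso[OF tB _ _ A_sec] \<mu> R_in \<mu>_eqv R_eqv
    by (auto simp: E_in E_tgt)

  \<comment> \<open>Over the face \<open>c\<close> is the image of \<open>as\<close>, so the atlas there is that of \<open>\<alpha>\<close> and \<open>\<alpha>\<close> is the restriction.\<close>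
  let ?A0 = "restrict_bundle (topspace ?X) A.B"
  have tA0: "torsor G ?X ?A0" using torsor_restrict[OF tA, of "topspace ?X"] by (simp add: cube_face_topspace)
  interpret TA0: tensor_torsor G Q E ?X ?A0 by unfold_locales (rule torsor.P[OF tA0])
  have A0_sel: "Tot ?A0 = subtopology (Tot A.B) {p. fst p \<in> topspace ?X}" "proj ?A0 = fst" "eps ?A0 = (\<lambda>p. src G (snd p))"
    "ract ?A0 = (\<lambda>p g. (fst p, gmult G (snd p) g))"
    by (simp_all add: restrict_bundle_def)
  define q where "q a = (proj \<alpha> a, pdiv G \<alpha> (as (proj \<alpha> a)) a)" for a
  have d: "pdiv G \<alpha> (as (proj \<alpha> a)) a \<in> arrows G" "tgt G (pdiv G \<alpha> (as (proj \<alpha> a)) a) = eps \<alpha> (as (proj \<alpha> a))"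
     "ract \<alpha> (as (proj \<alpha> a)) (pdiv G \<alpha> (as (proj \<alpha> a)) a) = a" "src G (pdiv G \<alpha> (as (proj \<alpha> a)) a) = eps \<alpha> a"
    if "a \<in> total_space \<alpha>" for a
    using \<alpha>.\<alpha>.pdiv[of "as (proj \<alpha> a)" a] as[OF \<alpha>.\<alpha>.proj_in[OF that]] that by auto
  have eX: "e x = eps \<alpha> (as x)" if "x \<in> topspace ?X" for x
    using \<mu>0(3)[OF as(1)[OF that]] \<Phi>X[OF that] by (simp add: e_def c_def)
  have q_in: "q a \<in> total_space A.B" "q a \<in> total_space ?A0" if a: "a \<in> total_space \<alpha>" for a
  proof -
    have x: "proj \<alpha> a \<in> topspace ?X" by (rule \<alpha>.\<alpha>.proj_in[OF a])
    show "q a \<in> total_space A.B" using d[OF a] XY(1)[OF x] eX[OF x] by (simp add: q_def A_iff)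
    then show "q a \<in> total_space ?A0" using x by (simp add: A0_sel q_def)
  qed
  have q_eqv: "q (ract \<alpha> a g) = ract ?A0 (q a) g" if a: "a \<in> total_space \<alpha>" "g \<in> arrows G" "eps \<alpha> a = tgt G g" for a g
  proof -
    let ?a = "as (proj \<alpha> a)" and ?g = "pdiv G \<alpha> (as (proj \<alpha> a)) a"
    have "pdiv G \<alpha> ?a (ract \<alpha> a g) = gmult G ?g g"
      using \<alpha>.\<alpha>.pdiv_eq[of ?a "gmult G ?g g"] \<alpha>.\<alpha>.act_assoc[of ?a ?g g] d[OF a(1)] as[OF \<alpha>.\<alpha>.proj_in[OF a(1)]] a
      by (simp add: G.closed G.st)
    then show ?thesis using a by (simp add: q_def A0_sel \<alpha>.\<alpha>.act_proj)
  qed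
  have q: "bundle_iso G (unit_groupoid ?X) \<alpha> ?A0 q"
  proof (rule torsor_iso[OF \<alpha>.\<alpha>.torsor_axioms tA0])
    show "q a \<in> total_space ?A0 \<and> proj ?A0 (q a) = proj \<alpha> a \<and> eps ?A0 (q a) = eps \<alpha> a" if "a \<in> total_space \<alpha>" for a
      using q_in(2)[OF that] d(4)[OF that] by (simp add: A0_sel q_def)
    show "q (ract \<alpha> a g) = ract ?A0 (q a) g" if "a \<in> total_space \<alpha>" "g \<in> arrows G" "eps \<alpha> a = tgt G g" for a g
      by (rule q_eqv[OF that])
    fix x assume "x \<in> topspace ?X"
    from \<alpha>.\<alpha>.local_section_in[OF this] obtain U \<sigma> where U: "sec U \<sigma>" "x \<in> U" unfolding sec_def by (elim exE conjE) blast
    have Uo: "openin ?X U" "continuous_map (subtopology ?X U) (Tot \<alpha>) \<sigma>" and \<sigma>: "\<And>z. z \<in> U \<Longrightarrow> \<sigma> z \<in> total_space \<alpha> \<and> proj \<alpha> (\<sigma> z) = z"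
      using U(1) by (auto simp: sec_def)
    have UX: "U \<subseteq> topspace ?X" by (rule openin_subset[OF Uo(1)])
    have incl: "continuous_map ?X ?Y (\<lambda>x. x)"
      using continuous_map_from_subtopology[OF continuous_map_id, of ?Y "topspace ?X"] by (simp add: cube_face_topspace id_def)
    have face: "continuous_map ?X L.Y (\<lambda>x. (x, 0))"
      by (intro continuous_map_pairedI) auto
    have "continuous_map (subtopology ?X U) (Tot A.B) (\<lambda>z. q (\<sigma> z))"
    proof (rule continuous_map_on_local)
      fix v assume v: "v \<in> U" "v \<in> topspace ?X"
      have "(v, 0) \<in> topspace L.Y" using v by simp
      from \<R>_cover[OF this] obtain V r where V: "(V, r) \<in> \<R>" "(v, 0) \<in> V" by (elim exE conjE)
      have VR: "(W V, \<lambda>y. r (\<Phi> y)) \<in> \<R>'" using V(1) by (auto simp: \<R>'_def)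
      define N where "N = {x \<in> topspace ?X. (x, 0) \<in> V}"
      have N: "openin ?X N" unfolding N_def by (rule openin_preimage[OF face \<R>_open[OF V(1)]])
      have UN: "z \<in> W V" "\<Phi> z = (z, 0)" "z \<in> U" "(z, 0) \<in> V" if "z \<in> U \<inter> N" for z
        using that UX XY(1) \<Phi>X by (auto simp: W_def N_def)
      have f: "continuous_map (subtopology ?X (U \<inter> N)) (subtopology ?Y (W V)) (\<lambda>x. x)"
        by (intro continuous_map_into_subtopology continuous_map_from_subtopology incl) (use UN in auto)
      have "L.compat V r (U \<times> {0}) (\<rho> \<sigma>)" using \<R>0_compat V(1) U(1) unfolding \<R>0_def by blast
      then have g0: "continuous_map (subtopology L.Y (V \<inter> U \<times> {0})) (Arr G) (\<lambda>y. gmult G (ginv G (r y)) (\<rho> \<sigma> y))"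
        by (simp add: L.compat_def)
      have "continuous_map (subtopology ?X (U \<inter> N)) (subtopology L.Y (V \<inter> U \<times> {0})) (\<lambda>x. (x, 0))"
        by (intro continuous_map_into_subtopology continuous_map_from_subtopology face) (use UN in auto)
      from continuous_map_comp[OF this g0]
      have g: "continuous_map (subtopology ?X (U \<inter> N)) (Arr G) (\<lambda>x. gmult G (ginv G (r (x, 0))) (\<rho> \<sigma> (x, 0)))" .
      have m: "r (z, 0) \<in> arrows G \<and> \<rho> \<sigma> (z, 0) \<in> arrows G \<and> tgt G (r (z, 0)) = tgt G (\<rho> \<sigma> (z, 0))" if z: "z \<in> U \<inter> N" for z
        using L.chartD(2,3)[OF \<R>_chart[OF V(1)] UN(4)[OF z]] \<rho>(1,2)[OF U(1), of "(z, 0)"] UN(3)[OF z] by (simp add: \<beta>'_sel)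
      have "continuous_map (subtopology ?X (U \<inter> N)) (Tot A.B)
          (\<lambda>x. (x, gmult G (r (\<Phi> x)) (gmult G (ginv G (r (x, 0))) (\<rho> \<sigma> (x, 0)))))"
        by (rule A.cont_into_glued[OF VR f g]) (use m UN in \<open>simp add: G.closed G.st\<close>)
      then have "continuous_map (subtopology ?X (U \<inter> N)) (Tot A.B) (\<lambda>z. q (\<sigma> z))"
        by (rule continuous_map_eq) (use m UN \<sigma> in \<open>simp add: q_def \<rho>_def G.mult_inv_cancel\<close>)
      then show "\<exists>N. openin ?X N \<and> v \<in> N \<and> continuous_map (subtopology ?X (U \<inter> N)) (Tot A.B) (\<lambda>z. q (\<sigma> z))"
        using N v V(2) by (intro exI[of _ N]) (simp add: N_def)
    qed
    then have "continuous_map (subtopology ?X U) (Tot ?A0) (\<lambda>z. q (\<sigma> z))"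
      unfolding A0_sel by (rule continuous_map_into_subtopology) (use \<sigma> UX in \<open>auto simp: q_def\<close>)
    then show "\<exists>V \<sigma>. openin ?X V \<and> x \<in> V \<and> continuous_map (subtopology ?X V) (Tot \<alpha>) \<sigma> \<and> (\<forall>z\<in>V. proj \<alpha> (\<sigma> z) = z) \<and>
        continuous_map (subtopology ?X V) (Tot ?A0) (\<lambda>z. q (\<sigma> z))"
      using Uo U(2) \<sigma> by blast
  qed
  have final: "TA.extension B (\<lambda>p. R (\<mu> p)) (tensor_map G ?A0 FB q z) = R (h z)" if z: "z \<in> total_space \<alpha>.T" for z
  proof -
    obtain a y b where zz: "z = \<alpha>.cls (a, y, b)" and dz: "(a, y, b) \<in> \<alpha>.D" using z by (auto simp: \<alpha>.topspace_T)
    have a: "a \<in> total_space \<alpha>" "b \<in> arrows Q" "tgt Q b = eps \<alpha> a" "y = eps \<alpha> a" using dz by (auto simp: \<alpha>.D_iff)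
    have x: "proj \<alpha> a \<in> topspace ?X" by (rule \<alpha>.\<alpha>.proj_in[OF a(1)])
    have "tensor_map G ?A0 FB q z = tensor_class G ?A0 FB (q a, y, b)" unfolding zz
    proof (rule \<alpha>.T_map[OF TA0.tensor_torsor_axioms dz _ q_eqv])
      show "q p \<in> total_space ?A0 \<and> eps ?A0 (q p) = eps \<alpha> p" if "p \<in> total_space \<alpha>" for p
        using q_in(2)[OF that] d(4)[OF that] by (simp add: A0_sel(3) q_def)
    qed
    also have "\<dots> = TA.cls (q a, y, b)"
      by (rule tensor_class_restrict[OF torsor.P[OF tA]]) (use x in \<open>simp add: q_def\<close>)
    finally have m: "tensor_map G ?A0 FB q z = TA.cls (q a, y, b)" .
    have "(q a, y, b) \<in> TA.D" using q_in(1)[OF a(1)] a d(4)[OF a(1)] by (simp add: TA.D_iff q_def)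
    from K_eq[OF this] have "TA.extension B (\<lambda>p. R (\<mu> p)) (tensor_map G ?A0 FB q z) = ract B (R (\<mu> (q a))) b" unfolding m .
    also have "\<mu> (q a) = \<mu>0 a"
      using \<mu>0_eqv[OF as(1)[OF x] d(1)[OF a(1)] d(2)[OF a(1), symmetric]] d(3)[OF a(1)] \<Phi>X[OF x] by (simp add: \<mu>_def q_def c'_def c_def)
    also have "ract B (R (\<mu>0 a)) b = R (ract \<beta> (\<mu>0 a) b)"
      using R_eqv[of "\<mu>0 a" b] \<mu>0[OF a(1)] a by simp
    also have "\<dots> = R (h z)" using h_\<mu>0[OF dz] by (simp add: zz)
    finally show ?thesis .
  qed
  show ?thesis
    by (rule exI[of _ A.B], rule exI[of _ B], rule exI[of _ "TA.extension B (\<lambda>p. R (\<mu> p))"], rule exI[of _ q], rule exI[of _ R])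
      (use torsor.P[OF tA] torsor.P[OF tB] K q R final in blast)
qed

theorem functor_bundle_serre_fibration: "serre_fibration TYPE('q) TYPE('r) Q G FB"
  unfolding serre_fibration_def
proof (intro conjI allI impI)
  show "principal_bundle Q G FB" by (rule functor_bundle_principal)
qed (elim conjE, rule lifting_property)

end

theorem proposition6p1:
  fixes G :: "('o, 'a) lie_groupoid"
  assumes "etale_lie_groupoid G" and "proper_groupoid G"
  shows "serre_fibration TYPE('q) TYPE('r) (effect_groupoid G) G
           (functor_bundle (effect_groupoid G) G id (effect G))"
proof -
  have "topological_groupoid G" using assms(1) by (simp add: etale_lie_groupoid_def)
  then interpret proper_etale_groupoid G by unfold_locales (use assms in auto)
  show ?thesis by (rule covering_functor.functor_bundle_serre_fibration[OF effect_covering])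
qed

end
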